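(* Let $n\ge1$, let $\Omega\subset\mathbb{R}^n$ be a bounded open set with smooth boundary, let $s\in(0,1)$ and $0\le\gamma\le1$. Let $f:\Omega\to[0,+\infty)$ be measurable with $|\{f=0\}|=0$ if $1/2<s<1$, and assume: if $\gamma=1$, then $f\in L^1(\Omega)$ and $q\ge0$; if $\gamma<1$, then $f\in L^m(\Omega)$ for some $m>1$ and $q\ge\max\{0,\frac{1-m\gamma}{m-1}\}$. Let $u$ be the unique distributional solution (as in the context) of $$-\Delta u+(-\Delta)^s u+u^q=\frac{f}{u^\gamma}\text{ in }\Omega,\qquad u>0\text{ in }\Omega,\qquad u=0\text{ in }\mathbb{R}^n\setminus\Omega,$$ with $u|_\Omega\in H_0^1(\Omega)$ and $u\in L^{q+1}(\Omega)$. Let $v(x)=v^*(\omega_n|x|^n)$ be the unique radial solution of $-\Delta v=f^\sharp$ in $\Omega^\sharp$, $v=0$ on $\partial\Omega^\sharp$. Then $$u^*(\tau)\le\big((\gamma+1)v^*(\tau)\big)^{\frac1{\gamma+1}}\quad\text{for a.e. }\tau\in(0,|\Omega|).$$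
   Context: The fractional Laplacian is taken without normalization constant. A distributional solution is a function $u\in W^{1,1}(\mathbb{R}^n)$ with $u|_\Omega\in W^{1,1}_0(\Omega)$, $u=0$ a.e. outside $\Omega$, $u>0$ in $\Omega$, $u^q, fu^{-\gamma}\in L^1_{\mathrm{loc}}(\Omega)$, and for all $\varphi\in C_0^\infty(\Omega)$: $\int_\Omega\nabla u\cdot\nabla\varphi+\iint_{\mathbb{R}^{2n}}\frac{(u(x)-u(y))(\varphi(x)-\varphi(y))}{|x-y|^{n+2s}}dxdy+\int_\Omega u^q\varphi=\int_\Omega fu^{-\gamma}\varphi$. For measurable $w$ on $\Omega$: $\mu_w(t)=|\{x\in\Omega:|w(x)|>t\}|$, the decreasing rearrangement $w^*(\sigma)=\sup\{t\ge0:\mu_w(t)>\sigma\}$ for $\sigma\in(0,|\Omega|)$, $\Omega^\sharp$ is the ball centered at $0$ with $|\Omega^\sharp|=|\Omega|$, $\omega_n$ is the measure of the unit ball, and the Schwarz rearrangement is $w^\sharp(x)=w^*(\omega_n|x|^n)$, $x\in\Omega^\sharp$. *)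

theory Defs
  imports "HOL-Analysis.Analysis"
begin

definition partial_deriv :: "'n::finite \<Rightarrow> (real^'n \<Rightarrow> real) \<Rightarrow> real^'n \<Rightarrow> real" where
  "partial_deriv i f x = frechet_derivative f (at x) (axis i 1)"

fun iter_partial :: "'n::finite list \<Rightarrow> (real^'n \<Rightarrow> real) \<Rightarrow> real^'n \<Rightarrow> real" where
  "iter_partial [] f = f"
| "iter_partial (i # is) f = partial_deriv i (iter_partial is f)"

definition smooth_on :: "(real^'n::finite) set \<Rightarrow> (real^'n \<Rightarrow> real) \<Rightarrow> bool" where
  "smooth_on U f \<longleftrightarrow> (\<forall>is. \<forall>x\<in>U. iter_partial is f differentiable (at x))"

definition classical_grad :: "(real^'n::finite \<Rightarrow> real) \<Rightarrow> real^'n \<Rightarrow> real^'n" where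
  "classical_grad f x = (\<chi> i. partial_deriv i f x)"

definition test_fun :: "(real^'n::finite) set \<Rightarrow> (real^'n \<Rightarrow> real) \<Rightarrow> bool" where
  "test_fun U \<phi> \<longleftrightarrow> smooth_on UNIV \<phi> \<and> compact (closure {x. \<phi> x \<noteq> 0}) \<and> closure {x. \<phi> x \<noteq> 0} \<subseteq> U"

definition smooth_bounded_domain :: "(real^'n::finite) set \<Rightarrow> bool" where
  "smooth_bounded_domain \<Omega> \<longleftrightarrow> open \<Omega> \<and> bounded \<Omega> \<and>
     (\<exists>\<rho>. smooth_on UNIV \<rho> \<and> \<Omega> = {x. \<rho> x < 0} \<and>
          (\<forall>x. \<rho> x = 0 \<longrightarrow> classical_grad \<rho> x \<noteq> 0))"

definition locally_integrable_on :: "(real^'n::finite \<Rightarrow> real) \<Rightarrow> (real^'n) set \<Rightarrow> bool" where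
  "locally_integrable_on g U \<longleftrightarrow> (\<forall>K. compact K \<and> K \<subseteq> U \<longrightarrow> set_integrable lebesgue K g)"

definition Lp_on :: "real \<Rightarrow> (real^'n::finite) set \<Rightarrow> (real^'n \<Rightarrow> real) \<Rightarrow> bool" where
  "Lp_on p U g \<longleftrightarrow> g \<in> borel_measurable (lebesgue_on U) \<and> set_integrable lebesgue U (\<lambda>x. \<bar>g x\<bar> powr p)"

definition weak_grad_on :: "(real^'n::finite) set \<Rightarrow> (real^'n \<Rightarrow> real) \<Rightarrow> (real^'n \<Rightarrow> real^'n) \<Rightarrow> bool" where
  "weak_grad_on U u G \<longleftrightarrow>
     locally_integrable_on u U \<and> (\<forall>i. locally_integrable_on (\<lambda>x. G x $ i) U) \<and>
     (\<forall>\<phi> i. test_fun U \<phi> \<longrightarrow>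
        (LINT x:U|lebesgue. u x * partial_deriv i \<phi> x) = - (LINT x:U|lebesgue. G x $ i * \<phi> x))"

definition W1p_on :: "real \<Rightarrow> (real^'n::finite) set \<Rightarrow> (real^'n \<Rightarrow> real) \<Rightarrow> bool" where
  "W1p_on p U u \<longleftrightarrow> Lp_on p U u \<and>
     (\<exists>G. weak_grad_on U u G \<and> G \<in> borel_measurable (lebesgue_on U) \<and>
          set_integrable lebesgue U (\<lambda>x. norm (G x) powr p))"

definition W01p_on :: "real \<Rightarrow> (real^'n::finite) set \<Rightarrow> (real^'n \<Rightarrow> real) \<Rightarrow> bool" where
  "W01p_on p U u \<longleftrightarrow> Lp_on p U u \<and>
     (\<exists>G. weak_grad_on U u G \<and> G \<in> borel_measurable (lebesgue_on U) \<and>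
          set_integrable lebesgue U (\<lambda>x. norm (G x) powr p) \<and>
          (\<exists>\<phi>::nat \<Rightarrow> real^'n \<Rightarrow> real. (\<forall>k. test_fun U (\<phi> k)) \<and>
             (\<lambda>k. (LINT x:U|lebesgue. \<bar>\<phi> k x - u x\<bar> powr p)
                 + (LINT x:U|lebesgue. norm (classical_grad (\<phi> k) x - G x) powr p)) \<longlonglongrightarrow> 0))"

text \<open>Distributional solution of -Delta u + (-Delta)^s u + u^q = f/u^gamma in Omega, u = 0 outside Omega
  (fractional Laplacian without normalisation constant).\<close>
definition distributional_solution ::
  "(real^'n::finite) set \<Rightarrow> real \<Rightarrow> real \<Rightarrow> real \<Rightarrow> (real^'n \<Rightarrow> real) \<Rightarrow> (real^'n \<Rightarrow> real) \<Rightarrow> bool" where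
  "distributional_solution \<Omega> s q \<gamma> f u \<longleftrightarrow>
     W1p_on 1 UNIV u \<and> W01p_on 1 \<Omega> u \<and>
     (AE x in lebesgue. x \<notin> \<Omega> \<longrightarrow> u x = 0) \<and>
     (\<forall>x\<in>\<Omega>. u x > 0) \<and>
     locally_integrable_on (\<lambda>x. u x powr q) \<Omega> \<and>
     locally_integrable_on (\<lambda>x. f x * u x powr (-\<gamma>)) \<Omega> \<and>
     (\<exists>G. weak_grad_on UNIV u G \<and>
       (\<forall>\<phi>. test_fun \<Omega> \<phi> \<longrightarrow>
          (LINT x:\<Omega>|lebesgue. G x \<bullet> classical_grad \<phi> x)
          + integral\<^sup>L (completion (lborel \<Otimes>\<^sub>M lborel))
              (\<lambda>(x,y). (u x - u y) * (\<phi> x - \<phi> y) / norm (x - y) powr (real CARD('n) + 2 * s))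
          + (LINT x:\<Omega>|lebesgue. u x powr q * \<phi> x)
          = (LINT x:\<Omega>|lebesgue. f x * u x powr (-\<gamma>) * \<phi> x)))"

definition distrib_fun :: "(real^'n::finite) set \<Rightarrow> (real^'n \<Rightarrow> real) \<Rightarrow> real \<Rightarrow> real" where
  "distrib_fun \<Omega> w t = measure lebesgue {x\<in>\<Omega>. \<bar>w x\<bar> > t}"

definition decr_rearr :: "(real^'n::finite) set \<Rightarrow> (real^'n \<Rightarrow> real) \<Rightarrow> real \<Rightarrow> real" where
  "decr_rearr \<Omega> w \<sigma> = (let T = {t. t \<ge> 0 \<and> distrib_fun \<Omega> w t > \<sigma>} in if T = {} then 0 else Sup T)"

definition unit_ball_vol :: "'n::finite itself \<Rightarrow> real" where
  "unit_ball_vol _ = measure lebesgue (ball (0::real^'n) 1)"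

text \<open>Omega^sharp: the ball centred at 0 with the same measure as Omega.\<close>
definition sym_ball :: "(real^'n::finite) set \<Rightarrow> (real^'n) set" where
  "sym_ball \<Omega> = ball 0 ((measure lebesgue \<Omega> / unit_ball_vol TYPE('n)) powr (1 / real CARD('n)))"

definition schwarz :: "(real^'n::finite) set \<Rightarrow> (real^'n \<Rightarrow> real) \<Rightarrow> real^'n \<Rightarrow> real" where
  "schwarz \<Omega> w x = decr_rearr \<Omega> w (unit_ball_vol TYPE('n) * norm x ^ CARD('n))"

end

theory Submission
  imports Defs
begin

text \<open>
  Testing the equation with a smooth step \<open>G(u)\<close> rising from \<open>0\<close> to \<open>1\<close> on \<open>[t, t + h]\<close>, the nonlocal and the
  absorption terms are nonnegative and can be dropped, so \<open>\<integral> G'(u) |\<nabla>u|\<^sup>2 \<le> t\<^sup>-\<^sup>\<gamma> F(\<mu>(t))\<close>, where \<open>\<mu>\<close> is the distribution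
  function of \<open>u\<close> and \<open>F\<close> the primitive of \<open>f\<^sup>*\<close>. The isoperimetric inequality bounds \<open>\<integral> G'(u) |\<nabla>u|\<close> from below by a
  power of \<open>\<mu>(t + h)\<close>; with the Cauchy--Schwarz inequality this gives \<open>t\<^sup>\<gamma> \<le> -\<mu>'(t) F(\<mu>(t)) / A(\<mu>(t))\<close> in discrete form,
  where \<open>A(\<sigma>) = n\<^sup>2 \<omega>\<^sup>2\<^sup>/\<^sup>n \<sigma>\<^sup>2\<^sup>-\<^sup>2\<^sup>/\<^sup>n\<close>. The radial problem for \<open>v\<close> reads \<open>-(v\<^sup>*)' = F / A\<close>, so integrating in \<open>t\<close> yields
  \<open>t\<^sup>\<gamma>\<^sup>+\<^sup>1 / (\<gamma> + 1) \<le> v\<^sup>*(\<mu>(t))\<close>.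
  The isoperimetric inequality is only needed for smooth functions, for which it follows from the Brunn--Minkowski inequality
  by differentiating the volume of neighbourhoods of superlevel sets.
\<close>

section \<open>Smooth functions of one variable\<close>

text \<open>The function \<open>G(u)\<close> is not an admissible test function: the equation is
  given only for smooth compactly supported ones, and the singular term f u^-gamma is only locally
  integrable. The tests are therefore G(\<phi> k) with \<phi> k tending to u in H^1, and every term
  has to survive the limit. The nonlocal term does because H^1 controls the Gagliardo seminorm; the
  singular term does because the equation itself, tested with smooth substitutes for absolute
  values, bounds it by the other terms. The isoperimetric inequality is likewise passed to the limit
  from smooth functions, so that neither perimeters nor the coarea formula occur. The distribution
  function is merely monotone and may have jumps and a singular part, which is why its differential
  inequality is kept as an inequality between differences. For v only a lower bound on its
  rearrangement is extracted, from radial test functions. Radial integrals run in the volume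
  variable omega |x|^n, which transports Lebesgue measure to the half-line.\<close>

inductive_set alg :: "('a \<Rightarrow> real) set \<Rightarrow> ('a \<Rightarrow> real) set" for B where
  alg_gen: "b \<in> B \<Longrightarrow> b \<in> alg B"
| alg_const: "(\<lambda>x. c) \<in> alg B"
| alg_add: "f \<in> alg B \<Longrightarrow> g \<in> alg B \<Longrightarrow> (\<lambda>x. f x + g x) \<in> alg B"
| alg_mult: "f \<in> alg B \<Longrightarrow> g \<in> alg B \<Longrightarrow> (\<lambda>x. f x * g x) \<in> alg B"

lemma alg_cmult: "f \<in> alg B \<Longrightarrow> (\<lambda>x. c * f x) \<in> alg B"
  by (rule alg_mult[OF alg_const])

lemma alg_sum: "(\<And>i. i \<in> I \<Longrightarrow> f i \<in> alg B) \<Longrightarrow> (\<lambda>x. \<Sum>i\<in>I. f i x) \<in> alg B"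
  by (induction I rule: infinite_finite_induct) (auto intro: alg_const alg_add)

definition smooth1 :: "(real \<Rightarrow> real) \<Rightarrow> bool" where
  "smooth1 f \<longleftrightarrow> (\<forall>k x. ((deriv ^^ k) f has_real_derivative (deriv ^^ Suc k) f x) (at x))"

lemma smooth1_deriv_pow: "smooth1 f \<Longrightarrow> ((deriv ^^ k) f has_real_derivative (deriv ^^ Suc k) f x) (at x)"
  unfolding smooth1_def by blast

lemma smooth1_D: "smooth1 f \<Longrightarrow> (f has_real_derivative deriv f x) (at x)"
  using smooth1_deriv_pow[of f 0] by simp

lemma smooth1_deriv: "smooth1 f \<Longrightarrow> smooth1 (deriv f)"
  unfolding smooth1_def by (metis funpow_swap1 funpow.simps(2) o_apply)

lemma smooth1_if_deriv:
  assumes "\<And>x. (f has_real_derivative g x) (at x)" "smooth1 g"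
  shows "smooth1 f"
proof -
  have "deriv f = g" using assms(1) DERIV_imp_deriv by blast
  then have *: "(deriv ^^ Suc k) f = (deriv ^^ k) g" for k
    by (simp only: funpow_Suc_right o_apply)
  show ?thesis unfolding smooth1_def
  proof (intro allI)
    fix k x
    show "((deriv ^^ k) f has_real_derivative (deriv ^^ Suc k) f x) (at x)"
    proof (cases k)
      case 0 then show ?thesis using assms(1) \<open>deriv f = g\<close> by simp
    next
      case (Suc j)
      show ?thesis unfolding Suc * using smooth1_deriv_pow[OF assms(2)] .
    qed
  qed
qed

lemma alg_derivative:
  assumes B: "\<forall>b\<in>B. \<exists>b'\<in>alg B. \<forall>x. (b has_real_derivative b' x) (at x)"
    and "f \<in> alg B"
  shows "\<exists>f'\<in>alg B. \<forall>x. (f has_real_derivative f' x) (at x)"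
  using assms(2)
proof induction
  case (alg_gen b) then show ?case using B by blast
next
  case (alg_const c)
  show ?case by (rule bexI[of _ "\<lambda>x. 0"]) (auto intro: alg.alg_const)
next
  case (alg_add f g)
  then obtain f' g' where "f' \<in> alg B" "g' \<in> alg B" "\<And>x. (f has_real_derivative f' x) (at x)"
     "\<And>x. (g has_real_derivative g' x) (at x)" by blast
  then show ?case
    by (intro bexI[of _ "\<lambda>x. f' x + g' x"]) (auto intro: alg.alg_add DERIV_add)
next
  case (alg_mult f g)
  then obtain f' g' where *: "f' \<in> alg B" "g' \<in> alg B" "\<And>x. (f has_real_derivative f' x) (at x)"
     "\<And>x. (g has_real_derivative g' x) (at x)" by blast
  show ?case
  proof (intro bexI[of _ "\<lambda>x. f' x * g x + g' x * f x"])
    show "\<forall>x. ((\<lambda>x. f x * g x) has_real_derivative f' x * g x + g' x * f x) (at x)"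
      using * by (auto intro: DERIV_mult)
    show "(\<lambda>x. f' x * g x + g' x * f x) \<in> alg B"
      using * alg_mult.hyps by (intro alg.alg_add alg.alg_mult)
  qed
qed

text \<open>It suffices that each generator has a derivative inside the algebra: sums and products
  then stay inside, so every iterated derivative does. This replaces Leibniz and chain rules of
  higher order; a smoothness proof only has to name a generating set closed in this sense.\<close>

lemma smooth1_alg:
  assumes B: "\<forall>b\<in>B. \<exists>b'\<in>alg B. \<forall>x. (b has_real_derivative b' x) (at x)"
    and f: "f \<in> alg B"
  shows "smooth1 f"
proof -
  have step: "deriv g \<in> alg B \<and> (\<forall>x. (g has_real_derivative deriv g x) (at x))" if g: "g \<in> alg B" for g
  proof -
    obtain g' where "g' \<in> alg B" "\<And>x. (g has_real_derivative g' x) (at x)"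
      using alg_derivative[OF B g] by blast
    moreover from this have "deriv g = g'" using DERIV_imp_deriv by blast
    ultimately show ?thesis by simp
  qed
  have "(deriv ^^ k) f \<in> alg B" for k
    by (induction k) (use f step in auto)
  then show ?thesis unfolding smooth1_def using step by simp
qed

lemma smooth1_const: "smooth1 (\<lambda>x. c)"
  by (rule smooth1_alg[of "{}"]) (auto intro: alg_const)

lemma smooth1_pair:
  assumes "smooth1 f" "smooth1 g"
  shows "smooth1 (\<lambda>x. f x * g x)" "smooth1 (\<lambda>x. f x + g x)"
proof -
  define B where "B = (\<Union>k. {(deriv ^^ k) f, (deriv ^^ k) g})"
  have B: "\<forall>b\<in>B. \<exists>b'\<in>alg B. \<forall>x. (b has_real_derivative b' x) (at x)"
  proof
    fix b assume "b \<in> B"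
    then consider k where "b = (deriv ^^ k) f" | k where "b = (deriv ^^ k) g"
      unfolding B_def by blast
    then show "\<exists>b'\<in>alg B. \<forall>x. (b has_real_derivative b' x) (at x)"
    proof cases
      case 1
      have "(deriv ^^ Suc k) f \<in> alg B" by (rule alg_gen, unfold B_def) blast
      then show ?thesis unfolding 1 using smooth1_deriv_pow[OF assms(1), of k] by blast
    next
      case 2
      have "(deriv ^^ Suc k) g \<in> alg B" by (rule alg_gen, unfold B_def) blast
      then show ?thesis unfolding 2 using smooth1_deriv_pow[OF assms(2), of k] by blast
    qed
  qed
  have "(deriv ^^ 0) f \<in> B" "(deriv ^^ 0) g \<in> B" unfolding B_def by blast+
  then have "f \<in> B" "g \<in> B" by simp_all
  then show "smooth1 (\<lambda>x. f x * g x)" "smooth1 (\<lambda>x. f x + g x)"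
    by - (intro smooth1_alg[OF B] alg_mult alg_add alg_gen; assumption)+
qed

lemmas smooth1_mult = smooth1_pair(1)
lemmas smooth1_add = smooth1_pair(2)

lemma smooth1_affine:
  assumes "smooth1 f"
  shows "smooth1 (\<lambda>x. f (a * x + b))"
proof (rule smooth1_alg)
  let ?B = "range (\<lambda>k x. (deriv ^^ k) f (a * x + b))"
  show "(\<lambda>x. f (a * x + b)) \<in> alg ?B" by (rule alg_gen) (auto intro: image_eqI[of _ _ 0])
  show "\<forall>g\<in>?B. \<exists>g'\<in>alg ?B. \<forall>x. (g has_real_derivative g' x) (at x)"
  proof
  fix g assume "g \<in> ?B"
  then obtain k where g: "g = (\<lambda>x. (deriv ^^ k) f (a * x + b))" by blast
  show "\<exists>g'\<in>alg ?B. \<forall>x. (g has_real_derivative g' x) (at x)"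
  proof (intro bexI allI)
    show "(\<lambda>x. a * (deriv ^^ Suc k) f (a * x + b)) \<in> alg ?B"
      by (intro alg_cmult alg_gen) blast
    fix x
    have "((\<lambda>x. (deriv ^^ k) f (a * x + b)) has_real_derivative (deriv ^^ Suc k) f (a * x + b) * a) (at x)"
      by (rule DERIV_chain2[OF smooth1_deriv_pow[OF assms]]) (auto intro!: derivative_eq_intros)
    then show "(g has_real_derivative a * (deriv ^^ Suc k) f (a * x + b)) (at x)"
      unfolding g by (simp only: mult.commute)
  qed
  qed
qed

text \<open>The factor x^-k is carried along because differentiating exp(-1/x) produces such powers:
  the family over all k generates an algebra closed under differentiation, and k = 0 is the usual
  smooth non-analytic function.\<close>

definition exp_bump :: "nat \<Rightarrow> real \<Rightarrow> real" where
  "exp_bump k x = (if x > 0 then (1/x)^k * exp (- (1/x)) else 0)"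

lemma exp_bump_tendsto_0: "(exp_bump k \<longlongrightarrow> 0) (at 0)"
proof -
  have "((\<lambda>y::real. y ^ k / exp y) \<longlongrightarrow> 0) at_top" by (rule tendsto_power_div_exp_0)
  then have "((\<lambda>x::real. (inverse x) ^ k / exp (inverse x)) \<longlongrightarrow> 0) (at_right 0)"
    by (rule filterlim_compose[OF _ filterlim_inverse_at_top_right])
  then have r: "(exp_bump k \<longlongrightarrow> 0) (at_right 0)"
    by (rule Lim_transform_eventually)
      (auto simp: exp_bump_def eventually_at_filter exp_minus field_simps)
  have l: "(exp_bump k \<longlongrightarrow> 0) (at_left 0)"
    by (rule Lim_transform_eventually[OF tendsto_const])
      (auto simp: exp_bump_def eventually_at_filter)
  show ?thesis using l r by (simp add: filterlim_at_split)
qed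

lemma exp_bump_deriv:
  "(exp_bump k has_real_derivative (- real k) * exp_bump (k+1) x + exp_bump (k+2) x) (at x)"
proof -
  consider "x > 0" | "x < 0" | "x = 0" by linarith
  then show ?thesis
  proof cases
    case 1
    have d: "((\<lambda>x. 1 / x) has_real_derivative - ((1/x)^2)) (at x)"
      using 1 by (auto intro!: derivative_eq_intros simp: power2_eq_square)
    have "((\<lambda>y. y ^ k * exp (- y)) has_real_derivative real k * y ^ (k-1) * exp (- y) - exp (- y) * y ^ k) (at y)" for y :: real
      by (auto intro!: derivative_eq_intros)
    from DERIV_chain2[OF this d]
    have "((\<lambda>x. (1/x)^k * exp (- (1/x))) has_real_derivative
        (real k * (1/x)^(k-1) * exp (- (1/x)) - exp (- (1/x)) * (1/x)^k) * - ((1/x)^2)) (at x)" .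
    also have "(real k * (1/x)^(k-1) * exp (- (1/x)) - exp (- (1/x)) * (1/x)^k) * - ((1/x)^2)
        = (- real k) * ((1/x)^(k+1) * exp (- (1/x))) + (1/x)^(k+2) * exp (- (1/x))"
      by (cases k) (simp_all add: power2_eq_square algebra_simps add_divide_distrib diff_divide_distrib)
    also have "\<dots> = (- real k) * exp_bump (k+1) x + exp_bump (k+2) x"
      using 1 by (simp only: exp_bump_def if_True)
    finally have "((\<lambda>x. (1/x)^k * exp (- (1/x))) has_real_derivative
        (- real k) * exp_bump (k+1) x + exp_bump (k+2) x) (at x)" .
    then show ?thesis
      by (rule has_field_derivative_transform_within_open[of _ _ _ "{0<..}"])
        (use 1 in \<open>auto simp: exp_bump_def\<close>)
  next
    case 2
    have "((\<lambda>x. 0) has_real_derivative 0) (at x)" by simp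
    then have "(exp_bump k has_real_derivative 0) (at x)"
      by (rule has_field_derivative_transform_within_open[of _ _ _ "{..<0}"])
        (use 2 in \<open>auto simp: exp_bump_def\<close>)
    then show ?thesis using 2 by (simp add: exp_bump_def)
  next
    case 3
    \<comment> \<open>At the origin the difference quotient of \<open>exp_bump k\<close> is
      \<open>exp_bump (k+1)\<close>, which tends to 0.\<close>
    have "((\<lambda>h. (exp_bump k (0 + h) - exp_bump k 0) / h) \<longlongrightarrow> 0) (at 0)"
      by (rule Lim_transform_eventually[OF exp_bump_tendsto_0[of "k+1"]])
        (auto simp: exp_bump_def eventually_at_filter field_simps)
    then show ?thesis unfolding 3 DERIV_def by (simp add: exp_bump_def)
  qed
qed

lemma smooth1_exp_bump: "smooth1 (exp_bump k)"
proof (rule smooth1_alg)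
  show "exp_bump k \<in> alg (range exp_bump)" by (auto intro: alg_gen)
  have "\<exists>b'\<in>alg (range exp_bump). \<forall>x. (exp_bump k has_real_derivative b' x) (at x)" for k
  proof (rule bexI[of _ "\<lambda>x. (- real k) * exp_bump (k+1) x + exp_bump (k+2) x"])
    show "(\<lambda>x. (- real k) * exp_bump (k+1) x + exp_bump (k+2) x) \<in> alg (range exp_bump)"
      by (intro alg_add alg_cmult alg_gen rangeI)
  qed (use exp_bump_deriv in blast)
  then show "\<forall>b\<in>range exp_bump. \<exists>b'\<in>alg (range exp_bump). \<forall>x. (b has_real_derivative b' x) (at x)"
    by blast
qed

lemma antiderivative_UNIV:
  fixes f :: "real \<Rightarrow> real"
  assumes "\<And>x. isCont f x"
  obtains F where "\<And>x. (F has_real_derivative f x) (at x)"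
proof -
  obtain F where "\<forall>x. (-\<infinity>::ereal) < x \<longrightarrow> x < (\<infinity>::ereal) \<longrightarrow> (F has_vector_derivative f x) (at x)"
    using einterval_antiderivative[of "-\<infinity>" "\<infinity>" f] assms by auto
  then show ?thesis using that by (auto simp: has_real_derivative_iff_has_vector_derivative)
qed

lemma smooth1_antideriv:
  assumes "smooth1 f"
  obtains F where "\<And>x. (F has_real_derivative f x) (at x)" "smooth1 F"
proof -
  have "isCont f x" for x using smooth1_D[OF assms] DERIV_isCont by blast
  then obtain F where "\<And>x. (F has_real_derivative f x) (at x)" using antiderivative_UNIV by blast
  then show ?thesis using that smooth1_if_deriv assms by blast
qed

lemma smooth1_step_of_density:
  assumes g: "smooth1 g" "\<And>x. g x \<ge> 0" "\<forall>x. x \<le> a \<or> b \<le> x \<longrightarrow> g x = 0"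
    and F: "\<And>x. (F has_real_derivative g x) (at x)" and pos: "F a < F b"
  defines "S \<equiv> \<lambda>x. (F x - F a) / (F b - F a)"
  shows "smooth1 S" "\<And>x. (S has_real_derivative g x / (F b - F a)) (at x)"
    "\<And>x y. x \<le> y \<Longrightarrow> S x \<le> S y" "\<And>x. x \<le> a \<Longrightarrow> S x = 0" "\<And>x. b \<le> x \<Longrightarrow> S x = 1"
proof -
  show d: "(S has_real_derivative g x / (F b - F a)) (at x)" for x
    unfolding S_def using pos by (auto intro!: derivative_eq_intros F)
  show "smooth1 S"
    by (rule smooth1_if_deriv[OF d])
      (use smooth1_mult[OF g(1) smooth1_const[of "1/(F b - F a)"]] in simp)
  show "S x \<le> S y" if "x \<le> y" for x y
    using that
  proof (rule DERIV_nonneg_imp_nondecreasing)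
    show "\<exists>y. (S has_real_derivative y) (at x) \<and> 0 \<le> y" for x
      using d[of x] g(2)[of x] pos by (intro exI[of _ "g x / (F b - F a)"]) auto
  qed
  have cont: "continuous_on A F" for A using F by (meson DERIV_isCont continuous_at_imp_continuous_on)
  have c1: "F x = F a" if "x \<le> a" for x
  proof (cases "x = a")
    case False
    have "(F has_real_derivative 0) (at y)" if "y < a" for y using F[of y] spec[OF g(3), of y] that by simp
    then show ?thesis using that False DERIV_isconst_end[of x a F] cont by simp
  qed simp
  show "S x = 0" if "x \<le> a" for x using c1[OF that] by (simp add: S_def)
  have c2: "F x = F b" if "b \<le> x" for x
  proof (cases "x = b")
    case False
    have "(F has_real_derivative 0) (at y)" if "b < y" for y using F[of y] spec[OF g(3), of y] that by simp
    then show ?thesis using that False DERIV_isconst_end[of b x F] cont by simp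
  qed simp
  show "S x = 1" if "b \<le> x" for x using c2[OF that] pos by (simp add: S_def)
qed

lemma smooth_step_exists:
  fixes a b :: real
  assumes "a < b"
  obtains S where "smooth1 S" "\<And>x y. x \<le> y \<Longrightarrow> S x \<le> S y"
    "\<And>x. x \<le> a \<Longrightarrow> S x = 0" "\<And>x. b \<le> x \<Longrightarrow> S x = 1"
proof -
  \<comment> \<open>A bump positive exactly on (a, b): one factor dies at a, the reflected one at
    b.\<close>
  define g where "g x = exp_bump 0 (1 * x + (-a)) * exp_bump 0 ((-1) * x + b)" for x
  have g: "smooth1 g" unfolding g_def by (intro smooth1_mult smooth1_affine smooth1_exp_bump)
  have g0: "g x \<ge> 0" for x by (auto simp: g_def exp_bump_def)
  have gz: "\<forall>x. x \<le> a \<or> b \<le> x \<longrightarrow> g x = 0" by (auto simp: g_def exp_bump_def)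
  obtain F where F: "\<And>x. (F has_real_derivative g x) (at x)" using smooth1_antideriv[OF g] by blast
  obtain z where z: "z > a" "z < b" "F b - F a = (b - a) * g z"
    using MVT2[OF assms, of F g] F by blast
  then have "g z > 0" by (auto simp: g_def exp_bump_def)
  then have "(b - a) * g z > 0" using assms by simp
  then have "F a < F b" using z(3) by linarith
  note S = smooth1_step_of_density[OF g g0 gz F this]
  show ?thesis
    by (rule that[OF S(1) S(3) S(4) S(5)])
qed

text \<open>An upward step on [a, a'] times a downward step on [b', b]. The monotonicity on either
  side of the plateau is recorded because later the sign of the derivative matters, not just the
  values.\<close>

lemma smooth_plateau_exists:
  fixes a a' b' b :: real
  assumes "a < a'" "a' \<le> b'" "b' < b"
  obtains P where "smooth1 P" "\<And>x. 0 \<le> P x" "\<And>x. P x \<le> 1"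
    "\<And>x. x \<le> a \<or> b \<le> x \<Longrightarrow> P x = 0" "\<And>x. a' \<le> x \<Longrightarrow> x \<le> b' \<Longrightarrow> P x = 1"
    "\<And>x y. x \<le> y \<Longrightarrow> y \<le> b' \<Longrightarrow> P x \<le> P y" "\<And>x y. a' \<le> x \<Longrightarrow> x \<le> y \<Longrightarrow> P y \<le> P x"
proof -
  obtain S where S: "smooth1 S" "\<And>x y. x \<le> y \<Longrightarrow> S x \<le> S y"
    "\<And>x. x \<le> a \<Longrightarrow> S x = 0" "\<And>x. a' \<le> x \<Longrightarrow> S x = 1" using smooth_step_exists[OF assms(1)] by blast
  obtain T where T: "smooth1 T" "\<And>x y. x \<le> y \<Longrightarrow> T x \<le> T y"
    "\<And>x. x \<le> b' \<Longrightarrow> T x = 0" "\<And>x. b \<le> x \<Longrightarrow> T x = 1" using smooth_step_exists[OF assms(3)] by blast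
  have S01: "0 \<le> S x \<and> S x \<le> 1" for x
    using S(2)[of "min x a" x] S(2)[of x "max x a'"] S(3)[of "min x a"] S(4)[of "max x a'"] by simp
  have T01: "0 \<le> T x \<and> T x \<le> 1" for x
    using T(2)[of "min x b'" x] T(2)[of x "max x b"] T(3)[of "min x b'"] T(4)[of "max x b"] by simp
  define P where "P x = S x * (1 + (-1) * T x)" for x
  show ?thesis
  proof (rule that[of P])
    show "smooth1 P" unfolding P_def by (intro smooth1_mult smooth1_add smooth1_const S T)
    show "0 \<le> P x" "P x \<le> 1" for x using S01[of x] T01[of x] by (auto simp: P_def intro!: mult_nonneg_nonneg mult_le_one)
    show "P x = 0" if "x \<le> a \<or> b \<le> x" for x using that S T by (auto simp: P_def)
    show "P x = 1" if "a' \<le> x" "x \<le> b'" for x using that S T by (auto simp: P_def)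
    show "P x \<le> P y" if "x \<le> y" "y \<le> b'" for x y using that S(2)[of x y] T(3)[of x] T(3)[of y] by (auto simp: P_def)
    show "P y \<le> P x" if "a' \<le> x" "x \<le> y" for x y using that S(4)[of x] S(4)[of y] T(2)[of x y] by (auto simp: P_def)
  qed
qed

text \<open>A smooth step of height 1 on an interval of length h must somewhere be steeper than 1/h;
  the excess can be any factor K > 1, and K is let go to 1 in
  \<open>level_inequality\<close>.\<close>

lemma smooth_step_slope_exists:
  fixes t h K :: real
  assumes "h > 0" "K > 1"
  obtains G where "smooth1 G" "\<And>x. 0 \<le> G x" "\<And>x. G x \<le> 1" "\<And>x. x \<le> t \<Longrightarrow> G x = 0"
    "\<And>x. t + h \<le> x \<Longrightarrow> G x = 1" "\<And>x. 0 \<le> deriv G x" "\<And>x. deriv G x \<le> K / h"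
    "\<And>x. x \<le> t \<or> t + h \<le> x \<Longrightarrow> deriv G x = 0"
proof -
  \<comment> \<open>Shoulder width chosen so that the plateau of the density has length h - 2e = h/K
    exactly; the mass is then at least h/K, and normalising yields slope at most K/h.\<close>
  define e where "e = h * (1 - 1/K) / 2"
  have "h / K < h" "h / K > 0" using assms by (auto simp: field_simps)
  moreover have e2: "2 * e = h - h / K" unfolding e_def by (simp add: right_diff_distrib)
  ultimately have e: "e > 0" "2 * e = h - h / K" "h / K > 0" by linarith+
  have "t < t + e" "t + e \<le> t + h - e" "t + h - e < t + h" using e by auto
  then obtain P where P: "smooth1 P" "\<And>x. 0 \<le> P x" "\<And>x. P x \<le> 1"
    "\<And>x. x \<le> t \<or> t + h \<le> x \<Longrightarrow> P x = 0" "\<And>x. t + e \<le> x \<Longrightarrow> x \<le> t + h - e \<Longrightarrow> P x = 1"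
    by (rule smooth_plateau_exists) blast
  obtain F where F: "\<And>x. (F has_real_derivative P x) (at x)" using smooth1_antideriv[OF P(1)] by blast
  have mono: "F x \<le> F y" if "x \<le> y" for x y
    using that by (rule DERIV_nonneg_imp_nondecreasing) (use F P in blast)
  have "t + e < t + h - e" using e by auto
  from MVT2[OF this, of F P] F obtain z where z: "t + e < z" "z < t + h - e"
     "F (t + h - e) - F (t + e) = (t + h - e - (t + e)) * P z" by blast
  then have "F (t + h - e) - F (t + e) = h / K" using P(5)[of z] e by auto
  then have D: "F (t+h) - F t \<ge> h / K" using mono[of t "t+e"] mono[of "t+h-e" "t+h"] e by auto
  then have "F t < F (t+h)" using e by auto
  have Pz: "\<forall>x. x \<le> t \<or> t + h \<le> x \<longrightarrow> P x = 0" using P(4) by blast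
  note S = smooth1_step_of_density[OF P(1) P(2) Pz F \<open>F t < F (t+h)\<close>]
  define G where "G = (\<lambda>x. (F x - F t) / (F (t+h) - F t))"
  have S: "smooth1 G" "\<And>x. (G has_real_derivative P x / (F (t+h) - F t)) (at x)"
    "\<And>x y. x \<le> y \<Longrightarrow> G x \<le> G y" "\<And>x. x \<le> t \<Longrightarrow> G x = 0" "\<And>x. t + h \<le> x \<Longrightarrow> G x = 1"
    unfolding G_def by - (rule S(1), rule S(2), rule S(3), assumption, rule S(4), assumption, rule S(5), assumption)
  have dG: "deriv G x = P x / (F (t+h) - F t)" for x using S(2) DERIV_imp_deriv by blast
  have ub: "deriv G x \<le> K / h" for x
  proof -
    have "P x / (F (t+h) - F t) \<le> 1 / (h / K)"
      using D e P by (intro frac_le) auto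
    then show ?thesis unfolding dG using assms by simp
  qed
  have "0 \<le> G x \<and> G x \<le> 1" for x
    using S(3)[of "min x t" x] S(3)[of x "max x (t+h)"] S(4)[of "min x t"] S(5)[of "max x (t+h)"] by simp
  then have G01: "0 \<le> G x" "G x \<le> 1" for x by auto
  have dG0: "0 \<le> deriv G x" for x using P(2)[of x] \<open>F t < F (t+h)\<close> by (simp add: dG)
  have dGz: "deriv G x = 0" if "x \<le> t \<or> t + h \<le> x" for x using P(4)[OF that] by (simp add: dG)
  show ?thesis
    by (rule that[OF S(1) G01 S(4) S(5) dG0 ub dGz])
qed

section \<open>Test functions\<close>

lemma partial_deriv_eq: "(f has_derivative f') (at x) \<Longrightarrow> partial_deriv i f x = f' (axis i 1)"
  unfolding partial_deriv_def using frechet_derivative_at by metis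

lemma partial_deriv_add:
  assumes "f differentiable at x" "g differentiable at x"
  shows "partial_deriv i (\<lambda>x. f x + g x) x = partial_deriv i f x + partial_deriv i g x"
proof -
  obtain f' g' where f: "(f has_derivative f') (at x)" and g: "(g has_derivative g') (at x)"
    using assms unfolding differentiable_def by blast
  show ?thesis
    using partial_deriv_eq[OF has_derivative_add[OF f g]] partial_deriv_eq[OF f] partial_deriv_eq[OF g] by simp
qed

lemma partial_deriv_mult:
  assumes "f differentiable at x" "g differentiable at x"
  shows "partial_deriv i (\<lambda>x. f x * g x) x = f x * partial_deriv i g x + partial_deriv i f x * g x"
proof -
  obtain f' g' where f: "(f has_derivative f') (at x)" and g: "(g has_derivative g') (at x)"
    using assms unfolding differentiable_def by blast
  show ?thesis
    using partial_deriv_eq[OF has_derivative_mult[OF f g]] partial_deriv_eq[OF f] partial_deriv_eq[OF g] by simp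
qed

lemma differentiable_has_grad:
  assumes "f differentiable at x"
  shows "(f has_derivative (\<lambda>h. classical_grad f x \<bullet> h)) (at x)"
proof -
  obtain f' where f': "(f has_derivative f') (at x)" using assms unfolding differentiable_def by blast
  then have lin: "linear f'" by (rule has_derivative_linear)
  have "f' h = classical_grad f x \<bullet> h" for h
  proof -
    have "f' h = f' (\<Sum>i\<in>UNIV. h $ i *\<^sub>R axis i 1)"
      by (simp add: basis_expansion flip: scalar_mult_eq_scaleR)
    also have "\<dots> = (\<Sum>i\<in>UNIV. h $ i * f' (axis i 1))"
      by (simp add: linear_sum[OF lin] linear_cmul[OF lin])
    finally show ?thesis by (simp add: inner_vec_def classical_grad_def partial_deriv_eq[OF f'] mult.commute)
  qed
  then show ?thesis using f' by presburger
qed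

text \<open>The several-variable version of \<open>smooth1_alg\<close>: with all partial derivatives
  of the generators in the algebra, \<open>iter_partial\<close> never leaves it.\<close>

lemma smooth_on_alg:
  fixes B :: "(real^'n::finite \<Rightarrow> real) set"
  assumes B: "\<forall>b\<in>B. (\<forall>x. b differentiable at x) \<and> (\<forall>i. partial_deriv i b \<in> alg B)"
    and f: "f \<in> alg B"
  shows "smooth_on UNIV f"
proof -
  have step: "(\<forall>x. g differentiable at x) \<and> (\<forall>i. partial_deriv i g \<in> alg B)" if "g \<in> alg B" for g
    using that
  proof induction
    case (alg_gen b) then show ?case using B by blast
  next
    case (alg_const c)
    have "partial_deriv i (\<lambda>x::real^'n. c) = (\<lambda>x. 0)" for i
      by (rule ext, subst partial_deriv_eq[OF has_derivative_const]) simp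
    then show ?case by (simp add: alg.alg_const)
  next
    case (alg_add f g)
    then have "partial_deriv i (\<lambda>x. f x + g x) = (\<lambda>x. partial_deriv i f x + partial_deriv i g x)" for i
      by (auto intro!: ext partial_deriv_add)
    then show ?case using alg_add by (auto intro: alg.alg_add)
  next
    case (alg_mult f g)
    then have "partial_deriv i (\<lambda>x. f x * g x) = (\<lambda>x. f x * partial_deriv i g x + partial_deriv i f x * g x)" for i
      by (auto intro!: ext partial_deriv_mult)
    then show ?case using alg_mult by (auto intro!: alg.alg_add alg.alg_mult)
  qed
  have "iter_partial is f \<in> alg B" for "is"
    by (induction "is") (use f step in auto)
  then show ?thesis unfolding smooth_on_def using step by blast
qed

lemma smooth_on_differentiable: "smooth_on UNIV f \<Longrightarrow> f differentiable at x"
  unfolding smooth_on_def by (metis UNIV_I iter_partial.simps(1))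

lemma iter_partial_snoc: "iter_partial is (partial_deriv i f) = iter_partial (is @ [i]) f"
  by (induction "is") auto

lemma smooth_on_partial: "smooth_on UNIV f \<Longrightarrow> smooth_on UNIV (partial_deriv i f)"
  unfolding smooth_on_def iter_partial_snoc by blast

lemma smooth_on_continuous: "smooth_on UNIV f \<Longrightarrow> continuous_on A f"
  by (meson continuous_at_imp_continuous_on differentiable_imp_continuous_within smooth_on_differentiable)

lemma partial_deriv_diff:
  assumes "f differentiable at x" "g differentiable at x"
  shows "partial_deriv i (\<lambda>x. f x - g x) x = partial_deriv i f x - partial_deriv i g x"
proof -
  obtain f' g' where f: "(f has_derivative f') (at x)" and g: "(g has_derivative g') (at x)"
    using assms unfolding differentiable_def by blast
  show ?thesis
    using partial_deriv_eq[OF has_derivative_diff[OF f g]] partial_deriv_eq[OF f] partial_deriv_eq[OF g] by simp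
qed

lemma smooth_on_diff:
  assumes "smooth_on UNIV f" "smooth_on UNIV g"
  shows "smooth_on UNIV (\<lambda>x. f x - g x)"
proof (rule smooth_on_alg)
  let ?B = "{h. smooth_on UNIV h}"
  show "\<forall>b\<in>?B. (\<forall>x. b differentiable at x) \<and> (\<forall>i. partial_deriv i b \<in> alg ?B)"
    by (auto intro: smooth_on_differentiable alg_gen smooth_on_partial)
  have "(\<lambda>x. f x + (-1) * g x) \<in> alg ?B"
    using assms by (intro alg_add alg_cmult alg_gen) auto
  then show "(\<lambda>x. f x - g x) \<in> alg ?B" by simp
qed

lemma has_derivative_compose_real:
  assumes "(G has_real_derivative G') (at (f x))" "(f has_derivative f') (at x)"
  shows "((\<lambda>x. G (f x)) has_derivative (\<lambda>h. G' * f' h)) (at x)"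
  using has_derivative_compose[OF assms(2) has_field_derivative_imp_has_derivative[OF assms(1)]] by simp

lemma partial_deriv_compose:
  assumes "(G has_real_derivative G') (at (f x))" "f differentiable at x"
  shows "partial_deriv i (\<lambda>x. G (f x)) x = G' * partial_deriv i f x"
proof -
  obtain f' where f: "(f has_derivative f') (at x)" using assms unfolding differentiable_def by blast
  show ?thesis
    using partial_deriv_eq[OF has_derivative_compose_real[OF assms(1) f]] partial_deriv_eq[OF f] by simp
qed

lemma differentiable_compose_real:
  assumes "(G has_real_derivative G') (at (f x))" "f differentiable at x"
  shows "(\<lambda>x. G (f x)) differentiable at x"
  using assms has_derivative_compose_real unfolding differentiable_def by blast

text \<open>Smooth functions together with all compositions H(f) form a closed generating set: a
  partial derivative of H(f) is H'(f) times a smooth function.\<close>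

lemma smooth_on_compose:
  assumes G: "smooth1 G" and f: "smooth_on UNIV f"
  shows "smooth_on UNIV (\<lambda>x. G (f x))"
proof (rule smooth_on_alg)
  let ?B = "{h. smooth_on UNIV h} \<union> (\<lambda>H x. H (f x)) ` {H. smooth1 H}"
  show "(\<lambda>x. G (f x)) \<in> alg ?B" using G by (intro alg_gen) blast
  show "\<forall>b\<in>?B. (\<forall>x. b differentiable at x) \<and> (\<forall>i. partial_deriv i b \<in> alg ?B)"
  proof
    fix b assume "b \<in> ?B"
    then consider "smooth_on UNIV b" | H where "smooth1 H" "b = (\<lambda>x. H (f x))" by blast
    then show "(\<forall>x. b differentiable at x) \<and> (\<forall>i. partial_deriv i b \<in> alg ?B)"
    proof cases
      case 1
      then show ?thesis by (auto intro: smooth_on_differentiable alg_gen smooth_on_partial)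
    next
      case 2
      have "partial_deriv i b = (\<lambda>x. deriv H (f x) * partial_deriv i f x)" for i
        unfolding 2 by (rule ext, rule partial_deriv_compose[OF smooth1_D[OF 2(1)] smooth_on_differentiable[OF f]])
      moreover have "(\<lambda>x. deriv H (f x) * partial_deriv i f x) \<in> alg ?B" for i
        using 2 f by (intro alg_mult alg_gen) (auto intro: smooth1_deriv smooth_on_partial)
      moreover have "b differentiable at x" for x
        unfolding 2 by (rule differentiable_compose_real[OF smooth1_D[OF 2(1)] smooth_on_differentiable[OF f]])
      ultimately show ?thesis by simp
    qed
  qed
qed

lemma smooth_on_component: "smooth_on UNIV (\<lambda>x::real^'n::finite. x $ i)"
proof (rule smooth_on_alg)
  let ?B = "{\<lambda>x::real^'n. x $ i}"
  show "(\<lambda>x. x $ i) \<in> alg ?B" by (intro alg_gen) simp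
  have d: "((\<lambda>x::real^'n. x $ i) has_derivative (\<lambda>h. h $ i)) (at x)" for x
    using bounded_linear.has_derivative[OF bounded_linear_vec_nth has_derivative_ident] by blast
  have "partial_deriv j (\<lambda>x::real^'n. x $ i) = (\<lambda>x. axis j 1 $ i)" for j
    by (rule ext, rule partial_deriv_eq[OF d])
  then show "\<forall>b\<in>?B. (\<forall>x. b differentiable at x) \<and> (\<forall>i. partial_deriv i b \<in> alg ?B)"
    using d by (auto simp: differentiable_def intro: alg_const)
qed

lemma has_derivative_inner_self: "((\<lambda>x::'a::real_inner. x \<bullet> x) has_derivative (\<lambda>h. 2 * (x \<bullet> h))) (at x)"
proof -
  have "(\<lambda>h. x \<bullet> h + h \<bullet> x) = (\<lambda>h. 2 * (x \<bullet> h))" by (rule ext) (metis inner_commute mult_2)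
  then show ?thesis using has_derivative_inner[OF has_derivative_ident has_derivative_ident, of x UNIV] by metis
qed

lemma smooth_on_inner_self: "smooth_on UNIV (\<lambda>x::real^'n::finite. x \<bullet> x)"
proof (rule smooth_on_alg)
  let ?B = "{h::real^'n \<Rightarrow> real. smooth_on UNIV h}"
  show "\<forall>b\<in>?B. (\<forall>x. b differentiable at x) \<and> (\<forall>i. partial_deriv i b \<in> alg ?B)"
    by (auto intro: smooth_on_differentiable alg_gen smooth_on_partial)
  show "(\<lambda>x. x \<bullet> x) \<in> alg ?B"
    unfolding inner_vec_def inner_real_def
    by (intro alg_sum alg_mult alg_gen CollectI smooth_on_component)
qed

text \<open>Radial functions are written through the polynomial \<open>x \<bullet> x\<close>, since
  the norm is not differentiable at the origin.\<close>

lemma partial_deriv_radial: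
  assumes "(g has_real_derivative g') (at (x \<bullet> x))"
  shows "partial_deriv i (\<lambda>x::real^'n::finite. g (x \<bullet> x)) x = 2 * g' * x $ i"
proof -
  have "partial_deriv i (\<lambda>x::real^'n. x \<bullet> x) x = 2 * (x $ i)"
    using partial_deriv_eq[OF has_derivative_inner_self, of i x] by (simp add: inner_axis)
  then show ?thesis
    using partial_deriv_compose[of g g' "\<lambda>x. x \<bullet> x" x i, OF assms smooth_on_differentiable[OF smooth_on_inner_self]]
    by simp
qed

lemma partial_deriv2_radial:
  assumes "smooth1 g"
  shows "partial_deriv i (partial_deriv i (\<lambda>x::real^'n::finite. g (x \<bullet> x))) x
    = 4 * deriv (deriv g) (x \<bullet> x) * (x $ i)^2 + 2 * deriv g (x \<bullet> x)"
proof -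
  have e: "partial_deriv i (\<lambda>x::real^'n. g (x \<bullet> x)) = (\<lambda>x. (2 * deriv g (x \<bullet> x)) * x $ i)"
    using partial_deriv_radial[OF smooth1_D[OF assms]] by fastforce
  have d1: "((\<lambda>t. 2 * deriv g t) has_real_derivative 2 * deriv (deriv g) t) (at t)" for t
    using smooth1_D[OF smooth1_deriv[OF assms]] by (rule DERIV_cmult)
  have df: "(\<lambda>x::real^'n. 2 * deriv g (x \<bullet> x)) differentiable at x"
    by (rule differentiable_compose_real[OF d1 smooth_on_differentiable[OF smooth_on_inner_self]])
  have dc: "(\<lambda>x::real^'n. x $ i) differentiable at x" by (rule smooth_on_differentiable[OF smooth_on_component])
  have pc: "partial_deriv i (\<lambda>x::real^'n. x $ i) x = 1"
    using partial_deriv_eq[OF bounded_linear.has_derivative[OF bounded_linear_vec_nth has_derivative_ident], of i i x]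
    by simp
  show ?thesis unfolding e partial_deriv_mult[OF df dc] pc partial_deriv_radial[OF d1]
    by (simp add: power2_eq_square)
qed

lemma test_funD:
  assumes "test_fun U \<phi>"
  shows "smooth_on UNIV \<phi>" "compact (closure {x. \<phi> x \<noteq> 0})" "\<And>x. x \<notin> U \<Longrightarrow> \<phi> x = 0"
  using assms closure_subset[of "{x. \<phi> x \<noteq> 0}"] unfolding test_fun_def by blast+

lemma zero_outside_support: "x \<notin> closure {x. \<phi> x \<noteq> 0} \<Longrightarrow> \<phi> x = 0"
  using closure_subset[of "{x. \<phi> x \<noteq> 0}"] by blast

lemma closed_subset_compact_imp_compact:
  fixes K :: "'a::t2_space set"
  assumes "compact K" "closed A" "A \<subseteq> K"
  shows "compact A"
  using compact_Int_closed[OF assms(1,2)] assms(3) by (simp add: Int_absorb1)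

lemma test_fun_of_support:
  assumes "test_fun U \<phi>" "smooth_on UNIV \<psi>" "\<And>x. x \<notin> closure {x. \<phi> x \<noteq> 0} \<Longrightarrow> \<psi> x = 0"
  shows "test_fun U \<psi>"
proof -
  have "{x. \<psi> x \<noteq> 0} \<subseteq> closure {x. \<phi> x \<noteq> 0}" using assms(3) by blast
  then have "closure {x. \<psi> x \<noteq> 0} \<subseteq> closure {x. \<phi> x \<noteq> 0}" by (simp add: closure_minimal)
  moreover from this have "compact (closure {x. \<psi> x \<noteq> 0})"
    using test_funD(2)[OF assms(1)] by (rule closed_subset_compact_imp_compact[rotated 2]) simp
  ultimately show ?thesis using assms(1,2) unfolding test_fun_def by blast
qed

lemma partial_deriv_outside_support:
  assumes "x \<notin> closure {x. \<phi> x \<noteq> 0}"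
  shows "partial_deriv i \<phi> x = 0"
proof -
  have "(\<phi> has_derivative (\<lambda>h. 0)) (at x)"
    by (rule has_derivative_transform_within_open[of "\<lambda>x. 0", where s="- closure {x. \<phi> x \<noteq> 0}"])
      (use assms closure_subset[of "{x. \<phi> x \<noteq> 0}"] in auto)
  then show ?thesis by (rule partial_deriv_eq)
qed

lemma test_fun_partial: "test_fun U \<phi> \<Longrightarrow> test_fun U (partial_deriv i \<phi>)"
  by (rule test_fun_of_support) (auto intro: smooth_on_partial test_funD partial_deriv_outside_support)

lemma test_fun_compose:
  assumes "test_fun U \<phi>" "smooth1 G" "G 0 = 0"
  shows "test_fun U (\<lambda>x. G (\<phi> x))"
proof (rule test_fun_of_support[OF assms(1)])
  show "smooth_on UNIV (\<lambda>x. G (\<phi> x))" using smooth_on_compose[OF assms(2) test_funD(1)[OF assms(1)]] .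
  show "G (\<phi> x) = 0" if "x \<notin> closure {x. \<phi> x \<noteq> 0}" for x
    using zero_outside_support[OF that] assms(3) by simp
qed

lemma test_fun_diff:
  assumes "test_fun U \<phi>" "test_fun U \<psi>"
  shows "test_fun U (\<lambda>x. \<phi> x - \<psi> x)"
proof -
  let ?A = "closure {x. \<phi> x \<noteq> 0}" and ?B = "closure {x. \<psi> x \<noteq> 0}"
  have "{x. \<phi> x - \<psi> x \<noteq> 0} \<subseteq> {x. \<phi> x \<noteq> 0} \<union> {x. \<psi> x \<noteq> 0}" by auto
  also have "\<dots> \<subseteq> ?A \<union> ?B" by (intro Un_mono closure_subset)
  finally have "{x. \<phi> x - \<psi> x \<noteq> 0} \<subseteq> ?A \<union> ?B" .
  then have "closure {x. \<phi> x - \<psi> x \<noteq> 0} \<subseteq> ?A \<union> ?B" by (intro closure_minimal) auto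
  moreover have "compact (?A \<union> ?B)" using test_funD(2) assms by (intro compact_Un) blast+
  ultimately have "compact (closure {x. \<phi> x - \<psi> x \<noteq> 0})"
    using closed_subset_compact_imp_compact closed_closure by blast
  then show ?thesis using assms \<open>closure {x. \<phi> x - \<psi> x \<noteq> 0} \<subseteq> ?A \<union> ?B\<close> unfolding test_fun_def
    by (auto intro: smooth_on_diff)
qed

lemma grad_outside_support: "x \<notin> closure {x. \<phi> x \<noteq> 0} \<Longrightarrow> classical_grad \<phi> x = 0"
  by (simp add: classical_grad_def partial_deriv_outside_support vec_eq_iff)

lemma grad_outside_domain: "test_fun U \<phi> \<Longrightarrow> x \<notin> U \<Longrightarrow> classical_grad \<phi> x = 0"
  by (rule grad_outside_support) (auto simp: test_fun_def)

lemma grad_compose: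
  assumes "smooth1 G" "smooth_on UNIV f"
  shows "classical_grad (\<lambda>x. G (f x)) x = deriv G (f x) *\<^sub>R classical_grad f x"
  by (simp add: classical_grad_def vec_eq_iff
      partial_deriv_compose[OF smooth1_D[OF assms(1)] smooth_on_differentiable[OF assms(2)]])

lemma grad_diff:
  assumes "smooth_on UNIV f" "smooth_on UNIV g"
  shows "classical_grad (\<lambda>x. f x - g x) x = classical_grad f x - classical_grad g x"
  by (simp add: classical_grad_def vec_eq_iff
      partial_deriv_diff[OF smooth_on_differentiable[OF assms(1)] smooth_on_differentiable[OF assms(2)]])

lemma grad_continuous:
  assumes "smooth_on UNIV f"
  shows "continuous_on A (classical_grad f)"
  unfolding classical_grad_def
  by (intro continuous_on_vec_lambda smooth_on_continuous smooth_on_partial assms)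

lemma test_fun_radial:
  assumes "smooth1 g" "\<And>t. t \<ge> T \<Longrightarrow> g t = 0" "0 < T" "T < R^2" "0 \<le> R"
  shows "test_fun (ball (0::real^'n::finite) R) (\<lambda>x. g (x \<bullet> x))"
proof -
  have "{x::real^'n. g (x \<bullet> x) \<noteq> 0} \<subseteq> cball 0 (sqrt T)"
  proof
    fix x :: "real^'n" assume "x \<in> {x. g (x \<bullet> x) \<noteq> 0}"
    then have "x \<bullet> x < T" using assms(2)[of "x \<bullet> x"] by (cases "T \<le> x \<bullet> x") auto
    then show "x \<in> cball 0 (sqrt T)" by (simp add: norm_eq_sqrt_inner)
  qed
  then have "closure {x::real^'n. g (x \<bullet> x) \<noteq> 0} \<subseteq> cball 0 (sqrt T)" by (simp add: closure_minimal)
  moreover have "sqrt T < R" using assms by (simp add: real_less_lsqrt)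
  then have "cball (0::real^'n) (sqrt T) \<subseteq> ball 0 R" by auto
  moreover have "compact (closure {x::real^'n. g (x \<bullet> x) \<noteq> 0})"
    using calculation(1) by (meson bounded_cball bounded_subset closed_closure compact_eq_bounded_closed)
  ultimately show ?thesis unfolding test_fun_def
    using smooth_on_compose[OF assms(1) smooth_on_inner_self] by blast
qed

lemma test_fun_bounded:
  assumes "test_fun U \<phi>"
  obtains C where "\<And>x. \<bar>\<phi> x\<bar> \<le> C"
proof -
  have "compact (\<phi> ` closure {x. \<phi> x \<noteq> 0})"
    by (intro compact_continuous_image smooth_on_continuous test_funD(1,2)[OF assms])
  then obtain C where C: "\<forall>y\<in>\<phi> ` closure {x. \<phi> x \<noteq> 0}. norm y \<le> C" using bounded_iff compact_imp_bounded by blast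
  have "\<bar>\<phi> x\<bar> \<le> max C 0" for x
  proof (cases "x \<in> closure {x. \<phi> x \<noteq> 0}")
    case True
    then have "norm (\<phi> x) \<le> C" using C by blast
    then show ?thesis by simp
  next
    case False
    then show ?thesis using zero_outside_support[of x \<phi>] by simp
  qed
  then show ?thesis using that by blast
qed

lemma integrable_compact_support:
  fixes f :: "'a::euclidean_space \<Rightarrow> 'b::{banach, second_countable_topology}"
  assumes "continuous_on UNIV f" "compact K" "\<And>x. x \<notin> K \<Longrightarrow> f x = 0"
  shows "integrable lborel f"
proof -
  have "integrable lborel (\<lambda>x. indicator K x *\<^sub>R f x)"
    by (rule borel_integrable_compact[OF assms(2)]) (rule continuous_on_subset[OF assms(1)], simp)
  moreover have "(\<lambda>x. indicator K x *\<^sub>R f x) = f" using assms(3) by (auto simp: indicator_def fun_eq_iff)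
  ultimately show ?thesis by simp
qed

lemma test_fun_continuous: "test_fun U \<phi> \<Longrightarrow> continuous_on A \<phi>"
  using smooth_on_continuous test_funD(1) by blast

lemma test_fun_borel: "test_fun U \<phi> \<Longrightarrow> \<phi> \<in> borel_measurable borel"
  by (simp add: borel_measurable_continuous_onI test_fun_continuous)

lemma test_fun_grad_borel: "test_fun U \<phi> \<Longrightarrow> classical_grad \<phi> \<in> borel_measurable borel"
  by (simp add: borel_measurable_continuous_onI grad_continuous test_funD(1))

lemma smooth1_borel: "smooth1 G \<Longrightarrow> G \<in> borel_measurable borel"
  by (intro borel_measurable_continuous_onI continuous_at_imp_continuous_on)
    (meson DERIV_isCont smooth1_D)

section \<open>The Brunn--Minkowski inequality\<close>

definition minkowski_sum :: "'a::ab_group_add set \<Rightarrow> 'a set \<Rightarrow> 'a set" where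
  "minkowski_sum A B = {x + y | x y. x \<in> A \<and> y \<in> B}"

lemma minkowski_sum_commute: "minkowski_sum A B = minkowski_sum B A"
  unfolding minkowski_sum_def by (auto; metis add.commute)

lemma minkowski_sum_mono: "A \<subseteq> A' \<Longrightarrow> B \<subseteq> B' \<Longrightarrow> minkowski_sum A B \<subseteq> minkowski_sum A' B'"
  unfolding minkowski_sum_def by blast

lemma open_minkowski_sum:
  fixes A B :: "'a::real_normed_vector set"
  assumes "open B"
  shows "open (minkowski_sum A B)"
proof -
  have "minkowski_sum A B = (\<Union>x\<in>A. (+) x ` B)" unfolding minkowski_sum_def by auto
  then show ?thesis using assms by (auto intro: open_translation)
qed

lemma bounded_minkowski_sum:
  fixes A B :: "'a::real_normed_vector set"
  assumes "bounded A" "bounded B"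
  shows "bounded (minkowski_sum A B)"
proof -
  have "minkowski_sum A B = (\<lambda>p. fst p + snd p) ` (A \<times> B)" unfolding minkowski_sum_def by force
  then show ?thesis using bounded_plus[OF assms] by (simp add: case_prod_unfold)
qed

lemma bounded_fmeasurable_lborel:
  "bounded A \<Longrightarrow> A \<in> sets borel \<Longrightarrow> A \<in> fmeasurable lborel"
  using emeasure_bounded_finite[of A] by (intro fmeasurableI) (auto simp: less_top)

lemma measure_box_nonempty:
  assumes "box a b \<noteq> {}"
  shows "measure lborel (box a b) = (\<Prod>i\<in>Basis. b \<bullet> i - a \<bullet> i)"
  using assms by (subst measure_lborel_box) (auto simp: box_ne_empty inner_diff_left less_imp_le)

lemma powr_root_power: "0 \<le> x \<Longrightarrow> n > 0 \<Longrightarrow> (x powr (1 / real n)) ^ n = x"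
  by (cases "x = 0") (auto simp: powr_power)

text \<open>The sum contains the box whose sides are the sums u_i + v_i. After division by its
  volume, the arithmetic-geometric mean inequality applies to the ratios u_i/(u_i+v_i) and
  v_i/(u_i+v_i), and the two means add up to 1.\<close>

lemma brunn_minkowski_box:
  fixes a b c d :: "'a::euclidean_space"
  assumes "box a b \<noteq> {}" "box c d \<noteq> {}"
  shows "(measure lborel (box a b) powr (1 / DIM('a)) + measure lborel (box c d) powr (1 / DIM('a))) ^ DIM('a)
    \<le> measure lborel (minkowski_sum (box a b) (box c d))"
proof -
  have ab: "a \<bullet> i < b \<bullet> i" and cd: "c \<bullet> i < d \<bullet> i" if "i \<in> Basis" for i
    using assms that by (auto simp: box_ne_empty)
  have sub: "box (a + c) (b + d) \<subseteq> minkowski_sum (box a b) (box c d)"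
  proof
    fix z assume z: "z \<in> box (a + c) (b + d)"
    \<comment> \<open>Relative position of z in the sum box, coordinate by coordinate; using the
      same ratio in both summands splits z.\<close>
    define r where "r i = (z \<bullet> i - a \<bullet> i - c \<bullet> i) / ((b \<bullet> i - a \<bullet> i) + (d \<bullet> i - c \<bullet> i))" for i
    have r: "0 < r i \<and> r i < 1" if "i \<in> Basis" for i
      using z ab[OF that] cd[OF that] that by (auto simp: r_def mem_box inner_add_left field_simps)
    define x where "x = (\<Sum>i\<in>Basis. (a \<bullet> i + r i * (b \<bullet> i - a \<bullet> i)) *\<^sub>R i)"
    have xi: "x \<bullet> i = a \<bullet> i + r i * (b \<bullet> i - a \<bullet> i)" if "i \<in> Basis" for i
      using that by (simp add: x_def)
    have "x \<in> box a b"
      using r ab by (auto simp: mem_box xi) (smt (verit, best) mult_left_le_one_le mult_less_cancel_right2)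
    moreover have zi: "(z - x) \<bullet> i = c \<bullet> i + r i * (d \<bullet> i - c \<bullet> i)" if "i \<in> Basis" for i
    proof -
      have "r i * ((b \<bullet> i - a \<bullet> i) + (d \<bullet> i - c \<bullet> i)) = z \<bullet> i - a \<bullet> i - c \<bullet> i"
        using ab[OF that] cd[OF that] by (simp add: r_def)
      then show ?thesis by (simp add: inner_diff_left xi[OF that] algebra_simps)
    qed
    have "z - x \<in> box c d"
      using r cd by (auto simp: mem_box zi) (smt (verit, best) mult_left_le_one_le mult_less_cancel_right2)
    ultimately show "z \<in> minkowski_sum (box a b) (box c d)"
      unfolding minkowski_sum_def by (intro CollectI exI[of _ x] exI[of _ "z - x"]) auto
  qed
  define n where "n = DIM('a)"
  define u where "u i = b \<bullet> i - a \<bullet> i" for i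
  define v where "v i = d \<bullet> i - c \<bullet> i" for i
  have uv: "u i > 0" "v i > 0" if "i \<in> Basis" for i using ab cd that by (auto simp: u_def v_def)
  have np: "n > 0" by (simp add: n_def)
  define P where "P = (\<Prod>i\<in>Basis. u i + v i)"
  have P: "P > 0" unfolding P_def using uv by (intro prod_pos) (auto intro: add_pos_pos)
  have amgm: "(\<Prod>i\<in>Basis. w i) powr (1 / n) / P powr (1 / n) \<le> (\<Sum>i\<in>Basis. (w i / (u i + v i)) / n)"
    if "\<And>i. i \<in> Basis \<Longrightarrow> w i > 0" for w
  proof -
    have "(\<Prod>i\<in>Basis. w i) powr (1 / n) / P powr (1 / n) = ((\<Prod>i\<in>Basis. w i) / P) powr (1 / n)"
      using that P by (subst powr_divide) (auto intro!: prod_nonneg simp: less_imp_le)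
    also have "\<dots> = (\<Prod>i\<in>Basis. w i / (u i + v i)) powr (1 / n)"
      unfolding P_def by (simp add: prod_dividef)
    also have "\<dots> \<le> (\<Sum>i\<in>Basis. (w i / (u i + v i)) / n)"
      unfolding n_def using that uv
      by (intro arith_geom_mean) (auto intro!: divide_nonneg_nonneg add_nonneg_nonneg simp: less_imp_le)
    finally show ?thesis .
  qed
  have "(\<Prod>i\<in>Basis. u i) powr (1 / n) / P powr (1 / n) + (\<Prod>i\<in>Basis. v i) powr (1 / n) / P powr (1 / n)
     \<le> (\<Sum>i\<in>(Basis::'a set). (u i / (u i + v i)) / n + (v i / (u i + v i)) / n)"
    unfolding sum.distrib using uv by (intro add_mono amgm) auto
  also have "\<dots> = (\<Sum>i\<in>(Basis::'a set). 1 / n)"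
  proof (rule sum.cong)
    fix i :: 'a assume "i \<in> Basis"
    then have "u i + v i \<noteq> 0" using uv[of i] by linarith
    then show "(u i / (u i + v i)) / n + (v i / (u i + v i)) / n = 1 / n"
      by (simp add: add_divide_distrib[symmetric])
  qed simp
  also have "\<dots> = 1" by (simp add: n_def)
  finally have "(\<Prod>i\<in>Basis. u i) powr (1 / n) + (\<Prod>i\<in>Basis. v i) powr (1 / n) \<le> P powr (1 / n)"
    using P by (simp add: add_divide_distrib[symmetric] divide_le_eq_1)
  then have "((\<Prod>i\<in>Basis. u i) powr (1 / n) + (\<Prod>i\<in>Basis. v i) powr (1 / n)) ^ n \<le> (P powr (1 / n)) ^ n"
    by (intro power_mono) auto
  also have "\<dots> = P" using P np by (intro powr_root_power) auto
  also have "P = measure lborel (box (a + c) (b + d))"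
  proof -
    have "box (a + c) (b + d) \<noteq> {}" using ab cd by (auto simp: box_ne_empty inner_add_left intro!: add_strict_mono)
    then show ?thesis
      by (subst measure_box_nonempty) (auto simp: P_def u_def v_def inner_add_left algebra_simps intro!: prod.cong)
  qed
  also have "\<dots> \<le> measure lborel (minkowski_sum (box a b) (box c d))"
    using sub by (intro measure_mono_fmeasurable bounded_fmeasurable_lborel bounded_minkowski_sum borel_open open_minkowski_sum)
      (auto simp: bounded_box)
  finally show ?thesis
    using assms by (simp add: measure_box_nonempty n_def u_def v_def)
qed

definition box_family :: "'a::euclidean_space set set \<Rightarrow> bool" where
  "box_family \<A> \<longleftrightarrow> finite \<A> \<and> disjoint \<A> \<and> (\<forall>A\<in>\<A>. A \<noteq> {} \<and> (\<exists>a b. A = box a b))"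

text \<open>Empty pieces are discarded so that a box missing H really lowers the number of boxes,
  the quantity of the later induction.\<close>

definition cut_family :: "'a set set \<Rightarrow> 'a set \<Rightarrow> 'a set set" where
  "cut_family \<A> H = (\<lambda>A. A \<inter> H) ` \<A> - {{}}"

lemma Union_cut_family: "\<Union>(cut_family \<A> H) = \<Union>\<A> \<inter> H"
  unfolding cut_family_def by auto

lemma box_family_open: "box_family \<A> \<Longrightarrow> open (\<Union>\<A>)"
  unfolding box_family_def by (metis open_Union open_box)

lemma box_family_bounded: "box_family \<A> \<Longrightarrow> bounded (\<Union>\<A>)"
  unfolding box_family_def by (metis bounded_Union bounded_box)

lemma box_family_fmeasurable: "box_family \<A> \<Longrightarrow> \<Union>\<A> \<in> fmeasurable lborel"
  by (intro bounded_fmeasurable_lborel box_family_bounded borel_open box_family_open)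

lemma box_family_nonempty: "box_family \<A> \<Longrightarrow> \<A> \<noteq> {} \<Longrightarrow> \<Union>\<A> \<noteq> {}"
  unfolding box_family_def by auto

lemma measure_open_pos:
  fixes U :: "'a::euclidean_space set"
  assumes "open U" "U \<noteq> {}" "bounded U"
  shows "0 < measure lborel U"
proof -
  obtain x e where "e > 0" "ball x e \<subseteq> U" using assms by (meson equals0I open_contains_ball)
  then have "0 < measure lborel (ball x e)" "measure lborel (ball x e) \<le> measure lborel U"
    using assms by (auto simp: content_ball_pos intro!: measure_mono_fmeasurable bounded_fmeasurable_lborel)
  then show ?thesis by linarith
qed

lemma box_cut:
  fixes i :: "'a::euclidean_space"
  assumes "i \<in> Basis"
  shows "box a b \<inter> {x. x \<bullet> i < k} = box a (\<Sum>j\<in>Basis. (if j = i then min (b \<bullet> i) k else b \<bullet> j) *\<^sub>R j)"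
    "box a b \<inter> {x. k < x \<bullet> i} = box (\<Sum>j\<in>Basis. (if j = i then max (a \<bullet> i) k else a \<bullet> j) *\<^sub>R j) b"
  using assms by (auto simp: set_eq_iff mem_box)

lemma box_family_cut:
  fixes i :: "'a::euclidean_space"
  assumes "box_family \<A>" "i \<in> Basis" "H = {x. x \<bullet> i < k} \<or> H = {x. k < x \<bullet> i}"
  shows "box_family (cut_family \<A> H)" "card (cut_family \<A> H) \<le> card \<A>"
    "A \<in> \<A> \<Longrightarrow> A \<inter> H = {} \<Longrightarrow> card (cut_family \<A> H) < card \<A>"
proof -
  have fin: "finite \<A>" using assms(1) by (simp add: box_family_def)
  have d: "disjoint (cut_family \<A> H)"
    using assms(1) unfolding box_family_def cut_family_def disjoint_def by blast
  have "\<exists>c d. A \<inter> H = box c d" if "A \<in> \<A>" for A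
  proof -
    obtain a b where "A = box a b" using assms(1) \<open>A \<in> \<A>\<close> unfolding box_family_def by blast
    then show ?thesis using assms(3) box_cut[OF assms(2), of a b k] by blast
  qed
  then show "box_family (cut_family \<A> H)"
    using d fin unfolding box_family_def cut_family_def by (intro conjI ballI finite_Diff finite_imageI) auto
  have "card (cut_family \<A> H) \<le> card ((\<lambda>A. A \<inter> H) ` \<A>)"
    unfolding cut_family_def using fin by (intro card_mono) auto
  then show "card (cut_family \<A> H) \<le> card \<A>" using card_image_le[OF fin] le_trans by blast
  assume A: "A \<in> \<A>" "A \<inter> H = {}"
  have "cut_family \<A> H \<subseteq> (\<lambda>A. A \<inter> H) ` (\<A> - {A})" unfolding cut_family_def using A by auto
  then have "card (cut_family \<A> H) \<le> card ((\<lambda>A. A \<inter> H) ` (\<A> - {A}))" using fin by (intro card_mono) auto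
  also have "\<dots> \<le> card (\<A> - {A})" using fin by (intro card_image_le) auto
  also have "\<dots> < card \<A>" using fin A(1) by (rule card_Diff1_less)
  finally show "card (cut_family \<A> H) < card \<A>" .
qed

lemma box_family_Union_inner: "box_family \<A> \<Longrightarrow> measure lborel (\<Union>\<A> \<inter> {x. x \<bullet> i < k}) = (\<Sum>A\<in>\<A>. measure lborel (A \<inter> {x. x \<bullet> i < k}))"
proof -
  assume A: "box_family \<A>"
  have "\<Union>\<A> \<inter> {x. x \<bullet> i < k} = (\<Union>A\<in>\<A>. A \<inter> {x. x \<bullet> i < k})" by auto
  also have "measure lborel \<dots> = (\<Sum>A\<in>\<A>. measure lborel (A \<inter> {x. x \<bullet> i < k}))"
  proof (rule measure_finite_Union)
    show "finite \<A>" using A by (simp add: box_family_def)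
    show "(\<lambda>A. A \<inter> {x. x \<bullet> i < k}) ` \<A> \<subseteq> sets lborel"
      using A by (auto simp: box_family_def intro!: sets.Int)
    show "disjoint_family_on (\<lambda>A. A \<inter> {x. x \<bullet> i < k}) \<A>"
      using A by (auto simp: box_family_def disjoint_def disjoint_family_on_def)
    show "emeasure lborel (A \<inter> {x. x \<bullet> i < k}) \<noteq> \<infinity>" if "A \<in> \<A>" for A
    proof -
      have "bounded (A \<inter> {x. x \<bullet> i < k})" using A that by (metis bounded_Int bounded_box box_family_def)
      from emeasure_bounded_finite[OF this] show ?thesis by auto
    qed
  qed
  finally show ?thesis .
qed

lemma measure_box_cut:
  fixes i :: "'a::euclidean_space"
  assumes "i \<in> Basis" "box a b \<noteq> {}"
  shows "measure lborel (box a b \<inter> {x. x \<bullet> i < k}) = max 0 (min (b \<bullet> i) k - a \<bullet> i) * (\<Prod>j\<in>Basis - {i}. b \<bullet> j - a \<bullet> j)"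
proof -
  have ab: "a \<bullet> j < b \<bullet> j" if "j \<in> Basis" for j using assms that by (auto simp: box_ne_empty)
  define b' where "b' = (\<Sum>j\<in>Basis. (if j = i then min (b \<bullet> i) k else b \<bullet> j) *\<^sub>R j)"
  have b': "b' \<bullet> j = (if j = i then min (b \<bullet> i) k else b \<bullet> j)" if "j \<in> Basis" for j
    using that unfolding b'_def by simp
  have e: "box a b \<inter> {x. x \<bullet> i < k} = box a b'" using box_cut(1)[OF assms(1)] by (simp add: b'_def)
  show ?thesis
  proof (cases "a \<bullet> i < k")
    case True
    then have "box a b' \<noteq> {}" using ab assms(1) by (auto simp: box_ne_empty b')
    then have "measure lborel (box a b') = (\<Prod>j\<in>Basis. b' \<bullet> j - a \<bullet> j)" by (rule measure_box_nonempty)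
    also have "\<dots> = (b' \<bullet> i - a \<bullet> i) * (\<Prod>j\<in>Basis - {i}. b' \<bullet> j - a \<bullet> j)"
      using assms(1) by (subst prod.remove[of _ i]) auto
    also have "(\<Prod>j\<in>Basis - {i}. b' \<bullet> j - a \<bullet> j) = (\<Prod>j\<in>Basis - {i}. b \<bullet> j - a \<bullet> j)"
      by (intro prod.cong) (auto simp: b')
    also have "b' \<bullet> i - a \<bullet> i = max 0 (min (b \<bullet> i) k - a \<bullet> i)"
      using True ab[OF assms(1)] assms(1) by (simp add: b')
    finally show ?thesis using e by simp
  next
    case False
    then have "b' \<bullet> i \<le> a \<bullet> i" using assms(1) by (simp add: b')
    then have "box a b' = {}" using assms(1) unfolding box_eq_empty by blast
    then show ?thesis using e False by simp
  qed
qed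

text \<open>Intermediate value theorem: by \<open>measure_box_cut\<close> the volume below height k
  is continuous in k, and it runs from 0 to the full volume because the family is bounded.\<close>

lemma box_family_cut_ratio:
  fixes i :: "'a::euclidean_space"
  assumes B: "box_family \<B>" and i: "i \<in> Basis" and r: "0 < r" "r < 1"
  shows "\<exists>k. measure lborel (\<Union>\<B> \<inter> {x. x \<bullet> i < k}) = r * measure lborel (\<Union>\<B>)"
proof -
  define m where "m k = measure lborel (\<Union>\<B> \<inter> {x. x \<bullet> i < k})" for k
  have "continuous_on UNIV (\<lambda>k. measure lborel (A \<inter> {x. x \<bullet> i < k}))" if "A \<in> \<B>" for A
  proof -
    obtain a b where ab: "A = box a b" "box a b \<noteq> {}" using B \<open>A \<in> \<B>\<close> by (metis box_family_def)
    show ?thesis unfolding ab(1) measure_box_cut[OF i ab(2)] by (intro continuous_intros)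
  qed
  then have cont: "continuous_on UNIV m"
    unfolding m_def box_family_Union_inner[OF B] by (intro continuous_on_sum) auto
  obtain N where N: "\<forall>x\<in>\<Union>\<B>. norm x \<le> N" using box_family_bounded[OF B] unfolding bounded_iff ..
  have bd: "\<bar>x \<bullet> i\<bar> \<le> N" if "x \<in> \<Union>\<B>" for x
    using bspec[OF N that] Basis_le_norm[OF i, of x] by linarith
  have 0: "\<Union>\<B> \<inter> {x. x \<bullet> i < - \<bar>N\<bar> - 1} = {}" using bd by fastforce
  have 1: "\<Union>\<B> \<inter> {x. x \<bullet> i < \<bar>N\<bar> + 1} = \<Union>\<B>" using bd by fastforce
  have "\<exists>k\<ge>-\<bar>N\<bar> - 1. k \<le> \<bar>N\<bar> + 1 \<and> m k = r * measure lborel (\<Union>\<B>)"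
  proof (rule IVT')
    show "m (- \<bar>N\<bar> - 1) \<le> r * measure lborel (\<Union>\<B>)" unfolding m_def 0 using r by simp
    show "r * measure lborel (\<Union>\<B>) \<le> m (\<bar>N\<bar> + 1)" unfolding m_def 1 using r by (simp add: mult_left_le_one_le)
  qed (auto intro: continuous_on_subset[OF cont])
  then show ?thesis unfolding m_def by blast
qed

lemma measure_split_hyperplane:
  fixes i :: "'a::euclidean_space"
  assumes "U \<in> fmeasurable lborel" "i \<in> Basis"
  shows "measure lborel U = measure lborel (U \<inter> {x. x \<bullet> i < k}) + measure lborel (U \<inter> {x. k < x \<bullet> i})"
proof -
  have U: "U \<in> sets borel" using assms by auto
  have fm: "U \<inter> {x. x \<bullet> i < k} \<in> fmeasurable lborel" "U \<inter> {x. k < x \<bullet> i} \<in> fmeasurable lborel"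
    using assms(1) by (auto intro!: fmeasurable_Int_fmeasurable)
  have null: "{x::'a. x \<bullet> i = k} \<in> null_sets lborel"
  proof -
    have "negligible {x::'a. x \<bullet> i = k}"
      using negligible_standard_hyperplane[OF assms(2)] by blast
    then have "{x::'a. x \<bullet> i = k} \<in> null_sets lebesgue" by (simp add: negligible_iff_null_sets)
    then show ?thesis by (simp add: null_sets_completion_iff)
  qed
  have "measure lborel U = measure lborel ((U \<inter> {x. x \<bullet> i < k}) \<union> (U \<inter> {x. k < x \<bullet> i}))"
  proof (rule measure_eq_AE)
    show "AE x in lborel. (x \<in> U) = (x \<in> U \<inter> {x. x \<bullet> i < k} \<union> U \<inter> {x. k < x \<bullet> i})"
      by (rule AE_I'[OF null]) auto
  qed (use U in auto)
  also have "\<dots> = measure lborel (U \<inter> {x. x \<bullet> i < k}) + measure lborel (U \<inter> {x. k < x \<bullet> i})"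
  proof -
    have "(U \<inter> {x. x \<bullet> i < k}) \<inter> (U \<inter> {x. k < x \<bullet> i}) = {}" by auto
    then show ?thesis using fm by (subst measure_Un3) auto
  qed
  finally show ?thesis .
qed

text \<open>If the projections of two open boxes overlapped in every coordinate, the boxes would
  meet; disjointness hence gives a coordinate in which one lies below the other.\<close>

lemma box_family_separate:
  fixes \<A> :: "'a::euclidean_space set set"
  assumes "box_family \<A>" "2 \<le> card \<A>"
  obtains i k A A' where "i \<in> Basis" "A \<in> \<A>" "A' \<in> \<A>" "A \<subseteq> {x. x \<bullet> i < k}" "A' \<subseteq> {x. k < x \<bullet> i}"
proof -
  obtain A A' where A: "A \<in> \<A>" "A' \<in> \<A>" "A \<noteq> A'"
    using assms(2) by (metis card_le_Suc0_iff_eq card.infinite not_less_eq_eq numeral_2_eq_2 zero_le)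
  obtain a b a' b' where ab: "A = box a b" "A' = box a' b'" "box a b \<noteq> {}" "box a' b' \<noteq> {}"
    using assms(1) A by (metis box_family_def)
  have "box a b \<inter> box a' b' = {}" using assms(1) A ab by (metis box_family_def disjoint_def)
  then obtain i where i: "i \<in> Basis" "b \<bullet> i \<le> a' \<bullet> i \<or> b' \<bullet> i \<le> a \<bullet> i"
    using ab(3,4) unfolding disjoint_interval box_ne_empty by (meson not_less)
  from i(2) show ?thesis
  proof
    assume "b \<bullet> i \<le> a' \<bullet> i"
    then show ?thesis using i(1) A ab
      by (intro that[of i A A' "b \<bullet> i"]) (force simp: mem_box)+
  next
    assume "b' \<bullet> i \<le> a \<bullet> i"
    then show ?thesis using i(1) A ab
      by (intro that[of i A' A "b' \<bullet> i"]) (force simp: mem_box)+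
  qed
qed

text \<open>The Hadwiger--Ohmann induction: a coordinate hyperplane separates two boxes of \<open>\<A>\<close>, and \<open>\<B>\<close> is cut by
  a parallel hyperplane in the same volume ratio, so that both halves contain fewer boxes.\<close>

lemma brunn_minkowski_box_family:
  fixes \<A> \<B> :: "'a::euclidean_space set set"
  assumes "box_family \<A>" "box_family \<B>" "\<A> \<noteq> {}" "\<B> \<noteq> {}"
  shows "(measure lborel (\<Union>\<A>) powr (1 / DIM('a)) + measure lborel (\<Union>\<B>) powr (1 / DIM('a))) ^ DIM('a)
    \<le> measure lborel (minkowski_sum (\<Union>\<A>) (\<Union>\<B>))"
  using assms
proof (induction "card \<A> + card \<B>" arbitrary: \<A> \<B> rule: less_induct)
  case less
  define n where "n = DIM('a)"
  define V where "V U = measure lborel U" for U :: "'a set"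
  have np: "n > 0" by (simp add: n_def)
  have fin: "finite \<A>" "finite \<B>" using less.prems by (auto simp: box_family_def)
  \<comment> \<open>Stated for a pair whose first family has two boxes, with its own induction
    hypothesis, so that it can be applied to both orders of the pair.\<close>
  have step: "(V (\<Union>\<C>) powr (1/n) + V (\<Union>\<D>) powr (1/n)) ^ n \<le> V (minkowski_sum (\<Union>\<C>) (\<Union>\<D>))"
    if C: "box_family \<C>" "box_family \<D>" "\<C> \<noteq> {}" "\<D> \<noteq> {}" and c2: "2 \<le> card \<C>"
      and IH: "\<And>\<C>' \<D>'. card \<C>' + card \<D>' < card \<C> + card \<D> \<Longrightarrow> box_family \<C>' \<Longrightarrow> box_family \<D>' \<Longrightarrow> \<C>' \<noteq> {} \<Longrightarrow> \<D>' \<noteq> {} \<Longrightarrow>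
        (V (\<Union>\<C>') powr (1/n) + V (\<Union>\<D>') powr (1/n)) ^ n \<le> V (minkowski_sum (\<Union>\<C>') (\<Union>\<D>'))"
    for \<C> \<D> :: "'a set set"
  proof -
    obtain i k A A' where s: "i \<in> Basis" "A \<in> \<C>" "A' \<in> \<C>" "A \<subseteq> {x. x \<bullet> i < k}" "A' \<subseteq> {x. k < x \<bullet> i}"
      by (rule box_family_separate[OF C(1) c2])
    have Ane: "A \<noteq> {}" "A' \<noteq> {}" using C(1) s by (auto simp: box_family_def)
    define L where "L k = {x::'a. x \<bullet> i < k}" for k
    define R where "R k = {x::'a. k < x \<bullet> i}" for k
    define CL where "CL = cut_family \<C> (L k)"
    define CR where "CR = cut_family \<C> (R k)"
    have CLR: "box_family CL" "box_family CR"
      unfolding CL_def CR_def L_def R_def using box_family_cut(1)[OF C(1) s(1)] by auto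
    have cCL: "card CL < card \<C>" unfolding CL_def
      by (rule box_family_cut(3)[OF C(1) s(1) _ s(3)]) (use s in \<open>auto simp: L_def\<close>)
    have cCR: "card CR < card \<C>" unfolding CR_def
      by (rule box_family_cut(3)[OF C(1) s(1) _ s(2)]) (use s in \<open>auto simp: R_def\<close>)
    have UC: "\<Union>CL = \<Union>\<C> \<inter> L k" "\<Union>CR = \<Union>\<C> \<inter> R k" by (auto simp: CL_def CR_def Union_cut_family)
    have "\<Union>CL \<noteq> {}" "\<Union>CR \<noteq> {}" unfolding UC L_def R_def using s Ane by blast+
    then have ne: "CL \<noteq> {}" "CR \<noteq> {}" by auto
    have pos: "V (\<Union>CL) > 0" "V (\<Union>CR) > 0" "V (\<Union>\<D>) > 0"
      unfolding V_def using CLR C \<open>\<Union>CL \<noteq> {}\<close> \<open>\<Union>CR \<noteq> {}\<close> box_family_nonempty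
      by (auto intro!: measure_open_pos box_family_open box_family_bounded)
    have sumC: "V (\<Union>\<C>) = V (\<Union>CL) + V (\<Union>CR)"
      unfolding V_def UC L_def R_def by (rule measure_split_hyperplane[OF box_family_fmeasurable[OF C(1)] s(1)])
    define r where "r = V (\<Union>CL) / V (\<Union>\<C>)"
    have r: "0 < r" "r < 1" "V (\<Union>CL) = r * V (\<Union>\<C>)" "V (\<Union>CR) = (1 - r) * V (\<Union>\<C>)"
    proof -
      have V: "V (\<Union>\<C>) > 0" using pos sumC by linarith
      then show "0 < r" "r < 1" "V (\<Union>CL) = r * V (\<Union>\<C>)" using pos sumC by (simp_all add: r_def)
      then show "V (\<Union>CR) = (1 - r) * V (\<Union>\<C>)" using sumC by (simp add: left_diff_distrib)
    qed
    obtain l where l: "V (\<Union>\<D> \<inter> L l) = r * V (\<Union>\<D>)"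
      using box_family_cut_ratio[OF C(2) s(1) r(1,2)] unfolding V_def L_def by blast
    define DL where "DL = cut_family \<D> (L l)"
    define DR where "DR = cut_family \<D> (R l)"
    have DLR: "box_family DL" "box_family DR" "card DL \<le> card \<D>" "card DR \<le> card \<D>"
      unfolding DL_def DR_def L_def R_def using box_family_cut(1,2)[OF C(2) s(1)] by auto
    have UD: "\<Union>DL = \<Union>\<D> \<inter> L l" "\<Union>DR = \<Union>\<D> \<inter> R l" by (auto simp: DL_def DR_def Union_cut_family)
    have sumD: "V (\<Union>\<D>) = V (\<Union>DL) + V (\<Union>DR)"
      unfolding V_def UD L_def R_def by (rule measure_split_hyperplane[OF box_family_fmeasurable[OF C(2)] s(1)])
    have rD: "V (\<Union>DL) = r * V (\<Union>\<D>)" "V (\<Union>DR) = (1 - r) * V (\<Union>\<D>)"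
      using l sumD unfolding UD by (auto simp: algebra_simps)
    then have "V (\<Union>DL) > 0" "V (\<Union>DR) > 0" using pos r by auto
    then have neD: "DL \<noteq> {}" "DR \<noteq> {}" by (auto simp: V_def)
    define X where "X = (V (\<Union>\<C>) powr (1/n) + V (\<Union>\<D>) powr (1/n)) ^ n"
    \<comment> \<open>Homogeneity: multiplying both volumes by \<rho> multiplies the Brunn-Minkowski
      bound by \<rho>. As both families are cut in the ratio r, the halves contribute r X and (1 -
      r) X.\<close>
    have scale: "((\<rho> * V (\<Union>\<C>)) powr (1/n) + (\<rho> * V (\<Union>\<D>)) powr (1/n)) ^ n = \<rho> * X" if "0 < \<rho>" for \<rho>
    proof -
      have "(\<rho> * V (\<Union>\<C>)) powr (1/n) + (\<rho> * V (\<Union>\<D>)) powr (1/n)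
          = \<rho> powr (1/n) * (V (\<Union>\<C>) powr (1/n) + V (\<Union>\<D>) powr (1/n))"
        using that by (simp add: powr_mult V_def distrib_left)
      then show ?thesis using that np by (simp add: power_mult_distrib powr_root_power X_def)
    qed
    have 1: "r * X \<le> V (minkowski_sum (\<Union>CL) (\<Union>DL))"
      using IH[of CL DL] cCL DLR CLR ne neD by (simp add: r(3) rD scale[OF r(1)])
    have 2: "(1 - r) * X \<le> V (minkowski_sum (\<Union>CR) (\<Union>DR))"
      using IH[of CR DR] cCR DLR CLR ne neD r(2) by (simp add: r(4) rD scale)
    have fm: "minkowski_sum (\<Union>E) (\<Union>F) \<in> fmeasurable lborel" if "box_family E" "box_family F" for E F :: "'a set set"
      by (intro bounded_fmeasurable_lborel bounded_minkowski_sum borel_open open_minkowski_sum box_family_bounded box_family_open that)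
    \<comment> \<open>The two partial sums lie on opposite sides of the hyperplane at height k + l,
      so their volumes add up.\<close>
    have dis: "minkowski_sum (\<Union>CL) (\<Union>DL) \<inter> minkowski_sum (\<Union>CR) (\<Union>DR) = {}"
    proof -
      have "minkowski_sum (\<Union>CL) (\<Union>DL) \<subseteq> {x. x \<bullet> i < k + l}" "minkowski_sum (\<Union>CR) (\<Union>DR) \<subseteq> {x. k + l < x \<bullet> i}"
        unfolding UC UD L_def R_def minkowski_sum_def by (auto simp: inner_add_left intro: add_strict_mono)
      then show ?thesis by fastforce
    qed
    have "X \<le> V (minkowski_sum (\<Union>CL) (\<Union>DL)) + V (minkowski_sum (\<Union>CR) (\<Union>DR))"
      using 1 2 by (simp add: algebra_simps)
    also have "\<dots> = V (minkowski_sum (\<Union>CL) (\<Union>DL) \<union> minkowski_sum (\<Union>CR) (\<Union>DR))"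
      unfolding V_def using fm CLR DLR dis by (subst measure_Un3) auto
    also have "\<dots> \<le> V (minkowski_sum (\<Union>\<C>) (\<Union>\<D>))"
      unfolding V_def
    proof (rule measure_mono_fmeasurable)
      show "minkowski_sum (\<Union>CL) (\<Union>DL) \<union> minkowski_sum (\<Union>CR) (\<Union>DR) \<subseteq> minkowski_sum (\<Union>\<C>) (\<Union>\<D>)"
        unfolding UC UD by (intro Un_least minkowski_sum_mono) auto
      show "minkowski_sum (\<Union>CL) (\<Union>DL) \<union> minkowski_sum (\<Union>CR) (\<Union>DR) \<in> sets lborel"
        using fm[OF CLR(1) DLR(1)] fm[OF CLR(2) DLR(2)] by (intro sets.Un) (auto dest: fmeasurableD)
    qed (rule fm[OF C(1,2)])
    finally show ?thesis unfolding X_def .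
  qed
  have IH: "(V (\<Union>\<C>') powr (1/n) + V (\<Union>\<D>') powr (1/n)) ^ n \<le> V (minkowski_sum (\<Union>\<C>') (\<Union>\<D>'))"
    if "card \<C>' + card \<D>' < card \<A> + card \<B>" "box_family \<C>'" "box_family \<D>'" "\<C>' \<noteq> {}" "\<D>' \<noteq> {}" for \<C>' \<D>'
    using less.hyps[OF that] unfolding V_def n_def .
  have cpos: "card \<A> \<ge> 1" "card \<B> \<ge> 1" using fin less.prems by (auto simp: Suc_le_eq card_gt_0_iff)
  then consider "2 \<le> card \<A>" | "2 \<le> card \<B>" | "card \<A> = 1" "card \<B> = 1" by linarith
  then have "(V (\<Union>\<A>) powr (1/n) + V (\<Union>\<B>) powr (1/n)) ^ n \<le> V (minkowski_sum (\<Union>\<A>) (\<Union>\<B>))"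
  proof cases
    case 1
    show ?thesis by (rule step[OF less.prems 1 IH])
  next
    case 2
    have "(V (\<Union>\<B>) powr (1/n) + V (\<Union>\<A>) powr (1/n)) ^ n \<le> V (minkowski_sum (\<Union>\<B>) (\<Union>\<A>))"
      by (rule step[OF less.prems(2,1,4,3) 2 IH]) auto
    then show ?thesis by (simp add: minkowski_sum_commute add.commute)
  next
    case 3
    then obtain A B where AB: "\<A> = {A}" "\<B> = {B}" by (metis card_1_singletonE)
    then obtain a b c d where "A = box a b" "B = box c d" "box a b \<noteq> {}" "box c d \<noteq> {}"
      using less.prems by (metis box_family_def singletonI)
    then show ?thesis using brunn_minkowski_box[of a b c d] by (simp add: V_def n_def AB)
  qed
  then show ?case unfolding V_def n_def .
qed

text \<open>An open set is a countable union of closed boxes, finitely many of which exhaust its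
  volume up to any error. A division of that finite union has boxes with disjoint interiors, and
  passing to interiors loses a null set.\<close>

lemma open_approx_box_family:
  fixes U :: "'a::euclidean_space set"
  assumes "open U" "bounded U" "c < measure lborel U"
  obtains \<A> where "box_family \<A>" "\<Union>\<A> \<subseteq> U" "c < measure lborel (\<Union>\<A>)"
proof -
  obtain \<D> where D: "countable \<D>" "\<And>X. X \<in> \<D> \<Longrightarrow> \<exists>a b. X = cbox a b" "\<Union>\<D> = U"
    using open_countable_Union_open_cbox[OF assms(1)] by metis
  \<comment> \<open>The empty box is inserted so that \<open>from_nat_into\<close> enumerates a
    nonempty set even when \<D> is empty.\<close>
  define \<D>' where "\<D>' = insert {} \<D>"
  have D': "countable \<D>'" "\<D>' \<noteq> {}" "\<Union>\<D>' = U" "\<And>X. X \<in> \<D>' \<Longrightarrow> \<exists>a b. X = cbox a b"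
    using D empty_as_interval unfolding \<D>'_def by (auto; metis)+
  define X where "X k = (\<Union>j\<le>k. from_nat_into \<D>' j)" for k
  have Xb: "from_nat_into \<D>' j \<in> \<D>'" for j using D' by (simp add: from_nat_into)
  have Xm: "X k \<in> sets borel" for k
    unfolding X_def using D'(4)[OF Xb] by (intro sets.finite_UN) (auto, metis cbox_borel)
  have UX: "(\<Union>k. X k) = U"
  proof -
    have "(\<Union>k. X k) = (\<Union>j. from_nat_into \<D>' j)" unfolding X_def by blast
    then show ?thesis unfolding range_from_nat_into[OF D'(2,1)] D'(3) .
  qed
  have fmU: "U \<in> fmeasurable lborel" using assms by (intro bounded_fmeasurable_lborel) auto
  have "(\<lambda>k. measure lborel (X k)) \<longlonglongrightarrow> measure lborel (\<Union>k. X k)"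
  proof (rule Lim_measure_incseq)
    show "range X \<subseteq> sets lborel" using Xm by auto
    show "incseq X" unfolding X_def incseq_def by (intro allI impI UN_mono) auto
    show "emeasure lborel (\<Union>k. X k) \<noteq> \<infinity>" unfolding UX using emeasure_bounded_finite[OF assms(2)] by auto
  qed
  then have "eventually (\<lambda>k. c < measure lborel (X k)) sequentially"
    using assms(3) unfolding UX by (rule order_tendstoD(1))
  then obtain k where k: "c < measure lborel (X k)" by (meson eventually_sequentially order_refl)
  obtain p where p: "p division_of (X k)"
    using elementary_unions_intervals[of "from_nat_into \<D>' ` {..k}"] D'(4)[OF Xb] unfolding X_def
    by (metis finite_atMost finite_imageI imageE)
  define \<A> where "\<A> = interior ` p - {{}}"
  have bf: "box_family \<A>"
  proof -
    have "disjoint \<A>"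
    proof (rule disjointI)
      fix S T assume "S \<in> \<A>" "T \<in> \<A>" "S \<noteq> T"
      then obtain K L where "K \<in> p" "L \<in> p" "S = interior K" "T = interior L" "K \<noteq> L" unfolding \<A>_def by blast
      then show "S \<inter> T = {}" using division_ofD(5)[OF p] by blast
    qed
    moreover have "\<exists>a b. interior K = box a b" if "K \<in> p" for K
      using division_ofD(4)[OF p that] interior_cbox by metis
    ultimately show ?thesis unfolding box_family_def \<A>_def using division_ofD(1)[OF p] by auto
  qed
  have Ap: "\<Union>\<A> = (\<Union>K\<in>p. interior K)" unfolding \<A>_def by auto
  have null: "(\<Union>K\<in>p. K - interior K) \<in> null_sets lborel"
  proof (rule null_sets_UN')
    show "countable p" using division_ofD(1)[OF p] by (rule countable_finite)
    show "K - interior K \<in> null_sets lborel" if "K \<in> p" for K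
      using division_ofD(4)[OF p that] null_sets_cbox_Diff_box interior_cbox by metis
  qed
  have "measure lborel (\<Union>\<A>) = measure lborel (X k)"
  proof (rule measure_eq_AE)
    show "AE x in lborel. (x \<in> \<Union>\<A>) = (x \<in> X k)"
      unfolding Ap division_ofD(6)[OF p, symmetric]
      by (rule AE_I'[OF null]) (use interior_subset in blast)
    show "\<Union>\<A> \<in> sets lborel" using box_family_open[OF bf] by simp
  qed (use Xm in auto)
  moreover have "\<Union>\<A> \<subseteq> U"
    unfolding Ap using interior_subset division_ofD(6)[OF p] UX by blast
  ultimately show ?thesis using that[OF bf] k by simp
qed

text \<open>Inner approximation by box families keeps at least the fraction t of both volumes; by
  homogeneity the bound shrinks by the factor t only, and t tends to 1.\<close>

lemma brunn_minkowski_open: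
  fixes U W :: "'a::euclidean_space set"
  assumes U: "open U" "bounded U" "U \<noteq> {}" and W: "open W" "bounded W" "W \<noteq> {}"
  shows "(measure lborel U powr (1 / DIM('a)) + measure lborel W powr (1 / DIM('a))) ^ DIM('a)
    \<le> measure lborel (minkowski_sum U W)"
proof -
  define n where "n = DIM('a)"
  have np: "n > 0" by (simp add: n_def)
  define X where "X = (measure lborel U powr (1/n) + measure lborel W powr (1/n)) ^ n"
  define M where "M = measure lborel (minkowski_sum U W)"
  have pos: "measure lborel U > 0" "measure lborel W > 0" using U W measure_open_pos by auto
  have "t * X \<le> M" if t: "0 < t" "t < 1" for t
  proof -
    have "t * measure lborel U < measure lborel U" "t * measure lborel W < measure lborel W" using t pos by auto
    then obtain \<A> \<B> where A: "box_family \<A>" "\<Union>\<A> \<subseteq> U" "t * measure lborel U < measure lborel (\<Union>\<A>)"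
      and B: "box_family \<B>" "\<Union>\<B> \<subseteq> W" "t * measure lborel W < measure lborel (\<Union>\<B>)"
      using open_approx_box_family[OF U(1,2)] open_approx_box_family[OF W(1,2)] by metis
    have ne: "\<A> \<noteq> {}" "\<B> \<noteq> {}"
      using A(3) B(3) pos t by (auto simp: mult_less_0_iff)
    have "t * X = ((t * measure lborel U) powr (1/n) + (t * measure lborel W) powr (1/n)) ^ n"
    proof -
      have "(t * measure lborel U) powr (1/n) + (t * measure lborel W) powr (1/n)
          = t powr (1/n) * (measure lborel U powr (1/n) + measure lborel W powr (1/n))"
        using t by (simp add: powr_mult distrib_left)
      then show ?thesis using t np by (simp add: power_mult_distrib powr_root_power X_def)
    qed
    also have "\<dots> \<le> (measure lborel (\<Union>\<A>) powr (1/n) + measure lborel (\<Union>\<B>) powr (1/n)) ^ n"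
      using A B t by (intro power_mono add_mono powr_mono2) auto
    also have "\<dots> \<le> measure lborel (minkowski_sum (\<Union>\<A>) (\<Union>\<B>))"
      using brunn_minkowski_box_family[OF A(1) B(1) ne] by (simp add: n_def)
    also have "\<dots> \<le> M" unfolding M_def
    proof (rule measure_mono_fmeasurable)
      show "minkowski_sum (\<Union>\<A>) (\<Union>\<B>) \<in> sets lborel"
        using open_minkowski_sum[OF box_family_open[OF B(1)]] by auto
      show "minkowski_sum U W \<in> fmeasurable lborel"
        using U W by (intro bounded_fmeasurable_lborel bounded_minkowski_sum borel_open open_minkowski_sum)
    qed (use minkowski_sum_mono A B in blast)
    finally show ?thesis .
  qed
  then have "X \<le> M" by (rule field_le_mult_one_interval)
  then show ?thesis by (simp add: X_def M_def n_def)
qed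

section \<open>A weak isoperimetric inequality\<close>

lemma (in sigma_finite_measure) nn_integral_layer_cake:
  assumes f[measurable]: "f \<in> borel_measurable M" and nonneg: "\<And>x. 0 \<le> f x"
  shows "(\<integral>\<^sup>+x. ennreal (f x) \<partial>M) = (\<integral>\<^sup>+t. indicator {0..} t * emeasure M {x\<in>space M. t < f x} \<partial>lborel)"
proof -
  interpret pair_sigma_finite M lborel ..
  let ?I = "\<lambda>x t. indicator {0..} t * indicator {x\<in>space M. t < f x} x :: ennreal"
  have m: "(\<lambda>(x, t). ?I x t) \<in> borel_measurable (M \<Otimes>\<^sub>M lborel)"
    unfolding indicator_def mem_Collect_eq by measurable
  have "(\<integral>\<^sup>+x. ennreal (f x) \<partial>M) = (\<integral>\<^sup>+x. \<integral>\<^sup>+t. ?I x t \<partial>lborel \<partial>M)"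
  proof (rule nn_integral_cong)
    fix x assume "x \<in> space M"
    then have "(\<integral>\<^sup>+t. ?I x t \<partial>lborel) = (\<integral>\<^sup>+t. indicator {0..<f x} t \<partial>lborel)"
      by (intro nn_integral_cong) (auto simp: indicator_def)
    then show "ennreal (f x) = (\<integral>\<^sup>+t. ?I x t \<partial>lborel)" using nonneg[of x] by simp
  qed
  also have "\<dots> = (\<integral>\<^sup>+t. \<integral>\<^sup>+x. ?I x t \<partial>M \<partial>lborel)" by (rule Fubini'[OF m, symmetric])
  also have "\<dots> = (\<integral>\<^sup>+t. indicator {0..} t * emeasure M {x\<in>space M. t < f x} \<partial>lborel)"
    by (intro nn_integral_cong) (simp add: nn_integral_cmult)
  finally show ?thesis .
qed

lemma unit_ball_vol_pos: "0 < unit_ball_vol TYPE('n::finite)"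
  unfolding unit_ball_vol_def by (simp add: content_ball_pos)

lemma measure_ball_unit_ball_vol:
  assumes "0 \<le> r"
  shows "measure lborel (ball (x::real^'n::finite) r) = unit_ball_vol TYPE('n) * r ^ CARD('n)"
  using content_ball_conv_unit_ball[OF assms, of x] unfolding unit_ball_vol_def by simp

text \<open>The sharp isoperimetric constant: a ball of volume m has perimeter
  \<open>iso_const\<close> times m^(1 - 1/n).\<close>

definition iso_const :: "'n::finite itself \<Rightarrow> real" where
  "iso_const _ = real CARD('n) * unit_ball_vol TYPE('n) powr (1 / real CARD('n))"

lemma iso_const_pos: "0 < iso_const TYPE('n::finite)"
  unfolding iso_const_def using unit_ball_vol_pos[where 'n='n] by simp

text \<open>Dimension 1 stands apart because of \<open>0 powr 0 = 0\<close>: for x = 0 the power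
  with natural exponent 0 is 1, the real power is 0.\<close>

lemma power_root_pred:
  assumes "0 \<le> x" "n > 0"
  shows "(x powr (1 / real n)) ^ (n - 1) = (if n = 1 then 1 else x powr (1 - 1 / real n))"
proof (cases "n = 1")
  case False
  have "(x powr (1 / real n)) ^ (n - 1) = x powr (real (n - 1) / real n)"
    using assms False by (cases "x = 0") (auto simp: powr_power)
  also have "real (n - 1) / real n = 1 - 1 / real n" using assms False by (simp add: of_nat_diff field_simps)
  finally show ?thesis using False by simp
qed simp

lemma power_add_ge:
  fixes a b :: real
  assumes "0 \<le> a" "0 \<le> b" "n > 0"
  shows "a ^ n + real n * a ^ (n - 1) * b \<le> (a + b) ^ n"
  using assms(3)
proof (induction n rule: nat_induct_non_zero)
  case 1 then show ?case by simp
next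
  case (Suc n)
  obtain k where k: "n = Suc k" using Suc.hyps by (cases n) auto
  have "a ^ Suc n + real (Suc n) * a ^ n * b \<le> (a ^ n + real n * a ^ (n - 1) * b) * (a + b)"
    using assms unfolding k by (simp add: algebra_simps)
  also have "\<dots> \<le> (a + b) ^ n * (a + b)" using Suc.IH assms by (intro mult_right_mono) auto
  finally show ?case by (simp add: mult.commute)
qed

text \<open>Brunn-Minkowski with a ball of radius e, keeping the first two terms of the expanded
  n-th power. The coefficient of e is the isoperimetric lower bound for the perimeter.\<close>

lemma measure_enlargement:
  fixes U :: "(real^'n::finite) set"
  assumes "open U" "bounded U" "0 < e"
  shows "measure lborel U + e * iso_const TYPE('n) * measure lborel U powr (1 - 1 / real CARD('n))
    \<le> measure lborel (minkowski_sum U (ball 0 e))"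
proof (cases "U = {}")
  case False
  define n where "n = CARD('n)"
  define m where "m = measure lborel U"
  define w where "w = unit_ball_vol TYPE('n)"
  have np: "n > 0" "DIM(real^'n) = n" by (auto simp: n_def)
  have pos: "m > 0" "w > 0" unfolding m_def w_def using measure_open_pos[OF assms(1) False assms(2)] unit_ball_vol_pos by auto
  have "(w * e ^ n) powr (1 / n) = w powr (1 / n) * e"
    using pos assms np by (simp add: powr_mult powr_realpow[symmetric] powr_powr)
  moreover have "(m powr (1/n) + measure lborel (ball (0::real^'n) e) powr (1/n)) ^ n
     \<le> measure lborel (minkowski_sum U (ball 0 e))"
    using brunn_minkowski_open[OF assms(1,2) False, of "ball 0 e"] assms(3) unfolding m_def np(2) by simp
  moreover have "measure lborel (ball (0::real^'n) e) = w * e ^ n"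
    using measure_ball_unit_ball_vol[of e "0::real^'n"] assms(3) by (simp add: w_def n_def)
  ultimately have "(m powr (1/n) + w powr (1/n) * e) ^ n \<le> measure lborel (minkowski_sum U (ball 0 e))"
    by simp
  moreover have "(m powr (1/n)) ^ n + real n * (m powr (1/n)) ^ (n - 1) * (w powr (1/n) * e) \<le> (m powr (1/n) + w powr (1/n) * e) ^ n"
    using assms np by (intro power_add_ge) auto
  moreover have "(m powr (1/n)) ^ n = m" using pos np by (intro powr_root_power) auto
  moreover have "(m powr (1/n)) ^ (n - 1) = m powr (1 - 1 / real n)"
    using power_root_pred[of m n] pos np by auto
  ultimately have "m + real n * m powr (1 - 1 / real n) * (w powr (1/n) * e) \<le> measure lborel (minkowski_sum U (ball 0 e))"
    by simp
  then show ?thesis unfolding iso_const_def n_def[symmetric] w_def[symmetric] m_def[symmetric]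
    by (simp add: mult_ac)
qed (simp add: minkowski_sum_def)

text \<open>Brunn--Minkowski is applied to the superlevel sets of \<open>\<phi>\<close>: their \<open>e\<close>-neighbourhoods are the superlevel
  sets of \<open>x \<mapsto> sup \<phi>(ball x e)\<close>, which exceeds \<open>\<phi>\<close> by at most \<open>e |\<nabla>\<phi>| + o(e)\<close>.\<close>

lemma isoperimetric_test_fun:
  fixes \<phi> :: "real^'n::finite \<Rightarrow> real"
  assumes \<phi>: "test_fun U \<phi>" and nonneg: "\<And>x. 0 \<le> \<phi> x" and l: "0 < l"
  shows "l * iso_const TYPE('n) * measure lborel {x. l < \<phi> x} powr (1 - 1 / real CARD('n))
    \<le> (\<integral>x. norm (classical_grad \<phi> x) \<partial>lborel)"
proof (rule field_le_epsilon)
  fix d :: real assume d: "0 < d"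
  define c where "c = iso_const TYPE('n) * measure lborel {x. l < \<phi> x} powr (1 - 1 / real CARD('n))"
  have c0: "0 \<le> c" unfolding c_def using iso_const_pos[where 'n='n] by simp
  have cont: "continuous_on UNIV \<phi>" by (rule test_fun_continuous[OF \<phi>])
  obtain R0 where R0: "\<forall>x\<in>closure {x. \<phi> x \<noteq> 0}. norm x \<le> R0"
    using compact_imp_bounded[OF test_funD(2)[OF \<phi>]] unfolding bounded_iff ..
  have out: "\<phi> x = 0" if "R0 < norm x" for x
    using R0 that zero_outside_support[of x \<phi>] by fastforce
  define R where "R = \<bar>R0\<bar> + 1"
  have R: "R > 0" by (simp add: R_def)
  define m where "m = measure lborel (cball (0::real^'n) R)"
  have m0: "0 \<le> m" by (simp add: m_def)
  \<comment> \<open>Tolerance for the oscillation of the gradient; over the ball of measure m,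
    outside which the enlarged function vanishes, it costs at most d.\<close>
  define \<eta> where "\<eta> = d / (m + 1)"
  have \<eta>: "\<eta> > 0" using d m0 by (simp add: \<eta>_def)
  have "\<eta> * m \<le> d" using d m0 by (simp add: \<eta>_def field_simps)
  have "uniformly_continuous_on (cball 0 (R + 1)) (classical_grad \<phi>)"
    by (intro compact_uniformly_continuous grad_continuous test_funD(1)[OF \<phi>]) auto
  then obtain e0 where e0: "e0 > 0" "\<And>x y. x \<in> cball 0 (R + 1) \<Longrightarrow> y \<in> cball 0 (R + 1) \<Longrightarrow> dist y x < e0 \<Longrightarrow>
      dist (classical_grad \<phi> y) (classical_grad \<phi> x) < \<eta>"
    unfolding uniformly_continuous_on_def using \<eta> by metis
  \<comment> \<open>A radius of at most 1 keeps the balls around points of \<open>cball 0 R\<close>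
    inside \<open>cball 0 (R + 1)\<close>, where uniform continuity is available, and the support of
    \<psi> inside \<open>cball 0 R\<close>.\<close>
  define e where "e = min e0 1"
  have e: "0 < e" "e \<le> e0" "e \<le> 1" using e0 by (auto simp: e_def)
  obtain C where C: "\<And>x. \<bar>\<phi> x\<bar> \<le> C" using test_fun_bounded[OF \<phi>] by blast
  define \<psi> where "\<psi> x = (SUP y\<in>ball x e. \<phi> y)" for x
  have bdd: "bdd_above (\<phi> ` A)" for A using C by (intro bdd_aboveI[of _ C]) (auto simp: abs_le_iff)
  have lev: "{x. t < \<psi> x} = minkowski_sum {x. t < \<phi> x} (ball 0 e)" for t
  proof -
    have "t < \<psi> x \<longleftrightarrow> (\<exists>y\<in>ball x e. t < \<phi> y)" for x
      unfolding \<psi>_def using e by (subst less_cSUP_iff[OF _ bdd]) auto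
    moreover have "(\<exists>y\<in>ball x e. t < \<phi> y) \<longleftrightarrow> x \<in> minkowski_sum {x. t < \<phi> x} (ball 0 e)" for x
    proof
      assume "\<exists>y\<in>ball x e. t < \<phi> y"
      then obtain y where "y \<in> ball x e" "t < \<phi> y" by blast
      then show "x \<in> minkowski_sum {x. t < \<phi> x} (ball 0 e)" unfolding minkowski_sum_def
        by - (rule CollectI, rule exI[of _ y], rule exI[of _ "x - y"], auto simp: dist_norm norm_minus_commute)
    next
      assume "x \<in> minkowski_sum {x. t < \<phi> x} (ball 0 e)"
      then obtain y z where "x = y + z" "t < \<phi> y" "norm z < e" unfolding minkowski_sum_def by auto
      then show "\<exists>y\<in>ball x e. t < \<phi> y" by (intro bexI[of _ y]) (auto simp: dist_norm)
    qed
    ultimately show ?thesis by blast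
  qed
  have opn: "open {x. t < \<phi> x}" for t using cont by (simp add: open_Collect_less)
  have opn': "open {x. t < \<psi> x}" for t unfolding lev by (rule open_minkowski_sum) simp
  have [measurable]: "\<psi> \<in> borel_measurable borel"
    by (subst borel_measurable_iff_greater) (use opn' in auto)
  have [measurable]: "\<phi> \<in> borel_measurable borel" by (rule test_fun_borel[OF \<phi>])
  have ge: "\<phi> x \<le> \<psi> x" for x unfolding \<psi>_def using e by (intro cSUP_upper bdd) auto
  have \<psi>0: "\<psi> x = 0" if "x \<notin> cball 0 R" for x
  proof -
    have "\<phi> y = 0" if "y \<in> ball x e" for y
    proof (rule out)
      have "norm x \<le> norm y + norm (x - y)" using norm_triangle_sub[of x y] by (simp add: add.commute)
      then show "R0 < norm y" using \<open>x \<notin> cball 0 R\<close> that e by (auto simp: R_def dist_norm)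
    qed
    then have "\<psi> x = (SUP y\<in>ball x e. 0)" unfolding \<psi>_def by (intro SUP_cong) auto
    then show ?thesis using e by simp
  qed
  have up: "\<psi> x \<le> \<phi> x + e * (norm (classical_grad \<phi> x) + \<eta> * indicator (cball 0 R) x)" for x
  proof (cases "x \<in> cball 0 R")
    case False
    then show ?thesis using \<psi>0[OF False] nonneg[of x] e by simp
  next
    case True
    have "\<phi> y \<le> \<phi> x + e * (norm (classical_grad \<phi> x) + \<eta>)" if y: "y \<in> ball x e" for y
    proof -
      have "norm (\<phi> y - \<phi> x) \<le> (norm (classical_grad \<phi> x) + \<eta>) * norm (y - x)"
      proof (rule differentiable_bound[of "ball x e"])
        fix z assume z: "z \<in> ball x e"
        show "(\<phi> has_derivative (\<lambda>h. classical_grad \<phi> z \<bullet> h)) (at z within ball x e)"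
          by (rule has_derivative_at_withinI[OF differentiable_has_grad[OF smooth_on_differentiable[OF test_funD(1)[OF \<phi>]]]])
        have zx: "dist z x < e" using z by (simp add: dist_commute)
        have "norm z \<le> norm x + dist z x" using norm_triangle_sub[of z x] by (simp add: dist_norm)
        then have "x \<in> cball 0 (R + 1)" "z \<in> cball 0 (R + 1)" "dist z x < e0"
          using zx e True by auto
        then have "dist (classical_grad \<phi> z) (classical_grad \<phi> x) < \<eta>" by (rule e0(2))
        then have b: "norm (classical_grad \<phi> z) \<le> norm (classical_grad \<phi> x) + \<eta>"
          using norm_triangle_sub[of "classical_grad \<phi> z" "classical_grad \<phi> x"] by (simp add: dist_norm)
        show "onorm (\<lambda>h. classical_grad \<phi> z \<bullet> h) \<le> norm (classical_grad \<phi> x) + \<eta>"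
        proof (rule onorm_bound)
          show "norm (classical_grad \<phi> z \<bullet> h) \<le> (norm (classical_grad \<phi> x) + \<eta>) * norm h" for h
            using Cauchy_Schwarz_ineq2[of "classical_grad \<phi> z" h] mult_right_mono[OF b norm_ge_zero[of h]] by simp
        qed (use \<eta> in auto)
      qed (use y e in auto)
      also have "\<dots> \<le> (norm (classical_grad \<phi> x) + \<eta>) * e"
        using y \<eta> by (intro mult_left_mono) (auto simp: dist_norm norm_minus_commute)
      finally show ?thesis by (simp add: mult.commute)
    qed
    then show ?thesis unfolding \<psi>_def using e True by (intro cSUP_least) auto
  qed
  have int\<phi>: "integrable lborel \<phi>"
    by (rule integrable_compact_support[OF cont test_funD(2)[OF \<phi>]]) (rule zero_outside_support)
  have intg: "integrable lborel (\<lambda>x. norm (classical_grad \<phi> x))"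
    by (rule integrable_compact_support[OF _ test_funD(2)[OF \<phi>]])
      (auto intro!: continuous_intros grad_continuous test_funD(1)[OF \<phi>] simp: grad_outside_support)
  have intc: "integrable lborel (\<lambda>x. indicator (cball (0::real^'n) R) x :: real)" for R
    using emeasure_lborel_cball_finite[of "0::real^'n" R] by (intro integrable_real_indicator) auto
  have intb: "integrable lborel (\<lambda>x. \<phi> x + e * (norm (classical_grad \<phi> x) + \<eta> * indicator (cball 0 R) x))"
    using int\<phi> intg intc by (intro Bochner_Integration.integrable_add integrable_mult_right) auto
  have \<psi>nn: "0 \<le> \<psi> x" for x using ge[of x] nonneg[of x] by linarith
  have int\<psi>: "integrable lborel \<psi>"
    by (rule Bochner_Integration.integrable_bound[OF intb]) (use up \<psi>nn in \<open>auto intro!: AE_I2 order_trans[OF up] abs_ge_self\<close>)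
  \<comment> \<open>At a level t < l the superlevel set contains that of level l, so its
    neighbourhood gains at least e c in measure; at levels t >= l no gain is claimed.\<close>
  have meas: "emeasure lborel {x. t < \<phi> x} + indicator {..<l} t * ennreal (e * c) \<le> emeasure lborel {x. t < \<psi> x}" if t: "0 \<le> t" for t
  proof -
    have bU: "bounded {x. t < \<phi> x}"
      using out t by (intro boundedI[of _ R0]) (force simp: not_less[symmetric])
    then have bW: "bounded {x. t < \<psi> x}" unfolding lev by (intro bounded_minkowski_sum) auto
    have fin: "emeasure lborel {x. t < \<phi> x} = ennreal (measure lborel {x. t < \<phi> x})"
         "emeasure lborel {x. t < \<psi> x} = ennreal (measure lborel {x. t < \<psi> x})"
      using emeasure_bounded_finite[OF bU] emeasure_bounded_finite[OF bW] by (auto intro!: emeasure_eq_ennreal_measure)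
    have "measure lborel {x. t < \<phi> x} + indicator {..<l} t * (e * c) \<le>
      measure lborel {x. t < \<phi> x} + e * iso_const TYPE('n) * measure lborel {x. t < \<phi> x} powr (1 - 1 / real CARD('n))"
    proof (cases "t < l")
      case True
      then have "measure lborel {x. l < \<phi> x} \<le> measure lborel {x. t < \<phi> x}"
        using bU opn by (intro measure_mono_fmeasurable bounded_fmeasurable_lborel) auto
      then have "measure lborel {x. l < \<phi> x} powr (1 - 1 / real CARD('n)) \<le> measure lborel {x. t < \<phi> x} powr (1 - 1 / real CARD('n))"
        by (intro powr_mono2) auto
      then show ?thesis using True e iso_const_pos[where 'n='n] by (simp add: c_def mult.assoc mult_left_mono)
    next
      case False
      then show ?thesis using e iso_const_pos[where 'n='n] by simp
    qed
    also have "\<dots> \<le> measure lborel {x. t < \<psi> x}" unfolding lev by (rule measure_enlargement[OF opn bU e(1)])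
    finally show ?thesis unfolding fin using e c0
      by (auto simp: indicator_def ennreal_plus[symmetric] simp del: ennreal_plus intro!: ennreal_leI)
  qed
  \<comment> \<open>Summing the gains over all levels by the layer cake formula gives l e c in
    total. The integral of \<phi> then cancels against the upper bound for \<psi>, and e divides
    out.\<close>
  have "ennreal ((\<integral>x. \<phi> x \<partial>lborel) + l * (e * c)) = (\<integral>\<^sup>+x. ennreal (\<phi> x) \<partial>lborel) + ennreal l * ennreal (e * c)"
    using nn_integral_eq_integral[OF int\<phi>] nonneg l e c0 by (simp add: ennreal_mult'[symmetric] integral_nonneg)
  also have "\<dots> = (\<integral>\<^sup>+t. indicator {0..} t * emeasure lborel {x. t < \<phi> x} + indicator {0..<l} t * ennreal (e * c) \<partial>lborel)"
  proof -
    have "(\<lambda>t. emeasure lborel {x. t < \<phi> x}) \<in> borel_measurable lborel"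
    proof -
      have "(\<lambda>t. \<integral>\<^sup>+x. indicator {x. t < \<phi> x} x \<partial>lborel) \<in> borel_measurable lborel"
        unfolding indicator_def mem_Collect_eq by measurable
      then show ?thesis by (subst (asm) nn_integral_indicator) auto
    qed
    then show ?thesis
    using lborel.nn_integral_layer_cake[of \<phi>] nonneg l
    by (subst nn_integral_add) (auto simp: nn_integral_multc)
  qed
  also have "\<dots> \<le> (\<integral>\<^sup>+t. indicator {0..} t * emeasure lborel {x. t < \<psi> x} \<partial>lborel)"
  proof (rule nn_integral_mono)
    show "indicator {0..} t * emeasure lborel {x. t < \<phi> x} + indicator {0..<l} t * ennreal (e * c)
      \<le> indicator {0..} t * emeasure lborel {x. t < \<psi> x}" for t
      using meas[of t] by (cases "0 \<le> t") (auto simp: indicator_def)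
  qed
  also have "\<dots> = (\<integral>\<^sup>+x. ennreal (\<psi> x) \<partial>lborel)"
    using lborel.nn_integral_layer_cake[of \<psi>] \<psi>nn by simp
  also have "\<dots> = ennreal (\<integral>x. \<psi> x \<partial>lborel)"
    using nn_integral_eq_integral[OF int\<psi>] \<psi>nn by simp
  finally have "(\<integral>x. \<phi> x \<partial>lborel) + l * (e * c) \<le> (\<integral>x. \<psi> x \<partial>lborel)"
    using \<psi>nn by (subst (asm) ennreal_le_iff) (auto intro: integral_nonneg)
  also have "\<dots> \<le> (\<integral>x. \<phi> x + e * (norm (classical_grad \<phi> x) + \<eta> * indicator (cball 0 R) x) \<partial>lborel)"
    by (rule integral_mono[OF int\<psi> intb up])
  also have "\<dots> = (\<integral>x. \<phi> x \<partial>lborel) + e * ((\<integral>x. norm (classical_grad \<phi> x) \<partial>lborel) + \<eta> * m)"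
    using int\<phi> intg intc by (simp add: m_def)
  finally have "e * (l * c) \<le> e * ((\<integral>x. norm (classical_grad \<phi> x) \<partial>lborel) + \<eta> * m)" by (simp add: mult_ac)
  then have "l * c \<le> (\<integral>x. norm (classical_grad \<phi> x) \<partial>lborel) + \<eta> * m" using e by simp
  then show "l * iso_const TYPE('n) * measure lborel {x. l < \<phi> x} powr (1 - 1 / real CARD('n))
    \<le> (\<integral>x. norm (classical_grad \<phi> x) \<partial>lborel) + d" using \<open>\<eta> * m \<le> d\<close> unfolding c_def by (simp add: mult.assoc)
qed

lemma emeasure_radial_sublevel:
  fixes a :: real
  shows "emeasure lborel {x::real^'n::finite. unit_ball_vol TYPE('n) * norm x ^ CARD('n) < a} = ennreal a"
proof (cases "a > 0")
  case True
  define w where "w = unit_ball_vol TYPE('n)"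
  define n where "n = CARD('n)"
  define r where "r = (a / w) powr (1 / n)"
  have w: "w > 0" "n > 0" unfolding w_def n_def using unit_ball_vol_pos by auto
  have r: "r \<ge> 0" "r ^ n = a / w" unfolding r_def using w True by (auto intro: powr_root_power)
  have "{x::real^'n. w * norm x ^ n < a} = ball 0 r"
  proof (intro set_eqI)
    fix x :: "real^'n"
    have "w * norm x ^ n < a \<longleftrightarrow> norm x ^ n < r ^ n" unfolding r(2) using w(1) by (simp add: pos_less_divide_eq mult.commute)
    also have "\<dots> \<longleftrightarrow> norm x < r" using r w by (metis norm_ge_zero power_less_imp_less_base power_strict_mono)
    finally show "x \<in> {x. w * norm x ^ n < a} \<longleftrightarrow> x \<in> ball 0 r" by simp
  qed
  moreover have "emeasure lborel (ball (0::real^'n) r) = ennreal a"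
    using measure_ball_unit_ball_vol[OF r(1), of "0::real^'n"] w r emeasure_lborel_ball_finite[of "0::real^'n" r]
    by (subst emeasure_eq_ennreal_measure) (auto simp: w_def[symmetric] n_def[symmetric])
  ultimately show ?thesis unfolding w_def n_def by simp
next
  case False
  have "{x::real^'n. unit_ball_vol TYPE('n) * norm x ^ CARD('n) < a} = {}"
    using False unit_ball_vol_pos[where 'n='n] by (auto simp: not_less intro!: order_trans[of a 0])
  then show ?thesis using False by (simp add: ennreal_neg)
qed

text \<open>This replaces polar coordinates. The volume variable omega |x|^n is the measure of the
  ball of radius |x|, so it carries Lebesgue measure to Lebesgue measure on the half-line; comparing
  the measures of {..<a} is enough.\<close>

lemma radial_distr:
  "distr (lborel :: (real^'n::finite) measure) borel (\<lambda>x. unit_ball_vol TYPE('n) * norm x ^ CARD('n))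
    = density lborel (indicator {0..})" (is "?L = ?R")
proof (rule measure_eqI_generator_eq[where E="range lessThan" and A="\<lambda>i. {..<real i}" and \<Omega>=UNIV])
  have e: "emeasure ?L {..<a} = ennreal a" "emeasure ?R {..<a} = ennreal a" for a :: real
  proof -
    show "emeasure ?L {..<a} = ennreal a"
      using emeasure_radial_sublevel[where 'n='n, of a] by (subst emeasure_distr) (auto simp: vimage_def)
    have "emeasure ?R {..<a} = (\<integral>\<^sup>+x. indicator {0..} x * indicator {..<a} x \<partial>lborel)"
      by (subst emeasure_density) auto
    also have "\<dots> = (\<integral>\<^sup>+x. indicator {0..<a} x \<partial>lborel)"
      by (intro nn_integral_cong) (auto split: split_indicator)
    finally show "emeasure ?R {..<a} = ennreal a" by (cases "0 \<le> a") (auto simp: ennreal_neg)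
  qed
  show "Int_stable (range (lessThan :: real \<Rightarrow> _))" 
  proof (rule Int_stableI)
    fix A B :: "real set" assume "A \<in> range lessThan" "B \<in> range lessThan"
    then obtain a b where "A = {..<a}" "B = {..<b}" by blast
    then have "A \<inter> B = {..<min a b}" by auto
    then show "A \<inter> B \<in> range lessThan" by blast
  qed
  show "emeasure ?L X = emeasure ?R X" if "X \<in> range lessThan" for X using that e by auto
  show "sets ?L = sigma_sets UNIV (range lessThan)" "sets ?R = sigma_sets UNIV (range lessThan)"
    by (simp_all add: borel_Iio)
  show "(\<Union>i. {..<real i}) = UNIV" using reals_Archimedean2 by auto
  show "emeasure ?L {..<real i} \<noteq> \<infinity>" for i unfolding e by simp
qed auto

lemma nn_integral_radial:
  assumes [measurable]: "h \<in> borel_measurable borel"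
  shows "(\<integral>\<^sup>+x. h (unit_ball_vol TYPE('n) * norm (x::real^'n::finite) ^ CARD('n)) \<partial>lborel)
    = (\<integral>\<^sup>+\<sigma>. h \<sigma> * indicator {0..} \<sigma> \<partial>lborel)"
proof -
  have "(\<integral>\<^sup>+x. h (unit_ball_vol TYPE('n) * norm (x::real^'n) ^ CARD('n)) \<partial>lborel)
    = (\<integral>\<^sup>+\<sigma>. h \<sigma> \<partial>(distr (lborel::(real^'n) measure) borel (\<lambda>x. unit_ball_vol TYPE('n) * norm x ^ CARD('n))))"
    by (subst nn_integral_distr) auto
  also have "\<dots> = (\<integral>\<^sup>+\<sigma>. h \<sigma> * indicator {0..} \<sigma> \<partial>lborel)"
    unfolding radial_distr by (subst nn_integral_density) (auto simp: mult.commute)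
  finally show ?thesis .
qed

lemma integral_radial:
  fixes h :: "real \<Rightarrow> real"
  assumes [measurable]: "h \<in> borel_measurable borel"
  shows "(\<integral>x. h (unit_ball_vol TYPE('n) * norm (x::real^'n::finite) ^ CARD('n)) \<partial>lborel)
    = (\<integral>\<sigma>. h \<sigma> * indicator {0..} \<sigma> \<partial>lborel)"
    and "integrable lborel (\<lambda>x::real^'n. h (unit_ball_vol TYPE('n) * norm x ^ CARD('n))) \<longleftrightarrow>
      integrable lborel (\<lambda>\<sigma>. h \<sigma> * indicator {0..} \<sigma>)"
proof -
  let ?T = "\<lambda>x::real^'n. unit_ball_vol TYPE('n) * norm x ^ CARD('n)"
  have d: "density lborel (indicator {0..}) = density (lborel::real measure) (\<lambda>x. ennreal (indicator {0..} x))"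
    by (simp add: ennreal_indicator)
  have "(\<integral>x. h (?T x) \<partial>lborel) = (\<integral>\<sigma>. h \<sigma> \<partial>(distr lborel borel ?T))"
    by (subst integral_distr) auto
  also have "\<dots> = (\<integral>\<sigma>. h \<sigma> * indicator {0..} \<sigma> \<partial>lborel)"
    unfolding radial_distr d by (subst integral_density) (auto simp: mult.commute)
  finally show "(\<integral>x. h (?T x) \<partial>lborel) = (\<integral>\<sigma>. h \<sigma> * indicator {0..} \<sigma> \<partial>lborel)" .
  have "integrable lborel (\<lambda>x. h (?T x)) \<longleftrightarrow> integrable (distr lborel borel ?T) h"
    by (subst integrable_distr_eq) auto
  also have "\<dots> \<longleftrightarrow> integrable lborel (\<lambda>\<sigma>. h \<sigma> * indicator {0..} \<sigma>)"
    unfolding radial_distr d by (subst integrable_density) (auto simp: mult.commute)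
  finally show "integrable lborel (\<lambda>x. h (?T x)) \<longleftrightarrow> integrable lborel (\<lambda>\<sigma>. h \<sigma> * indicator {0..} \<sigma>)" .
qed

section \<open>Decreasing rearrangements\<close>

lemma sigma_finite_lebesgue: "sigma_finite_measure (lebesgue :: 'a::euclidean_space measure)"
proof
  obtain A :: "'a set set" where A: "countable A" "A \<subseteq> sets lborel" "\<Union>A = space lborel" "\<forall>a\<in>A. emeasure lborel a \<noteq> \<infinity>"
    using lborel.sigma_finite_countable by blast
  then show "\<exists>A::'a set set. countable A \<and> A \<subseteq> sets lebesgue \<and> \<Union>A = space lebesgue \<and> (\<forall>a\<in>A. emeasure lebesgue a \<noteq> \<infinity>)"
    by (intro exI[of _ A]) (auto simp: subset_iff)
qed

locale rearrangeable =
  fixes \<Omega> :: "(real^'n::finite) set" and w :: "real^'n \<Rightarrow> real"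
  assumes dom: "\<Omega> \<in> lmeasurable" and meas: "w \<in> borel_measurable (lebesgue_on \<Omega>)"
begin

abbreviation "\<mu> \<equiv> distrib_fun \<Omega> w"

text \<open>For \<sigma> <= 0 the set of levels in \<open>decr_rearr\<close> can be unbounded and
  its \<open>Sup\<close> meaningless, so the value 0 is put there and \<open>rearr\<close> becomes a
  Borel function on the whole line.\<close>

definition rearr :: "real \<Rightarrow> real" where
  "rearr \<sigma> = (if \<sigma> > 0 then decr_rearr \<Omega> w \<sigma> else 0)"

lemma level_measurable: "{x\<in>\<Omega>. \<bar>w x\<bar> > t} \<in> lmeasurable"
proof -
  have "(\<lambda>x. if x \<in> \<Omega> then w x else 0) \<in> borel_measurable lebesgue"
    using dom by (intro borel_measurable_if_I[OF meas]) auto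
  then have "{x \<in> space lebesgue. \<bar>if x \<in> \<Omega> then w x else 0\<bar> > t} \<in> sets lebesgue" by measurable
  then have "\<Omega> \<inter> {x. \<bar>if x \<in> \<Omega> then w x else 0\<bar> > t} \<in> lmeasurable"
    using dom by (intro fmeasurable_Int_fmeasurable) auto
  also have "\<Omega> \<inter> {x. \<bar>if x \<in> \<Omega> then w x else 0\<bar> > t} = {x\<in>\<Omega>. \<bar>w x\<bar> > t}" by auto
  finally show ?thesis .
qed

lemma distrib_antimono: "s \<le> t \<Longrightarrow> \<mu> t \<le> \<mu> s"
  unfolding distrib_fun_def using level_measurable by (intro measure_mono_fmeasurable) (auto dest: fmeasurableD)

lemma distrib_le: "\<mu> t \<le> measure lebesgue \<Omega>"
  unfolding distrib_fun_def using level_measurable dom by (intro measure_mono_fmeasurable) (auto dest: fmeasurableD)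

lemma distrib_nonneg: "0 \<le> \<mu> t"
  unfolding distrib_fun_def by simp

text \<open>Right continuity of \<mu>, a consequence of the strict inequality in its definition and
  of continuity of the measure from below.\<close>

lemma distrib_right_continuous:
  assumes "\<sigma> < \<mu> t"
  obtains t' where "t < t'" "\<sigma> < \<mu> t'"
proof -
  let ?A = "\<lambda>k. {x\<in>\<Omega>. \<bar>w x\<bar> > t + 1 / Suc k}"
  have "(\<Union>k. ?A k) = {x\<in>\<Omega>. \<bar>w x\<bar> > t}"
  proof (intro equalityI subsetI)
    fix x assume "x \<in> {x\<in>\<Omega>. \<bar>w x\<bar> > t}"
    moreover from this obtain k where "1 / Suc k < \<bar>w x\<bar> - t" by (metis (no_types) diff_gt_0_iff_gt mem_Collect_eq nat_approx_posE)
    ultimately show "x \<in> (\<Union>k. ?A k)" by (auto intro!: exI[of _ k])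
  next
    fix x assume "x \<in> (\<Union>k. ?A k)"
    then obtain k where "x \<in> \<Omega>" "t + 1 / Suc k < \<bar>w x\<bar>" by blast
    moreover have "0 < 1 / real (Suc k)" by simp
    ultimately have "x \<in> \<Omega>" "t < \<bar>w x\<bar>" by linarith+
    then show "x \<in> {x\<in>\<Omega>. \<bar>w x\<bar> > t}" by blast
  qed
  moreover have "(\<lambda>k. measure lebesgue (?A k)) \<longlonglongrightarrow> measure lebesgue (\<Union>k. ?A k)"
  proof (rule Lim_measure_incseq)
    show "range ?A \<subseteq> sets lebesgue" using level_measurable by (auto dest: fmeasurableD)
    show "incseq ?A"
    proof (rule incseq_SucI)
      fix k
      have "1 / real (Suc (Suc k)) \<le> 1 / real (Suc k)" by (simp add: field_simps)
      then show "?A k \<subseteq> ?A (Suc k)" by auto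
    qed
    show "emeasure lebesgue (\<Union>k. ?A k) \<noteq> \<infinity>"
      unfolding calculation using level_measurable[of t] by (auto simp: fmeasurable_def)
  qed
  ultimately have "(\<lambda>k. \<mu> (t + 1 / Suc k)) \<longlonglongrightarrow> \<mu> t" unfolding distrib_fun_def by simp
  then have "eventually (\<lambda>k. \<sigma> < \<mu> (t + 1 / Suc k)) sequentially" using assms by (rule order_tendstoD(1))
  then obtain k where "\<sigma> < \<mu> (t + 1 / Suc k)" by (meson eventually_sequentially order_refl)
  then show ?thesis using that[of "t + 1 / Suc k"] by simp
qed

text \<open>Continuity of the measure from above, available as \<Omega> has finite measure. It
  bounds the set of levels in \<open>decr_rearr\<close> for positive \<sigma>.\<close>

lemma distrib_vanishes:
  assumes "0 < \<sigma>"
  obtains t where "0 \<le> t" "\<mu> t < \<sigma>"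
proof -
  let ?A = "\<lambda>k::nat. {x\<in>\<Omega>. \<bar>w x\<bar> > real k}"
  have "(\<Inter>k. ?A k) = {}"
  proof -
    have "\<exists>k. \<not> real k < \<bar>w x\<bar>" for x using real_arch_simple[of "\<bar>w x\<bar>"] by (auto simp: not_less)
    then show ?thesis by auto
  qed
  moreover have "(\<lambda>k. measure lebesgue (?A k)) \<longlonglongrightarrow> measure lebesgue (\<Inter>k. ?A k)"
  proof (rule Lim_measure_decseq)
    show "range ?A \<subseteq> sets lebesgue" using level_measurable by (auto dest: fmeasurableD)
    show "decseq ?A" by (rule decseq_SucI) auto
    show "emeasure lebesgue (?A k) \<noteq> \<infinity>" for k using level_measurable[of "real k"] by (auto simp: fmeasurable_def)
  qed
  ultimately have "(\<lambda>k. \<mu> (real k)) \<longlonglongrightarrow> 0" unfolding distrib_fun_def by simp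
  then have "eventually (\<lambda>k. \<mu> (real k) < \<sigma>) sequentially" using assms by (rule order_tendstoD(2))
  then obtain k where "\<mu> (real k) < \<sigma>" by (meson eventually_sequentially order_refl)
  then show ?thesis using that[of "real k"] by simp
qed

lemma bdd_above_levels: "0 < \<sigma> \<Longrightarrow> bdd_above {t. 0 \<le> t \<and> \<sigma> < \<mu> t}"
proof -
  assume "0 < \<sigma>"
  then obtain T where "0 \<le> T" "\<mu> T < \<sigma>" by (rule distrib_vanishes)
  then have "t \<le> T" if "0 \<le> t" "\<sigma> < \<mu> t" for t
    using that distrib_antimono[of T t] by (cases "t \<le> T") auto
  then show ?thesis by (intro bdd_aboveI[of _ T]) auto
qed

text \<open>\<open>decr_rearr\<close> is the generalised inverse of \<mu>; the equivalence is strict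
  on both sides because \<mu> is right-continuous. Monotonicity, measurability and equimeasurability
  of the rearrangement all rest on it.\<close>

lemma less_decr_rearr_iff:
  assumes "0 < \<sigma>" "0 \<le> t"
  shows "t < decr_rearr \<Omega> w \<sigma> \<longleftrightarrow> \<sigma> < \<mu> t"
proof
  assume l: "t < decr_rearr \<Omega> w \<sigma>"
  \<comment> \<open>The default value 0 for an empty set of levels cannot exceed t >= 0.\<close>
  then have ne: "{t. 0 \<le> t \<and> \<sigma> < \<mu> t} \<noteq> {}" using assms unfolding decr_rearr_def Let_def by (auto split: if_splits)
  then have "t < Sup {t. 0 \<le> t \<and> \<sigma> < \<mu> t}" using l unfolding decr_rearr_def Let_def by (simp split: if_splits)
  then obtain t' where "t < t'" "\<sigma> < \<mu> t'"
    using less_cSup_iff[OF ne bdd_above_levels[OF assms(1)]] by auto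
  then show "\<sigma> < \<mu> t" using distrib_antimono[of t t'] by auto
next
  assume "\<sigma> < \<mu> t"
  then obtain t' where t': "t < t'" "\<sigma> < \<mu> t'" by (rule distrib_right_continuous)
  then have "t' \<in> {t. 0 \<le> t \<and> \<sigma> < \<mu> t}" using assms by auto
  moreover from this have "t' \<le> Sup {t. 0 \<le> t \<and> \<sigma> < \<mu> t}" by (intro cSup_upper bdd_above_levels assms(1))
  ultimately show "t < decr_rearr \<Omega> w \<sigma>" using t' unfolding decr_rearr_def Let_def by auto
qed

lemma decr_rearr_nonneg: "0 < \<sigma> \<Longrightarrow> 0 \<le> decr_rearr \<Omega> w \<sigma>"
proof (cases "{t. 0 \<le> t \<and> \<sigma> < \<mu> t} = {}")
  case True
  then show ?thesis unfolding decr_rearr_def Let_def by (simp add: True)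
next
  case False
  assume "0 < \<sigma>"
  from False obtain t where "t \<in> {t. 0 \<le> t \<and> \<sigma> < \<mu> t}" by blast
  moreover from this have "t \<le> Sup {t. 0 \<le> t \<and> \<sigma> < \<mu> t}"
    by (intro cSup_upper bdd_above_levels \<open>0 < \<sigma>\<close>)
  ultimately show ?thesis using False unfolding decr_rearr_def Let_def by auto
qed

lemma decr_rearr_antimono:
  assumes "0 < \<sigma>" "\<sigma> \<le> \<sigma>'"
  shows "decr_rearr \<Omega> w \<sigma>' \<le> decr_rearr \<Omega> w \<sigma>"
proof (rule ccontr)
  assume "\<not> ?thesis"
  then have l: "decr_rearr \<Omega> w \<sigma> < decr_rearr \<Omega> w \<sigma>'" by simp
  have n: "0 \<le> decr_rearr \<Omega> w \<sigma>" using assms by (intro decr_rearr_nonneg)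
  have "\<sigma>' < \<mu> (decr_rearr \<Omega> w \<sigma>)" using l less_decr_rearr_iff[OF _ n, of \<sigma>'] assms by auto
  then have "\<sigma> < \<mu> (decr_rearr \<Omega> w \<sigma>)" using assms by auto
  then show False using less_decr_rearr_iff[OF assms(1) n] by simp
qed

lemma rearr_nonneg: "0 \<le> rearr \<sigma>"
  unfolding rearr_def using decr_rearr_nonneg by auto

lemma rearr_antimono: "0 < \<sigma> \<Longrightarrow> \<sigma> \<le> \<sigma>' \<Longrightarrow> rearr \<sigma>' \<le> rearr \<sigma>"
  unfolding rearr_def using decr_rearr_antimono[of \<sigma> \<sigma>'] by auto

lemma less_rearr_iff: "0 \<le> t \<Longrightarrow> t < rearr \<sigma> \<longleftrightarrow> 0 < \<sigma> \<and> \<sigma> < \<mu> t"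
  unfolding rearr_def using less_decr_rearr_iff by auto

lemma rearr_superlevel: "{\<sigma>. t < rearr \<sigma>} = (if 0 \<le> t then {0<..<\<mu> t} else UNIV)"
proof (cases "0 \<le> t")
  case True then show ?thesis using less_rearr_iff by auto
next
  case False
  have "t < rearr \<sigma>" for \<sigma> using False rearr_nonneg[of \<sigma>] by linarith
  then show ?thesis using False by auto
qed

lemma rearr_borel[measurable]: "rearr \<in> borel_measurable borel"
  by (subst borel_measurable_iff_greater) (auto simp: rearr_superlevel)

text \<open>Hardy--Littlewood, by integrating the inequality between the measures of superlevel sets.\<close>

lemma nn_integral_le_rearr:
  assumes w: "\<And>x. x \<in> \<Omega> \<Longrightarrow> 0 \<le> w x" and E: "E \<in> sets lebesgue" "E \<subseteq> \<Omega>"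
  shows "(\<integral>\<^sup>+x. ennreal (w x) * indicator E x \<partial>lebesgue)
      \<le> (\<integral>\<^sup>+\<sigma>. ennreal (rearr \<sigma>) * indicator {0<..<measure lebesgue E} \<sigma> \<partial>lborel)"
proof -
  interpret leb: sigma_finite_measure "lebesgue :: (real^'n) measure" by (rule sigma_finite_lebesgue)
  have Ef: "E \<in> lmeasurable" using dom E by (metis Int_absorb1 fmeasurable_Int_fmeasurable)
  define h where "h x = (if x \<in> \<Omega> then w x else 0) * indicator E x" for x
  have hm: "h \<in> borel_measurable lebesgue"
    unfolding h_def using E dom by (intro borel_measurable_times borel_measurable_if_I[OF meas] borel_measurable_indicator) auto
  have hn: "0 \<le> h x" for x using w by (auto simp: h_def)
  define k where "k \<sigma> = rearr \<sigma> * indicator {0<..<measure lebesgue E} \<sigma>" for \<sigma>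
  have km[measurable]: "k \<in> borel_measurable lborel" unfolding k_def by measurable
  have "(\<integral>\<^sup>+x. ennreal (w x) * indicator E x \<partial>lebesgue) = (\<integral>\<^sup>+x. ennreal (h x) \<partial>lebesgue)"
    using E by (intro nn_integral_cong) (auto simp: h_def split: split_indicator)
  also have "\<dots> = (\<integral>\<^sup>+t. indicator {0..} t * emeasure lebesgue {x. t < h x} \<partial>lborel)"
    using leb.nn_integral_layer_cake[OF hm hn] by simp
  also have "\<dots> \<le> (\<integral>\<^sup>+t. indicator {0..} t * emeasure lborel {\<sigma>. t < k \<sigma>} \<partial>lborel)"
  proof (rule nn_integral_mono)
    fix t :: real
    show "indicator {0..} t * emeasure lebesgue {x. t < h x} \<le> indicator {0..} t * emeasure lborel {\<sigma>. t < k \<sigma>}"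
    proof (cases "0 \<le> t")
      case True
      have "t < h x \<longleftrightarrow> x \<in> E \<and> x \<in> \<Omega> \<and> t < \<bar>w x\<bar>" for x
        using True w[of x] E(2) by (cases "x \<in> E") (auto simp: h_def)
      then have "{x. t < h x} = E \<inter> {x\<in>\<Omega>. \<bar>w x\<bar> > t}" by blast
      then have "emeasure lebesgue {x. t < h x} = ennreal (measure lebesgue (E \<inter> {x\<in>\<Omega>. \<bar>w x\<bar> > t}))"
        using Ef level_measurable[of t] by (simp add: emeasure_eq_measure2 fmeasurableD fmeasurable_Int_fmeasurable)
      \<comment> \<open>Both measures bound that of the intersection, and their minimum is the
        length of the superlevel set of the rearrangement cut off at |E|.\<close>
      also have "\<dots> \<le> ennreal (min (measure lebesgue E) (\<mu> t))"
        unfolding distrib_fun_def using Ef level_measurable[of t] E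
        by (intro ennreal_leI min.boundedI measure_mono_fmeasurable) (auto dest: fmeasurableD)
      also have "\<dots> = emeasure lborel {0<..<min (measure lebesgue E) (\<mu> t)}"
        using distrib_nonneg[of t] by simp
      also have "{0<..<min (measure lebesgue E) (\<mu> t)} = {\<sigma>. t < k \<sigma>}"
      proof -
        have "t < k \<sigma> \<longleftrightarrow> \<sigma> \<in> {0<..<min (measure lebesgue E) (\<mu> t)}" for \<sigma>
        proof (cases "\<sigma> \<in> {0<..<measure lebesgue E}")
          case True
          then have "k \<sigma> = rearr \<sigma>" by (simp add: k_def)
          then show ?thesis using True less_rearr_iff[OF \<open>0 \<le> t\<close>, of \<sigma>] by auto
        next
          case False
          then have "k \<sigma> = 0" by (simp add: k_def)
          then show ?thesis using False \<open>0 \<le> t\<close> by auto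
        qed
        then show ?thesis by blast
      qed
      finally show ?thesis using True by simp
    qed simp
  qed
  also have "\<dots> = (\<integral>\<^sup>+\<sigma>. ennreal (k \<sigma>) \<partial>lborel)"
    using lborel.nn_integral_layer_cake[OF km] rearr_nonneg by (simp add: k_def)
  also have "\<dots> = (\<integral>\<^sup>+\<sigma>. ennreal (rearr \<sigma>) * indicator {0<..<measure lebesgue E} \<sigma> \<partial>lborel)"
    by (intro nn_integral_cong) (auto simp: k_def split: split_indicator)
  finally show ?thesis .
qed

text \<open>Corresponding superlevel sets have the same measure. This direction is the one that
  makes the rearrangement of an integrable function integrable.\<close>

lemma nn_integral_rearr_le:
  assumes w: "\<And>x. x \<in> \<Omega> \<Longrightarrow> 0 \<le> w x"
  shows "(\<integral>\<^sup>+\<sigma>. ennreal (rearr \<sigma>) \<partial>lborel) \<le> (\<integral>\<^sup>+x. ennreal (w x) * indicator \<Omega> x \<partial>lebesgue)"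
proof -
  interpret leb: sigma_finite_measure "lebesgue :: (real^'n) measure" by (rule sigma_finite_lebesgue)
  define h where "h x = (if x \<in> \<Omega> then w x else 0)" for x
  have hm: "h \<in> borel_measurable lebesgue"
    unfolding h_def using dom by (intro borel_measurable_if_I[OF meas]) auto
  have hn: "0 \<le> h x" for x using w by (auto simp: h_def)
  have "(\<integral>\<^sup>+\<sigma>. ennreal (rearr \<sigma>) \<partial>lborel) = (\<integral>\<^sup>+t. indicator {0..} t * emeasure lborel {\<sigma>. t < rearr \<sigma>} \<partial>lborel)"
    using lborel.nn_integral_layer_cake[of rearr] rearr_nonneg by simp
  also have "\<dots> \<le> (\<integral>\<^sup>+t. indicator {0..} t * emeasure lebesgue {x. t < h x} \<partial>lborel)"
  proof (rule nn_integral_mono)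
    fix t :: real
    show "indicator {0..} t * emeasure lborel {\<sigma>. t < rearr \<sigma>} \<le> indicator {0..} t * emeasure lebesgue {x. t < h x}"
    proof (cases "0 \<le> t")
      case True
      have "t < h x \<longleftrightarrow> x \<in> \<Omega> \<and> t < \<bar>w x\<bar>" for x
        using True w[of x] by (cases "x \<in> \<Omega>") (auto simp: h_def)
      then have "{x. t < h x} = {x\<in>\<Omega>. \<bar>w x\<bar> > t}" by blast
      then show ?thesis
        using True rearr_superlevel[of t] level_measurable[of t] distrib_nonneg[of t]
        by (simp add: distrib_fun_def emeasure_eq_measure2 fmeasurableD)
    qed simp
  qed
  also have "\<dots> = (\<integral>\<^sup>+x. ennreal (h x) \<partial>lebesgue)"
    using leb.nn_integral_layer_cake[OF hm hn] by simp
  also have "\<dots> = (\<integral>\<^sup>+x. ennreal (w x) * indicator \<Omega> x \<partial>lebesgue)"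
    by (intro nn_integral_cong) (auto simp: h_def split: split_indicator)
  finally show ?thesis .
qed

definition rearr_primitive :: "real \<Rightarrow> real" where
  "rearr_primitive r = (\<integral>\<sigma>. rearr \<sigma> * indicator {0<..<r} \<sigma> \<partial>lborel)"

lemma rearr_primitive_nonneg: "0 \<le> rearr_primitive r"
  unfolding rearr_primitive_def using rearr_nonneg by (intro Bochner_Integration.integral_nonneg) auto

lemma integrable_rearr_subset:
  assumes "integrable lborel rearr" "A \<in> sets borel"
  shows "integrable lborel (\<lambda>\<sigma>. rearr \<sigma> * indicator A \<sigma>)"
  by (rule Bochner_Integration.integrable_bound[OF assms(1)])
    (use assms rearr_nonneg in \<open>auto split: split_indicator\<close>)

lemma nn_integral_rearr_primitive:
  assumes "integrable lborel rearr"
  shows "(\<integral>\<^sup>+\<sigma>. ennreal (rearr \<sigma>) * indicator {0<..<r} \<sigma> \<partial>lborel) = ennreal (rearr_primitive r)"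
proof -
  have "(\<integral>\<^sup>+\<sigma>. ennreal (rearr \<sigma>) * indicator {0<..<r} \<sigma> \<partial>lborel) = (\<integral>\<^sup>+\<sigma>. ennreal (rearr \<sigma> * indicator {0<..<r} \<sigma>) \<partial>lborel)"
    by (intro nn_integral_cong) (auto split: split_indicator)
  also have "\<dots> = ennreal (rearr_primitive r)"
    unfolding rearr_primitive_def using rearr_nonneg
    by (intro nn_integral_eq_integral integrable_rearr_subset assms) auto
  finally show ?thesis .
qed

text \<open>The decreasing integrand may be unbounded near 0, but to the right of r/2 it is bounded
  by its value there, so the primitive is Lipschitz on that half-line.\<close>

lemma isCont_rearr_primitive:
  assumes int: "integrable lborel rearr" and "0 < r"
  shows "isCont rearr_primitive r"
proof -
  define C where "C = rearr (r / 2)"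
  have C: "0 \<le> C" unfolding C_def by (rule rearr_nonneg)
  have lip: "\<bar>rearr_primitive b - rearr_primitive a\<bar> \<le> C * (b - a)" if ab: "r / 2 \<le> a" "a \<le> b" for a b
  proof -
    have "rearr_primitive b - rearr_primitive a = (\<integral>\<sigma>. rearr \<sigma> * indicator {0<..<b} \<sigma> - rearr \<sigma> * indicator {0<..<a} \<sigma> \<partial>lborel)"
      unfolding rearr_primitive_def using int by (subst Bochner_Integration.integral_diff) (auto intro!: integrable_rearr_subset)
    also have "\<dots> = (\<integral>\<sigma>. rearr \<sigma> * indicator {a..<b} \<sigma> \<partial>lborel)"
      using ab \<open>0 < r\<close> by (intro Bochner_Integration.integral_cong) (auto split: split_indicator)
    finally have e: "rearr_primitive b - rearr_primitive a = (\<integral>\<sigma>. rearr \<sigma> * indicator {a..<b} \<sigma> \<partial>lborel)" .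
    have "(\<integral>\<sigma>. rearr \<sigma> * indicator {a..<b} \<sigma> \<partial>lborel) \<le> (\<integral>\<sigma>. C * indicator {a..<b} \<sigma> \<partial>lborel)"
    proof (rule integral_mono')
      show "rearr \<sigma> * indicator {a..<b} \<sigma> \<le> C * indicator {a..<b} \<sigma>" for \<sigma>
        using ab \<open>0 < r\<close> rearr_antimono[of "r/2" \<sigma>] unfolding C_def by (auto split: split_indicator)
    qed (use C ab in \<open>auto intro!: integrable_real_indicator\<close>)
    also have "\<dots> = C * (b - a)" using ab by simp
    finally have "(\<integral>\<sigma>. rearr \<sigma> * indicator {a..<b} \<sigma> \<partial>lborel) \<le> C * (b - a)" .
    moreover have "0 \<le> (\<integral>\<sigma>. rearr \<sigma> * indicator {a..<b} \<sigma> \<partial>lborel)"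
      using rearr_nonneg by (intro Bochner_Integration.integral_nonneg) auto
    ultimately show ?thesis using e by simp
  qed
  have "continuous_on {r/2<..} rearr_primitive"
  proof (rule lipschitz_on_continuous_on[of C])
    show "C-lipschitz_on {r/2<..} rearr_primitive"
    proof (rule lipschitz_onI)
      fix x y assume "x \<in> {r/2<..}" "y \<in> {r/2<..}"
      then show "dist (rearr_primitive x) (rearr_primitive y) \<le> C * dist x y"
        using lip[of x y] lip[of y x] by (cases "x \<le> y") (auto simp: dist_real_def abs_minus_commute)
    qed (rule C)
  qed
  then show ?thesis using \<open>0 < r\<close> by (simp add: continuous_on_eq_continuous_at)
qed

end

lemma AE_lborel_nonzero: "AE x in lborel. (x::'a::euclidean_space) \<noteq> 0"
  by (rule AE_I'[of "{0}"]) (auto simp: null_sets_def)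

section \<open>Weak gradients tested with smooth functions\<close>

lemma integrable_mult_test_fun:
  fixes g :: "real^'n::finite \<Rightarrow> real"
  assumes g: "locally_integrable_on g U" and \<phi>: "test_fun U \<phi>"
  shows "integrable lebesgue (\<lambda>x. g x * \<phi> x)"
proof -
  define K where "K = closure {x. \<phi> x \<noteq> 0}"
  have K: "compact K" "K \<subseteq> U" using \<phi> by (auto simp: test_fun_def K_def)
  have i: "integrable lebesgue (\<lambda>x. indicator K x *\<^sub>R g x)"
    using g K unfolding locally_integrable_on_def set_integrable_def by blast
  obtain C where C: "\<And>x. \<bar>\<phi> x\<bar> \<le> C" using test_fun_bounded[OF \<phi>] by blast
  have m: "\<phi> \<in> borel_measurable lebesgue"
    using test_fun_borel[OF \<phi>] by (simp add: measurable_completion)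
  have e: "g x * \<phi> x = (indicator K x *\<^sub>R g x) * \<phi> x" for x
    using zero_outside_support[of x \<phi>] by (auto simp: K_def split: split_indicator)
  have "integrable lebesgue (\<lambda>x. (indicator K x *\<^sub>R g x) * \<phi> x)"
  proof (rule Bochner_Integration.integrable_bound[OF integrable_mult_left[of C, OF integrable_norm[OF i]]])
    show "(\<lambda>x. indicator K x *\<^sub>R g x * \<phi> x) \<in> borel_measurable lebesgue"
      using borel_measurable_integrable[OF i] m by (intro borel_measurable_times)
    show "AE x in lebesgue. norm (indicator K x *\<^sub>R g x * \<phi> x) \<le> norm (norm (indicator K x *\<^sub>R g x) * C)"
    proof (rule AE_I2)
      fix x
      have "\<bar>C\<bar> = C" using C[of 0] by linarith
      then show "norm (indicator K x *\<^sub>R g x * \<phi> x) \<le> norm (norm (indicator K x *\<^sub>R g x) * C)"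
        using C[of x] by (simp add: abs_mult mult_left_mono)
    qed
  qed
  then show ?thesis unfolding e .
qed

lemma set_integral_mult_test_fun:
  assumes "test_fun U \<phi>" "U \<subseteq> V"
  shows "(LINT x:V|lebesgue. g x * \<phi> x) = (\<integral>x. g x * \<phi> x \<partial>lebesgue)"
  unfolding set_lebesgue_integral_def
  by (intro Bochner_Integration.integral_cong)
    (use test_funD(3)[OF assms(1)] assms(2) in \<open>auto split: split_indicator\<close>)

definition laplacian :: "(real^'n::finite \<Rightarrow> real) \<Rightarrow> real^'n \<Rightarrow> real" where
  "laplacian \<phi> x = (\<Sum>i\<in>UNIV. partial_deriv i (partial_deriv i \<phi>) x)"

lemma test_fun_mono: "test_fun U \<phi> \<Longrightarrow> U \<subseteq> V \<Longrightarrow> test_fun V \<phi>"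
  unfolding test_fun_def by blast

text \<open>Both derivatives are moved onto the test function. The resulting expression contains
  only u, so two weak gradients of u, given on different domains, produce the same value without any
  uniqueness argument.\<close>

lemma weak_grad_laplacian:
  fixes u :: "real^'n::finite \<Rightarrow> real"
  assumes G: "weak_grad_on V u G" and \<phi>: "test_fun U \<phi>" and UV: "U \<subseteq> V"
  shows "integrable lebesgue (\<lambda>x. u x * laplacian \<phi> x)"
    "(LINT x:U|lebesgue. G x \<bullet> classical_grad \<phi> x) = - (\<integral>x. u x * laplacian \<phi> x \<partial>lebesgue)"
    "(\<integral>x. G x \<bullet> classical_grad \<phi> x \<partial>lebesgue) = - (\<integral>x. u x * laplacian \<phi> x \<partial>lebesgue)"
proof -
  note tV = test_fun_mono[OF _ UV]
  have lu: "locally_integrable_on u V" and lG: "\<And>i. locally_integrable_on (\<lambda>x. G x $ i) V"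
    and eq: "\<And>\<psi> i. test_fun V \<psi> \<Longrightarrow> (LINT x:V|lebesgue. u x * partial_deriv i \<psi> x) = - (LINT x:V|lebesgue. G x $ i * \<psi> x)"
    using G unfolding weak_grad_on_def by blast+
  have tp: "test_fun V (partial_deriv i \<phi>)" "test_fun V (partial_deriv i (partial_deriv i \<phi>))" for i
    by (intro test_fun_partial tV \<phi>)+
  have iu: "integrable lebesgue (\<lambda>x. u x * partial_deriv i (partial_deriv i \<phi>) x)" for i
    by (rule integrable_mult_test_fun[OF lu tp(2)])
  have iG: "integrable lebesgue (\<lambda>x. G x $ i * partial_deriv i \<phi> x)" for i
    by (rule integrable_mult_test_fun[OF lG tp(1)])
  show "integrable lebesgue (\<lambda>x. u x * laplacian \<phi> x)"
    unfolding laplacian_def sum_distrib_left by (rule Bochner_Integration.integrable_sum) (rule iu)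
  have "(\<integral>x. G x \<bullet> classical_grad \<phi> x \<partial>lebesgue) = (\<Sum>i\<in>UNIV. \<integral>x. G x $ i * partial_deriv i \<phi> x \<partial>lebesgue)"
    unfolding inner_vec_def classical_grad_def using iG by (simp add: Bochner_Integration.integral_sum)
  also have "\<dots> = (\<Sum>i\<in>UNIV. - (\<integral>x. u x * partial_deriv i (partial_deriv i \<phi>) x \<partial>lebesgue))"
  proof (rule sum.cong)
    fix i
    show "(\<integral>x. G x $ i * partial_deriv i \<phi> x \<partial>lebesgue) = - (\<integral>x. u x * partial_deriv i (partial_deriv i \<phi>) x \<partial>lebesgue)"
      using eq[OF tp(1), of i i] set_integral_mult_test_fun[OF tp(1) order_refl, of "\<lambda>x. G x $ i"]
        set_integral_mult_test_fun[OF tp(2) order_refl, of u] by simp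
  qed simp
  also have "\<dots> = - (\<integral>x. u x * laplacian \<phi> x \<partial>lebesgue)"
    unfolding laplacian_def sum_distrib_left using iu by (simp add: Bochner_Integration.integral_sum sum_negf)
  finally show *: "(\<integral>x. G x \<bullet> classical_grad \<phi> x \<partial>lebesgue) = - (\<integral>x. u x * laplacian \<phi> x \<partial>lebesgue)" .
  have "(LINT x:U|lebesgue. G x \<bullet> classical_grad \<phi> x) = (\<integral>x. G x \<bullet> classical_grad \<phi> x \<partial>lebesgue)"
    unfolding set_lebesgue_integral_def
    by (intro Bochner_Integration.integral_cong) (auto simp: grad_outside_domain[OF \<phi>] split: split_indicator)
  then show "(LINT x:U|lebesgue. G x \<bullet> classical_grad \<phi> x) = - (\<integral>x. u x * laplacian \<phi> x \<partial>lebesgue)"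
    using * by simp
qed

section \<open>Radial test functions\<close>

lemma deriv_pow_zero_on_open:
  assumes "open S" "\<And>x. x \<in> S \<Longrightarrow> f x = (0::real)" "x \<in> S"
  shows "(deriv ^^ k) f x = 0"
  using assms(3)
proof (induction k arbitrary: x)
  case 0 then show ?case using assms by simp
next
  case (Suc k)
  have "((deriv ^^ k) f has_real_derivative 0) (at x)"
    by (rule has_field_derivative_transform_within_open[of "\<lambda>_. 0" _ _ S]) (use Suc assms in auto)
  then show ?case by (simp add: DERIV_imp_deriv)
qed

text \<open>The radial profile contains real powers of t = |x|^2, singular at 0; multiplication by
  \<theta>, which vanishes up to \<tau>, removes a neighbourhood of 0. Powers times derivatives of
  \<theta> form a family closed under differentiation.\<close>

lemma smooth1_powr_profile:
  assumes \<theta>: "smooth1 \<theta>" and zero: "\<And>\<sigma>. \<sigma> \<le> \<tau> \<Longrightarrow> \<theta> \<sigma> = 0" and pos: "0 < \<tau>" "0 < w" "0 < b"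
  shows "smooth1 (\<lambda>t. if 0 < t then t powr a * \<theta> (w * t powr b) else 0)"
proof -
  define M where "M a j t = (if 0 < t then t powr a * (deriv ^^ j) \<theta> (w * t powr b) else 0)" for a j t
  define t0 where "t0 = (\<tau> / w) powr (1 / b)"
  have t0: "0 < t0" using pos by (simp add: t0_def)
  have small: "w * t powr b < \<tau>" if "0 < t" "t < t0" for t
  proof -
    have "t powr b < t0 powr b" using that pos by (intro powr_less_mono2) auto
    also have "t0 powr b = \<tau> / w" using pos by (simp add: t0_def powr_powr)
    finally show ?thesis using pos by (simp add: field_simps)
  qed
  have Mz: "M a j t = 0" if "t < t0" for a j t
    using deriv_pow_zero_on_open[of "{..<\<tau>}" \<theta> "w * t powr b" j] zero small[of t] that by (auto simp: M_def)
  have d: "(M a j has_real_derivative a * M (a - 1) j t + w * b * M (a + b - 1) (Suc j) t) (at t)" for a j t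
  proof (cases "0 < t")
    case True
    have 1: "((\<lambda>t. w * t powr b) has_real_derivative w * (b * t powr (b - 1))) (at t)"
      using True by (auto intro!: derivative_eq_intros)
    have 2: "((\<lambda>t. (deriv ^^ j) \<theta> (w * t powr b)) has_real_derivative
        (deriv ^^ Suc j) \<theta> (w * t powr b) * (w * (b * t powr (b - 1)))) (at t)"
      by (rule DERIV_chain2[OF smooth1_deriv_pow[OF \<theta>] 1])
    have 3: "((\<lambda>t. t powr a) has_real_derivative a * t powr (a - 1)) (at t)"
      using True by (auto intro!: derivative_eq_intros)
    have "((\<lambda>t. t powr a * (deriv ^^ j) \<theta> (w * t powr b)) has_real_derivative
       a * t powr (a - 1) * (deriv ^^ j) \<theta> (w * t powr b)
       + (deriv ^^ Suc j) \<theta> (w * t powr b) * (w * (b * t powr (b - 1))) * t powr a) (at t)"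
      by (rule DERIV_mult[OF 3 2])
    also have "a * t powr (a - 1) * (deriv ^^ j) \<theta> (w * t powr b)
       + (deriv ^^ Suc j) \<theta> (w * t powr b) * (w * (b * t powr (b - 1))) * t powr a
       = a * M (a - 1) j t + w * b * M (a + b - 1) (Suc j) t"
    proof -
      have "t powr (a + b - 1) = t powr (b - 1) * t powr a" using powr_add[of t "b - 1" a] by (simp add: algebra_simps)
      then show ?thesis using True by (simp add: M_def del: funpow.simps)
    qed
    finally show ?thesis
      by (rule has_field_derivative_transform_within_open[of _ _ _ "{0<..}"]) (use True in \<open>auto simp: M_def\<close>)
  next
    case False
    have "(M a j has_real_derivative 0) (at t)"
      by (rule has_field_derivative_transform_within_open[of "\<lambda>_. 0" _ _ "{..<t0}"]) (use False t0 Mz in auto)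
    then show ?thesis using False by (simp add: M_def)
  qed
  let ?B = "\<Union>a j. {M a j}"
  have gen: "M a j \<in> alg ?B" for a j by (rule alg_gen) blast
  have "smooth1 (M a 0)"
  proof (rule smooth1_alg[of ?B])
    show "\<forall>m\<in>?B. \<exists>m'\<in>alg ?B. \<forall>x. (m has_real_derivative m' x) (at x)"
    proof
      fix m assume "m \<in> ?B"
      then obtain a j where m: "m = M a j" by blast
      have "(\<lambda>t. a * M (a - 1) j t + w * b * M (a + b - 1) (Suc j) t) \<in> alg ?B"
        by (intro alg_add alg_cmult gen)
      then show "\<exists>m'\<in>alg ?B. \<forall>x. (m has_real_derivative m' x) (at x)"
        by (rule bexI[rotated]) (simp only: m, intro allI d)
    qed
  qed (rule gen)
  moreover have "M a 0 = (\<lambda>t. if 0 < t then t powr a * \<theta> (w * t powr b) else 0)" by (simp add: M_def fun_eq_iff)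
  ultimately show ?thesis by simp
qed

text \<open>\<open>iso_const\<^sup>2 * \<sigma> powr (2 - 2/n)\<close> is the coefficient of the radial Laplacian in the volume variable \<open>\<sigma> = \<omega> |x|\<^sup>n\<close>:
  if \<open>\<psi>' = -\<theta> / (iso_const\<^sup>2 * \<sigma> powr (2 - 2/n))\<close>, then \<open>\<Delta> (\<psi> (\<omega> |x|\<^sup>n)) = -\<theta>' (\<omega> |x|\<^sup>n)\<close>.\<close>

definition vol_coeff :: "'n::finite itself \<Rightarrow> real \<Rightarrow> real" where
  "vol_coeff _ \<sigma> = (iso_const TYPE('n))\<^sup>2 * \<sigma> powr (2 - 2 / real CARD('n))"

lemma vol_coeff_pos: "0 < \<sigma> \<Longrightarrow> 0 < vol_coeff TYPE('n::finite) \<sigma>"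
  unfolding vol_coeff_def using iso_const_pos[where 'n='n] by simp

text \<open>Written in t = |x|^2, the Laplacian of g(t) is 4 t g'' + 2 n g'. The choice g' =
  -\<kappa> t^(-n/2) \<theta>(omega t^(n/2)) makes the terms with \<theta> itself cancel and leaves
  a multiple of \<theta>'. Since \<theta> vanishes near 0 and from \<tau>3 < M on, g is smooth and
  compactly supported in the ball of volume M.\<close>

lemma radial_test_fun_exists:
  fixes M :: real
  assumes \<theta>: "smooth1 \<theta>" "\<And>\<sigma>. 0 \<le> \<theta> \<sigma>" "\<And>\<sigma>. \<sigma> \<le> \<tau>0 \<or> \<tau>3 \<le> \<sigma> \<Longrightarrow> \<theta> \<sigma> = 0"
    and \<tau>: "0 < \<tau>0" "\<tau>0 < \<tau>3" "\<tau>3 < M"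
  defines "vol \<equiv> \<lambda>x::real^'n::finite. unit_ball_vol TYPE('n) * norm x ^ CARD('n)"
  obtains \<psi> where
    "test_fun (ball 0 ((M / unit_ball_vol TYPE('n)) powr (1 / real CARD('n)))) (\<lambda>x. \<psi> (vol x))"
    "\<And>x. laplacian (\<lambda>x. \<psi> (vol x)) x = - deriv \<theta> (vol x)"
    "\<And>\<sigma>. 0 < \<sigma> \<Longrightarrow> (\<psi> has_real_derivative - (\<theta> \<sigma> / vol_coeff TYPE('n) \<sigma>)) (at \<sigma>)"
    "\<And>\<sigma>. \<tau>3 \<le> \<sigma> \<Longrightarrow> \<psi> \<sigma> = 0" "\<psi> \<in> borel_measurable borel"
proof -
  define n where "n = real CARD('n)"
  define w where "w = unit_ball_vol TYPE('n)"
  define b where "b = n / 2"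
  \<comment> \<open>Normalisation giving 4 \<kappa> w b = 1, hence exactly -\<theta>' as the
    Laplacian.\<close>
  define \<kappa> where "\<kappa> = 1 / (2 * n * w)"
  have pos: "0 < n" "0 < w" "0 < b" "0 < \<kappa>" unfolding n_def w_def b_def \<kappa>_def using unit_ball_vol_pos[where 'n='n] by auto
  define k where "k t = (if 0 < t then t powr (-b) * \<theta> (w * t powr b) else 0)" for t
  have "smooth1 k" unfolding k_def by (rule smooth1_powr_profile[where \<tau>=\<tau>0]) (use \<theta> \<tau> pos in auto)
  then have sk: "smooth1 (\<lambda>t. (-\<kappa>) * k t)" by (intro smooth1_mult smooth1_const)
  then obtain H where H: "\<And>t. (H has_real_derivative (-\<kappa>) * k t) (at t)" "smooth1 H" using smooth1_antideriv by blast
  define T where "T = (\<tau>3 / w) powr (1 / b)"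
  have T: "0 < T" "T powr b = \<tau>3 / w" using pos \<tau> by (auto simp: T_def powr_powr)
  \<comment> \<open>The constant makes g vanish from T on, where T is the value of |x|^2 at volume
    \<tau>3.\<close>
  define g where "g t = H t + (- H T)" for t
  have sg: "smooth1 g" unfolding g_def by (intro smooth1_add smooth1_const H)
  have dg: "(g has_real_derivative (-\<kappa>) * k t) (at t)" for t
    unfolding g_def using H(1)[of t] by (auto intro!: derivative_eq_intros)
  have kz: "k t = 0" if "T \<le> t" for t
  proof -
    have "T powr b \<le> t powr b" using that T pos by (intro powr_mono2) auto
    then have "\<tau>3 \<le> w * t powr b" using T pos by (simp add: field_simps)
    then show ?thesis using \<theta>(3) by (simp add: k_def)
  qed
  have gz: "g t = 0" if "T \<le> t" for t
  proof (cases "T = t")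
    case False
    have d0: "(g has_real_derivative 0) (at r)" if "T < r" for r using dg[of r] kz[of r] that by simp
    have "continuous_on {T..t} g" using dg by (meson DERIV_isCont continuous_at_imp_continuous_on)
    then have "g t = g T" using False that d0 by (intro DERIV_isconst_end) auto
    then show ?thesis by (simp add: g_def)
  qed (simp add: g_def)
  define \<psi> where "\<psi> \<sigma> = g ((\<bar>\<sigma>\<bar> / w) powr (1 / b))" for \<sigma>
  have vol: "vol x = w * (x \<bullet> x) powr b" "0 \<le> vol x" for x
  proof -
    show "0 \<le> vol x" using pos by (simp add: vol_def w_def[symmetric])
    show "vol x = w * (x \<bullet> x) powr b"
    proof (cases "x = 0")
      case False
      have "x \<bullet> x = norm x powr 2" using False by (simp add: power2_norm_eq_inner powr_numeral)
      then have "(x \<bullet> x) powr b = (norm x powr 2) powr b" by (rule arg_cong)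
      also have "\<dots> = norm x powr n" unfolding powr_powr by (simp add: b_def)
      also have "\<dots> = norm x ^ CARD('n)" using False by (simp add: n_def powr_realpow)
      finally show ?thesis by (simp add: vol_def w_def)
    qed (simp add: vol_def)
  qed
  have \<psi>vol: "\<psi> (vol x) = g (x \<bullet> x)" for x
  proof -
    have "(\<bar>vol x\<bar> / w) powr (1 / b) = ((x \<bullet> x) powr b) powr (1 / b)" using vol[of x] pos by simp
    also have "\<dots> = x \<bullet> x" using pos by (simp add: powr_powr powr_one)
    finally show ?thesis by (simp add: \<psi>_def)
  qed
  define R where "R = (M / w) powr (1 / n)"
  have "T < R^2"
  proof -
    have "T < (M / w) powr (1 / b)" unfolding T_def using \<tau> pos by (intro powr_less_mono2) (auto simp: divide_strict_right_mono)
    also have "(M / w) powr (1 / b) = R powr 2" using pos by (simp add: R_def powr_powr b_def)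
    also have "\<dots> = R^2" using \<tau> pos by (simp add: R_def powr_numeral)
    finally show ?thesis .
  qed
  then have tf: "test_fun (ball (0::real^'n) R) (\<lambda>x. g (x \<bullet> x))"
    by (intro test_fun_radial[OF sg, of T]) (use gz T in \<open>auto simp: R_def\<close>)
  have d1: "deriv g t = (-\<kappa>) * k t" for t using dg DERIV_imp_deriv by blast
  have lap: "laplacian (\<lambda>x::real^'n. g (x \<bullet> x)) x = - deriv \<theta> (vol x)" for x
  proof -
    define t where "t = x \<bullet> x"
    have "laplacian (\<lambda>x::real^'n. g (x \<bullet> x)) x = (\<Sum>i\<in>UNIV. 4 * deriv (deriv g) t * (x $ i)^2 + 2 * deriv g t)"
      unfolding laplacian_def partial_deriv2_radial[OF sg] t_def ..
    also have "\<dots> = 4 * deriv (deriv g) t * t + 2 * n * deriv g t"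
      by (simp add: sum.distrib sum_distrib_left[symmetric] t_def inner_vec_def power2_eq_square n_def)
    also have "\<dots> = - deriv \<theta> (w * t powr b)"
    proof (cases "t = 0")
      case True
      have "deriv \<theta> 0 = 0" using deriv_pow_zero_on_open[of "{..<\<tau>0}" \<theta> 0 1] \<theta>(3) \<tau> by simp
      then show ?thesis using True by (simp add: d1 k_def)
    next
      case False
      then have t: "0 < t" by (simp add: t_def)
      have 1: "((\<lambda>t. w * t powr b) has_real_derivative w * (b * t powr (b - 1))) (at t)"
        using t by (auto intro!: derivative_eq_intros)
      have 2: "((\<lambda>t. \<theta> (w * t powr b)) has_real_derivative deriv \<theta> (w * t powr b) * (w * (b * t powr (b - 1)))) (at t)"
        by (rule DERIV_chain2[OF smooth1_D[OF \<theta>(1)] 1])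
      have 3: "((\<lambda>t. t powr (-b)) has_real_derivative (-b) * t powr (-b - 1)) (at t)"
        using t by (auto intro!: derivative_eq_intros)
      have 4: "((\<lambda>t. (-\<kappa>) * (t powr (-b) * \<theta> (w * t powr b))) has_real_derivative
        (-\<kappa>) * ((-b) * t powr (-b - 1) * \<theta> (w * t powr b)
           + deriv \<theta> (w * t powr b) * (w * (b * t powr (b - 1))) * t powr (-b))) (at t)"
        by (rule DERIV_cmult[OF DERIV_mult[OF 3 2]])
      have 5: "((\<lambda>t. (-\<kappa>) * k t) has_real_derivative
        (-\<kappa>) * ((-b) * t powr (-b - 1) * \<theta> (w * t powr b)
           + deriv \<theta> (w * t powr b) * (w * (b * t powr (b - 1))) * t powr (-b))) (at t)"
        by (rule has_field_derivative_transform_within_open[OF 4, of "{0<..}"]) (use t in \<open>auto simp: k_def\<close>)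
      moreover have "deriv g = (\<lambda>t. (-\<kappa>) * k t)" using d1 by blast
      ultimately have dd: "deriv (deriv g) t = (-\<kappa>) * ((-b) * t powr (-b - 1) * \<theta> (w * t powr b)
           + deriv \<theta> (w * t powr b) * (w * (b * t powr (b - 1))) * t powr (-b))"
        using DERIV_imp_deriv by metis
      have p1: "t powr (-b - 1) * t = t powr (-b)" using t powr_add[of t "-b - 1" 1] by simp
      have p2: "t powr (b - 1) * t powr (-b) * t = 1"
        using t powr_add[of t "b - 1" "-b"] powr_add[of t "-1" 1] by (simp add: powr_minus)
      have "4 * deriv (deriv g) t * t + 2 * n * deriv g t
        = - (4 * \<kappa> * w * b) * deriv \<theta> (w * t powr b) * (t powr (b - 1) * t powr (-b) * t)
          + \<kappa> * \<theta> (w * t powr b) * (4 * b * (t powr (-b - 1) * t) - 2 * n * t powr (-b))"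
        using t unfolding dd d1 k_def by (simp add: algebra_simps)
      also have "\<dots> = - (4 * \<kappa> * w * b) * deriv \<theta> (w * t powr b)"
        unfolding p1 p2 by (simp add: b_def)
      also have "4 * \<kappa> * w * b = 1" using pos by (simp add: \<kappa>_def b_def)
      finally show ?thesis by simp
    qed
    finally show ?thesis by (simp add: vol t_def)
  qed
  have d\<psi>: "(\<psi> has_real_derivative - (\<theta> \<sigma> / vol_coeff TYPE('n) \<sigma>)) (at \<sigma>)" if s: "0 < \<sigma>" for \<sigma>
  proof -
    define t where "t = (\<sigma> / w) powr (1 / b)"
    have t: "0 < t" "t powr b = \<sigma> / w" using s pos by (auto simp: t_def powr_powr)
    have "((\<lambda>\<sigma>. (\<sigma> / w) powr (1 / b)) has_real_derivative (1 / b) * (\<sigma> / w) powr (1 / b - 1) * (1 / w)) (at \<sigma>)"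
      using s pos by (auto intro!: derivative_eq_intros)
    from DERIV_chain2[OF dg this]
    have "((\<lambda>\<sigma>. g ((\<sigma> / w) powr (1 / b))) has_real_derivative
        (-\<kappa>) * k t * ((1 / b) * (\<sigma> / w) powr (1 / b - 1) * (1 / w))) (at \<sigma>)"
      unfolding t_def .
    also have "(-\<kappa>) * k t * ((1 / b) * (\<sigma> / w) powr (1 / b - 1) * (1 / w)) = - (\<theta> \<sigma> / vol_coeff TYPE('n) \<sigma>)"
    proof -
      have kt: "k t = (w / \<sigma>) * \<theta> \<sigma>" using t s pos by (simp add: k_def powr_minus)
      have "vol_coeff TYPE('n) \<sigma> = (n * w powr (1 / n))\<^sup>2 * \<sigma> powr (2 - 2 / n)"
        by (simp add: vol_coeff_def iso_const_def n_def w_def)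
      also have "\<dots> = n\<^sup>2 * w powr (2 / n) * (\<sigma>\<^sup>2 / \<sigma> powr (2 / n))"
      proof -
        have "(w powr (1 / n))\<^sup>2 = w powr (2 / n)" using pos by (simp add: powr_power)
        moreover have "\<sigma> powr (2 - 2 / n) = \<sigma>\<^sup>2 / \<sigma> powr (2 / n)" using s by (simp add: powr_diff powr_numeral)
        ultimately show ?thesis by (simp add: power_mult_distrib)
      qed
      finally have vc: "vol_coeff TYPE('n) \<sigma> = n\<^sup>2 * w powr (2 / n) * (\<sigma>\<^sup>2 / \<sigma> powr (2 / n))" .
      have "1 / b = 2 / n" by (simp add: b_def)
      then have e: "(\<sigma> / w) powr (1 / b - 1) = (\<sigma> powr (2 / n) / w powr (2 / n)) * (w / \<sigma>)"
        using s pos by (simp add: powr_diff powr_divide)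
      show ?thesis unfolding kt vc e unfolding \<kappa>_def b_def using s pos by (simp add: field_simps power2_eq_square)
    qed
    finally have "((\<lambda>\<sigma>. g ((\<sigma> / w) powr (1 / b))) has_real_derivative - (\<theta> \<sigma> / vol_coeff TYPE('n) \<sigma>)) (at \<sigma>)" .
    then show ?thesis
      by (rule has_field_derivative_transform_within_open[of _ _ _ "{0<..}"]) (use s in \<open>auto simp: \<psi>_def\<close>)
  qed
  have \<psi>z: "\<psi> \<sigma> = 0" if "\<tau>3 \<le> \<sigma>" for \<sigma>
  proof -
    have "T \<le> (\<sigma> / w) powr (1 / b)" unfolding T_def using that \<tau> pos by (intro powr_mono2) (auto simp: divide_right_mono)
    then show ?thesis using gz that \<tau> by (simp add: \<psi>_def)
  qed
  have [measurable]: "g \<in> borel_measurable borel" by (rule smooth1_borel[OF sg])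
  have \<psi>m: "\<psi> \<in> borel_measurable borel" unfolding \<psi>_def by measurable
  have "(\<lambda>x. \<psi> (vol x)) = (\<lambda>x. g (x \<bullet> x))" using \<psi>vol by blast
  then show ?thesis using that[of \<psi>] tf lap d\<psi> \<psi>z \<psi>m unfolding R_def w_def n_def by simp
qed

lemma (in rearrangeable) rearr_primitive_borel[measurable]: "rearr_primitive \<in> borel_measurable borel"
proof -
  have "(\<lambda>r. \<integral>\<sigma>. rearr \<sigma> * (if 0 < \<sigma> \<and> \<sigma> < r then 1 else 0) \<partial>lborel) \<in> borel_measurable borel"
    by measurable
  moreover have "rearr_primitive r = (\<integral>\<sigma>. rearr \<sigma> * (if 0 < \<sigma> \<and> \<sigma> < r then 1 else 0) \<partial>lborel)" for r
    unfolding rearr_primitive_def by (intro Bochner_Integration.integral_cong) (auto simp: indicator_def)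
  ultimately show ?thesis by presburger
qed

lemma (in rearrangeable) integrable_rearr:
  assumes w: "\<And>x. x \<in> \<Omega> \<Longrightarrow> 0 \<le> w x" and int: "set_integrable lebesgue \<Omega> w"
  shows "integrable lborel rearr"
proof (rule integrableI_nonneg)
  have "(\<integral>\<^sup>+\<sigma>. ennreal (rearr \<sigma>) \<partial>lborel) \<le> (\<integral>\<^sup>+x. ennreal (w x) * indicator \<Omega> x \<partial>lebesgue)"
    by (rule nn_integral_rearr_le[OF w])
  also have "\<dots> = (\<integral>\<^sup>+x. ennreal (norm (indicator \<Omega> x *\<^sub>R w x)) \<partial>lebesgue)"
    using w by (intro nn_integral_cong) (auto split: split_indicator)
  also have "\<dots> < \<infinity>" using int unfolding set_integrable_def integrable_iff_bounded by blast
  finally show "(\<integral>\<^sup>+\<sigma>. ennreal (rearr \<sigma>) \<partial>lborel) < \<infinity>" .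
qed (use rearr_nonneg in auto)

lemma vol_coeff_borel[measurable]: "vol_coeff TYPE('n::finite) \<in> borel_measurable borel"
  unfolding vol_coeff_def by measurable

text \<open>Testing the equation of \<open>v\<close> with a radial function whose Laplacian is \<open>-\<theta>'\<close>, for a plateau function \<open>\<theta>\<close> of the
  volume variable: the left-hand side averages \<open>v\<^sup>*\<close> near \<open>\<tau>0\<close>, up to a term of good sign.\<close>

lemma radial_solution_lower_bound:
  fixes \<Omega> :: "(real^'n::finite) set" and f v :: "real^'n \<Rightarrow> real"
  assumes rf: "rearrangeable \<Omega> f" and rv: "rearrangeable (sym_ball \<Omega>) v"
    and f0: "\<And>x. x \<in> \<Omega> \<Longrightarrow> 0 \<le> f x" and fint: "set_integrable lebesgue \<Omega> f"
    and radial: "AE x in lebesgue. x \<in> sym_ball \<Omega> \<longrightarrow>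
        v x = decr_rearr (sym_ball \<Omega>) v (unit_ball_vol TYPE('n) * norm x ^ CARD('n))"
    and wg: "weak_grad_on (sym_ball \<Omega>) v G"
    and sol: "\<And>\<phi>. test_fun (sym_ball \<Omega>) \<phi> \<Longrightarrow>
        (LINT x:sym_ball \<Omega>|lebesgue. G x \<bullet> classical_grad \<phi> x) = (LINT x:sym_ball \<Omega>|lebesgue. schwarz \<Omega> f x * \<phi> x)"
    and H: "\<And>r. 0 < r \<Longrightarrow> (H has_real_derivative rearrangeable.rearr_primitive \<Omega> f r / vol_coeff TYPE('n) r) (at r)"
    and \<tau>: "0 < \<tau>0" "\<tau>0 < \<tau>1" "\<tau>1 < \<tau>2" "\<tau>2 < measure lebesgue \<Omega>"
  shows "H \<tau>2 - H \<tau>1 \<le> decr_rearr (sym_ball \<Omega>) v \<tau>0"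
proof -
  interpret F: rearrangeable \<Omega> f by (rule rf)
  interpret V: rearrangeable "sym_ball \<Omega>" v by (rule rv)
  define M where "M = measure lebesgue \<Omega>"
  define vol where "vol = (\<lambda>x::real^'n. unit_ball_vol TYPE('n) * norm x ^ CARD('n))"
  have vol_pos: "0 < vol x" if "x \<noteq> 0" for x
    using that unit_ball_vol_pos[where 'n='n] by (simp add: vol_def)
  have [measurable]: "vol \<in> borel_measurable borel" unfolding vol_def by measurable
  define A where "A = vol_coeff TYPE('n)"
  have A: "0 < A r" if "0 < r" for r unfolding A_def by (rule vol_coeff_pos[OF that])
  have [measurable]: "A \<in> borel_measurable borel" unfolding A_def by measurable
  have intf: "integrable lborel F.rearr" by (rule F.integrable_rearr[OF f0 fint])
  \<comment> \<open>The plateau function must return to 0 strictly before M for the radial function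
    to have compact support in the open ball.\<close>
  define \<tau>3 where "\<tau>3 = (\<tau>2 + M) / 2"
  have \<tau>3: "\<tau>2 < \<tau>3" "\<tau>3 < M" using \<tau> by (auto simp: \<tau>3_def M_def)
  obtain \<theta> where \<theta>: "smooth1 \<theta>" "\<And>x. 0 \<le> \<theta> x" "\<And>x. \<theta> x \<le> 1"
    "\<And>x. x \<le> \<tau>0 \<or> \<tau>3 \<le> x \<Longrightarrow> \<theta> x = 0" "\<And>x. \<tau>1 \<le> x \<Longrightarrow> x \<le> \<tau>2 \<Longrightarrow> \<theta> x = 1"
    "\<And>x y. x \<le> y \<Longrightarrow> y \<le> \<tau>2 \<Longrightarrow> \<theta> x \<le> \<theta> y" "\<And>x y. \<tau>1 \<le> x \<Longrightarrow> x \<le> y \<Longrightarrow> \<theta> y \<le> \<theta> x"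
    by (rule smooth_plateau_exists[OF \<tau>(2) less_imp_le[OF \<tau>(3)] \<tau>3(1)]) blast
  obtain \<psi> where \<psi>: "test_fun (ball 0 ((M / unit_ball_vol TYPE('n)) powr (1 / real CARD('n)))) (\<lambda>x. \<psi> (vol x))"
    "\<And>x. laplacian (\<lambda>x. \<psi> (vol x)) x = - deriv \<theta> (vol x)"
    "\<And>\<sigma>. 0 < \<sigma> \<Longrightarrow> (\<psi> has_real_derivative - (\<theta> \<sigma> / A \<sigma>)) (at \<sigma>)"
    "\<And>\<sigma>. \<tau>3 \<le> \<sigma> \<Longrightarrow> \<psi> \<sigma> = 0" "\<psi> \<in> borel_measurable borel"
    unfolding vol_def A_def
    by (rule radial_test_fun_exists[of \<theta> \<tau>0 \<tau>3 M, OF \<theta>(1,2)]) (use \<theta>(4) \<tau> \<tau>3 in auto)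
  note [measurable] = \<psi>(5) smooth1_borel[OF \<theta>(1)] smooth1_borel[OF smooth1_deriv[OF \<theta>(1)]]
  define \<phi> where "\<phi> = (\<lambda>x. \<psi> (vol x))"
  have t\<phi>: "test_fun (sym_ball \<Omega>) \<phi>" using \<psi>(1) unfolding \<phi>_def sym_ball_def M_def by simp
  have lap: "laplacian \<phi> x = - deriv \<theta> (vol x)" for x unfolding \<phi>_def by (rule \<psi>(2))
  note L = weak_grad_laplacian[OF wg t\<phi> order_refl]
  have iv: "integrable lebesgue (\<lambda>x. v x * deriv \<theta> (vol x))" using L(1) by (simp add: lap)
  have eq: "(\<integral>x. v x * deriv \<theta> (vol x) \<partial>lebesgue) = (\<integral>x. schwarz \<Omega> f x * \<phi> x \<partial>lebesgue)"
    using sol[OF t\<phi>] L(2) set_integral_mult_test_fun[OF t\<phi> order_refl, of "schwarz \<Omega> f"] by (simp add: lap)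
  have nz: "AE x in lebesgue. (x::real^'n) \<noteq> 0" by (rule AE_completion[OF AE_lborel_nonzero])
  have \<theta>'out: "deriv \<theta> (vol x) = 0" if "x \<notin> sym_ball \<Omega>" for x
  proof -
    have "partial_deriv i (partial_deriv i \<phi>) x = 0" for i
      by (rule test_funD(3)[OF _ that]) (intro test_fun_partial t\<phi>)
    then show ?thesis using lap[of x] by (simp add: laplacian_def)
  qed
  have "(\<integral>x. v x * deriv \<theta> (vol x) \<partial>lebesgue) = (\<integral>x. V.rearr (vol x) * deriv \<theta> (vol x) \<partial>lebesgue)"
  proof (rule integral_cong_AE)
    show "AE x in lebesgue. v x * deriv \<theta> (vol x) = V.rearr (vol x) * deriv \<theta> (vol x)"
      using radial nz
    proof eventually_elim
      case (elim x)
      then show ?case using \<theta>'out[of x] vol_pos[of x] by (cases "x \<in> sym_ball \<Omega>") (auto simp: V.rearr_def vol_def)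
    qed
  qed (use borel_measurable_integrable[OF iv] in \<open>auto intro!: measurable_completion\<close>)
  also have "\<dots> = (\<integral>x. V.rearr (vol x) * deriv \<theta> (vol x) \<partial>lborel)"
    by (rule integral_completion) measurable
  also have "\<dots> = (\<integral>\<sigma>. V.rearr \<sigma> * deriv \<theta> \<sigma> * indicator {0..} \<sigma> \<partial>lborel)"
    unfolding vol_def by (subst integral_radial(1)) auto
  \<comment> \<open>On [\<tau>0, \<tau>1] the derivative of \<theta> is nonnegative and the
    rearrangement is at most its value at \<tau>0; beyond \<tau>1 the derivative is nonpositive, so
    that part only lowers the integral.\<close>
  also have "\<dots> \<le> (\<integral>\<sigma>. V.rearr \<tau>0 * (deriv \<theta> \<sigma> * indicator {\<tau>0..\<tau>1} \<sigma>) \<partial>lborel)"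
  proof -
    have up: "0 \<le> deriv \<theta> \<sigma>" if "\<sigma> < \<tau>2" for \<sigma>
    proof (rule mono_on_imp_deriv_nonneg)
      show "mono_on {..\<tau>2} \<theta>" using \<theta>(6) by (auto simp: mono_on_def)
    qed (use smooth1_D[OF \<theta>(1)] that in auto)
    have down: "deriv \<theta> \<sigma> \<le> 0" if "\<tau>1 < \<sigma>" for \<sigma>
    proof -
      have "0 \<le> - deriv \<theta> \<sigma>"
      proof (rule mono_on_imp_deriv_nonneg)
        show "mono_on {\<tau>1..} (\<lambda>x. - \<theta> x)" using \<theta>(7) by (auto simp: mono_on_def)
        show "((\<lambda>x. - \<theta> x) has_real_derivative - deriv \<theta> \<sigma>) (at \<sigma>)" by (rule DERIV_minus[OF smooth1_D[OF \<theta>(1)]])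
      qed (use that in auto)
      then show ?thesis by simp
    qed
    have zero: "deriv \<theta> \<sigma> = 0" if "\<sigma> < \<tau>0" for \<sigma>
      using deriv_pow_zero_on_open[of "{..<\<tau>0}" \<theta> \<sigma> 1] \<theta>(4) that by simp
    show ?thesis
    proof (rule integral_mono')
      show "integrable lborel (\<lambda>\<sigma>. V.rearr \<tau>0 * (deriv \<theta> \<sigma> * indicator {\<tau>0..\<tau>1} \<sigma>))"
        by (intro integrable_mult_right integrable_FTC_Icc_nonneg[of _ _ _ \<theta>]) (use smooth1_D[OF \<theta>(1)] up \<tau> in auto)
      show "0 \<le> V.rearr \<tau>0 * (deriv \<theta> \<sigma> * indicator {\<tau>0..\<tau>1} \<sigma>)" for \<sigma>
        using up[of \<sigma>] V.rearr_nonneg[of \<tau>0] \<tau> by (auto split: split_indicator)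
      show "V.rearr \<sigma> * deriv \<theta> \<sigma> * indicator {0..} \<sigma> \<le> V.rearr \<tau>0 * (deriv \<theta> \<sigma> * indicator {\<tau>0..\<tau>1} \<sigma>)" for \<sigma>
      proof -
        consider "\<sigma> < \<tau>0" | "\<tau>0 \<le> \<sigma>" "\<sigma> \<le> \<tau>1" | "\<tau>1 < \<sigma>" by linarith
        then show ?thesis
        proof cases
          case 1 then show ?thesis using zero by simp
        next
          case 2 then show ?thesis
            using V.rearr_antimono[of \<tau>0 \<sigma>] up[of \<sigma>] \<tau> by (auto intro: mult_right_mono)
        next
          case 3 then show ?thesis
            using down[of \<sigma>] V.rearr_nonneg[of \<sigma>] by (auto simp: mult_le_0_iff split: split_indicator)
        qed
      qed
    qed
  qed
  also have "\<dots> = V.rearr \<tau>0"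
  proof -
    have "(\<integral>\<sigma>. deriv \<theta> \<sigma> * indicator {\<tau>0..\<tau>1} \<sigma> \<partial>lborel) = \<theta> \<tau>1 - \<theta> \<tau>0"
    proof (rule integral_FTC_Icc_real)
      show "isCont (deriv \<theta>) x" for x using smooth1_D[OF smooth1_deriv[OF \<theta>(1)]] DERIV_isCont by blast
    qed (use smooth1_D[OF \<theta>(1)] \<tau> in auto)
    then show ?thesis using \<theta>(4)[of \<tau>0] \<theta>(5)[of \<tau>1] \<tau> by simp
  qed
  finally have ub: "(\<integral>x. schwarz \<Omega> f x * \<phi> x \<partial>lebesgue) \<le> V.rearr \<tau>0" using eq by simp
  have \<psi>mono: "\<psi> b \<le> \<psi> a" if "0 < a" "a \<le> b" for a b
    using that(2)
  proof (rule DERIV_nonpos_imp_nonincreasing)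
    fix x assume "a \<le> x" "x \<le> b"
    then have "0 < x" using that by simp
    then have "0 \<le> \<theta> x / A x" using \<theta>(2) A by (intro divide_nonneg_pos)
    then show "\<exists>y. (\<psi> has_real_derivative y) (at x) \<and> y \<le> 0" using \<psi>(3)[OF \<open>0 < x\<close>] by (intro exI[of _ "- (\<theta> x / A x)"]) auto
  qed
  have \<psi>nn: "0 \<le> \<psi> \<sigma>" if "0 < \<sigma>" for \<sigma>
    using \<psi>mono[OF that, of "max \<sigma> \<tau>3"] \<psi>(4)[of "max \<sigma> \<tau>3"] by simp
  \<comment> \<open>\<psi> is constant on (0, \<tau>0], where \<theta> = 0. It therefore stays
    bounded near 0 in spite of the singular coefficient, and the product with the rearrangement of f
    is integrable.\<close>
  have \<psi>le: "\<psi> \<sigma> \<le> \<psi> \<tau>0" if "0 < \<sigma>" for \<sigma>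
  proof (cases "\<tau>0 \<le> \<sigma>")
    case True
    then show ?thesis using \<psi>mono[of \<tau>0 \<sigma>] \<tau> by simp
  next
    case False
    then have "\<sigma> \<le> \<tau>0" by simp
    then show ?thesis
    proof (rule DERIV_nonneg_imp_nondecreasing)
      fix x assume "\<sigma> \<le> x" "x \<le> \<tau>0"
      then have "0 < x" "\<theta> x = 0" using that \<theta>(4) by auto
      then show "\<exists>y. (\<psi> has_real_derivative y) (at x) \<and> 0 \<le> y" using \<psi>(3)[OF \<open>0 < x\<close>] by auto
    qed
  qed
  define h where "h \<sigma> = F.rearr \<sigma> * \<psi> \<sigma>" for \<sigma>
  have h0: "0 \<le> h \<sigma>" for \<sigma> unfolding h_def using \<psi>nn F.rearr_nonneg[of \<sigma>] by (cases "0 < \<sigma>") (auto simp: F.rearr_def)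
  have hz: "h \<sigma> = 0" if "\<sigma> \<le> 0" for \<sigma> using that by (simp add: h_def F.rearr_def)
  have hm[measurable]: "h \<in> borel_measurable borel" unfolding h_def by measurable
  have hint: "integrable lborel h"
  proof (rule Bochner_Integration.integrable_bound[OF integrable_mult_left[OF intf, of "\<psi> \<tau>0"]])
    show "AE x in lborel. norm (h x) \<le> norm (F.rearr x * \<psi> \<tau>0)"
    proof (rule AE_I2)
      fix x :: real
      show "norm (h x) \<le> norm (F.rearr x * \<psi> \<tau>0)"
      proof (cases "0 < x")
        case True
        then show ?thesis unfolding h_def using \<psi>le[OF True] \<psi>nn[OF True] F.rearr_nonneg[of x]
          by (simp add: abs_mult mult_left_mono)
      qed (simp add: hz)
    qed
  qed simp
  have schw: "schwarz \<Omega> f x = F.rearr (vol x)" if "x \<noteq> 0" for x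
    using vol_pos[OF that] by (simp add: schwarz_def F.rearr_def vol_def)
  have "(\<integral>x. schwarz \<Omega> f x * \<phi> x \<partial>lebesgue) = (\<integral>x. h (vol x) \<partial>lebesgue)"
  proof (rule integral_cong_AE)
    have "schwarz \<Omega> f = (\<lambda>x. if x = 0 then schwarz \<Omega> f 0 else F.rearr (vol x))"
      using schw by auto
    also have "\<dots> \<in> borel_measurable borel" by measurable
    finally have [measurable]: "schwarz \<Omega> f \<in> borel_measurable borel" .
    show "(\<lambda>x. schwarz \<Omega> f x * \<phi> x) \<in> borel_measurable lebesgue"
      unfolding \<phi>_def by (rule measurable_completion) measurable
    show "AE x in lebesgue. schwarz \<Omega> f x * \<phi> x = h (vol x)"
      using nz by eventually_elim (simp add: schw h_def \<phi>_def)
  qed (auto intro!: measurable_completion)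
  also have "\<dots> = (\<integral>x. h (vol x) \<partial>lborel)" by (rule integral_completion) measurable
  also have "\<dots> = (\<integral>\<sigma>. h \<sigma> * indicator {0..} \<sigma> \<partial>lborel)" unfolding vol_def by (rule integral_radial(1)) measurable
  also have "\<dots> = (\<integral>\<sigma>. h \<sigma> \<partial>lborel)"
    by (intro Bochner_Integration.integral_cong) (auto simp: hz split: split_indicator)
  finally have ih: "(\<integral>\<sigma>. h \<sigma> \<partial>lborel) \<le> V.rearr \<tau>0" using ub by simp
  have H\<tau>: "ennreal (H \<tau>2 - H \<tau>1) \<le> ennreal (\<integral>\<sigma>. h \<sigma> \<partial>lborel)"
  proof -
    \<comment> \<open>\<open>H \<tau>2 - H \<tau>1\<close> is a double integral of 1/A(r) times the
      rearrangement of f over 0 < \<sigma> < r and \<tau>1 <= r <= \<tau>2. Integrating in r first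
      leaves, for fixed \<sigma>, at most the integral of \<theta>/A from \<sigma> to \<tau>3,
      because \<theta> = 1 on [\<tau>1, \<tau>2]; that integral is \<psi>(\<sigma>).\<close>
    let ?q = "\<lambda>r \<sigma>. ennreal (F.rearr \<sigma>) * (indicator {\<tau>1..\<tau>2} r * indicator {\<sigma><..} r * ennreal (1 / A r))"
    have qm: "(\<lambda>(r, \<sigma>). ?q r \<sigma>) \<in> borel_measurable (lborel \<Otimes>\<^sub>M lborel)"
      unfolding indicator_def greaterThan_iff by measurable
    have "ennreal (H \<tau>2 - H \<tau>1) = (\<integral>\<^sup>+r. ennreal (F.rearr_primitive r / A r) * indicator {\<tau>1..\<tau>2} r \<partial>lborel)"
    proof (rule nn_integral_FTC_Icc[symmetric])
      show "(H has_real_derivative F.rearr_primitive r / A r) (at r)" if "r \<in> {\<tau>1..\<tau>2}" for r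
        using H[of r] that \<tau> unfolding A_def by auto
      show "0 \<le> F.rearr_primitive r / A r" if "r \<in> {\<tau>1..\<tau>2}" for r
        using F.rearr_primitive_nonneg[of r] A[of r] that \<tau> by (auto intro: divide_nonneg_pos)
    qed (use \<tau> in auto)
    also have "\<dots> = (\<integral>\<^sup>+r. \<integral>\<^sup>+\<sigma>. ?q r \<sigma> \<partial>lborel \<partial>lborel)"
    proof (rule nn_integral_cong)
      fix r :: real
      show "ennreal (F.rearr_primitive r / A r) * indicator {\<tau>1..\<tau>2} r = (\<integral>\<^sup>+\<sigma>. ?q r \<sigma> \<partial>lborel)"
      proof (cases "r \<in> {\<tau>1..\<tau>2}")
        case True
        then have r: "0 < r" using \<tau> by auto
        have "(\<integral>\<^sup>+\<sigma>. ?q r \<sigma> \<partial>lborel) = (\<integral>\<^sup>+\<sigma>. ennreal (F.rearr \<sigma>) * indicator {0<..<r} \<sigma> * ennreal (1 / A r) \<partial>lborel)"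
          using True by (intro nn_integral_cong) (auto simp: F.rearr_def split: split_indicator)
        also have "\<dots> = ennreal (F.rearr_primitive r) * ennreal (1 / A r)"
          by (subst nn_integral_multc) (auto simp: F.nn_integral_rearr_primitive[OF intf])
        also have "\<dots> = ennreal (F.rearr_primitive r / A r)"
          using A[OF r] F.rearr_primitive_nonneg[of r] by (simp add: ennreal_mult'[symmetric])
        finally show ?thesis using True by simp
      qed simp
    qed
    also have "\<dots> = (\<integral>\<^sup>+\<sigma>. \<integral>\<^sup>+r. ?q r \<sigma> \<partial>lborel \<partial>lborel)"
      using lborel_pair.Fubini'[of "\<lambda>r \<sigma>. ?q r \<sigma>"] qm by simp
    also have "\<dots> \<le> (\<integral>\<^sup>+\<sigma>. ennreal (h \<sigma>) \<partial>lborel)"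
    proof (rule nn_integral_mono)
      fix \<sigma> :: real
      show "(\<integral>\<^sup>+r. ?q r \<sigma> \<partial>lborel) \<le> ennreal (h \<sigma>)"
      proof (cases "0 < \<sigma> \<and> \<sigma> < \<tau>3")
        case False
        then have "?q r \<sigma> = 0" for r using \<tau>3 by (auto simp: F.rearr_def split: split_indicator)
        then have "(\<integral>\<^sup>+r. ?q r \<sigma> \<partial>lborel) = (\<integral>\<^sup>+r. 0 \<partial>(lborel :: real measure))" by (simp only:)
        then show ?thesis by simp
      next
        case True
        have "(\<integral>\<^sup>+r. ?q r \<sigma> \<partial>lborel) = ennreal (F.rearr \<sigma>) * (\<integral>\<^sup>+r. indicator {\<tau>1..\<tau>2} r * indicator {\<sigma><..} r * ennreal (1 / A r) \<partial>lborel)"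
          by (subst nn_integral_cmult) auto
        also have "(\<integral>\<^sup>+r. indicator {\<tau>1..\<tau>2} r * indicator {\<sigma><..} r * ennreal (1 / A r) \<partial>lborel)
            \<le> (\<integral>\<^sup>+r. ennreal (\<theta> r / A r) * indicator {\<sigma>..\<tau>3} r \<partial>lborel)"
          using \<theta>(5) \<tau>3 by (intro nn_integral_mono) (auto split: split_indicator)
        also have "\<dots> = ennreal ((- \<psi> \<tau>3) - (- \<psi> \<sigma>))"
        proof (rule nn_integral_FTC_Icc)
          fix r assume "r \<in> {\<sigma>..\<tau>3}"
          then have "0 < r" using True by auto
          from DERIV_minus[OF \<psi>(3)[OF this]] show "((\<lambda>r. - \<psi> r) has_real_derivative \<theta> r / A r) (at r)" by simp
          show "0 \<le> \<theta> r / A r" using A[OF \<open>0 < r\<close>] \<theta>(2)[of r] by (intro divide_nonneg_pos)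
        qed (use True in auto)
        also have "(- \<psi> \<tau>3) - (- \<psi> \<sigma>) = \<psi> \<sigma>" using \<psi>(4)[of \<tau>3] by simp
        finally show ?thesis using F.rearr_nonneg[of \<sigma>] \<psi>nn True by (simp add: h_def ennreal_mult mult_left_mono)
      qed
    qed
    also have "\<dots> = ennreal (\<integral>\<sigma>. h \<sigma> \<partial>lborel)" using hint h0 by (intro nn_integral_eq_integral) auto
    finally show ?thesis .
  qed
  have "0 \<le> (\<integral>\<sigma>. h \<sigma> \<partial>lborel)" using h0 by simp
  then have "H \<tau>2 - H \<tau>1 \<le> (\<integral>\<sigma>. h \<sigma> \<partial>lborel)" using H\<tau> by (subst (asm) ennreal_le_iff) auto
  then show ?thesis using ih \<tau> by (simp add: V.rearr_def)
qed

section \<open>The nonlocal energy\<close>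

lemma L2_product:
  fixes f g :: "'a \<Rightarrow> real"
  assumes [measurable]: "f \<in> borel_measurable M" "g \<in> borel_measurable M"
    and f: "integrable M (\<lambda>x. (f x)\<^sup>2)" and g: "integrable M (\<lambda>x. (g x)\<^sup>2)"
  shows "integrable M (\<lambda>x. f x * g x)"
    "\<bar>\<integral>x. f x * g x \<partial>M\<bar> \<le> sqrt (\<integral>x. (f x)\<^sup>2 \<partial>M) * sqrt (\<integral>x. (g x)\<^sup>2 \<partial>M)"
proof -
  show i: "integrable M (\<lambda>x. f x * g x)"
  proof (rule Bochner_Integration.integrable_bound[OF Bochner_Integration.integrable_add[OF f g]])
    show "AE x in M. norm (f x * g x) \<le> norm ((f x)\<^sup>2 + (g x)\<^sup>2)"
    proof (rule AE_I2)
      fix x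
      have "2 * \<bar>f x\<bar> * \<bar>g x\<bar> \<le> (f x)\<^sup>2 + (g x)\<^sup>2" using sum_squares_bound[of "\<bar>f x\<bar>" "\<bar>g x\<bar>"] by simp
      moreover have "0 \<le> \<bar>f x\<bar> * \<bar>g x\<bar>" by simp
      ultimately have "\<bar>f x\<bar> * \<bar>g x\<bar> \<le> (f x)\<^sup>2 + (g x)\<^sup>2" unfolding mult.assoc by linarith
      then show "norm (f x * g x) \<le> norm ((f x)\<^sup>2 + (g x)\<^sup>2)" by (simp add: abs_mult)
    qed
  qed simp
  have "ennreal (\<integral>x. \<bar>f x * g x\<bar> \<partial>M) = (\<integral>\<^sup>+x. ennreal \<bar>f x\<bar> * ennreal \<bar>g x\<bar> \<partial>M)"
    using nn_integral_eq_integral[OF integrable_abs[OF i]] by (simp add: abs_mult ennreal_mult)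
  then have "ennreal ((\<integral>x. \<bar>f x * g x\<bar> \<partial>M)\<^sup>2) = (\<integral>\<^sup>+x. ennreal \<bar>f x\<bar> * ennreal \<bar>g x\<bar> \<partial>M)\<^sup>2"
    by (metis ennreal_power integral_nonneg_AE AE_I2 abs_ge_zero)
  also have "\<dots> \<le> (\<integral>\<^sup>+x. (ennreal \<bar>f x\<bar>)\<^sup>2 \<partial>M) * (\<integral>\<^sup>+x. (ennreal \<bar>g x\<bar>)\<^sup>2 \<partial>M)"
    by (rule Cauchy_Schwarz_nn_integral) auto
  also have "\<dots> = ennreal ((\<integral>x. (f x)\<^sup>2 \<partial>M) * (\<integral>x. (g x)\<^sup>2 \<partial>M))"
    using nn_integral_eq_integral[OF f] nn_integral_eq_integral[OF g] by (simp add: ennreal_power ennreal_mult)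
  finally have "(\<integral>x. \<bar>f x * g x\<bar> \<partial>M)\<^sup>2 \<le> (\<integral>x. (f x)\<^sup>2 \<partial>M) * (\<integral>x. (g x)\<^sup>2 \<partial>M)"
    by (subst (asm) ennreal_le_iff) auto
  then have "\<integral>x. \<bar>f x * g x\<bar> \<partial>M \<le> sqrt ((\<integral>x. (f x)\<^sup>2 \<partial>M) * (\<integral>x. (g x)\<^sup>2 \<partial>M))"
    by (rule real_le_rsqrt)
  moreover have "\<bar>\<integral>x. f x * g x \<partial>M\<bar> \<le> \<integral>x. \<bar>f x * g x\<bar> \<partial>M" by (rule integral_abs_bound)
  ultimately show "\<bar>\<integral>x. f x * g x \<partial>M\<bar> \<le> sqrt (\<integral>x. (f x)\<^sup>2 \<partial>M) * sqrt (\<integral>x. (g x)\<^sup>2 \<partial>M)"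
    unfolding real_sqrt_mult by linarith
qed

lemma nn_integral_lborel_translate:
  fixes f :: "'a::euclidean_space \<Rightarrow> ennreal"
  assumes [measurable]: "f \<in> borel_measurable borel"
  shows "(\<integral>\<^sup>+y. f y \<partial>lborel) = (\<integral>\<^sup>+h. f (x + h) \<partial>lborel)"
proof -
  have "(\<integral>\<^sup>+y. f y \<partial>lborel) = (\<integral>\<^sup>+y. f y \<partial>(distr lborel borel ((+) x)))" by (simp add: lborel_distr_plus)
  also have "\<dots> = (\<integral>\<^sup>+h. f (x + h) \<partial>lborel)" by (subst nn_integral_distr) auto
  finally show ?thesis .
qed

text \<open>With the singular kernel absorbed into the measure, the nonlocal form is the L^2 inner
  product of increments u(x) - u(y), and Cauchy-Schwarz applies directly. On the diagonal, a null
  set, the density has the default value 0.\<close>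

definition kernel_measure :: "real \<Rightarrow> ((real^'n::finite) \<times> (real^'n)) measure" where
  "kernel_measure s = density (lborel \<Otimes>\<^sub>M lborel)
     (\<lambda>z. ennreal (1 / norm (fst z - snd z) powr (real CARD('n) + 2 * s)))"

lemma sets_kernel_measure[simp, measurable_cong]: "sets (kernel_measure s) = sets borel"
  unfolding kernel_measure_def by (simp add: lborel_prod)

lemma nn_integral_kernel_measure:
  fixes f :: "(real^'n::finite) \<times> (real^'n) \<Rightarrow> ennreal"
  assumes [measurable]: "f \<in> borel_measurable borel"
  shows "(\<integral>\<^sup>+z. f z \<partial>kernel_measure s)
    = (\<integral>\<^sup>+h. ennreal (1 / norm h powr (real CARD('n) + 2 * s)) * (\<integral>\<^sup>+x. f (x, x + h) \<partial>lborel) \<partial>lborel)"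
proof -
  let ?p = "real CARD('n) + 2 * s"
  have [measurable]: "f \<in> borel_measurable (borel \<Otimes>\<^sub>M borel)" using assms by (simp add: borel_prod)
  have "(\<integral>\<^sup>+z. f z \<partial>kernel_measure s)
      = (\<integral>\<^sup>+z. ennreal (1 / norm (fst z - snd z) powr ?p) * f z \<partial>(lborel \<Otimes>\<^sub>M lborel))"
    unfolding kernel_measure_def by (rule nn_integral_density) auto
  also have "\<dots> = (\<integral>\<^sup>+x. \<integral>\<^sup>+y. ennreal (1 / norm (x - y) powr ?p) * f (x, y) \<partial>lborel \<partial>lborel)"
    by (subst lborel.nn_integral_fst[symmetric]) auto
  also have "\<dots> = (\<integral>\<^sup>+x. \<integral>\<^sup>+h. ennreal (1 / norm h powr ?p) * f (x, x + h) \<partial>lborel \<partial>lborel)"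
  proof (rule nn_integral_cong)
    fix x :: "real^'n"
    show "(\<integral>\<^sup>+y. ennreal (1 / norm (x - y) powr ?p) * f (x, y) \<partial>lborel)
        = (\<integral>\<^sup>+h. ennreal (1 / norm h powr ?p) * f (x, x + h) \<partial>lborel)"
      by (subst nn_integral_lborel_translate[of _ x]) auto
  qed
  also have "\<dots> = (\<integral>\<^sup>+h. \<integral>\<^sup>+x. ennreal (1 / norm h powr ?p) * f (x, x + h) \<partial>lborel \<partial>lborel)"
    by (rule lborel_pair.Fubini'[symmetric]) (simp add: case_prod_unfold)
  also have "\<dots> = (\<integral>\<^sup>+h. ennreal (1 / norm h powr ?p) * (\<integral>\<^sup>+x. f (x, x + h) \<partial>lborel) \<partial>lborel)"
    by (intro nn_integral_cong nn_integral_cmult) auto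
  finally show ?thesis .
qed

lemma nn_integral_powr_near_0:
  assumes "-1 < a"
  shows "(\<integral>\<^sup>+x. ennreal (x powr a) * indicator {0..1} x \<partial>lborel) < \<infinity>"
proof -
  obtain I where "((\<lambda>x. x powr a) has_integral I) {0..1}"
    using integrable_on_powr_from_0[OF assms, of 1] by (auto simp: integrable_on_def)
  then have "(\<integral>\<^sup>+x. ennreal (x powr a) * indicator {0..1} x \<partial>lborel) = ennreal I"
    by (intro nn_integral_has_integral_lebesgue') auto
  then show ?thesis by simp
qed

lemma nn_integral_powr_near_infinity:
  assumes "a < -1"
  shows "(\<integral>\<^sup>+x. ennreal (x powr a) * indicator {1..} x \<partial>lborel) < \<infinity>"
proof -
  have "(\<integral>\<^sup>+x. ennreal (x powr a) * indicator {1..} x \<partial>lborel) = ennreal (0 - 1 powr (a + 1) / (a + 1))"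
  proof (rule nn_integral_FTC_atLeast[where F="\<lambda>x. x powr (a + 1) / (a + 1)"])
    show "((\<lambda>x. x powr (a + 1) / (a + 1)) has_real_derivative x powr a) (at x)" if "1 \<le> x" for x
      using that assms by (auto intro!: derivative_eq_intros)
    have "((\<lambda>x::real. x powr (a + 1)) \<longlongrightarrow> 0) at_top"
      using assms by (intro tendsto_neg_powr filterlim_ident) auto
    then show "((\<lambda>x. x powr (a + 1) / (a + 1)) \<longlongrightarrow> 0) at_top"
      by (rule tendsto_divide_zero)
  qed auto
  then show ?thesis by simp
qed

text \<open>Near the origin |h|^(2 - n - 2s) is integrable because s < 1, at infinity |h|^(-n - 2s)
  because s > 0. In the volume variable both become one-dimensional power integrals.\<close>

lemma kernel_moment_finite:
  assumes s: "0 < s" "s < 1"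
  shows "(\<integral>\<^sup>+h. ennreal (1 / norm h powr (real CARD('n) + 2 * s) * min ((norm h)\<^sup>2) 1) \<partial>(lborel :: (real^'n::finite) measure)) < \<infinity>"
proof -
  define n where "n = real CARD('n)"
  define w where "w = unit_ball_vol TYPE('n)"
  have pos: "0 < n" "0 < w" unfolding n_def w_def using unit_ball_vol_pos[where 'n='n] by auto
  define k where "k \<rho> = ennreal (1 / \<rho> powr (n + 2 * s) * min (\<rho>\<^sup>2) 1)" for \<rho> :: real
  define \<rho> where "\<rho> \<sigma> = (\<sigma> / w) powr (1 / n)" for \<sigma>
  have [measurable]: "k \<in> borel_measurable borel" unfolding k_def by measurable
  have [measurable]: "\<rho> \<in> borel_measurable borel" unfolding \<rho>_def by measurable
  have \<rho>n: "\<rho> (w * norm h ^ CARD('n)) = norm (h::real^'n)" for h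
  proof -
    have "\<rho> (w * norm h ^ CARD('n)) = (norm h ^ CARD('n)) powr (1 / n)" using pos by (simp add: \<rho>_def)
    also have "\<dots> = norm h"
    proof (cases "h = 0")
      case False
      then have "norm h ^ CARD('n) = norm h powr n" by (simp add: n_def powr_realpow)
      then show ?thesis using pos False by (simp add: powr_powr)
    qed simp
    finally show ?thesis .
  qed
  have "(\<integral>\<^sup>+h. ennreal (1 / norm h powr (real CARD('n) + 2 * s) * min ((norm h)\<^sup>2) 1) \<partial>(lborel :: (real^'n) measure))
     = (\<integral>\<^sup>+h. k (\<rho> (w * norm (h::real^'n) ^ CARD('n))) \<partial>lborel)"
    unfolding \<rho>n by (simp add: k_def n_def)
  also have "\<dots> = (\<integral>\<^sup>+\<sigma>. k (\<rho> \<sigma>) * indicator {0..} \<sigma> \<partial>lborel)"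
    unfolding w_def by (rule nn_integral_radial) measurable
  \<comment> \<open>Rescaling by w puts the unit sphere at x = 1, where the two power bounds are
    switched.\<close>
  also have "\<dots> = ennreal w * (\<integral>\<^sup>+x. k (\<rho> (0 + w * x)) * indicator {0..} (0 + w * x) \<partial>lborel)"
    using pos by (subst nn_integral_real_affine[of _ w 0]) auto
  finally have eq: "(\<integral>\<^sup>+h. ennreal (1 / norm h powr (real CARD('n) + 2 * s) * min ((norm h)\<^sup>2) 1) \<partial>(lborel :: (real^'n) measure))
    = ennreal w * (\<integral>\<^sup>+x. k (\<rho> (0 + w * x)) * indicator {0..} (0 + w * x) \<partial>lborel)" .
  have "(\<integral>\<^sup>+x. k (\<rho> (0 + w * x)) * indicator {0..} (0 + w * x) \<partial>lborel)
     \<le> (\<integral>\<^sup>+x. ennreal (x powr ((2 - 2 * s) / n - 1)) * indicator {0..1} x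
          + ennreal (x powr (- (2 * s / n) - 1)) * indicator {1..} x \<partial>lborel)"
  proof (rule nn_integral_mono)
    fix x :: real
    have a: "k (\<rho> (0 + w * x)) \<le> ennreal (x powr ((2 - 2 * s) / n - 1))" if "0 < x"
    proof -
      have "\<rho> (0 + w * x) = x powr (1 / n)" using pos by (simp add: \<rho>_def)
      moreover have "1 / (x powr (1 / n)) powr (n + 2 * s) * (x powr (1 / n))\<^sup>2 = x powr ((2 - 2 * s) / n - 1)"
      proof -
        have "(x powr (1 / n))\<^sup>2 = x powr (2 / n)" using that by (simp add: powr_power)
        moreover have "1 / (x powr (1 / n)) powr (n + 2 * s) = x powr (- ((n + 2 * s) / n))"
          using that by (simp add: powr_powr powr_minus divide_inverse mult.commute)
        moreover have "- ((n + 2 * s) / n) + 2 / n = (2 - 2 * s) / n - 1" using pos by (simp add: field_simps)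
        ultimately show ?thesis using powr_add[of x "- ((n + 2 * s) / n)" "2 / n"] by simp
      qed
      moreover have "1 / (x powr (1 / n)) powr (n + 2 * s) * min ((x powr (1 / n))\<^sup>2) 1
        \<le> 1 / (x powr (1 / n)) powr (n + 2 * s) * (x powr (1 / n))\<^sup>2" by (intro mult_left_mono) auto
      ultimately show ?thesis unfolding k_def by (intro ennreal_leI) simp
    qed
    have b: "k (\<rho> (0 + w * x)) \<le> ennreal (x powr (- (2 * s / n) - 1))" if "0 < x"
    proof -
      have "\<rho> (0 + w * x) = x powr (1 / n)" using pos by (simp add: \<rho>_def)
      moreover have "1 / (x powr (1 / n)) powr (n + 2 * s) = x powr (- (2 * s / n) - 1)"
      proof -
        have "1 / (x powr (1 / n)) powr (n + 2 * s) = x powr (- ((n + 2 * s) / n))"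
          using that by (simp add: powr_powr powr_minus divide_inverse mult.commute)
        moreover have "- ((n + 2 * s) / n) = - (2 * s / n) - 1" using pos by (simp add: field_simps)
        ultimately show ?thesis by simp
      qed
      moreover have "1 / (x powr (1 / n)) powr (n + 2 * s) * min ((x powr (1 / n))\<^sup>2) 1
        \<le> 1 / (x powr (1 / n)) powr (n + 2 * s) * 1" by (intro mult_left_mono) auto
      ultimately show ?thesis unfolding k_def by (intro ennreal_leI) simp
    qed
    have z: "k (\<rho> (0 + w * 0)) = 0" by (simp add: k_def \<rho>_def)
    consider "x < 0" | "x = 0" | "0 < x" "x \<le> 1" | "1 < x" by linarith
    then show "k (\<rho> (0 + w * x)) * indicator {0..} (0 + w * x) \<le> ennreal (x powr ((2 - 2 * s) / n - 1)) * indicator {0..1} x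
          + ennreal (x powr (- (2 * s / n) - 1)) * indicator {1..} x"
    proof cases
      case 1
      then have "w * x < 0" using pos by (simp add: mult_pos_neg)
      then show ?thesis by simp
    next
      case 2 then show ?thesis using z by simp
    next
      case 3
      have "k (\<rho> (0 + w * x)) * indicator {0..} (0 + w * x) \<le> ennreal (x powr ((2 - 2 * s) / n - 1)) * indicator {0..1} x"
      proof -
        have "0 \<le> w * x" using 3 pos by simp
        then have "indicator {0..} (0 + w * x) = (1::ennreal)" "indicator {0..1} x = (1::ennreal)" using 3 by auto
        then show ?thesis using a[OF 3(1)] by (simp only: mult_1_right)
      qed
      also have "\<dots> \<le> \<dots> + ennreal (x powr (- (2 * s / n) - 1)) * indicator {1..} x" by (rule add_increasing2) simp_all
      finally show ?thesis .
    next
      case 4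
      have "k (\<rho> (0 + w * x)) * indicator {0..} (0 + w * x) \<le> ennreal (x powr (- (2 * s / n) - 1)) * indicator {1..} x"
      proof -
        have "0 \<le> w * x" using 4 pos by simp
        then have "indicator {0..} (0 + w * x) = (1::ennreal)" "indicator {1..} x = (1::ennreal)" using 4 by auto
        then show ?thesis using b 4 by (simp only: mult_1_right)
      qed
      also have "\<dots> \<le> ennreal (x powr ((2 - 2 * s) / n - 1)) * indicator {0..1} x + \<dots>" by (rule add_increasing) simp_all
      finally show ?thesis .
    qed
  qed
  also have "\<dots> = (\<integral>\<^sup>+x. ennreal (x powr ((2 - 2 * s) / n - 1)) * indicator {0..1} x \<partial>lborel)
          + (\<integral>\<^sup>+x. ennreal (x powr (- (2 * s / n) - 1)) * indicator {1..} x \<partial>lborel)"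
    by (rule nn_integral_add) measurable
  finally have "ennreal w * (\<integral>\<^sup>+x. k (\<rho> (0 + w * x)) * indicator {0..} (0 + w * x) \<partial>lborel)
     \<le> ennreal w * ((\<integral>\<^sup>+x. ennreal (x powr ((2 - 2 * s) / n - 1)) * indicator {0..1} x \<partial>lborel)
          + (\<integral>\<^sup>+x. ennreal (x powr (- (2 * s / n) - 1)) * indicator {1..} x \<partial>lborel))"
    by (rule mult_left_mono) simp
  also have "\<dots> < \<infinity>"
    using nn_integral_powr_near_0[of "(2 - 2 * s) / n - 1"] nn_integral_powr_near_infinity[of "- (2 * s / n) - 1"] pos s
    by (simp add: ennreal_mult_less_top)
  finally show ?thesis unfolding eq .
qed

text \<open>The difference is the integral of the directional derivative along the segment;
  Cauchy-Schwarz in the segment parameter and translation invariance in x give the estimate with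
  constant 1.\<close>

lemma test_fun_translate_L2:
  fixes \<psi> :: "real^'n::finite \<Rightarrow> real"
  assumes \<psi>: "test_fun U \<psi>"
  shows "(\<integral>\<^sup>+x. ennreal ((\<psi> x - \<psi> (x + h))\<^sup>2) \<partial>lborel)
    \<le> ennreal ((norm h)\<^sup>2) * (\<integral>\<^sup>+x. ennreal ((norm (classical_grad \<psi> x))\<^sup>2) \<partial>lborel)"
proof -
  have cg: "continuous_on A (classical_grad \<psi>)" for A by (rule grad_continuous[OF test_funD(1)[OF \<psi>]])
  have [measurable]: "classical_grad \<psi> \<in> borel_measurable borel" by (rule test_fun_grad_borel[OF \<psi>])
  have pw: "ennreal ((\<psi> x - \<psi> (x + h))\<^sup>2)
      \<le> (\<integral>\<^sup>+t. ennreal ((norm h)\<^sup>2) * ennreal ((norm (classical_grad \<psi> (x + t *\<^sub>R h)))\<^sup>2) * indicator {0..1} t \<partial>lborel)" for x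
  proof -
    let ?g = "\<lambda>t. classical_grad \<psi> (x + t *\<^sub>R h) \<bullet> h"
    have d: "((\<lambda>t. \<psi> (x + t *\<^sub>R h)) has_real_derivative ?g t) (at t)" for t
    proof -
      have "((\<lambda>t. x + t *\<^sub>R h) has_derivative (\<lambda>r. r *\<^sub>R h)) (at t)" by (auto intro!: derivative_eq_intros)
      from has_derivative_compose[OF this differentiable_has_grad[OF smooth_on_differentiable[OF test_funD(1)[OF \<psi>]]]]
      have "((\<lambda>t. \<psi> (x + t *\<^sub>R h)) has_derivative (\<lambda>r. classical_grad \<psi> (x + t *\<^sub>R h) \<bullet> (r *\<^sub>R h))) (at t)" .
      moreover have "(\<lambda>r. classical_grad \<psi> (x + t *\<^sub>R h) \<bullet> (r *\<^sub>R h)) = (*) (?g t)" by (rule ext) simp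
      ultimately show ?thesis unfolding has_field_derivative_def by (simp only:)
    qed
    have cont: "continuous_on UNIV ?g"
      by (intro continuous_intros continuous_on_compose2[OF cg[of UNIV]]) auto
    have [measurable]: "?g \<in> borel_measurable borel" by (rule borel_measurable_continuous_onI[OF cont])
    have "(\<integral>t. ?g t * indicator {0..1} t \<partial>lborel) = \<psi> (x + 1 *\<^sub>R h) - \<psi> (x + 0 *\<^sub>R h)"
      by (rule integral_FTC_Icc_real) (use d cont in \<open>auto simp: continuous_on_eq_continuous_at\<close>)
    then have "\<psi> x - \<psi> (x + h) = - (\<integral>t. ?g t * indicator {0..1} t \<partial>lborel)" by simp
    then have "ennreal \<bar>\<psi> x - \<psi> (x + h)\<bar> = ennreal \<bar>\<integral>t. ?g t * indicator {0..1} t \<partial>lborel\<bar>" by simp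
    also have "\<dots> \<le> (\<integral>\<^sup>+t. norm (?g t * indicator {0..1} t) \<partial>lborel)"
      using integral_norm_bound_ennreal[of lborel "\<lambda>t. ?g t * indicator {0..1} t"]
        has_bochner_integral_FTC_Icc_real[of 0 1 "\<lambda>t. \<psi> (x + t *\<^sub>R h)" ?g] d cont
      by (auto simp: continuous_on_eq_continuous_at has_bochner_integral_iff)
    also have "\<dots> = (\<integral>\<^sup>+t. (ennreal \<bar>?g t\<bar> * indicator {0..1} t) * indicator {0..1} t \<partial>lborel)"
      by (intro nn_integral_cong) (auto split: split_indicator)
    finally have "(ennreal \<bar>\<psi> x - \<psi> (x + h)\<bar>)\<^sup>2 \<le> (\<integral>\<^sup>+t. (ennreal \<bar>?g t\<bar> * indicator {0..1} t) * indicator {0..1} t \<partial>lborel)\<^sup>2"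
      by (rule power_mono) simp
    also have "\<dots> \<le> (\<integral>\<^sup>+t. (ennreal \<bar>?g t\<bar> * indicator {0..1} t)\<^sup>2 \<partial>lborel) * (\<integral>\<^sup>+t. (indicator {0..1} t)\<^sup>2 \<partial>(lborel::real measure))"
      by (rule Cauchy_Schwarz_nn_integral) auto
    also have "(\<integral>\<^sup>+t. (indicator {0..1} t)\<^sup>2 \<partial>(lborel::real measure)) = (\<integral>\<^sup>+t. indicator {0..1} t \<partial>(lborel::real measure))"
      by (intro nn_integral_cong) (auto split: split_indicator)
    also have "\<dots> = 1" by simp
    also have "(\<integral>\<^sup>+t. (ennreal \<bar>?g t\<bar> * indicator {0..1} t)\<^sup>2 \<partial>lborel) * 1
       \<le> (\<integral>\<^sup>+t. ennreal ((norm h)\<^sup>2) * ennreal ((norm (classical_grad \<psi> (x + t *\<^sub>R h)))\<^sup>2) * indicator {0..1} t \<partial>lborel)"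
    proof -
      have "(ennreal \<bar>?g t\<bar>)\<^sup>2 \<le> ennreal ((norm h)\<^sup>2) * ennreal ((norm (classical_grad \<psi> (x + t *\<^sub>R h)))\<^sup>2)" for t
      proof -
        have "\<bar>?g t\<bar>\<^sup>2 \<le> (norm (classical_grad \<psi> (x + t *\<^sub>R h)) * norm h)\<^sup>2"
          by (intro power_mono Cauchy_Schwarz_ineq2) simp
        then show ?thesis by (simp add: ennreal_power ennreal_mult[symmetric] power_mult_distrib mult.commute ennreal_leI)
      qed
      then show ?thesis unfolding mult_1_right by (intro nn_integral_mono) (auto split: split_indicator)
    qed
    finally show ?thesis by (simp add: ennreal_power)
  qed
  have "(\<integral>\<^sup>+x. ennreal ((\<psi> x - \<psi> (x + h))\<^sup>2) \<partial>lborel)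
     \<le> (\<integral>\<^sup>+x. \<integral>\<^sup>+t. ennreal ((norm h)\<^sup>2) * ennreal ((norm (classical_grad \<psi> (x + t *\<^sub>R h)))\<^sup>2) * indicator {0..1} t \<partial>lborel \<partial>lborel)"
    by (rule nn_integral_mono) (rule pw)
  also have "\<dots> = (\<integral>\<^sup>+t. \<integral>\<^sup>+x. ennreal ((norm h)\<^sup>2) * ennreal ((norm (classical_grad \<psi> (x + t *\<^sub>R h)))\<^sup>2) * indicator {0..1} t \<partial>lborel \<partial>lborel)"
    by (rule lborel_pair.Fubini'[symmetric]) (simp add: case_prod_unfold)
  also have "\<dots> = (\<integral>\<^sup>+t. ennreal ((norm h)\<^sup>2) * (\<integral>\<^sup>+x. ennreal ((norm (classical_grad \<psi> x))\<^sup>2) \<partial>lborel) * indicator {0..1} (t::real) \<partial>lborel)"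
  proof (rule nn_integral_cong)
    fix t :: real
    have "(\<integral>\<^sup>+x. ennreal ((norm h)\<^sup>2) * ennreal ((norm (classical_grad \<psi> (x + t *\<^sub>R h)))\<^sup>2) * indicator {0..1} t \<partial>lborel)
      = ennreal ((norm h)\<^sup>2) * (\<integral>\<^sup>+x. ennreal ((norm (classical_grad \<psi> (t *\<^sub>R h + x)))\<^sup>2) \<partial>lborel) * indicator {0..1} t"
      by (simp add: nn_integral_cmult nn_integral_multc add.commute)
    also have "(\<integral>\<^sup>+x. ennreal ((norm (classical_grad \<psi> (t *\<^sub>R h + x)))\<^sup>2) \<partial>lborel) = (\<integral>\<^sup>+x. ennreal ((norm (classical_grad \<psi> x))\<^sup>2) \<partial>lborel)"
      by (rule nn_integral_lborel_translate[symmetric]) measurable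
    finally show "(\<integral>\<^sup>+x. ennreal ((norm h)\<^sup>2) * ennreal ((norm (classical_grad \<psi> (x + t *\<^sub>R h)))\<^sup>2) * indicator {0..1} t \<partial>lborel)
      = ennreal ((norm h)\<^sup>2) * (\<integral>\<^sup>+x. ennreal ((norm (classical_grad \<psi> x))\<^sup>2) \<partial>lborel) * indicator {0..1} t" .
  qed
  also have "\<dots> = ennreal ((norm h)\<^sup>2) * (\<integral>\<^sup>+x. ennreal ((norm (classical_grad \<psi> x))\<^sup>2) \<partial>lborel)"
    by (simp add: nn_integral_cmult)
  finally show ?thesis .
qed

definition h1_norm_sq :: "(real^'n::finite \<Rightarrow> real) \<Rightarrow> real" where
  "h1_norm_sq \<psi> = (\<integral>x. (\<psi> x)\<^sup>2 \<partial>lborel) + (\<integral>x. (norm (classical_grad \<psi> x))\<^sup>2 \<partial>lborel)"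

lemma test_fun_integrable_sq:
  assumes "test_fun U \<psi>"
  shows "integrable lborel (\<lambda>x. (\<psi> x)\<^sup>2)" "integrable lborel (\<lambda>x. (norm (classical_grad \<psi> x))\<^sup>2)"
proof -
  show "integrable lborel (\<lambda>x. (\<psi> x)\<^sup>2)"
  proof (rule integrable_compact_support[OF _ test_funD(2)[OF assms]])
    show "(\<psi> x)\<^sup>2 = 0" if "x \<notin> closure {x. \<psi> x \<noteq> 0}" for x using zero_outside_support[OF that] by simp
  qed (intro continuous_intros test_fun_continuous[OF assms])
  show "integrable lborel (\<lambda>x. (norm (classical_grad \<psi> x))\<^sup>2)"
  proof (rule integrable_compact_support[OF _ test_funD(2)[OF assms]])
    show "(norm (classical_grad \<psi> x))\<^sup>2 = 0" if "x \<notin> closure {x. \<psi> x \<noteq> 0}" for x using grad_outside_support[OF that] by simp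
  qed (intro continuous_intros grad_continuous test_funD(1)[OF assms])
qed

definition gagliardo :: "real \<Rightarrow> (real^'n::finite \<Rightarrow> real) \<Rightarrow> ennreal" where
  "gagliardo s \<psi> = (\<integral>\<^sup>+z. ennreal ((\<psi> (fst z) - \<psi> (snd z))\<^sup>2) \<partial>kernel_measure s)"

text \<open>The embedding of H^1 into H^s: \<open>test_fun_translate_L2\<close> for short
  increments, a crude L^2 bound for long ones, then integration against the kernel.\<close>

lemma gagliardo_le_h1:
  assumes s: "0 < s" "s < 1"
  obtains C where "0 \<le> C" "\<And>U (\<psi>::real^'n::finite \<Rightarrow> real). test_fun U \<psi> \<Longrightarrow> gagliardo s \<psi> \<le> ennreal (C * h1_norm_sq \<psi>)"
proof -
  define p where "p = real CARD('n) + 2 * s"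
  define I where "I = (\<integral>\<^sup>+h. ennreal (1 / norm h powr p * min ((norm h)\<^sup>2) 1) \<partial>(lborel :: (real^'n) measure))"
  have "I < \<infinity>" unfolding I_def p_def by (rule kernel_moment_finite[OF s])
  then obtain c where c: "0 \<le> c" "I = ennreal c" by (cases I) auto
  have "gagliardo s \<psi> \<le> ennreal (4 * c * h1_norm_sq \<psi>)" if \<psi>: "test_fun U \<psi>" for U and \<psi> :: "real^'n \<Rightarrow> real"
  proof -
    have [measurable]: "\<psi> \<in> borel_measurable borel" by (rule test_fun_borel[OF \<psi>])
    define N where "N = (\<integral>x. (\<psi> x)\<^sup>2 \<partial>lborel)"
    define D where "D = (\<integral>x. (norm (classical_grad \<psi> x))\<^sup>2 \<partial>lborel)"
    have ND: "0 \<le> N" "0 \<le> D" "(\<integral>\<^sup>+x. ennreal ((\<psi> x)\<^sup>2) \<partial>lborel) = ennreal N"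
      "(\<integral>\<^sup>+x. ennreal ((norm (classical_grad \<psi> x))\<^sup>2) \<partial>lborel) = ennreal D"
      unfolding N_def D_def using test_fun_integrable_sq[OF \<psi>] by (auto simp: nn_integral_eq_integral)
    \<comment> \<open>One bound for both regimes. The factor 4 comes from 2a^2 + 2b^2 integrated
      over two translates of the same function.\<close>
    have inner: "(\<integral>\<^sup>+x. ennreal ((\<psi> x - \<psi> (x + h))\<^sup>2) \<partial>lborel) \<le> ennreal (4 * (N + D) * min ((norm h)\<^sup>2) 1)" for h
    proof (cases "(norm h)\<^sup>2 \<le> 1")
      case True
      have "(\<integral>\<^sup>+x. ennreal ((\<psi> x - \<psi> (x + h))\<^sup>2) \<partial>lborel) \<le> ennreal ((norm h)\<^sup>2 * D)"
        using test_fun_translate_L2[OF \<psi>, of h] ND by (simp add: ennreal_mult)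
      also have "(norm h)\<^sup>2 * D \<le> 4 * (N + D) * min ((norm h)\<^sup>2) 1"
      proof -
        have "(norm h)\<^sup>2 * D \<le> (norm h)\<^sup>2 * (4 * (N + D))" using ND by (intro mult_left_mono) auto
        then show ?thesis using True by (simp add: min_absorb1 mult.commute)
      qed
      finally show ?thesis by (simp add: ennreal_leI)
    next
      case False
      have "(\<integral>\<^sup>+x. ennreal ((\<psi> x - \<psi> (x + h))\<^sup>2) \<partial>lborel) \<le> (\<integral>\<^sup>+x. ennreal (2 * (\<psi> x)\<^sup>2) + ennreal (2 * (\<psi> (h + x))\<^sup>2) \<partial>lborel)"
      proof (rule nn_integral_mono)
        fix x
        have "(\<psi> x - \<psi> (x + h))\<^sup>2 \<le> 2 * (\<psi> x)\<^sup>2 + 2 * (\<psi> (h + x))\<^sup>2"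
          using sum_squares_bound[of "\<psi> x" "- \<psi> (x + h)"] by (simp add: power2_diff add.commute)
        then show "ennreal ((\<psi> x - \<psi> (x + h))\<^sup>2) \<le> ennreal (2 * (\<psi> x)\<^sup>2) + ennreal (2 * (\<psi> (h + x))\<^sup>2)"
          by (simp add: ennreal_plus[symmetric] ennreal_leI del: ennreal_plus)
      qed
      also have "\<dots> = 2 * (\<integral>\<^sup>+x. ennreal ((\<psi> x)\<^sup>2) \<partial>lborel) + 2 * (\<integral>\<^sup>+x. ennreal ((\<psi> (h + x))\<^sup>2) \<partial>lborel)"
        by (simp add: nn_integral_add nn_integral_cmult ennreal_mult)
      also have "(\<integral>\<^sup>+x. ennreal ((\<psi> (h + x))\<^sup>2) \<partial>lborel) = (\<integral>\<^sup>+x. ennreal ((\<psi> x)\<^sup>2) \<partial>lborel)"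
        by (rule nn_integral_lborel_translate[symmetric]) measurable
      also have "2 * (\<integral>\<^sup>+x. ennreal ((\<psi> x)\<^sup>2) \<partial>lborel) + 2 * (\<integral>\<^sup>+x. ennreal ((\<psi> x)\<^sup>2) \<partial>lborel) = ennreal (4 * N)"
        unfolding ND using ND(1) by (simp add: ennreal_mult'[symmetric] ennreal_plus[symmetric] ennreal_numeral[symmetric] del: ennreal_plus ennreal_numeral)
      also have "\<dots> \<le> ennreal (4 * (N + D) * min ((norm h)\<^sup>2) 1)"
        using False ND by (intro ennreal_leI) simp
      finally show ?thesis .
    qed
    have "gagliardo s \<psi> = (\<integral>\<^sup>+h. ennreal (1 / norm h powr p) * (\<integral>\<^sup>+x. ennreal ((\<psi> x - \<psi> (x + h))\<^sup>2) \<partial>lborel) \<partial>lborel)"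
      unfolding gagliardo_def p_def by (subst nn_integral_kernel_measure) (auto simp flip: borel_prod)
    also have "\<dots> \<le> (\<integral>\<^sup>+h. ennreal (4 * (N + D)) * ennreal (1 / norm h powr p * min ((norm h)\<^sup>2) 1) \<partial>(lborel :: (real^'n) measure))"
    proof (rule nn_integral_mono)
      fix h :: "real^'n"
      have "ennreal (1 / norm h powr p) * (\<integral>\<^sup>+x. ennreal ((\<psi> x - \<psi> (x + h))\<^sup>2) \<partial>lborel)
        \<le> ennreal (1 / norm h powr p) * ennreal (4 * (N + D) * min ((norm h)\<^sup>2) 1)"
        by (rule mult_left_mono[OF inner]) simp
      also have "\<dots> = ennreal (4 * (N + D)) * ennreal (1 / norm h powr p * min ((norm h)\<^sup>2) 1)"
      proof -
        have "1 / norm h powr p * (4 * (N + D) * min ((norm h)\<^sup>2) 1) = 4 * (N + D) * (1 / norm h powr p * min ((norm h)\<^sup>2) 1)"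
          by (simp only: mult_ac)
        then show ?thesis using ND by (subst (1 2) ennreal_mult'[symmetric]) auto
      qed
      finally show "ennreal (1 / norm h powr p) * (\<integral>\<^sup>+x. ennreal ((\<psi> x - \<psi> (x + h))\<^sup>2) \<partial>lborel)
        \<le> ennreal (4 * (N + D)) * ennreal (1 / norm h powr p * min ((norm h)\<^sup>2) 1)" .
    qed
    also have "\<dots> = ennreal (4 * (N + D)) * I" unfolding I_def by (rule nn_integral_cmult) measurable
    also have "\<dots> = ennreal (4 * c * h1_norm_sq \<psi>)"
    proof -
      have "4 * c * h1_norm_sq \<psi> = (4 * (N + D)) * c" by (simp add: h1_norm_sq_def N_def D_def)
      then have "ennreal (4 * c * h1_norm_sq \<psi>) = ennreal (4 * (N + D) * c)" by (rule arg_cong)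
      also have "\<dots> = ennreal (4 * (N + D)) * ennreal c" using ND by (intro ennreal_mult') auto
      finally show ?thesis unfolding c by (rule sym)
    qed
    finally show ?thesis .
  qed
  then show ?thesis using that[of "4 * c"] c by simp
qed

section \<open>The energy inequality on level sets\<close>

text \<open>Fatou's lemma with bounds that vary along the sequence: the means by which estimates for
  smooth functions pass to U and G(U).\<close>

lemma nn_integral_fatou_le:
  fixes f :: "nat \<Rightarrow> 'a \<Rightarrow> ennreal"
  assumes "\<And>j. f j \<in> borel_measurable M" and "AE x in M. (\<lambda>j. f j x) \<longlonglongrightarrow> F x"
    and "\<And>j. (\<integral>\<^sup>+x. f j x \<partial>M) \<le> c j" and "c \<longlonglongrightarrow> C"
  shows "(\<integral>\<^sup>+x. F x \<partial>M) \<le> C"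
proof -
  have "(\<integral>\<^sup>+x. F x \<partial>M) = (\<integral>\<^sup>+x. liminf (\<lambda>j. f j x) \<partial>M)"
    using assms(2) by (intro nn_integral_cong_AE) (auto elim!: eventually_mono simp: lim_imp_Liminf)
  also have "\<dots> \<le> liminf (\<lambda>j. \<integral>\<^sup>+x. f j x \<partial>M)" by (rule nn_integral_liminf) (use assms(1) in auto)
  also have "\<dots> \<le> liminf c" by (rule Liminf_mono) (use assms(3) in auto)
  also have "\<dots> = C" using assms(4) by (simp add: lim_imp_Liminf)
  finally show ?thesis .
qed

lemma norm_diff_sq_le:
  fixes a b :: "'a::real_normed_vector"
  shows "(norm (a - b))\<^sup>2 \<le> 2 * (norm a)\<^sup>2 + 2 * (norm b)\<^sup>2"
proof -
  have "(norm (a - b))\<^sup>2 \<le> (norm a + norm b)\<^sup>2" by (intro power_mono norm_triangle_ineq4) simp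
  also have "\<dots> \<le> 2 * (norm a)\<^sup>2 + 2 * (norm b)\<^sup>2"
    using sum_squares_bound[of "norm a" "norm b"] by (simp add: power2_sum)
  finally show ?thesis .
qed

lemma norm_diff_sq_le3:
  fixes a b c :: "'a::real_normed_vector"
  shows "(norm (a - b))\<^sup>2 \<le> 2 * (norm (a - c))\<^sup>2 + 2 * (norm (b - c))\<^sup>2"
  using norm_diff_sq_le[of "a - c" "b - c"] by simp

lemma integrable_norm_diff_sq:
  fixes f g :: "'a \<Rightarrow> 'b::{banach, second_countable_topology}"
  assumes [measurable]: "f \<in> borel_measurable M" "g \<in> borel_measurable M"
    and "integrable M (\<lambda>x. (norm (f x))\<^sup>2)" "integrable M (\<lambda>x. (norm (g x))\<^sup>2)"
  shows "integrable M (\<lambda>x. (norm (f x - g x))\<^sup>2)"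
proof (rule Bochner_Integration.integrable_bound)
  show "integrable M (\<lambda>x. 2 * (norm (f x))\<^sup>2 + 2 * (norm (g x))\<^sup>2)" using assms(3,4) by simp
  show "AE x in M. norm ((norm (f x - g x))\<^sup>2) \<le> norm (2 * (norm (f x))\<^sup>2 + 2 * (norm (g x))\<^sup>2)"
    using norm_diff_sq_le by (intro AE_I2) (auto intro: order_trans)
qed simp

lemma AE_lborel_pair:
  fixes P :: "'a::euclidean_space \<Rightarrow> bool"
  assumes "AE x in lborel. P x"
  shows "AE z in lborel \<Otimes>\<^sub>M lborel. P (fst z) \<and> P (snd z)"
proof -
  obtain N where "{x \<in> space lborel. \<not> P x} \<subseteq> N" "emeasure lborel N = 0" "N \<in> sets lborel"
    by (rule AE_E[OF assms])
  then have N: "{x. \<not> P x} \<subseteq> N" "N \<in> null_sets lborel" by (auto intro: null_setsI)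
  have "N \<times> UNIV \<in> null_sets (lborel \<Otimes>\<^sub>M lborel)" "UNIV \<times> N \<in> null_sets (lborel \<Otimes>\<^sub>M lborel)"
    using N(2) lborel.emeasure_pair_measure_Times[of N lborel UNIV] lborel.emeasure_pair_measure_Times[of UNIV lborel N]
    by (auto simp: null_sets_def intro!: pair_measureI)
  then have "(N \<times> UNIV) \<union> (UNIV \<times> N) \<in> null_sets (lborel \<Otimes>\<^sub>M lborel)" by (rule null_sets.Un)
  then show "AE z in lborel \<Otimes>\<^sub>M lborel. P (fst z) \<and> P (snd z)"
    by (rule AE_I') (use N(1) in auto)
qed

lemma AE_kernel_measure:
  fixes P :: "real^'n::finite \<Rightarrow> bool"
  assumes "AE x in lborel. P x"
  shows "AE z in kernel_measure s. P (fst z) \<and> P (snd z)"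
  using AE_lborel_pair[OF assms] unfolding kernel_measure_def by (subst AE_density) auto

abbreviation incr :: "('a \<Rightarrow> real) \<Rightarrow> 'a \<times> 'a \<Rightarrow> real" where
  "incr \<psi> z \<equiv> \<psi> (fst z) - \<psi> (snd z)"

lemma incr_borel[measurable]:
  assumes [measurable]: "\<psi> \<in> borel_measurable borel"
  shows "(incr \<psi> :: ((real^'n::finite) \<times> (real^'n)) \<Rightarrow> real) \<in> borel_measurable (kernel_measure s)"
proof -
  have "(\<lambda>z. \<psi> (fst z) - \<psi> (snd z)) \<in> borel_measurable (borel \<Otimes>\<^sub>M borel)" by measurable
  then show ?thesis unfolding borel_prod measurable_cong_sets[OF sets_kernel_measure refl] .
qed

lemma gagliardo_finite:
  fixes \<psi> :: "real^'n::finite \<Rightarrow> real"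
  assumes [measurable]: "\<psi> \<in> borel_measurable borel" and "gagliardo s \<psi> \<le> ennreal c" "0 \<le> c"
  shows "integrable (kernel_measure s) (\<lambda>z. (incr \<psi> z)\<^sup>2)" "(\<integral>z. (incr \<psi> z)\<^sup>2 \<partial>kernel_measure s) \<le> c"
proof -
  have "gagliardo s \<psi> < \<infinity>" using assms(2) by (auto intro: le_less_trans)
  then show i: "integrable (kernel_measure s) (\<lambda>z. (incr \<psi> z)\<^sup>2)"
    unfolding gagliardo_def by (intro integrableI_nonneg) auto
  have "ennreal (\<integral>z. (incr \<psi> z)\<^sup>2 \<partial>kernel_measure s) = gagliardo s \<psi>"
    unfolding gagliardo_def using nn_integral_eq_integral[OF i] by simp
  then have "ennreal (\<integral>z. (incr \<psi> z)\<^sup>2 \<partial>kernel_measure s) \<le> ennreal c" using assms(2) by simp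
  then show "(\<integral>z. (incr \<psi> z)\<^sup>2 \<partial>kernel_measure s) \<le> c" using assms(3) by simp
qed

text \<open>A smooth substitute for the absolute value, shifted to vanish at 0 so that compositions
  with test functions remain test functions. The identity, the root and its reciprocal generate an
  algebra closed under differentiation.\<close>

lemma smooth1_sqrt_abs:
  assumes "0 < e"
  shows "smooth1 (\<lambda>x. sqrt (x\<^sup>2 + e\<^sup>2) + (- e))"
proof -
  let ?r = "\<lambda>x::real. sqrt (x\<^sup>2 + e\<^sup>2)"
  let ?B = "{\<lambda>x. x, ?r, \<lambda>x. 1 / ?r x}"
  have pos: "0 < x\<^sup>2 + e\<^sup>2" for x using assms by (simp add: add_nonneg_pos)
  have r: "(?r has_real_derivative x * (1 / ?r x)) (at x)" for x
    using pos[of x] assms by (auto intro!: derivative_eq_intros simp: field_simps)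
  have "?r x \<noteq> 0" for x using assms by (auto simp: add_nonneg_eq_0_iff)
  then have i: "((\<lambda>x. 1 / ?r x) has_real_derivative (-1) * (x * ((1 / ?r x) * ((1 / ?r x) * (1 / ?r x))))) (at x)" for x
    using assms pos[of x] by (auto intro!: derivative_eq_intros r simp: divide_simps)
  have "smooth1 ?r"
  proof (rule smooth1_alg[of ?B])
    have g: "(\<lambda>x. x) \<in> alg ?B" "?r \<in> alg ?B" "(\<lambda>x. 1 / ?r x) \<in> alg ?B" by (rule alg_gen, simp)+
    show "?r \<in> alg ?B" by (rule g)
    have 1: "\<exists>b'\<in>alg ?B. \<forall>x. ((\<lambda>x. x) has_real_derivative b' x) (at x)"
      by (rule bexI[OF _ alg_const[of 1]]) simp
    have 2: "\<exists>b'\<in>alg ?B. \<forall>x. (?r has_real_derivative b' x) (at x)"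
      by (rule bexI[OF _ alg_mult[OF g(1,3)]]) (use r in blast)
    have 3: "\<exists>b'\<in>alg ?B. \<forall>x. ((\<lambda>x. 1 / ?r x) has_real_derivative b' x) (at x)"
      by (rule bexI[OF _ alg_mult[OF alg_const[of "-1"] alg_mult[OF g(1) alg_mult[OF g(3) alg_mult[OF g(3) g(3)]]]]]) (use i in blast)
    show "\<forall>b\<in>?B. \<exists>b'\<in>alg ?B. \<forall>x. (b has_real_derivative b' x) (at x)" using 1 2 3 by blast
  qed
  then show ?thesis by (intro smooth1_add smooth1_const)
qed

lemma deriv_bound_imp_lipschitz:
  fixes G :: "real \<Rightarrow> real"
  assumes "\<And>x. (G has_real_derivative G' x) (at x)" "\<And>x. \<bar>G' x\<bar> \<le> L"
  shows "\<bar>G x - G y\<bar> \<le> L * \<bar>x - y\<bar>"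
  using field_differentiable_bound[of UNIV G G' L x y] assms by auto

lemma gagliardo_lipschitz:
  fixes \<psi> :: "real^'n::finite \<Rightarrow> real"
  assumes [measurable]: "\<psi> \<in> borel_measurable borel" and L: "\<And>x y. \<bar>G x - G y\<bar> \<le> L * \<bar>x - y\<bar>"
  shows "gagliardo s (\<lambda>x. G (\<psi> x)) \<le> ennreal (L\<^sup>2) * gagliardo s \<psi>"
proof -
  have "gagliardo s (\<lambda>x. G (\<psi> x)) \<le> (\<integral>\<^sup>+z. ennreal (L\<^sup>2) * ennreal ((incr \<psi> z)\<^sup>2) \<partial>kernel_measure s)"
    unfolding gagliardo_def
  proof (rule nn_integral_mono)
    fix z :: "(real^'n) \<times> (real^'n)"
    have "\<bar>G (\<psi> (fst z)) - G (\<psi> (snd z))\<bar>\<^sup>2 \<le> (L * \<bar>incr \<psi> z\<bar>)\<^sup>2" by (intro power_mono L) simp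
    then show "ennreal ((G (\<psi> (fst z)) - G (\<psi> (snd z)))\<^sup>2) \<le> ennreal (L\<^sup>2) * ennreal ((incr \<psi> z)\<^sup>2)"
      by (simp add: ennreal_mult[symmetric] power_mult_distrib ennreal_leI)
  qed
  also have "\<dots> = ennreal (L\<^sup>2) * gagliardo s \<psi>" unfolding gagliardo_def by (rule nn_integral_cmult) measurable
  finally show ?thesis .
qed

text \<open>The equation for Borel representatives extended by 0: U and D stand for u and its
  gradient, g for u^q and p for f u^-gamma. The function p is integrable only against test
  functions, g outright; the approximations converge in H^1 and almost everywhere.\<close>

locale energy_solution =
  fixes \<Omega> :: "(real^'n::finite) set" and s :: real and U :: "real^'n \<Rightarrow> real" and D :: "real^'n \<Rightarrow> real^'n"
    and g p :: "real^'n \<Rightarrow> real" and \<phi> :: "nat \<Rightarrow> real^'n \<Rightarrow> real"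
  assumes s: "0 < s" "s < 1"
    and \<Omega>: "\<Omega> \<in> fmeasurable lborel"
    and U_borel[measurable]: "U \<in> borel_measurable borel" and D_borel[measurable]: "D \<in> borel_measurable borel"
    and U_outside: "\<And>x. x \<notin> \<Omega> \<Longrightarrow> U x = 0" and D_outside: "\<And>x. x \<notin> \<Omega> \<Longrightarrow> D x = 0"
    and U_sq: "integrable lborel (\<lambda>x. (norm (U x))\<^sup>2)" and D_sq: "integrable lborel (\<lambda>x. (norm (D x))\<^sup>2)"
    and test: "\<And>k. test_fun \<Omega> (\<phi> k)"
    and conv: "(\<lambda>k. (\<integral>x. (norm (\<phi> k x - U x))\<^sup>2 \<partial>lborel) + (\<integral>x. (norm (classical_grad (\<phi> k) x - D x))\<^sup>2 \<partial>lborel)) \<longlonglongrightarrow> 0"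
    and conv_AE: "AE x in lborel. (\<lambda>k. \<phi> k x) \<longlonglongrightarrow> U x"
    and g_borel[measurable]: "g \<in> borel_measurable borel" and g_nonneg: "\<And>x. 0 \<le> g x" and g_int: "integrable lborel g"
    and p_borel[measurable]: "p \<in> borel_measurable borel" and p_nonneg: "\<And>x. 0 \<le> p x"
    and p_int: "\<And>\<psi>. test_fun \<Omega> \<psi> \<Longrightarrow> integrable lborel (\<lambda>x. p x * \<psi> x)"
    and eq: "\<And>\<psi>. test_fun \<Omega> \<psi> \<Longrightarrow>
      (\<integral>x. D x \<bullet> classical_grad \<psi> x \<partial>lborel) + (\<integral>z. incr U z * incr \<psi> z \<partial>kernel_measure s) + (\<integral>x. g x * \<psi> x \<partial>lborel)
        = (\<integral>x. p x * \<psi> x \<partial>lborel)"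
begin

definition err :: "nat \<Rightarrow> real" where
  "err k = (\<integral>x. (norm (\<phi> k x - U x))\<^sup>2 \<partial>lborel) + (\<integral>x. (norm (classical_grad (\<phi> k) x - D x))\<^sup>2 \<partial>lborel)"

lemma err_tendsto: "err \<longlonglongrightarrow> 0"
  unfolding err_def by (rule conv)

lemma err_nonneg: "0 \<le> err k"
  unfolding err_def by simp

lemma \<phi>_borel[measurable]: "\<phi> k \<in> borel_measurable borel" "classical_grad (\<phi> k) \<in> borel_measurable borel"
  using test_fun_borel test_fun_grad_borel test by blast+

lemma test_sq:
  assumes "test_fun \<Omega> \<psi>"
  shows "integrable lborel (\<lambda>x. (norm (\<psi> x))\<^sup>2)" "integrable lborel (\<lambda>x. (norm (classical_grad \<psi> x))\<^sup>2)"
  using test_fun_integrable_sq[OF assms] by simp_all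

lemma err_integrable:
  "integrable lborel (\<lambda>x. (norm (\<phi> k x - U x))\<^sup>2)" "integrable lborel (\<lambda>x. (norm (classical_grad (\<phi> k) x - D x))\<^sup>2)"
  by (intro integrable_norm_diff_sq U_sq D_sq test_sq test; measurable)+

text \<open>Stated for pairs \<open>(b, B)\<close> so that it covers both \<open>(U, D)\<close> and \<open>(G \<circ> U, G' \<circ> U \<cdot> D)\<close>.\<close>

lemma h1_diff_le:
  assumes \<psi>: "test_fun \<Omega> \<psi>" "test_fun \<Omega> \<eta>" and [measurable]: "b \<in> borel_measurable borel" "B \<in> borel_measurable borel"
    and b: "integrable lborel (\<lambda>x. (norm (b x))\<^sup>2)" "integrable lborel (\<lambda>x. (norm (B x))\<^sup>2)"
  shows "h1_norm_sq (\<lambda>x. \<psi> x - \<eta> x) \<le>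
     2 * ((\<integral>x. (norm (\<psi> x - b x))\<^sup>2 \<partial>lborel) + (\<integral>x. (norm (classical_grad \<psi> x - B x))\<^sup>2 \<partial>lborel))
     + 2 * ((\<integral>x. (norm (\<eta> x - b x))\<^sup>2 \<partial>lborel) + (\<integral>x. (norm (classical_grad \<eta> x - B x))\<^sup>2 \<partial>lborel))"
proof -
  note [measurable] = test_fun_borel[OF \<psi>(1)] test_fun_borel[OF \<psi>(2)] test_fun_grad_borel[OF \<psi>(1)] test_fun_grad_borel[OF \<psi>(2)]
  have i: "integrable lborel (\<lambda>x. (norm (\<psi> x - b x))\<^sup>2)" "integrable lborel (\<lambda>x. (norm (\<eta> x - b x))\<^sup>2)"
    "integrable lborel (\<lambda>x. (norm (classical_grad \<psi> x - B x))\<^sup>2)" "integrable lborel (\<lambda>x. (norm (classical_grad \<eta> x - B x))\<^sup>2)"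
    by (intro integrable_norm_diff_sq b test_sq \<psi>; measurable)+
  have d: "test_fun \<Omega> (\<lambda>x. \<psi> x - \<eta> x)" by (rule test_fun_diff[OF \<psi>])
  have 1: "(\<integral>x. (\<psi> x - \<eta> x)\<^sup>2 \<partial>lborel) \<le> (\<integral>x. 2 * (norm (\<psi> x - b x))\<^sup>2 + 2 * (norm (\<eta> x - b x))\<^sup>2 \<partial>lborel)"
  proof (rule integral_mono)
    show "(\<psi> x - \<eta> x)\<^sup>2 \<le> 2 * (norm (\<psi> x - b x))\<^sup>2 + 2 * (norm (\<eta> x - b x))\<^sup>2" for x
      using norm_diff_sq_le3[of "\<psi> x" "\<eta> x" "b x"] by simp
  qed (use test_fun_integrable_sq(1)[OF d] i in auto)
  have 2: "(\<integral>x. (norm (classical_grad (\<lambda>x. \<psi> x - \<eta> x) x))\<^sup>2 \<partial>lborel)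
      \<le> (\<integral>x. 2 * (norm (classical_grad \<psi> x - B x))\<^sup>2 + 2 * (norm (classical_grad \<eta> x - B x))\<^sup>2 \<partial>lborel)"
  proof (rule integral_mono)
    show "(norm (classical_grad (\<lambda>x. \<psi> x - \<eta> x) x))\<^sup>2 \<le> 2 * (norm (classical_grad \<psi> x - B x))\<^sup>2 + 2 * (norm (classical_grad \<eta> x - B x))\<^sup>2" for x
      unfolding grad_diff[OF test_funD(1)[OF \<psi>(1)] test_funD(1)[OF \<psi>(2)]] by (rule norm_diff_sq_le3)
  qed (use test_fun_integrable_sq(2)[OF d] i in auto)
  show ?thesis unfolding h1_norm_sq_def using 1 2 i by simp
qed

definition N0 :: real where
  "N0 = (\<integral>x. (norm (U x))\<^sup>2 \<partial>lborel) + (\<integral>x. (norm (D x))\<^sup>2 \<partial>lborel)"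

lemma h1_approx_le: "h1_norm_sq (\<phi> k) \<le> 2 * err k + 2 * N0"
proof -
  have 1: "(\<integral>x. (\<phi> k x)\<^sup>2 \<partial>lborel) \<le> (\<integral>x. 2 * (norm (\<phi> k x - U x))\<^sup>2 + 2 * (norm (U x))\<^sup>2 \<partial>lborel)"
  proof (rule integral_mono)
    show "(\<phi> k x)\<^sup>2 \<le> 2 * (norm (\<phi> k x - U x))\<^sup>2 + 2 * (norm (U x))\<^sup>2" for x
      using norm_diff_sq_le[of "\<phi> k x - U x" "- U x"] by simp
  qed (use test_fun_integrable_sq(1)[OF test] err_integrable U_sq in auto)
  have 2: "(\<integral>x. (norm (classical_grad (\<phi> k) x))\<^sup>2 \<partial>lborel) \<le> (\<integral>x. 2 * (norm (classical_grad (\<phi> k) x - D x))\<^sup>2 + 2 * (norm (D x))\<^sup>2 \<partial>lborel)"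
  proof (rule integral_mono)
    show "(norm (classical_grad (\<phi> k) x))\<^sup>2 \<le> 2 * (norm (classical_grad (\<phi> k) x - D x))\<^sup>2 + 2 * (norm (D x))\<^sup>2" for x
      using norm_diff_sq_le[of "classical_grad (\<phi> k) x - D x" "- D x"] by simp
  qed (use test_fun_integrable_sq(2)[OF test] err_integrable D_sq in auto)
  show ?thesis unfolding h1_norm_sq_def err_def N0_def using 1 2 err_integrable U_sq D_sq by simp
qed

text \<open>Chosen once for the whole locale, so that the same embedding constant serves every
  member of an approximating sequence.\<close>

definition Cg :: real where
  "Cg = (SOME C. 0 \<le> C \<and> (\<forall>U (\<psi>::real^'n \<Rightarrow> real). test_fun U \<psi> \<longrightarrow> gagliardo s \<psi> \<le> ennreal (C * h1_norm_sq \<psi>)))"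

lemma Cg: "0 \<le> Cg" "test_fun V (\<psi>::real^'n \<Rightarrow> real) \<Longrightarrow> gagliardo s \<psi> \<le> ennreal (Cg * h1_norm_sq \<psi>)"
proof -
  obtain C where "0 \<le> C" "\<And>U (\<psi>::real^'n \<Rightarrow> real). test_fun U \<psi> \<Longrightarrow> gagliardo s \<psi> \<le> ennreal (C * h1_norm_sq \<psi>)"
    using gagliardo_le_h1[OF s] by blast
  then have "\<exists>C. 0 \<le> C \<and> (\<forall>U (\<psi>::real^'n \<Rightarrow> real). test_fun U \<psi> \<longrightarrow> gagliardo s \<psi> \<le> ennreal (C * h1_norm_sq \<psi>))" by blast
  from someI_ex[OF this] have "0 \<le> Cg \<and> (\<forall>U (\<psi>::real^'n \<Rightarrow> real). test_fun U \<psi> \<longrightarrow> gagliardo s \<psi> \<le> ennreal (Cg * h1_norm_sq \<psi>))"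
    unfolding Cg_def .
  then show "0 \<le> Cg" "test_fun V (\<psi>::real^'n \<Rightarrow> real) \<Longrightarrow> gagliardo s \<psi> \<le> ennreal (Cg * h1_norm_sq \<psi>)" by blast+
qed

lemma h1_norm_sq_nonneg: "0 \<le> h1_norm_sq \<psi>"
  unfolding h1_norm_sq_def by simp

text \<open>The embedding applies to the differences \<open>\<phi> j - \<phi> k\<close> of test
  functions; Fatou in j carries the estimate to U, which need not be smooth.\<close>

lemma gagliardo_err: "gagliardo s (\<lambda>x. U x - \<phi> k x) \<le> ennreal (2 * Cg * err k)"
  unfolding gagliardo_def
proof (rule nn_integral_fatou_le[where c="\<lambda>j. ennreal (Cg * (2 * err j + 2 * err k))"])
  let ?w = "\<lambda>j x. \<phi> j x - \<phi> k x"
  show "(\<lambda>z. ennreal ((incr (?w j) z)\<^sup>2)) \<in> borel_measurable (kernel_measure s)" for j by measurable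
  show "AE z in kernel_measure s. (\<lambda>j. ennreal ((incr (?w j) z)\<^sup>2)) \<longlonglongrightarrow> ennreal ((incr (\<lambda>x. U x - \<phi> k x) z)\<^sup>2)"
    using AE_kernel_measure[OF conv_AE] by eventually_elim (intro tendsto_intros; auto)
  show "(\<integral>\<^sup>+z. ennreal ((incr (?w j) z)\<^sup>2) \<partial>kernel_measure s) \<le> ennreal (Cg * (2 * err j + 2 * err k))" for j
  proof -
    have "gagliardo s (?w j) \<le> ennreal (Cg * h1_norm_sq (?w j))" by (rule Cg(2)[OF test_fun_diff[OF test test]])
    also have "\<dots> \<le> ennreal (Cg * (2 * err j + 2 * err k))"
      using h1_diff_le[OF test test U_borel D_borel U_sq D_sq, of j k] Cg(1)
      by (intro ennreal_leI mult_left_mono) (auto simp: err_def)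
    finally show ?thesis unfolding gagliardo_def .
  qed
  have "(\<lambda>j. Cg * (2 * err j + 2 * err k)) \<longlonglongrightarrow> Cg * (2 * 0 + 2 * err k)" by (intro tendsto_intros err_tendsto)
  then show "(\<lambda>j. ennreal (Cg * (2 * err j + 2 * err k))) \<longlonglongrightarrow> ennreal (2 * Cg * err k)"
    by (intro tendsto_ennrealI) (simp add: mult_ac)
qed

lemma incr_test_sq:
  assumes "test_fun \<Omega> \<psi>"
  shows "integrable (kernel_measure s) (\<lambda>z. (incr \<psi> z)\<^sup>2)" "(\<integral>z. (incr \<psi> z)\<^sup>2 \<partial>kernel_measure s) \<le> Cg * h1_norm_sq \<psi>"
  by (rule gagliardo_finite[OF test_fun_borel[OF assms] Cg(2)[OF assms] mult_nonneg_nonneg[OF Cg(1) h1_norm_sq_nonneg]])+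

lemma incr_err_sq:
  "integrable (kernel_measure s) (\<lambda>z. (incr (\<lambda>x. U x - \<phi> k x) z)\<^sup>2)"
  "(\<integral>z. (incr (\<lambda>x. U x - \<phi> k x) z)\<^sup>2 \<partial>kernel_measure s) \<le> 2 * Cg * err k"
  by (rule gagliardo_finite[OF _ gagliardo_err]; use Cg(1) err_nonneg in simp)+

lemma incr_U_sq: "integrable (kernel_measure s) (\<lambda>z. (incr U z)\<^sup>2)"
proof -
  have "integrable (kernel_measure s) (\<lambda>z. (norm (incr (\<lambda>x. U x - \<phi> 0 x) z - (\<lambda>z. - incr (\<phi> 0) z) z))\<^sup>2)"
  proof (rule integrable_norm_diff_sq)
    show "integrable (kernel_measure s) (\<lambda>z. (norm (- incr (\<phi> 0) z))\<^sup>2)"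
      unfolding norm_minus_cancel using incr_test_sq(1)[OF test, of 0] by (simp only: real_norm_def power2_abs)
    show "integrable (kernel_measure s) (\<lambda>z. (norm (incr (\<lambda>x. U x - \<phi> 0 x) z))\<^sup>2)"
      using incr_err_sq(1)[of 0] by (simp only: real_norm_def power2_abs)
    show "(\<lambda>z. - incr (\<phi> 0) z) \<in> borel_measurable (kernel_measure s)"
      by (intro borel_measurable_uminus incr_borel \<phi>_borel)
    show "incr (\<lambda>x. U x - \<phi> 0 x) \<in> borel_measurable (kernel_measure s)"
      by (intro incr_borel borel_measurable_diff U_borel \<phi>_borel)
  qed
  then show ?thesis by (simp add: algebra_simps)
qed

text \<open>An upper bound for the norm of the gradient and nonlocal terms of the equation together,
  as a functional of the test function \<psi> measured by
  \<open>sqrt (h1_norm_sq \<psi>)\<close>.\<close>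

definition K0 :: real where
  "K0 = sqrt (\<integral>x. (norm (D x))\<^sup>2 \<partial>lborel) + sqrt (\<integral>z. (incr U z)\<^sup>2 \<partial>kernel_measure s) * sqrt Cg"

lemma K0_nonneg: "0 \<le> K0"
  unfolding K0_def using Cg(1) by simp

lemma D_inner:
  assumes [measurable]: "B \<in> borel_measurable borel" and B: "integrable lborel (\<lambda>x. (norm (B x))\<^sup>2)"
  shows "integrable lborel (\<lambda>x. D x \<bullet> B x)"
    "\<bar>\<integral>x. D x \<bullet> B x \<partial>lborel\<bar> \<le> sqrt (\<integral>x. (norm (D x))\<^sup>2 \<partial>lborel) * sqrt (\<integral>x. (norm (B x))\<^sup>2 \<partial>lborel)"
proof -
  note L = L2_product[of "\<lambda>x. norm (D x)" lborel "\<lambda>x. norm (B x)", OF _ _ D_sq B]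
  have i: "integrable lborel (\<lambda>x. norm (D x) * norm (B x))" by (rule L(1)) measurable
  show j: "integrable lborel (\<lambda>x. D x \<bullet> B x)"
    by (rule Bochner_Integration.integrable_bound[OF i]) (auto intro!: AE_I2 Cauchy_Schwarz_ineq2)
  have "\<bar>\<integral>x. D x \<bullet> B x \<partial>lborel\<bar> \<le> (\<integral>x. \<bar>D x \<bullet> B x\<bar> \<partial>lborel)" by (rule integral_abs_bound)
  also have "\<dots> \<le> (\<integral>x. norm (D x) * norm (B x) \<partial>lborel)"
    by (rule integral_mono[OF integrable_abs[OF j] i]) (rule Cauchy_Schwarz_ineq2)
  also have "\<dots> \<le> sqrt (\<integral>x. (norm (D x))\<^sup>2 \<partial>lborel) * sqrt (\<integral>x. (norm (B x))\<^sup>2 \<partial>lborel)"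
    by (rule order_trans[OF abs_ge_self L(2)]) measurable
  finally show "\<bar>\<integral>x. D x \<bullet> B x \<partial>lborel\<bar> \<le> sqrt (\<integral>x. (norm (D x))\<^sup>2 \<partial>lborel) * sqrt (\<integral>x. (norm (B x))\<^sup>2 \<partial>lborel)" .
qed

lemma g_test:
  assumes "test_fun \<Omega> \<psi>"
  shows "integrable lborel (\<lambda>x. g x * \<psi> x)"
proof -
  obtain C where C: "\<And>x. \<bar>\<psi> x\<bar> \<le> C" using test_fun_bounded[OF assms] by blast
  note [measurable] = test_fun_borel[OF assms]
  show ?thesis
  proof (rule Bochner_Integration.integrable_bound[OF integrable_mult_left[OF g_int, of C]])
    show "AE x in lborel. norm (g x * \<psi> x) \<le> norm (g x * C)"
      using C g_nonneg by (intro AE_I2) (auto simp: abs_mult intro!: mult_left_mono order_trans[OF C abs_ge_self])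
  qed measurable
qed

text \<open>Testing with the smooth functions \<open>sqrt (\<psi>\<^sup>2 + e\<^sup>2) - e\<close>, which increase to \<open>\<bar>\<psi>\<bar>\<close>, bounds the singular
  term, which is only locally integrable.\<close>

lemma p_abs_bound:
  assumes \<psi>: "test_fun \<Omega> \<psi>"
  shows "(\<integral>\<^sup>+x. ennreal (p x * \<bar>\<psi> x\<bar>) \<partial>lborel) \<le> ennreal ((\<integral>x. g x * \<bar>\<psi> x\<bar> \<partial>lborel) + K0 * sqrt (h1_norm_sq \<psi>))"
proof (rule nn_integral_fatou_le[where c="\<lambda>_. ennreal ((\<integral>x. g x * \<bar>\<psi> x\<bar> \<partial>lborel) + K0 * sqrt (h1_norm_sq \<psi>))"])
  note [measurable] = test_fun_borel[OF \<psi>]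
  define e where "e j = 1 / real (Suc j)" for j
  have e: "0 < e j" for j by (simp add: e_def)
  define R where "R j x = sqrt (x\<^sup>2 + (e j)\<^sup>2) + (- e j)" for j x
  have sm: "smooth1 (R j)" for j unfolding R_def by (rule smooth1_sqrt_abs[OF e])
  note [measurable] = smooth1_borel[OF sm]
  have R0: "R j 0 = 0" for j using e[of j] by (simp add: R_def)
  have Rnn: "0 \<le> R j x" for j x
  proof -
    have "e j \<le> sqrt (x\<^sup>2 + (e j)\<^sup>2)" using e[of j] by (intro real_le_rsqrt) simp
    then show ?thesis by (simp add: R_def)
  qed
  have Rle: "R j x \<le> \<bar>x\<bar>" for j x
    using sqrt_add_le_add_sqrt[of "x\<^sup>2" "(e j)\<^sup>2"] e[of j] by (simp add: R_def)
  have dR: "\<bar>deriv (R j) x\<bar> \<le> 1" for j x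
  proof -
    have pos: "0 < x\<^sup>2 + (e j)\<^sup>2" using e[of j] by (simp add: add_nonneg_pos)
    have "(R j has_real_derivative x / sqrt (x\<^sup>2 + (e j)\<^sup>2)) (at x)"
      unfolding R_def using pos by (auto intro!: derivative_eq_intros simp: field_simps)
    then have "deriv (R j) x = x / sqrt (x\<^sup>2 + (e j)\<^sup>2)" by (rule DERIV_imp_deriv)
    moreover have "\<bar>x\<bar> \<le> sqrt (x\<^sup>2 + (e j)\<^sup>2)" by (intro real_le_rsqrt) simp
    ultimately show ?thesis using pos by (simp add: abs_divide)
  qed
  show "(\<lambda>x. ennreal (p x * R j (\<psi> x))) \<in> borel_measurable lborel" for j by measurable
  show "AE x in lborel. (\<lambda>j. ennreal (p x * R j (\<psi> x))) \<longlonglongrightarrow> ennreal (p x * \<bar>\<psi> x\<bar>)"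
  proof (rule AE_I2)
    fix x
    have "e \<longlonglongrightarrow> 0" unfolding e_def using LIMSEQ_inverse_real_of_nat by (simp add: inverse_eq_divide)
    then have "(\<lambda>j. R j (\<psi> x)) \<longlonglongrightarrow> sqrt ((\<psi> x)\<^sup>2 + 0\<^sup>2) + (- 0)" unfolding R_def by (intro tendsto_intros)
    then have "(\<lambda>j. p x * R j (\<psi> x)) \<longlonglongrightarrow> p x * \<bar>\<psi> x\<bar>" by (intro tendsto_mult tendsto_const) simp
    then show "(\<lambda>j. ennreal (p x * R j (\<psi> x))) \<longlonglongrightarrow> ennreal (p x * \<bar>\<psi> x\<bar>)" by (rule tendsto_ennrealI)
  qed
  show "(\<integral>\<^sup>+x. ennreal (p x * R j (\<psi> x)) \<partial>lborel) \<le> ennreal ((\<integral>x. g x * \<bar>\<psi> x\<bar> \<partial>lborel) + K0 * sqrt (h1_norm_sq \<psi>))" for j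
  proof -
    define \<eta> where "\<eta> x = R j (\<psi> x)" for x
    have \<eta>: "test_fun \<Omega> \<eta>" unfolding \<eta>_def by (rule test_fun_compose[OF \<psi> sm R0])
    note [measurable] = test_fun_borel[OF \<eta>] test_fun_grad_borel[OF \<eta>]
    have gr: "norm (classical_grad \<eta> x) \<le> norm (classical_grad \<psi> x)" for x
    proof -
      have "classical_grad \<eta> x = deriv (R j) (\<psi> x) *\<^sub>R classical_grad \<psi> x"
        unfolding \<eta>_def by (rule grad_compose[OF sm test_funD(1)[OF \<psi>]])
      then show ?thesis using dR[of j "\<psi> x"] by (simp add: mult_left_le_one_le)
    qed
    have h: "(\<integral>x. (norm (classical_grad \<eta> x))\<^sup>2 \<partial>lborel) \<le> h1_norm_sq \<psi>"
    proof -
      have "(\<integral>x. (norm (classical_grad \<eta> x))\<^sup>2 \<partial>lborel) \<le> (\<integral>x. (norm (classical_grad \<psi> x))\<^sup>2 \<partial>lborel)"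
        using gr by (intro integral_mono test_sq \<eta> \<psi> power_mono) auto
      then show ?thesis unfolding h1_norm_sq_def by (simp add: add_increasing)
    qed
    have 1: "(\<integral>x. D x \<bullet> classical_grad \<eta> x \<partial>lborel) \<le> sqrt (\<integral>x. (norm (D x))\<^sup>2 \<partial>lborel) * sqrt (h1_norm_sq \<psi>)"
    proof -
      have "(\<integral>x. D x \<bullet> classical_grad \<eta> x \<partial>lborel) \<le> sqrt (\<integral>x. (norm (D x))\<^sup>2 \<partial>lborel) * sqrt (\<integral>x. (norm (classical_grad \<eta> x))\<^sup>2 \<partial>lborel)"
        by (rule order_trans[OF abs_ge_self D_inner(2)[OF _ test_sq(2)[OF \<eta>]]]) measurable
      also have "\<dots> \<le> sqrt (\<integral>x. (norm (D x))\<^sup>2 \<partial>lborel) * sqrt (h1_norm_sq \<psi>)" using h by (intro mult_left_mono) auto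
      finally show ?thesis .
    qed
    have 2: "(\<integral>z. incr U z * incr \<eta> z \<partial>kernel_measure s) \<le> sqrt (\<integral>z. (incr U z)\<^sup>2 \<partial>kernel_measure s) * (sqrt Cg * sqrt (h1_norm_sq \<psi>))"
    proof -
      have lip: "\<bar>R j x - R j y\<bar> \<le> 1 * \<bar>x - y\<bar>" for x y
        by (rule deriv_bound_imp_lipschitz[OF smooth1_D[OF sm] dR])
      have "gagliardo s \<eta> \<le> ennreal (1\<^sup>2) * gagliardo s \<psi>"
        unfolding \<eta>_def by (rule gagliardo_lipschitz[OF _ lip]) measurable
      also have "\<dots> \<le> ennreal (Cg * h1_norm_sq \<psi>)" using Cg(2)[OF \<psi>] by simp
      finally have "(\<integral>z. (incr \<eta> z)\<^sup>2 \<partial>kernel_measure s) \<le> Cg * h1_norm_sq \<psi>"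
        by (rule gagliardo_finite(2)[OF test_fun_borel[OF \<eta>] _ mult_nonneg_nonneg[OF Cg(1) h1_norm_sq_nonneg]])
      then have a: "sqrt (\<integral>z. (incr \<eta> z)\<^sup>2 \<partial>kernel_measure s) \<le> sqrt Cg * sqrt (h1_norm_sq \<psi>)"
        by (simp flip: real_sqrt_mult)
      have "(\<integral>z. incr U z * incr \<eta> z \<partial>kernel_measure s) \<le> \<bar>\<integral>z. incr U z * incr \<eta> z \<partial>kernel_measure s\<bar>" by simp
      also have "\<dots> \<le> sqrt (\<integral>z. (incr U z)\<^sup>2 \<partial>kernel_measure s) * sqrt (\<integral>z. (incr \<eta> z)\<^sup>2 \<partial>kernel_measure s)"
        by (rule L2_product(2)[OF _ _ incr_U_sq incr_test_sq(1)[OF \<eta>]]) measurable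
      also have "\<dots> \<le> sqrt (\<integral>z. (incr U z)\<^sup>2 \<partial>kernel_measure s) * (sqrt Cg * sqrt (h1_norm_sq \<psi>))"
        using a by (rule mult_left_mono) simp
      finally show ?thesis .
    qed
    have 3: "(\<integral>x. g x * \<eta> x \<partial>lborel) \<le> (\<integral>x. g x * \<bar>\<psi> x\<bar> \<partial>lborel)"
    proof (rule integral_mono[OF g_test[OF \<eta>]])
      show "integrable lborel (\<lambda>x. g x * \<bar>\<psi> x\<bar>)"
        using integrable_abs[OF g_test[OF \<psi>]] g_nonneg by (simp add: abs_mult)
    qed (use Rle g_nonneg in \<open>auto simp: \<eta>_def intro: mult_left_mono\<close>)
    \<comment> \<open>The singular term of the equation is now p integrated against a smooth
      stand-in for the absolute value of \<psi>, and the equation transfers the bounds on the other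
      three terms to it.\<close>
    have "(\<integral>x. p x * \<eta> x \<partial>lborel) \<le> (\<integral>x. g x * \<bar>\<psi> x\<bar> \<partial>lborel) + K0 * sqrt (h1_norm_sq \<psi>)"
      using eq[OF \<eta>] 1 2 3 by (simp add: K0_def algebra_simps)
    moreover have "(\<integral>\<^sup>+x. ennreal (p x * \<eta> x) \<partial>lborel) = ennreal (\<integral>x. p x * \<eta> x \<partial>lborel)"
      using Rnn p_nonneg by (intro nn_integral_eq_integral p_int \<eta>) (auto simp: \<eta>_def)
    ultimately show ?thesis unfolding \<eta>_def by (simp add: ennreal_leI)
  qed
qed auto

end

text \<open>G is the smooth step of the truncation argument. Vanishing up to a positive level gives
  \<open>G 0 = 0\<close>, so that G(\<phi> k) is again a test function; the slope bound L controls
  its gradient and its increments.\<close>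

locale energy_truncation = energy_solution +
  fixes G :: "real \<Rightarrow> real" and t L :: real
  assumes G_smooth: "smooth1 G" and G_nonneg: "\<And>x. 0 \<le> G x" and G_le_1: "\<And>x. G x \<le> 1"
    and t_pos: "0 < t" and G_zero: "\<And>x. x \<le> t \<Longrightarrow> G x = 0"
    and G'_nonneg: "\<And>x. 0 \<le> deriv G x" and G'_le: "\<And>x. deriv G x \<le> L"
    and G'_zero: "\<And>x. x \<le> t \<Longrightarrow> deriv G x = 0"
begin

lemma G_borel[measurable]: "G \<in> borel_measurable borel" "deriv G \<in> borel_measurable borel"
  using smooth1_borel smooth1_deriv G_smooth by blast+

lemma G_lip: "\<bar>G x - G y\<bar> \<le> L * \<bar>x - y\<bar>"
  by (rule deriv_bound_imp_lipschitz[OF smooth1_D[OF G_smooth]]) (use G'_nonneg G'_le in auto)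

lemma G_0: "G 0 = 0"
  using G_zero t_pos by simp

lemma G_mono: "x \<le> y \<Longrightarrow> G x \<le> G y"
  by (rule DERIV_nonneg_imp_nondecreasing) (use smooth1_D[OF G_smooth] G'_nonneg in blast)+

lemma G_cont: "isCont G x" "isCont (deriv G) x"
  using smooth1_D[OF G_smooth] smooth1_D[OF smooth1_deriv[OF G_smooth]] DERIV_isCont by blast+

definition a :: "nat \<Rightarrow> real^'a \<Rightarrow> real" where "a k x = G (\<phi> k x)"

definition A :: "real^'a \<Rightarrow> real^'a" where "A x = deriv G (U x) *\<^sub>R D x"

lemma a_test: "test_fun \<Omega> (a k)"
  unfolding a_def by (rule test_fun_compose[OF test G_smooth G_0])

lemma a_borel[measurable]: "a k \<in> borel_measurable borel" "classical_grad (a k) \<in> borel_measurable borel"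
  using test_fun_borel test_fun_grad_borel a_test by blast+

lemma A_borel[measurable]: "A \<in> borel_measurable borel"
  unfolding A_def by measurable

lemma a_grad: "classical_grad (a k) x = deriv G (\<phi> k x) *\<^sub>R classical_grad (\<phi> k) x"
  unfolding a_def by (rule grad_compose[OF G_smooth test_funD(1)[OF test]])

lemma GU_sq: "integrable lborel (\<lambda>x. (norm (G (U x)))\<^sup>2)"
proof (rule Bochner_Integration.integrable_bound[OF integrable_mult_right[of "L\<^sup>2", OF U_sq]])
  show "AE x in lborel. norm ((norm (G (U x)))\<^sup>2) \<le> norm (L\<^sup>2 * (norm (U x))\<^sup>2)"
  proof (rule AE_I2)
    fix x
    have "\<bar>G (U x)\<bar>\<^sup>2 \<le> (L * \<bar>U x\<bar>)\<^sup>2" using G_lip[of "U x" 0] G_0 by (intro power_mono) auto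
    then show "norm ((norm (G (U x)))\<^sup>2) \<le> norm (L\<^sup>2 * (norm (U x))\<^sup>2)" by (simp add: power_mult_distrib)
  qed
qed measurable

lemma A_norm_le: "norm (A x) \<le> L * norm (D x)"
  unfolding A_def using G'_nonneg[of "U x"] G'_le[of "U x"] by (simp add: mult_right_mono)

lemma A_sq: "integrable lborel (\<lambda>x. (norm (A x))\<^sup>2)"
proof (rule Bochner_Integration.integrable_bound[OF integrable_mult_right[of "L\<^sup>2", OF D_sq]])
  show "AE x in lborel. norm ((norm (A x))\<^sup>2) \<le> norm (L\<^sup>2 * (norm (D x))\<^sup>2)"
  proof (rule AE_I2)
    fix x
    have "(norm (A x))\<^sup>2 \<le> (L * norm (D x))\<^sup>2" by (intro power_mono A_norm_le) simp
    then show "norm ((norm (A x))\<^sup>2) \<le> norm (L\<^sup>2 * (norm (D x))\<^sup>2)" by (simp add: power_mult_distrib)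
  qed
qed measurable

definition d1 :: "nat \<Rightarrow> real" where "d1 k = (\<integral>x. g x * \<bar>a k x - G (U x)\<bar> \<partial>lborel)"

definition d2 :: "nat \<Rightarrow> real" where "d2 k = (\<integral>x. (norm (a k x - G (U x)))\<^sup>2 \<partial>lborel)"

definition d3 :: "nat \<Rightarrow> real" where "d3 k = (\<integral>x. (norm (classical_grad (a k) x - A x))\<^sup>2 \<partial>lborel)"

lemma d_integrable:
  "integrable lborel (\<lambda>x. g x * \<bar>a k x - G (U x)\<bar>)"
  "integrable lborel (\<lambda>x. (norm (a k x - G (U x)))\<^sup>2)"
  "integrable lborel (\<lambda>x. (norm (classical_grad (a k) x - A x))\<^sup>2)"
proof -
  show "integrable lborel (\<lambda>x. g x * \<bar>a k x - G (U x)\<bar>)"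
  proof (rule Bochner_Integration.integrable_bound[OF g_int])
    show "AE x in lborel. norm (g x * \<bar>a k x - G (U x)\<bar>) \<le> norm (g x)"
    proof (rule AE_I2)
      fix x
      have "\<bar>a k x - G (U x)\<bar> \<le> 1" unfolding a_def
        using G_nonneg[of "\<phi> k x"] G_le_1[of "\<phi> k x"] G_nonneg[of "U x"] G_le_1[of "U x"] by linarith
      then show "norm (g x * \<bar>a k x - G (U x)\<bar>) \<le> norm (g x)" using g_nonneg[of x] by (simp add: abs_mult mult_left_le)
    qed
  qed measurable
  show "integrable lborel (\<lambda>x. (norm (a k x - G (U x)))\<^sup>2)"
    by (intro integrable_norm_diff_sq GU_sq test_sq a_test; measurable)
  show "integrable lborel (\<lambda>x. (norm (classical_grad (a k) x - A x))\<^sup>2)"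
    by (intro integrable_norm_diff_sq A_sq test_sq a_test; measurable)
qed

lemma a_AE: "AE x in lborel. (\<lambda>k. a k x) \<longlonglongrightarrow> G (U x)"
  using conv_AE unfolding a_def by eventually_elim (rule isCont_tendsto_compose[OF G_cont(1)])

lemma d1_tendsto: "d1 \<longlonglongrightarrow> 0"
proof -
  have "(\<lambda>k. \<integral>x. g x * \<bar>a k x - G (U x)\<bar> \<partial>lborel) \<longlonglongrightarrow> (\<integral>x. 0 \<partial>(lborel :: (real^'a) measure))"
  proof (rule integral_dominated_convergence[where w=g])
    show "AE x in lborel. (\<lambda>k. g x * \<bar>a k x - G (U x)\<bar>) \<longlonglongrightarrow> 0"
      using a_AE by eventually_elim (auto intro!: tendsto_mult_right_zero tendsto_rabs_zero simp: LIM_zero_iff)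
    show "AE x in lborel. norm (g x * \<bar>a k x - G (U x)\<bar>) \<le> g x" for k
    proof (rule AE_I2)
      fix x
      have "\<bar>a k x - G (U x)\<bar> \<le> 1" unfolding a_def
        using G_nonneg[of "\<phi> k x"] G_le_1[of "\<phi> k x"] G_nonneg[of "U x"] G_le_1[of "U x"] by linarith
      then show "norm (g x * \<bar>a k x - G (U x)\<bar>) \<le> g x" using g_nonneg[of x] by (simp add: abs_mult mult_left_le)
    qed
  qed (use g_int in measurable)
  then show ?thesis by (simp add: d1_def[abs_def])
qed

lemma d2_le: "d2 k \<le> L\<^sup>2 * err k"
proof -
  have "d2 k \<le> (\<integral>x. L\<^sup>2 * (norm (\<phi> k x - U x))\<^sup>2 \<partial>lborel)" unfolding d2_def
  proof (rule integral_mono[OF d_integrable(2)])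
    fix x
    have "\<bar>G (\<phi> k x) - G (U x)\<bar>\<^sup>2 \<le> (L * \<bar>\<phi> k x - U x\<bar>)\<^sup>2" by (intro power_mono G_lip) simp
    then show "(norm (a k x - G (U x)))\<^sup>2 \<le> L\<^sup>2 * (norm (\<phi> k x - U x))\<^sup>2" by (simp add: a_def power_mult_distrib)
  qed (intro integrable_mult_right err_integrable)
  also have "\<dots> = L\<^sup>2 * (\<integral>x. (norm (\<phi> k x - U x))\<^sup>2 \<partial>lborel)" by simp
  also have "\<dots> \<le> L\<^sup>2 * err k" unfolding err_def by (intro mult_left_mono) auto
  finally show ?thesis .
qed

text \<open>The part of the chain-rule error that H^1 convergence does not control: G' at \<phi> k
  against G' at U, weighted by |D|^2. It tends to 0 by dominated convergence, G' being continuous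
  and bounded.\<close>

definition dev :: "nat \<Rightarrow> real" where
  "dev k = (\<integral>x. (deriv G (U x) - deriv G (\<phi> k x))\<^sup>2 * (norm (D x))\<^sup>2 \<partial>lborel)"

lemma dev_bound: "(deriv G (U x) - deriv G (\<phi> k x))\<^sup>2 * (norm (D x))\<^sup>2 \<le> L\<^sup>2 * (norm (D x))\<^sup>2"
proof -
  have "\<bar>deriv G (U x) - deriv G (\<phi> k x)\<bar> \<le> L"
    using G'_nonneg[of "U x"] G'_le[of "U x"] G'_nonneg[of "\<phi> k x"] G'_le[of "\<phi> k x"] by linarith
  then have "\<bar>deriv G (U x) - deriv G (\<phi> k x)\<bar>\<^sup>2 \<le> L\<^sup>2" by (intro power_mono) auto
  then show ?thesis by (intro mult_right_mono) auto
qed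

lemma dev_integrable: "integrable lborel (\<lambda>x. (deriv G (U x) - deriv G (\<phi> k x))\<^sup>2 * (norm (D x))\<^sup>2)"
proof (rule Bochner_Integration.integrable_bound[OF integrable_mult_right[of "L\<^sup>2", OF D_sq]])
  show "AE x in lborel. norm ((deriv G (U x) - deriv G (\<phi> k x))\<^sup>2 * (norm (D x))\<^sup>2) \<le> norm (L\<^sup>2 * (norm (D x))\<^sup>2)"
    using dev_bound by (intro AE_I2) simp
qed measurable

lemma dev_tendsto: "dev \<longlonglongrightarrow> 0"
proof -
  have "(\<lambda>k. \<integral>x. (deriv G (U x) - deriv G (\<phi> k x))\<^sup>2 * (norm (D x))\<^sup>2 \<partial>lborel) \<longlonglongrightarrow> (\<integral>x. 0 \<partial>(lborel :: (real^'a) measure))"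
  proof (rule integral_dominated_convergence[where w="\<lambda>x. L\<^sup>2 * (norm (D x))\<^sup>2"])
    show "AE x in lborel. (\<lambda>k. (deriv G (U x) - deriv G (\<phi> k x))\<^sup>2 * (norm (D x))\<^sup>2) \<longlonglongrightarrow> 0"
      using conv_AE
    proof eventually_elim
      case (elim x)
      have "(\<lambda>k. (deriv G (U x) - deriv G (\<phi> k x))\<^sup>2 * (norm (D x))\<^sup>2)
          \<longlonglongrightarrow> (deriv G (U x) - deriv G (U x))\<^sup>2 * (norm (D x))\<^sup>2"
        by (intro tendsto_intros isCont_tendsto_compose[OF G_cont(2) elim])
      then show ?case by simp
    qed
    show "AE x in lborel. norm ((deriv G (U x) - deriv G (\<phi> k x))\<^sup>2 * (norm (D x))\<^sup>2) \<le> L\<^sup>2 * (norm (D x))\<^sup>2" for k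
      using dev_bound by (intro AE_I2) simp
    show "integrable lborel (\<lambda>x. L\<^sup>2 * (norm (D x))\<^sup>2)" by (intro integrable_mult_right D_sq)
  qed measurable
  then show ?thesis by (simp add: dev_def[abs_def])
qed

lemma d3_le: "d3 k \<le> 2 * L\<^sup>2 * err k + 2 * dev k"
proof -
  have "d3 k \<le> (\<integral>x. 2 * (L\<^sup>2 * (norm (classical_grad (\<phi> k) x - D x))\<^sup>2)
      + 2 * ((deriv G (U x) - deriv G (\<phi> k x))\<^sup>2 * (norm (D x))\<^sup>2) \<partial>lborel)"
    unfolding d3_def
  proof (rule integral_mono[OF d_integrable(3)])
    fix x
    let ?h = "deriv G (\<phi> k x)"
    \<comment> \<open>The error splits into a multiple of the H^1 error, with factor at most L, and
      the deviation measured by \<open>dev\<close>.\<close>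
    have "classical_grad (a k) x - A x = ?h *\<^sub>R (classical_grad (\<phi> k) x - D x) - (deriv G (U x) - ?h) *\<^sub>R D x"
      unfolding a_grad A_def by (simp add: scaleR_diff_right scaleR_diff_left)
    then have "(norm (classical_grad (a k) x - A x))\<^sup>2
        \<le> 2 * (norm (?h *\<^sub>R (classical_grad (\<phi> k) x - D x)))\<^sup>2 + 2 * (norm ((deriv G (U x) - ?h) *\<^sub>R D x))\<^sup>2"
      by (simp only:) (rule norm_diff_sq_le)
    also have "\<dots> = 2 * (?h\<^sup>2 * (norm (classical_grad (\<phi> k) x - D x))\<^sup>2) + 2 * ((deriv G (U x) - ?h)\<^sup>2 * (norm (D x))\<^sup>2)"
      by (simp add: power_mult_distrib)
    also have "\<dots> \<le> 2 * (L\<^sup>2 * (norm (classical_grad (\<phi> k) x - D x))\<^sup>2) + 2 * ((deriv G (U x) - ?h)\<^sup>2 * (norm (D x))\<^sup>2)"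
      using G'_nonneg[of "\<phi> k x"] G'_le[of "\<phi> k x"] by (simp add: mult_right_mono power_mono)
    finally show "(norm (classical_grad (a k) x - A x))\<^sup>2 \<le> 2 * (L\<^sup>2 * (norm (classical_grad (\<phi> k) x - D x))\<^sup>2)
      + 2 * ((deriv G (U x) - ?h)\<^sup>2 * (norm (D x))\<^sup>2)" .
  qed (intro Bochner_Integration.integrable_add integrable_mult_right err_integrable dev_integrable)
  also have "\<dots> = 2 * (L\<^sup>2 * (\<integral>x. (norm (classical_grad (\<phi> k) x - D x))\<^sup>2 \<partial>lborel)) + 2 * dev k"
    unfolding dev_def using err_integrable(2) dev_integrable by simp
  also have "\<dots> \<le> 2 * L\<^sup>2 * err k + 2 * dev k"
    unfolding err_def by (simp add: mult_left_mono)
  finally show ?thesis .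
qed

definition \<delta> :: "nat \<Rightarrow> real" where "\<delta> k = d2 k + d3 k"

lemma \<delta>_nonneg: "0 \<le> \<delta> k" "0 \<le> d2 k" "0 \<le> d3 k"
  unfolding \<delta>_def d2_def d3_def by simp_all

lemma d_tendsto: "d2 \<longlonglongrightarrow> 0" "d3 \<longlonglongrightarrow> 0" "\<delta> \<longlonglongrightarrow> 0"
proof -
  have "(\<lambda>k. L\<^sup>2 * err k) \<longlonglongrightarrow> L\<^sup>2 * 0" by (intro tendsto_intros err_tendsto)
  then show 2: "d2 \<longlonglongrightarrow> 0"
    by (intro tendsto_sandwich[of "\<lambda>_. 0" d2 sequentially "\<lambda>k. L\<^sup>2 * err k" 0]) (auto simp: \<delta>_nonneg d2_le)
  have "(\<lambda>k. 2 * L\<^sup>2 * err k + 2 * dev k) \<longlonglongrightarrow> 2 * L\<^sup>2 * 0 + 2 * 0" by (intro tendsto_intros err_tendsto dev_tendsto)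
  then show 3: "d3 \<longlonglongrightarrow> 0"
    by (intro tendsto_sandwich[of "\<lambda>_. 0" d3 sequentially "\<lambda>k. 2 * L\<^sup>2 * err k + 2 * dev k" 0]) (auto simp: \<delta>_nonneg d3_le)
  show "\<delta> \<longlonglongrightarrow> 0" unfolding \<delta>_def using tendsto_add[OF 2 3] by simp
qed

text \<open>\<open>p_abs_bound\<close> holds for the test functions \<open>a k - a j\<close>;
  letting j tend to infinity by Fatou replaces \<open>a j\<close> by G(U). Hence \<open>a k\<close>
  converges to G(U) in L^1 with weight p, although p itself need not be integrable.\<close>

lemma p_diff_bound: "(\<integral>\<^sup>+x. ennreal (p x * \<bar>a k x - G (U x)\<bar>) \<partial>lborel) \<le> ennreal (d1 k + K0 * sqrt (2 * \<delta> k))"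
proof (rule nn_integral_fatou_le[where f="\<lambda>j x. ennreal (p x * \<bar>a k x - a j x\<bar>)"
      and c="\<lambda>j. ennreal (d1 k + d1 j + K0 * sqrt (2 * \<delta> k + 2 * \<delta> j))"])
  show "(\<lambda>x. ennreal (p x * \<bar>a k x - a j x\<bar>)) \<in> borel_measurable lborel" for j by measurable
  show "AE x in lborel. (\<lambda>j. ennreal (p x * \<bar>a k x - a j x\<bar>)) \<longlonglongrightarrow> ennreal (p x * \<bar>a k x - G (U x)\<bar>)"
    using a_AE by eventually_elim (intro tendsto_ennrealI tendsto_intros; assumption)
  show "(\<integral>\<^sup>+x. ennreal (p x * \<bar>a k x - a j x\<bar>) \<partial>lborel) \<le> ennreal (d1 k + d1 j + K0 * sqrt (2 * \<delta> k + 2 * \<delta> j))" for j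
  proof -
    have td: "test_fun \<Omega> (\<lambda>x. a k x - a j x)" by (rule test_fun_diff[OF a_test a_test])
    have "(\<integral>x. g x * \<bar>a k x - a j x\<bar> \<partial>lborel) \<le> (\<integral>x. g x * \<bar>a k x - G (U x)\<bar> + g x * \<bar>a j x - G (U x)\<bar> \<partial>lborel)"
    proof (rule integral_mono)
      show "integrable lborel (\<lambda>x. g x * \<bar>a k x - a j x\<bar>)"
        using integrable_abs[OF g_test[OF td]] g_nonneg by (simp add: abs_mult)
      show "g x * \<bar>a k x - a j x\<bar> \<le> g x * \<bar>a k x - G (U x)\<bar> + g x * \<bar>a j x - G (U x)\<bar>" for x
        unfolding distrib_left[symmetric] using g_nonneg[of x] by (intro mult_left_mono) auto
    qed (intro Bochner_Integration.integrable_add d_integrable)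
    also have "\<dots> = d1 k + d1 j" unfolding d1_def using d_integrable(1) by simp
    finally have 1: "(\<integral>x. g x * \<bar>a k x - a j x\<bar> \<partial>lborel) \<le> d1 k + d1 j" .
    have "h1_norm_sq (\<lambda>x. a k x - a j x) \<le> 2 * \<delta> k + 2 * \<delta> j"
      using h1_diff_le[OF a_test a_test _ A_borel GU_sq A_sq, of k j] by (simp add: \<delta>_def d2_def d3_def)
    then have "K0 * sqrt (h1_norm_sq (\<lambda>x. a k x - a j x)) \<le> K0 * sqrt (2 * \<delta> k + 2 * \<delta> j)"
      using K0_nonneg by (intro mult_left_mono) auto
    then show ?thesis using 1 by (intro order_trans[OF p_abs_bound[OF td]] ennreal_leI) linarith
  qed
  have "(\<lambda>j. d1 k + d1 j + K0 * sqrt (2 * \<delta> k + 2 * \<delta> j)) \<longlonglongrightarrow> d1 k + 0 + K0 * sqrt (2 * \<delta> k + 2 * 0)"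
    by (intro tendsto_intros d1_tendsto d_tendsto)
  then show "(\<lambda>j. ennreal (d1 k + d1 j + K0 * sqrt (2 * \<delta> k + 2 * \<delta> j))) \<longlonglongrightarrow> ennreal (d1 k + K0 * sqrt (2 * \<delta> k))"
    by (intro tendsto_ennrealI) simp
qed

text \<open>Cauchy-Schwarz bound for the cost of writing \<phi> k in place of U in the nonlocal term
  tested with \<open>a k\<close>; not the exponent of the singular term.\<close>

definition \<gamma> :: "nat \<Rightarrow> real" where
  "\<gamma> k = sqrt (2 * Cg * err k) * sqrt (L\<^sup>2 * (Cg * (2 * err k + 2 * N0)))"

lemma \<gamma>_tendsto: "\<gamma> \<longlonglongrightarrow> 0"
proof -
  have "\<gamma> \<longlonglongrightarrow> sqrt (2 * Cg * 0) * sqrt (L\<^sup>2 * (Cg * (2 * 0 + 2 * N0)))"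
    unfolding \<gamma>_def by (intro tendsto_intros err_tendsto)
  then show ?thesis by simp
qed

text \<open>The nonlocal term is nonnegative in the limit: it is nonnegative with \<open>\<phi> k\<close> in place of \<open>U\<close>, since \<open>G\<close> is monotone.\<close>

lemma nonlocal_term_ge: "- \<gamma> k \<le> (\<integral>z. incr U z * incr (a k) z \<partial>kernel_measure s)"
proof -
  let ?w = "\<lambda>x. U x - \<phi> k x"
  note m = incr_borel[of _ s]
  have wm: "?w \<in> borel_measurable borel" by measurable
  have i1: "integrable (kernel_measure s) (\<lambda>z. incr (\<phi> k) z * incr (a k) z)"
    by (rule L2_product(1)[OF m m incr_test_sq(1)[OF test] incr_test_sq(1)[OF a_test]]) measurable
  have i2: "integrable (kernel_measure s) (\<lambda>z. incr ?w z * incr (a k) z)"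
    by (rule L2_product(1)[OF m[OF wm] m incr_err_sq(1) incr_test_sq(1)[OF a_test]]) measurable
  have nn: "0 \<le> incr (\<phi> k) z * incr (a k) z" for z
    using G_mono[of "\<phi> k (fst z)" "\<phi> k (snd z)"] G_mono[of "\<phi> k (snd z)" "\<phi> k (fst z)"]
    by (cases "\<phi> k (fst z) \<le> \<phi> k (snd z)") (auto simp: a_def zero_le_mult_iff)
  have "(\<integral>z. (incr (a k) z)\<^sup>2 \<partial>kernel_measure s) \<le> L\<^sup>2 * (Cg * (2 * err k + 2 * N0))"
  proof (rule gagliardo_finite(2))
    have "gagliardo s (a k) \<le> ennreal (L\<^sup>2) * gagliardo s (\<phi> k)"
      unfolding a_def by (rule gagliardo_lipschitz[OF _ G_lip]) measurable
    also have "\<dots> \<le> ennreal (L\<^sup>2) * ennreal (Cg * (2 * err k + 2 * N0))"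
      by (intro mult_left_mono order_trans[OF Cg(2)[OF test]] ennreal_leI mult_left_mono h1_approx_le Cg(1)) simp
    also have "\<dots> = ennreal (L\<^sup>2 * (Cg * (2 * err k + 2 * N0)))" by (simp add: ennreal_mult')
    finally show "gagliardo s (a k) \<le> ennreal (L\<^sup>2 * (Cg * (2 * err k + 2 * N0)))" .
    show "0 \<le> L\<^sup>2 * (Cg * (2 * err k + 2 * N0))"
      using Cg(1) err_nonneg[of k] by (simp add: N0_def)
  qed measurable
  then have b: "sqrt (\<integral>z. (incr (a k) z)\<^sup>2 \<partial>kernel_measure s) \<le> sqrt (L\<^sup>2 * (Cg * (2 * err k + 2 * N0)))"
    by (rule real_sqrt_le_mono)
  have "\<bar>\<integral>z. incr ?w z * incr (a k) z \<partial>kernel_measure s\<bar>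
      \<le> sqrt (\<integral>z. (incr ?w z)\<^sup>2 \<partial>kernel_measure s) * sqrt (\<integral>z. (incr (a k) z)\<^sup>2 \<partial>kernel_measure s)"
    by (rule L2_product(2)[OF m[OF wm] m incr_err_sq(1) incr_test_sq(1)[OF a_test]]) measurable
  also have "\<dots> \<le> \<gamma> k" unfolding \<gamma>_def
    by (rule mult_mono[OF real_sqrt_le_mono[OF incr_err_sq(2)] b]) (use Cg(1) err_nonneg[of k] in auto)
  finally have "- \<gamma> k \<le> (\<integral>z. incr ?w z * incr (a k) z \<partial>kernel_measure s)" by linarith
  also have "\<dots> \<le> (\<integral>z. incr (\<phi> k) z * incr (a k) z \<partial>kernel_measure s) + (\<integral>z. incr ?w z * incr (a k) z \<partial>kernel_measure s)"
    using Bochner_Integration.integral_nonneg[of "kernel_measure s" "\<lambda>z. incr (\<phi> k) z * incr (a k) z"] nn by simp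
  also have "\<dots> = (\<integral>z. incr (\<phi> k) z * incr (a k) z + incr ?w z * incr (a k) z \<partial>kernel_measure s)"
    by (rule Bochner_Integration.integral_add[OF i1 i2, symmetric])
  also have "\<dots> = (\<integral>z. incr U z * incr (a k) z \<partial>kernel_measure s)"
    by (intro Bochner_Integration.integral_cong) (auto simp: algebra_simps)
  finally show ?thesis .
qed

text \<open>The equation tested with \<open>a k\<close>: the absorption term is nonnegative, the
  nonlocal one is at least \<open>- \<gamma> k\<close>, and the singular one exceeds its value at
  G(U) by a vanishing amount at most. An infinite right-hand side leaves nothing to prove.\<close>

lemma energy_inequality:
  "ennreal (\<integral>x. deriv G (U x) * (norm (D x))\<^sup>2 \<partial>lborel) \<le> (\<integral>\<^sup>+x. ennreal (p x * G (U x)) \<partial>lborel)"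
proof (cases "(\<integral>\<^sup>+x. ennreal (p x * G (U x)) \<partial>lborel) = \<infinity>")
  case False
  then obtain P where P: "0 \<le> P" "(\<integral>\<^sup>+x. ennreal (p x * G (U x)) \<partial>lborel) = ennreal P"
    by (cases "\<integral>\<^sup>+x. ennreal (p x * G (U x)) \<partial>lborel") auto
  have le: "(\<integral>x. D x \<bullet> classical_grad (a k) x \<partial>lborel) - \<gamma> k \<le> P + (d1 k + K0 * sqrt (2 * \<delta> k))" for k
  proof -
    have b0: "0 \<le> d1 k + K0 * sqrt (2 * \<delta> k)"
      using K0_nonneg \<delta>_nonneg(1)[of k] g_nonneg by (auto simp: d1_def intro!: add_nonneg_nonneg mult_nonneg_nonneg)
    have "ennreal (\<integral>x. p x * a k x \<partial>lborel) = (\<integral>\<^sup>+x. ennreal (p x * a k x) \<partial>lborel)"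
      using p_nonneg G_nonneg by (intro nn_integral_eq_integral[symmetric] p_int a_test) (auto simp: a_def)
    also have "\<dots> \<le> (\<integral>\<^sup>+x. ennreal (p x * G (U x)) + ennreal (p x * \<bar>a k x - G (U x)\<bar>) \<partial>lborel)"
    proof (rule nn_integral_mono)
      fix x
      have "p x * a k x \<le> p x * (G (U x) + \<bar>a k x - G (U x)\<bar>)" using p_nonneg[of x] by (intro mult_left_mono) auto
      then show "ennreal (p x * a k x) \<le> ennreal (p x * G (U x)) + ennreal (p x * \<bar>a k x - G (U x)\<bar>)"
        using p_nonneg[of x] G_nonneg[of "U x"]
        by (simp add: ennreal_plus[symmetric] distrib_left ennreal_leI del: ennreal_plus)
    qed
    also have "\<dots> = ennreal P + (\<integral>\<^sup>+x. ennreal (p x * \<bar>a k x - G (U x)\<bar>) \<partial>lborel)"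
      unfolding P(2)[symmetric] by (rule nn_integral_add) measurable
    also have "\<dots> \<le> ennreal P + ennreal (d1 k + K0 * sqrt (2 * \<delta> k))" by (intro add_left_mono p_diff_bound)
    also have "\<dots> = ennreal (P + (d1 k + K0 * sqrt (2 * \<delta> k)))" using P(1) b0 by (rule ennreal_plus[symmetric])
    finally have "(\<integral>x. p x * a k x \<partial>lborel) \<le> P + (d1 k + K0 * sqrt (2 * \<delta> k))" using P(1) b0 by (subst (asm) ennreal_le_iff) auto
    moreover have "0 \<le> (\<integral>x. g x * a k x \<partial>lborel)" using g_nonneg G_nonneg by (intro Bochner_Integration.integral_nonneg) (auto simp: a_def)
    ultimately show ?thesis using eq[OF a_test, of k] nonlocal_term_ge[of k] by linarith
  qed
  have "(\<lambda>k. \<integral>x. D x \<bullet> classical_grad (a k) x \<partial>lborel) \<longlonglongrightarrow> (\<integral>x. D x \<bullet> A x \<partial>lborel)"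
  proof (rule LIM_zero_cancel, rule tendsto_rabs_zero_cancel, rule tendsto_sandwich[of "\<lambda>_. 0" _ _ "\<lambda>k. sqrt (\<integral>x. (norm (D x))\<^sup>2 \<partial>lborel) * sqrt (d3 k)"])
    show "\<forall>\<^sub>F k in sequentially. \<bar>(\<integral>x. D x \<bullet> classical_grad (a k) x \<partial>lborel) - (\<integral>x. D x \<bullet> A x \<partial>lborel)\<bar>
       \<le> sqrt (\<integral>x. (norm (D x))\<^sup>2 \<partial>lborel) * sqrt (d3 k)"
    proof (rule always_eventually, rule allI)
      fix k
      have "(\<integral>x. D x \<bullet> classical_grad (a k) x \<partial>lborel) - (\<integral>x. D x \<bullet> A x \<partial>lborel) = (\<integral>x. D x \<bullet> (classical_grad (a k) x - A x) \<partial>lborel)"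
        unfolding inner_diff_right
        by (rule Bochner_Integration.integral_diff[symmetric]) (intro D_inner(1) test_sq a_test A_sq; measurable)+
      also have "\<bar>\<dots>\<bar> \<le> sqrt (\<integral>x. (norm (D x))\<^sup>2 \<partial>lborel) * sqrt (d3 k)"
        unfolding d3_def by (rule D_inner(2)[OF _ d_integrable(3)]) measurable
      finally show "\<bar>(\<integral>x. D x \<bullet> classical_grad (a k) x \<partial>lborel) - (\<integral>x. D x \<bullet> A x \<partial>lborel)\<bar>
       \<le> sqrt (\<integral>x. (norm (D x))\<^sup>2 \<partial>lborel) * sqrt (d3 k)" .
    qed
    have "(\<lambda>k. sqrt (\<integral>x. (norm (D x))\<^sup>2 \<partial>lborel) * sqrt (d3 k)) \<longlonglongrightarrow> sqrt (\<integral>x. (norm (D x))\<^sup>2 \<partial>lborel) * sqrt 0"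
      by (intro tendsto_intros d_tendsto)
    then show "(\<lambda>k. sqrt (\<integral>x. (norm (D x))\<^sup>2 \<partial>lborel) * sqrt (d3 k)) \<longlonglongrightarrow> 0" by simp
  qed auto
  then have "(\<lambda>k. (\<integral>x. D x \<bullet> classical_grad (a k) x \<partial>lborel) - \<gamma> k) \<longlonglongrightarrow> (\<integral>x. D x \<bullet> A x \<partial>lborel) - 0"
    by (intro tendsto_diff \<gamma>_tendsto)
  moreover have "(\<lambda>k. P + (d1 k + K0 * sqrt (2 * \<delta> k))) \<longlonglongrightarrow> P + (0 + K0 * sqrt (2 * 0))"
    by (intro tendsto_intros d1_tendsto d_tendsto)
  ultimately have "(\<integral>x. D x \<bullet> A x \<partial>lborel) - 0 \<le> P + (0 + K0 * sqrt (2 * 0))"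
    using le by (intro LIMSEQ_le) blast+
  moreover have "(\<integral>x. D x \<bullet> A x \<partial>lborel) = (\<integral>x. deriv G (U x) * (norm (D x))\<^sup>2 \<partial>lborel)"
    by (simp add: A_def power2_norm_eq_inner)
  ultimately show ?thesis unfolding P(2) by (simp add: ennreal_leI)
qed simp

text \<open>The isoperimetric inequality for \<open>a k\<close> is used at a level l < 1, since G(U)
  = 1 where U > r while \<open>a k\<close> is only close to 1 on most of that set; then k tends to
  infinity and l to 1.\<close>

lemma isoperimetric_limit:
  assumes one: "\<And>x. r < x \<Longrightarrow> G x = 1"
  shows "iso_const TYPE('a) * measure lborel {x. r < U x} powr (1 - 1 / real CARD('a)) \<le> (\<integral>x. norm (A x) \<partial>lborel)"
proof (cases "measure lborel {x. r < U x} = 0")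
  \<comment> \<open>A real power with base 0 is 0. The case is separated because in dimension 1,
    where the exponent is 0, the power jumps at base 0 and would not pass to the limit.\<close>
  case True
  then show ?thesis by simp
next
  case False
  define m where "m = measure lborel {x. r < U x}"
  have m: "0 < m" using False by (simp add: m_def zero_less_measure_iff)
  define \<alpha> where "\<alpha> = 1 - 1 / real CARD('a)"
  have \<alpha>: "0 \<le> \<alpha>" by (simp add: \<alpha>_def)
  define c where "c = iso_const TYPE('a)"
  have c: "0 < c" unfolding c_def by (rule iso_const_pos)
  have iA: "integrable lborel (\<lambda>x. norm (A x))" and Alim: "(\<lambda>k. \<integral>x. norm (classical_grad (a k) x) \<partial>lborel) \<longlonglongrightarrow> (\<integral>x. norm (A x) \<partial>lborel)"
  proof -
    have \<Omega>s: "\<Omega> \<in> sets borel" using \<Omega> by auto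
    have ind: "integrable lborel (\<lambda>x. (indicator \<Omega> x)\<^sup>2 :: real)" "(\<integral>x. (indicator \<Omega> x)\<^sup>2 \<partial>lborel) = measure lborel \<Omega>"
    proof -
      have "(indicator \<Omega> x :: real)\<^sup>2 = indicator \<Omega> x" for x by (auto split: split_indicator)
      then show "integrable lborel (\<lambda>x. (indicator \<Omega> x)\<^sup>2 :: real)" "(\<integral>x. (indicator \<Omega> x)\<^sup>2 \<partial>lborel) = measure lborel \<Omega>"
        using \<Omega> \<Omega>s by (auto simp: fmeasurable_def)
    qed
    \<comment> \<open>\<Omega> has finite measure, so L^2 convergence of the gradients implies L^1
      convergence.\<close>
    have L1: "integrable lborel (\<lambda>x. norm (V x))" "(\<integral>x. norm (V x) \<partial>lborel) \<le> sqrt (\<integral>x. (norm (V x))\<^sup>2 \<partial>lborel) * sqrt (measure lborel \<Omega>)"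
      if [measurable]: "V \<in> borel_measurable borel" and V: "integrable lborel (\<lambda>x. (norm (V x))\<^sup>2)" and out: "\<And>x. x \<notin> \<Omega> \<Longrightarrow> V x = 0"
      for V :: "real^'a \<Rightarrow> real^'a"
    proof -
      have e: "norm (V x) * indicator \<Omega> x = norm (V x)" for x using out[of x] by (auto split: split_indicator)
      have [measurable]: "indicator \<Omega> \<in> borel_measurable (lborel :: (real^'a) measure)" using \<Omega>s by simp
      note L2 = L2_product[of "\<lambda>x. norm (V x)" lborel "\<lambda>x. indicator \<Omega> x :: real", OF _ _ V ind(1)]
      show "integrable lborel (\<lambda>x. norm (V x))" using L2(1) unfolding e by simp
      have "\<bar>\<integral>x. norm (V x) \<partial>lborel\<bar> \<le> sqrt (\<integral>x. (norm (V x))\<^sup>2 \<partial>lborel) * sqrt (measure lborel \<Omega>)"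
        using L2(2) unfolding e ind(2) by simp
      then show "(\<integral>x. norm (V x) \<partial>lborel) \<le> sqrt (\<integral>x. (norm (V x))\<^sup>2 \<partial>lborel) * sqrt (measure lborel \<Omega>)" by linarith
    qed
    have Aout: "A x = 0" if "x \<notin> \<Omega>" for x using D_outside[OF that] by (simp add: A_def)
    have aout: "classical_grad (a k) x = 0" if "x \<notin> \<Omega>" for x k by (rule grad_outside_domain[OF a_test that])
    show iA: "integrable lborel (\<lambda>x. norm (A x))" by (rule L1(1)[OF A_borel A_sq Aout])
    have ia: "integrable lborel (\<lambda>x. norm (classical_grad (a k) x))" for k by (rule L1(1)[OF a_borel(2) test_sq(2)[OF a_test] aout])
    have id: "integrable lborel (\<lambda>x. norm (classical_grad (a k) x - A x))"
      "(\<integral>x. norm (classical_grad (a k) x - A x) \<partial>lborel) \<le> sqrt (d3 k) * sqrt (measure lborel \<Omega>)" for k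
      unfolding d3_def by (rule L1[OF _ d_integrable(3)], measurable, simp add: Aout aout)+
    show "(\<lambda>k. \<integral>x. norm (classical_grad (a k) x) \<partial>lborel) \<longlonglongrightarrow> (\<integral>x. norm (A x) \<partial>lborel)"
    proof (rule LIM_zero_cancel, rule tendsto_rabs_zero_cancel, rule tendsto_sandwich[of "\<lambda>_. 0" _ _ "\<lambda>k. sqrt (d3 k) * sqrt (measure lborel \<Omega>)"])
      show "\<forall>\<^sub>F k in sequentially. \<bar>(\<integral>x. norm (classical_grad (a k) x) \<partial>lborel) - (\<integral>x. norm (A x) \<partial>lborel)\<bar> \<le> sqrt (d3 k) * sqrt (measure lborel \<Omega>)"
      proof (rule always_eventually, rule allI)
        fix k
        have "\<bar>(\<integral>x. norm (classical_grad (a k) x) \<partial>lborel) - (\<integral>x. norm (A x) \<partial>lborel)\<bar>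
          = \<bar>\<integral>x. norm (classical_grad (a k) x) - norm (A x) \<partial>lborel\<bar>" by (subst Bochner_Integration.integral_diff[OF ia iA]) simp
        also have "\<dots> \<le> (\<integral>x. \<bar>norm (classical_grad (a k) x) - norm (A x)\<bar> \<partial>lborel)" by (rule integral_abs_bound)
        also have "\<dots> \<le> (\<integral>x. norm (classical_grad (a k) x - A x) \<partial>lborel)"
          by (rule integral_mono[OF integrable_abs[OF Bochner_Integration.integrable_diff[OF ia iA]] id(1)]) (rule norm_triangle_ineq3)
        also note id(2)
        finally show "\<bar>(\<integral>x. norm (classical_grad (a k) x) \<partial>lborel) - (\<integral>x. norm (A x) \<partial>lborel)\<bar> \<le> sqrt (d3 k) * sqrt (measure lborel \<Omega>)" .
      qed
      have "(\<lambda>k. sqrt (d3 k) * sqrt (measure lborel \<Omega>)) \<longlonglongrightarrow> sqrt 0 * sqrt (measure lborel \<Omega>)" by (intro tendsto_intros d_tendsto)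
      then show "(\<lambda>k. sqrt (d3 k) * sqrt (measure lborel \<Omega>)) \<longlonglongrightarrow> 0" by simp
    qed auto
  qed
  have "l * (c * m powr \<alpha>) \<le> (\<integral>x. norm (A x) \<partial>lborel)" if l: "0 < l" "l < 1" for l
  proof -
    \<comment> \<open>Chebyshev: where r < U and \<open>a k\<close> is at most l, the difference
      from G(U) is at least 1 - l, so this set has measure at most \<open>b k\<close>.\<close>
    define b where "b k = d2 k / (1 - l)\<^sup>2" for k
    have blim: "b \<longlonglongrightarrow> 0" unfolding b_def using tendsto_divide[OF d_tendsto(1) tendsto_const, of "(1 - l)\<^sup>2"] l by simp
    have fm: "{x. 0 < \<psi> x} \<inter> \<Omega> \<in> fmeasurable lborel" if [measurable]: "\<psi> \<in> borel_measurable borel" for \<psi> :: "real^'a \<Rightarrow> real"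
      using \<Omega> by (subst Int_commute) (intro fmeasurable_Int_fmeasurable; measurable)
    have lev: "{x. l < a k x} \<in> fmeasurable lborel" for k
    proof -
      have "{x. l < a k x} = {x. 0 < a k x - l} \<inter> \<Omega>"
        using test_funD(3)[OF a_test, of _ k] l by (auto, metis less_asym)
      then show ?thesis using fm[of "\<lambda>x. a k x - l"] by simp
    qed
    have ilev: "integrable lborel (\<lambda>x. indicator {x. l < a k x} x :: real)" "(\<integral>x. indicator {x. l < a k x} x \<partial>lborel) = measure lborel {x. l < a k x}" for k
      using lev[of k] by (auto simp: fmeasurable_def)
    have mk: "m \<le> measure lborel {x. l < a k x} + b k" for k
    proof -
      have "m = (\<integral>x. indicator {x. r < U x} x \<partial>lborel)" by (simp add: m_def)
      also have "\<dots> \<le> (\<integral>x. indicator {x. l < a k x} x + (norm (a k x - G (U x)))\<^sup>2 / (1 - l)\<^sup>2 \<partial>lborel)"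
      proof (rule integral_mono')
        show "integrable lborel (\<lambda>x. indicator {x. l < a k x} x + (norm (a k x - G (U x)))\<^sup>2 / (1 - l)\<^sup>2)"
          using ilev(1) d_integrable(2) by simp
        show "indicator {x. r < U x} x \<le> indicator {x. l < a k x} x + (norm (a k x - G (U x)))\<^sup>2 / (1 - l)\<^sup>2" for x
        proof (cases "r < U x \<and> a k x \<le> l")
          case True
          then have "(1 - l)\<^sup>2 \<le> \<bar>a k x - G (U x)\<bar>\<^sup>2" using one[of "U x"] l by (intro power_mono) auto
          then have "1 \<le> (norm (a k x - G (U x)))\<^sup>2 / (1 - l)\<^sup>2" using l by (simp add: divide_simps)
          then show ?thesis using True by (simp add: indicator_def)
        qed (auto simp: indicator_def)
      qed auto
      also have "\<dots> = measure lborel {x. l < a k x} + b k"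
        unfolding b_def d2_def using ilev d_integrable(2) by simp
      finally show ?thesis .
    qed
    have "(\<lambda>k. l * (c * (max 0 (m - b k)) powr \<alpha>)) \<longlonglongrightarrow> l * (c * (max 0 (m - 0)) powr \<alpha>)"
      using m by (intro tendsto_intros blim) auto
    moreover have "l * (c * (max 0 (m - b k)) powr \<alpha>) \<le> (\<integral>x. norm (classical_grad (a k) x) \<partial>lborel)" for k
    proof -
      have "(max 0 (m - b k)) powr \<alpha> \<le> measure lborel {x. l < a k x} powr \<alpha>"
        using mk[of k] \<alpha> by (intro powr_mono2) auto
      then have "l * (c * (max 0 (m - b k)) powr \<alpha>) \<le> l * (c * measure lborel {x. l < a k x} powr \<alpha>)"
        using l c by (intro mult_left_mono) auto
      also have "\<dots> \<le> (\<integral>x. norm (classical_grad (a k) x) \<partial>lborel)"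
        using isoperimetric_test_fun[OF a_test[of k] _ l(1)] G_nonneg by (simp add: a_def c_def \<alpha>_def mult.assoc)
      finally show ?thesis .
    qed
    ultimately have "l * (c * (max 0 (m - 0)) powr \<alpha>) \<le> (\<integral>x. norm (A x) \<partial>lborel)"
      using Alim by (intro LIMSEQ_le) blast+
    then show ?thesis using m by simp
  qed
  then have "c * m powr \<alpha> \<le> (\<integral>x. norm (A x) \<partial>lborel)" by (rule field_le_mult_one_interval)
  then show ?thesis unfolding c_def m_def \<alpha>_def .
qed

end

section \<open>The comparison argument\<close>

context energy_solution
begin

lemma superlevel_fmeasurable:
  assumes "0 < t"
  shows "{x. t < U x} \<in> fmeasurable lborel"
proof -
  have "{x. t < U x} \<in> sets borel" by measurable
  moreover have "{x. t < U x} = \<Omega> \<inter> {x. t < U x}" using U_outside assms by (auto, metis less_asym)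
  ultimately show ?thesis using \<Omega> by (metis fmeasurable_Int_fmeasurable sets_lborel)
qed

text \<open>Here B bounds the data on {U > t}. The isoperimetric bound is squared, and
  Cauchy-Schwarz separates the integral of G'(U) |D|^2, at most B, from that of G'(U), at most the
  slope bound times the measure of the strip t < U <= t + h.\<close>

lemma level_inequality:
  assumes t: "0 < t" and h: "0 < h" and B: "0 \<le> B" "(\<integral>\<^sup>+x. ennreal (p x) * indicator {x. t < U x} x \<partial>lborel) \<le> ennreal B"
  shows "h * vol_coeff TYPE('n) (measure lborel {x. t + h < U x})
    \<le> B * (measure lborel {x. t < U x} - measure lborel {x. t + h < U x})"
proof (rule field_le_mult_one_interval)
  \<comment> \<open>The slope of the smooth step is at most K/h with K = 1/z; the factor z lost in
    this way is removed by letting z tend to 1.\<close>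
  fix z :: real assume z: "0 < z" "z < 1"
  define K where "K = 1 / z"
  have K: "1 < K" using z by (simp add: K_def)
  define m where "m r = measure lborel {x. r < U x}" for r
  define c where "c = iso_const TYPE('n)"
  define \<alpha> where "\<alpha> = 1 - 1 / real CARD('n)"
  obtain G where G: "smooth1 G" "\<And>x. 0 \<le> G x" "\<And>x. G x \<le> 1" "\<And>x. x \<le> t \<Longrightarrow> G x = 0"
    "\<And>x. t + h \<le> x \<Longrightarrow> G x = 1" "\<And>x. 0 \<le> deriv G x" "\<And>x. deriv G x \<le> K / h"
    "\<And>x. x \<le> t \<or> t + h \<le> x \<Longrightarrow> deriv G x = 0"
    by (rule smooth_step_slope_exists[OF h K]) blast
  interpret T: energy_truncation \<Omega> s U D g p \<phi> G t "K / h"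
    by unfold_locales (use G t in auto)
  have Gz: "deriv G (U x) = 0" if "\<not> (t < U x \<and> U x \<le> t + h)" for x
    using that G(8)[of "U x"] by (cases "U x \<le> t") auto
  have fm: "{x. t < U x} \<in> fmeasurable lborel" "{x. t + h < U x} \<in> fmeasurable lborel"
    using superlevel_fmeasurable t h by auto
  have md: "measure lborel ({x. t < U x} - {x. t + h < U x}) = m t - m (t + h)"
    unfolding m_def using fm h by (intro measure_Diff) (auto simp: fmeasurable_def)
  have fd: "integrable lborel (\<lambda>x. indicator ({x. t < U x} - {x. t + h < U x}) x :: real)"
    using fmeasurable_Diff[OF fm(1) fmeasurableD[OF fm(2)]] by (auto simp: fmeasurable_def)
  have ub: "deriv G (U x) \<le> K / h * indicator ({x. t < U x} - {x. t + h < U x}) x" for x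
    using G(7)[of "U x"] Gz[of x] by (cases "t < U x \<and> U x \<le> t + h") (auto simp: indicator_def)
  have i1: "integrable lborel (\<lambda>x. deriv G (U x))"
  proof (rule Bochner_Integration.integrable_bound[OF integrable_mult_right[OF fd, of "K / h"]])
    show "AE x in lborel. norm (deriv G (U x)) \<le> norm (K / h * indicator ({x. t < U x} - {x. t + h < U x}) x)"
    proof (rule AE_I2)
      fix x
      have "norm (deriv G (U x)) = deriv G (U x)" using G(6)[of "U x"] by simp
      also have "\<dots> \<le> norm (K / h * indicator ({x. t < U x} - {x. t + h < U x}) x)"
        unfolding real_norm_def by (rule order_trans[OF ub abs_ge_self])
      finally show "norm (deriv G (U x)) \<le> norm (K / h * indicator ({x. t < U x} - {x. t + h < U x}) x)" .
    qed
  qed measurable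
  have I1: "(\<integral>x. deriv G (U x) \<partial>lborel) \<le> K / h * (m t - m (t + h))"
  proof -
    have "(\<integral>x. deriv G (U x) \<partial>lborel) \<le> (\<integral>x. K / h * indicator ({x. t < U x} - {x. t + h < U x}) x \<partial>lborel)"
      by (rule integral_mono[OF i1 integrable_mult_right[OF fd] ub])
    also have "\<dots> = K / h * (m t - m (t + h))" using md by simp
    finally show ?thesis .
  qed
  have i2: "integrable lborel (\<lambda>x. deriv G (U x) * (norm (D x))\<^sup>2)"
  proof (rule Bochner_Integration.integrable_bound[OF integrable_mult_right[OF D_sq, of "K / h"]])
    show "AE x in lborel. norm (deriv G (U x) * (norm (D x))\<^sup>2) \<le> norm (K / h * (norm (D x))\<^sup>2)"
    proof (rule AE_I2)
      fix x
      have "norm (deriv G (U x) * (norm (D x))\<^sup>2) = deriv G (U x) * (norm (D x))\<^sup>2" using G(6)[of "U x"] by simp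
      also have "\<dots> \<le> K / h * (norm (D x))\<^sup>2" using G(7) by (rule mult_right_mono) simp
      also have "\<dots> \<le> norm (K / h * (norm (D x))\<^sup>2)" unfolding real_norm_def by (rule abs_ge_self)
      finally show "norm (deriv G (U x) * (norm (D x))\<^sup>2) \<le> norm (K / h * (norm (D x))\<^sup>2)" .
    qed
  qed measurable
  have I2: "(\<integral>x. deriv G (U x) * (norm (D x))\<^sup>2 \<partial>lborel) \<le> B"
  proof -
    have "ennreal (\<integral>x. deriv G (U x) * (norm (D x))\<^sup>2 \<partial>lborel) \<le> (\<integral>\<^sup>+x. ennreal (p x * G (U x)) \<partial>lborel)"
      by (rule T.energy_inequality)
    also have "\<dots> \<le> (\<integral>\<^sup>+x. ennreal (p x) * indicator {x. t < U x} x \<partial>lborel)"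
    proof (rule nn_integral_mono)
      show "ennreal (p x * G (U x)) \<le> ennreal (p x) * indicator {x. t < U x} x" for x
      proof (cases "t < U x")
        case True
        have "p x * G (U x) \<le> p x" using G(2,3)[of "U x"] p_nonneg[of x] by (simp add: mult_left_le)
        then show ?thesis using True by (simp add: ennreal_leI)
      qed (use G(4)[of "U x"] in simp)
    qed
    also note B(2)
    finally show ?thesis using B(1) by simp
  qed
  have "c * m (t + h) powr \<alpha> \<le> (\<integral>x. norm (T.A x) \<partial>lborel)"
    unfolding c_def m_def \<alpha>_def by (rule T.isoperimetric_limit) (use G(5) in auto)
  \<comment> \<open>G' is split into two square roots, only one of which stays with the
    gradient.\<close>
  also have "\<dots> = (\<integral>x. (sqrt (deriv G (U x)) * norm (D x)) * sqrt (deriv G (U x)) \<partial>lborel)"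
    unfolding T.A_def using G(6) by (intro Bochner_Integration.integral_cong) (auto simp: mult_ac)
  also have "\<dots> \<le> sqrt (\<integral>x. (sqrt (deriv G (U x)) * norm (D x))\<^sup>2 \<partial>lborel) * sqrt (\<integral>x. (sqrt (deriv G (U x)))\<^sup>2 \<partial>lborel)"
    by (rule order_trans[OF abs_ge_self L2_product(2)]) (use G(6) i1 i2 in \<open>auto simp: power_mult_distrib\<close>)
  also have "\<dots> = sqrt ((\<integral>x. deriv G (U x) * (norm (D x))\<^sup>2 \<partial>lborel) * (\<integral>x. deriv G (U x) \<partial>lborel))"
    using G(6) by (simp add: power_mult_distrib real_sqrt_mult)
  finally have "c * m (t + h) powr \<alpha> \<le> sqrt ((\<integral>x. deriv G (U x) * (norm (D x))\<^sup>2 \<partial>lborel) * (\<integral>x. deriv G (U x) \<partial>lborel))" .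
  then have "(c * m (t + h) powr \<alpha>)\<^sup>2
      \<le> (sqrt ((\<integral>x. deriv G (U x) * (norm (D x))\<^sup>2 \<partial>lborel) * (\<integral>x. deriv G (U x) \<partial>lborel)))\<^sup>2"
    using iso_const_pos[where 'n='n] by (intro power_mono) (auto simp: c_def)
  also have "\<dots> = (\<integral>x. deriv G (U x) * (norm (D x))\<^sup>2 \<partial>lborel) * (\<integral>x. deriv G (U x) \<partial>lborel)"
    using G(6) by (intro real_sqrt_pow2 mult_nonneg_nonneg Bochner_Integration.integral_nonneg) auto
  also have "\<dots> \<le> B * (K / h * (m t - m (t + h)))"
    using I1 I2 B(1) G(6) by (intro mult_mono) (auto intro!: Bochner_Integration.integral_nonneg)
  finally have "(c * m (t + h) powr \<alpha>)\<^sup>2 \<le> B * (K / h * (m t - m (t + h)))" .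
  moreover have "(c * m (t + h) powr \<alpha>)\<^sup>2 = vol_coeff TYPE('n) (m (t + h))"
  proof -
    have "(m (t + h) powr \<alpha>)\<^sup>2 = m (t + h) powr (2 - 2 / real CARD('n))"
      by (simp add: power2_eq_square powr_add[symmetric] \<alpha>_def)
    then show ?thesis by (simp add: vol_coeff_def c_def power_mult_distrib)
  qed
  ultimately have "h * vol_coeff TYPE('n) (m (t + h)) \<le> h * (B * (K / h * (m t - m (t + h))))"
    using h by (intro mult_left_mono) auto
  also have "\<dots> = K * (B * (m t - m (t + h)))" using h by simp
  finally have "z * (h * vol_coeff TYPE('n) (m (t + h))) \<le> z * (K * (B * (m t - m (t + h))))"
    using z by (intro mult_left_mono) auto
  also have "\<dots> = B * (m t - m (t + h))" using z by (simp add: K_def)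
  finally show "z * (h * vol_coeff TYPE('n) (measure lborel {x. t + h < U x}))
    \<le> B * (measure lborel {x. t < U x} - measure lborel {x. t + h < U x})" unfolding m_def .
qed

end

text \<open>Replaces the differentiation theorem for monotone functions, at the price of a hypothesis at every point.\<close>

lemma lower_right_derivative_growth:
  fixes \<Phi> P :: "real \<Rightarrow> real"
  assumes ab: "a \<le> b" and mono: "\<And>x y. a \<le> x \<Longrightarrow> x \<le> y \<Longrightarrow> y \<le> b \<Longrightarrow> \<Phi> x \<le> \<Phi> y"
    and cont: "continuous_on {a..b} P"
    and step: "\<And>x \<eta>. a \<le> x \<Longrightarrow> x < b \<Longrightarrow> 0 < \<eta> \<Longrightarrow>
      \<exists>\<delta>>0. \<forall>h. 0 < h \<longrightarrow> h < \<delta> \<longrightarrow> P (x + h) - P x \<le> \<Phi> (x + h) - \<Phi> x + \<eta> * h"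
  shows "P b - P a \<le> \<Phi> b - \<Phi> a"
proof (rule field_le_epsilon)
  fix e :: real assume e: "0 < e"
  define \<eta> where "\<eta> = e / (b - a + 1)"
  have \<eta>: "0 < \<eta>" "\<eta> * (b - a) \<le> e" using e ab by (auto simp: \<eta>_def field_simps)
  \<comment> \<open>Continuous induction: S collects the points reached with slack \<eta> per unit
    length; its supremum belongs to S and cannot lie below b.\<close>
  define S where "S = {x \<in> {a..b}. P x - P a \<le> \<Phi> x - \<Phi> a + \<eta> * (x - a)}"
  have aS: "a \<in> S" using ab by (simp add: S_def)
  have bdd: "bdd_above S" by (rule bdd_aboveI[of _ b]) (simp add: S_def)
  define c where "c = Sup S"
  have cle: "x \<le> c" if "x \<in> S" for x unfolding c_def by (rule cSup_upper[OF that bdd])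
  have cab: "a \<le> c" "c \<le> b" using cle[OF aS] unfolding c_def using aS by (auto intro!: cSup_least simp: S_def)
  have "c \<in> S"
  proof -
    \<comment> \<open>S itself might fail to be closed because \<Phi> may jump. The jumps go upward,
      so \<Phi>(x) <= \<Phi>(c) for x in S, and freezing \<Phi> at c gives a closed superset whose
      condition at c is membership in S.\<close>
    let ?T = "{x \<in> {a..b}. P x - \<eta> * (x - a) \<le> P a + \<Phi> c - \<Phi> a}"
    have "closed ?T"
      by (rule continuous_on_closed_Collect_le) (intro continuous_intros cont closed_atLeastAtMost)+
    moreover have "S \<subseteq> ?T"
    proof
      fix x assume x: "x \<in> S"
      then have "\<Phi> x \<le> \<Phi> c" using cle[OF x] cab by (intro mono) (auto simp: S_def)
      then show "x \<in> ?T" using x by (auto simp: S_def)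
    qed
    moreover have "c \<in> closure S" unfolding c_def using aS bdd by (intro closure_contains_Sup) auto
    ultimately have "c \<in> ?T" using closure_minimal by blast
    then show ?thesis by (auto simp: S_def)
  qed
  have "c = b"
  proof (rule ccontr)
    assume "c \<noteq> b"
    then have "c < b" using cab by simp
    then obtain \<delta> where \<delta>: "0 < \<delta>" "\<And>h. 0 < h \<Longrightarrow> h < \<delta> \<Longrightarrow> P (c + h) - P c \<le> \<Phi> (c + h) - \<Phi> c + \<eta> * h"
      using step[OF cab(1) _ \<eta>(1)] by blast
    define h where "h = min (\<delta> / 2) (b - c)"
    have h: "0 < h" "h < \<delta>" "c + h \<le> b" using \<delta>(1) \<open>c < b\<close> by (auto simp: h_def min_def)
    have "c + h \<in> S" using \<open>c \<in> S\<close> \<delta>(2)[OF h(1,2)] h cab by (auto simp: S_def algebra_simps)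
    then show False using cle[of "c + h"] h by simp
  qed
  then show "P b - P a \<le> \<Phi> b - \<Phi> a + e" using \<open>c \<in> S\<close> \<eta> by (auto simp: S_def)
qed

lemma powr_primitive_step:
  fixes x h \<gamma> :: real
  assumes "0 < x" "0 < h" "0 \<le> \<gamma>"
  shows "(x + h) powr (\<gamma> + 1) / (\<gamma> + 1) - x powr (\<gamma> + 1) / (\<gamma> + 1) \<le> h * (x + h) powr \<gamma>"
proof -
  have "\<exists>z. x < z \<and> z < x + h \<and> (x + h) powr (\<gamma> + 1) / (\<gamma> + 1) - x powr (\<gamma> + 1) / (\<gamma> + 1) = (x + h - x) * z powr \<gamma>"
  proof (rule MVT2)
    show "((\<lambda>y. y powr (\<gamma> + 1) / (\<gamma> + 1)) has_real_derivative y powr \<gamma>) (at y)" if "x \<le> y" for y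
      using that assms by (auto intro!: derivative_eq_intros)
  qed (use assms in auto)
  then obtain z where z: "x < z" "z < x + h" "(x + h) powr (\<gamma> + 1) / (\<gamma> + 1) - x powr (\<gamma> + 1) / (\<gamma> + 1) = h * z powr \<gamma>"
    by auto
  moreover have "z powr \<gamma> \<le> (x + h) powr \<gamma>" using z assms by (intro powr_mono2) auto
  ultimately show ?thesis using assms by (simp add: mult_left_mono)
qed

text \<open>The differential inequality \<open>t\<^sup>\<gamma> \<le> - \<mu>'(t) F(\<mu>(t)) / A(\<mu>(t))\<close>, in the discrete form \<open>level\<close>, integrated.\<close>

lemma level_growth:
  fixes \<mu> F A H :: "real \<Rightarrow> real"
  assumes \<gamma>: "0 \<le> \<gamma>" and T: "0 < T" "0 < \<mu> T"
    and \<mu>_mono: "\<And>s t. s \<le> t \<Longrightarrow> \<mu> t \<le> \<mu> s" and \<mu>_le: "\<And>t. \<mu> t \<le> M"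
    and \<mu>_right: "\<And>t r. r < \<mu> t \<Longrightarrow> \<exists>t'>t. r < \<mu> t'"
    and level: "\<And>t h. 0 < t \<Longrightarrow> 0 < h \<Longrightarrow> h * A (\<mu> (t + h)) * t powr \<gamma> \<le> F (\<mu> t) * (\<mu> t - \<mu> (t + h))"
    and F: "\<And>r. 0 \<le> F r" "\<And>r. 0 < r \<Longrightarrow> isCont F r" and A: "\<And>r. 0 < r \<Longrightarrow> 0 < A r" "\<And>r. 0 < r \<Longrightarrow> isCont A r"
    and H: "\<And>r. 0 < r \<Longrightarrow> (H has_real_derivative F r / A r) (at r)"
  shows "T powr (\<gamma> + 1) / (\<gamma> + 1) \<le> H M - H (\<mu> T)"
proof -
  define P where "P t = t powr (\<gamma> + 1) / (\<gamma> + 1)" for t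
  have Hmono: "H r \<le> H r'" if "0 < r" "r \<le> r'" for r r'
    using that(2)
  proof (rule DERIV_nonneg_imp_nondecreasing)
    fix x assume "r \<le> x" "x \<le> r'"
    then have "0 < x" using that by simp
    then show "\<exists>y. (H has_real_derivative y) (at x) \<and> 0 \<le> y"
      using H[of x] F(1)[of x] A(1)[of x] by (intro exI[of _ "F x / A x"]) (auto intro: divide_nonneg_pos)
  qed
  \<comment> \<open>The integration starts at \<epsilon> > 0 because \<open>level\<close> is
    available for positive levels only; \<epsilon> tends to 0 at the end.\<close>
  have main: "P T - P \<epsilon> \<le> H M - H (\<mu> T)" if \<epsilon>: "0 < \<epsilon>" "\<epsilon> \<le> T" for \<epsilon>
  proof -
    have pos: "0 < \<mu> t" if "t \<le> T" for t using T \<mu>_mono[OF that] by linarith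
    have "P T - P \<epsilon> \<le> - H (\<mu> T) - (- H (\<mu> \<epsilon>))"
    proof (rule lower_right_derivative_growth[OF \<epsilon>(2)])
      show "- H (\<mu> x) \<le> - H (\<mu> y)" if "\<epsilon> \<le> x" "x \<le> y" "y \<le> T" for x y
        using Hmono[OF pos[OF that(3)] \<mu>_mono[OF that(2)]] by simp
      show "continuous_on {\<epsilon>..T} P" unfolding P_def using \<epsilon> \<gamma> by (intro continuous_intros) auto
      fix x \<eta> :: real assume x: "\<epsilon> \<le> x" "x < T" and \<eta>: "0 < \<eta>"
      have x0: "0 < x" using x \<epsilon> by simp
      define m where "m = \<mu> x"
      have m0: "0 < m" unfolding m_def using x by (intro pos) simp
      define X where "X = x powr \<gamma>"
      have X: "0 < X" using x0 by (simp add: X_def)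
      \<comment> \<open>Relative error allowed for A and for F/A near m. Both errors together leave
        the factor (1 - \<kappa>)^2 >= 1 - 2\<kappa>, which costs at most half of \<eta>; the other
        half goes into the continuity of the power with exponent \<gamma>.\<close>
      define \<kappa> where "\<kappa> = min (1/2) (\<eta> / (4 * X))"
      have \<kappa>: "0 < \<kappa>" "\<kappa> < 1" "2 * \<kappa> * X \<le> \<eta> / 2"
      proof -
        show "0 < \<kappa>" "\<kappa> < 1" using \<eta> X by (auto simp: \<kappa>_def)
        have "\<kappa> * (4 * X) \<le> \<eta>" using X by (simp add: \<kappa>_def pos_le_divide_eq[symmetric])
        then show "2 * \<kappa> * X \<le> \<eta> / 2" by simp
      qed
      define Q where "Q r = F r / A r" for r
      \<comment> \<open>If F vanished at m, \<open>level\<close> between x and T would contradict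
        the positivity of A at \<mu>(T).\<close>
      have Fm: "0 < F m"
      proof (rule ccontr)
        assume "\<not> 0 < F m"
        then have "F m = 0" using F(1)[of m] by simp
        then have "(T - x) * A (\<mu> T) * x powr \<gamma> \<le> 0" using level[OF x0, of "T - x"] x by (simp add: m_def)
        moreover have "0 < (T - x) * A (\<mu> T) * x powr \<gamma>" using x x0 A(1)[OF T(2)] by simp
        ultimately show False by simp
      qed
      have Am: "0 < A m" and Qm: "0 < Q m" using A(1)[OF m0] Fm by (auto simp: Q_def)
      have "isCont Q m" unfolding Q_def using F(2)[OF m0] A(2)[OF m0] Am by (intro continuous_intros) auto
      then have "\<forall>\<^sub>F r in nhds m. (1 - \<kappa>) * Q m < Q r"
        using \<kappa> Qm unfolding isCont_def tendsto_at_iff_tendsto_nhds by (intro order_tendstoD(1)) auto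
      moreover have "\<forall>\<^sub>F r in nhds m. (1 - \<kappa>) * A m < A r"
        using \<kappa> Am A(2)[OF m0] unfolding isCont_def tendsto_at_iff_tendsto_nhds by (intro order_tendstoD(1)) auto
      ultimately have "\<forall>\<^sub>F r in nhds m. (1 - \<kappa>) * Q m < Q r \<and> (1 - \<kappa>) * A m < A r" by (rule eventually_conj)
      then obtain \<rho> where \<rho>: "0 < \<rho>" "\<And>r. dist r m < \<rho> \<Longrightarrow> (1 - \<kappa>) * Q m < Q r \<and> (1 - \<kappa>) * A m < A r"
        unfolding eventually_nhds_metric by blast
      \<comment> \<open>Right continuity of \<mu> keeps \<mu>(x + h) positive and within \<rho> of m
        for all small h > 0.\<close>
      obtain t' where t': "x < t'" "max (m - \<rho>) 0 < \<mu> t'"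
        using \<mu>_right[of "max (m - \<rho>) 0" x] \<rho>(1) m0 by (auto simp: m_def)
      have "isCont (\<lambda>h. (x + h) powr \<gamma>) 0" using x0 by (intro continuous_intros) auto
      then have "((\<lambda>h. (x + h) powr \<gamma>) \<longlongrightarrow> X) (nhds 0)"
        using tendsto_at_iff_tendsto_nhds[of "\<lambda>h. (x + h) powr \<gamma>" 0] by (simp add: isCont_def X_def)
      then have "\<forall>\<^sub>F h in nhds 0. (x + h) powr \<gamma> < X + \<eta> / 2"
        using \<eta> by (intro order_tendstoD(2)) auto
      then obtain \<delta>1 where \<delta>1: "0 < \<delta>1" "\<And>h. dist h 0 < \<delta>1 \<Longrightarrow> (x + h) powr \<gamma> < X + \<eta> / 2"
        unfolding eventually_nhds_metric by blast
      define \<delta> where "\<delta> = min \<delta>1 (t' - x)"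
      show "\<exists>\<delta>>0. \<forall>h. 0 < h \<longrightarrow> h < \<delta> \<longrightarrow> P (x + h) - P x \<le> - H (\<mu> (x + h)) - (- H (\<mu> x)) + \<eta> * h"
      proof (intro exI[of _ \<delta>] conjI allI impI)
        show "0 < \<delta>" using \<delta>1 t' by (simp add: \<delta>_def)
        fix h assume h: "0 < h" "h < \<delta>"
        define m1 where "m1 = \<mu> (x + h)"
        have "\<mu> t' \<le> m1" unfolding m1_def using h by (intro \<mu>_mono) (simp add: \<delta>_def)
        then have m1: "0 < m1" "m - \<rho> < m1" "m1 \<le> m" using t' \<mu>_mono[of x "x + h"] h by (auto simp: m1_def m_def)
        have lev: "h * X * A m1 \<le> F m * (m - m1)"
          using level[OF x0 h(1)] by (simp add: m1_def m_def X_def mult_ac)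
        have A1: "(1 - \<kappa>) * A m < A m1" using \<rho>(2)[of m1] m1 \<rho>(1) by (auto simp: dist_real_def)
        have "0 < h * X * A m1" using h X A(1)[OF m1(1)] by simp
        then have "0 < F m * (m - m1)" using lev by linarith
        \<comment> \<open>\<open>level\<close> itself shows that \<mu> decreases strictly here, as
          the mean value theorem below requires.\<close>
        then have lt: "m1 < m" using Fm by (simp add: zero_less_mult_iff)
        have "\<exists>z. m1 < z \<and> z < m \<and> H m - H m1 = (m - m1) * Q z"
          unfolding Q_def using lt m1 by (intro MVT2) (auto intro: H)
        then obtain z where z: "m1 < z" "z < m" "H m - H m1 = (m - m1) * Q z" by blast
        have Qz: "(1 - \<kappa>) * Q m < Q z" using \<rho>(2)[of z] z m1 by (auto simp: dist_real_def)
        have "h * X * (1 - 2 * \<kappa>) \<le> h * X * ((1 - \<kappa>) * (1 - \<kappa>))"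
          using h X by (intro mult_left_mono) (auto simp: algebra_simps)
        also have "\<dots> \<le> (m - m1) * Q z"
        proof -
          have "h * X * ((1 - \<kappa>) * A m) \<le> h * X * A m1" using h X A1 by (intro mult_left_mono) auto
          also have "\<dots> \<le> F m * (m - m1)" by (rule lev)
          also have "F m = Q m * A m" using Am by (simp add: Q_def)
          finally have "(h * X * (1 - \<kappa>)) * A m \<le> (Q m * (m - m1)) * A m" by (simp add: mult_ac)
          then have "h * X * (1 - \<kappa>) \<le> Q m * (m - m1)" using Am by simp
          then have "h * X * (1 - \<kappa>) * (1 - \<kappa>) \<le> Q m * (m - m1) * (1 - \<kappa>)" using \<kappa> by (intro mult_right_mono) auto
          also have "\<dots> = (m - m1) * ((1 - \<kappa>) * Q m)" by (simp only: mult_ac)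
          also have "\<dots> \<le> (m - m1) * Q z" using lt Qz by (intro mult_left_mono) auto
          finally show ?thesis by (simp add: mult.assoc)
        qed
        finally have 1: "h * X * (1 - 2 * \<kappa>) \<le> H m - H m1" using z(3) by simp
        have "P (x + h) - P x \<le> h * (x + h) powr \<gamma>" unfolding P_def by (rule powr_primitive_step[OF x0 h(1) \<gamma>])
        also have "\<dots> \<le> h * (X + \<eta> / 2)" using \<delta>1(2)[of h] h by (intro mult_left_mono) (auto simp: \<delta>_def)
        also have "\<dots> = h * X * (1 - 2 * \<kappa>) + h * (2 * \<kappa> * X) + h * (\<eta> / 2)" by (simp add: algebra_simps)
        also have "\<dots> \<le> h * X * (1 - 2 * \<kappa>) + h * (\<eta> / 2) + h * (\<eta> / 2)"
          using mult_left_mono[OF \<kappa>(3) less_imp_le[OF h(1)]] by (intro add_right_mono add_left_mono)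
        also have "\<dots> = h * X * (1 - 2 * \<kappa>) + \<eta> * h" by (simp add: algebra_simps)
        also have "\<dots> \<le> H m - H m1 + \<eta> * h" using 1 by simp
        finally show "P (x + h) - P x \<le> - H (\<mu> (x + h)) - (- H (\<mu> x)) + \<eta> * h" by (simp add: m1_def m_def)
      qed
    qed
    moreover have "H (\<mu> \<epsilon>) \<le> H M" using \<epsilon> \<mu>_le by (intro Hmono pos)
    ultimately show ?thesis by linarith
  qed
  have "(P \<longlongrightarrow> 0) (at_right 0)"
  proof -
    have "((\<lambda>t. t powr (\<gamma> + 1) / (\<gamma> + 1)) \<longlongrightarrow> 0 powr (\<gamma> + 1) / (\<gamma> + 1)) (at_right 0)"
      using \<gamma> by (intro tendsto_intros) (auto simp: eventually_at_right_less intro!: eventually_at_rightI[of 0 1])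
    then show ?thesis unfolding P_def by simp
  qed
  then have "((\<lambda>\<epsilon>. P T - P \<epsilon>) \<longlongrightarrow> P T - 0) (at_right 0)" by (intro tendsto_intros)
  then have "P T - 0 \<le> H M - H (\<mu> T)"
    by (rule tendsto_upperbound) (use main T in \<open>auto intro!: eventually_at_rightI[of 0 T]\<close>)
  then show ?thesis by (simp add: P_def)
qed

section \<open>From the distributional formulation to Borel representatives\<close>

lemma borel_measurable_completion_AE:
  assumes g: "g \<in> borel_measurable M" and ae: "AE x in M. f x = g x"
  shows "f \<in> borel_measurable (completion M)"
proof (rule measurableI)
  fix A :: "'b set" assume A: "A \<in> sets borel"
  have "AE x in completion M. x \<in> g -` A \<inter> space M \<longleftrightarrow> x \<in> f -` A \<inter> space M"
    by (rule AE_completion) (use ae in eventually_elim, auto)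
  moreover have "g -` A \<inter> space M \<in> sets (completion M)" using measurable_sets[OF g A] by simp
  ultimately show "f -` A \<inter> space (completion M) \<in> sets (completion M)"
    unfolding space_completion by (rule completion.in_sets_AE) simp
qed simp

lemma completion_AE_integral:
  fixes f g :: "'a \<Rightarrow> 'b::{banach, second_countable_topology}"
  assumes g: "g \<in> borel_measurable M" and ae: "AE x in M. f x = g x"
  shows "integral\<^sup>L (completion M) f = integral\<^sup>L M g" "integrable (completion M) f \<longleftrightarrow> integrable M g"
proof -
  have f: "f \<in> borel_measurable (completion M)" by (rule borel_measurable_completion_AE[OF g ae])
  have g': "g \<in> borel_measurable (completion M)" by (rule measurable_completion[OF g])
  have "integral\<^sup>L (completion M) f = integral\<^sup>L (completion M) g"
    by (rule integral_cong_AE[OF f g' AE_completion[OF ae]])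
  then show "integral\<^sup>L (completion M) f = integral\<^sup>L M g" using integral_completion[OF g] by simp
  have "integrable (completion M) f \<longleftrightarrow> integrable (completion M) g"
    by (rule integrable_cong_AE[OF f g' AE_completion[OF ae]])
  then show "integrable (completion M) f \<longleftrightarrow> integrable M g" using integrable_completion[OF g] by simp
qed

lemma powr_two: "0 \<le> x \<Longrightarrow> x powr 2 = (x::real)\<^sup>2"
  by (cases "x = 0") (auto simp: powr_numeral)

lemma borel_version_vec:
  fixes G :: "real^'n::finite \<Rightarrow> real^'n"
  assumes G: "G \<in> borel_measurable lebesgue"
  obtains D where "D \<in> borel_measurable borel" "AE x in lborel. G x = D x"
proof -
  have "\<exists>d. d \<in> borel_measurable lborel \<and> (AE x in lborel. G x $ i = d x)" for i
  proof -
    have "(\<lambda>x. G x \<bullet> axis i 1) \<in> borel_measurable lebesgue" using G by measurable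
    then have "(\<lambda>x. G x $ i) \<in> borel_measurable lebesgue" by (simp add: inner_axis)
    from completion_ex_borel_measurable_real[OF this] show ?thesis by blast
  qed
  then obtain d where d: "\<And>i. d i \<in> borel_measurable lborel" "\<And>i. AE x in lborel. G x $ i = d i x" by metis
  define D where "D x = (\<chi> i. d i x)" for x
  have "D \<in> borel_measurable borel"
  proof (subst borel_measurable_euclidean_space, rule ballI)
    fix b :: "real^'n" assume "b \<in> Basis"
    then obtain i where "b = axis i 1" by (auto simp: Basis_vec_def)
    then have "(\<lambda>x. D x \<bullet> b) = d i" by (simp add: D_def inner_axis fun_eq_iff)
    then show "(\<lambda>x. D x \<bullet> b) \<in> borel_measurable borel" using d(1)[of i] by simp
  qed
  moreover have "AE x in lborel. \<forall>i. G x $ i = d i x" using d(2) by (simp add: eventually_all_finite)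
  then have "AE x in lborel. G x = D x" by eventually_elim (simp add: D_def vec_eq_iff)
  ultimately show ?thesis using that by blast
qed

text \<open>Two weak gradients of u occur, one on the whole space in the equation and one on
  \<Omega> in the H^1_0 approximation; the energy argument needs the second inside the equation. All
  functions are replaced by Borel ones with their signs valid at every point.\<close>

lemma distributional_solution_energy:
  fixes \<Omega> :: "(real^'n::finite) set"
  assumes \<Omega>: "open \<Omega>" "bounded \<Omega>" and s: "0 < s" "s < 1" and q: "0 \<le> q"
    and f_meas: "f \<in> borel_measurable (lebesgue_on \<Omega>)" and f_nonneg: "\<forall>x\<in>\<Omega>. 0 \<le> f x"
    and sol: "distributional_solution \<Omega> s q \<gamma> f u" and H01: "W01p_on 2 \<Omega> u" and Lq: "Lp_on (q + 1) \<Omega> u"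
  obtains U D g p \<phi> where "energy_solution \<Omega> s U D g p \<phi>"
    "AE x in lborel. U x = (if x \<in> \<Omega> then u x else 0)"
    "AE x in lborel. p x = (if x \<in> \<Omega> then f x * u x powr (- \<gamma>) else 0)"
proof -
  have \<Omega>b[measurable]: "\<Omega> \<in> sets borel" using \<Omega> by auto
  have \<Omega>f: "\<Omega> \<in> fmeasurable lborel" by (rule bounded_fmeasurable_lborel[OF \<Omega>(2) \<Omega>b])
  have upos: "0 < u x" if "x \<in> \<Omega>" for x using sol that unfolding distributional_solution_def by blast
  have uout: "AE x in lborel. x \<notin> \<Omega> \<longrightarrow> u x = 0"
    using sol unfolding distributional_solution_def AE_completion_iff by blast
  have u_meas: "u \<in> borel_measurable (lebesgue_on \<Omega>)" and u2: "set_integrable lebesgue \<Omega> (\<lambda>x. \<bar>u x\<bar> powr 2)"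
    using H01 unfolding W01p_on_def Lp_on_def by blast+
  obtain G \<phi> where wG: "weak_grad_on \<Omega> u G" and Gm: "G \<in> borel_measurable (lebesgue_on \<Omega>)"
    and G2: "set_integrable lebesgue \<Omega> (\<lambda>x. norm (G x) powr 2)" and t\<phi>: "\<And>k. test_fun \<Omega> (\<phi> k)"
    and lim: "(\<lambda>k::nat. (LINT x:\<Omega>|lebesgue. \<bar>\<phi> k x - u x\<bar> powr 2)
                 + (LINT x:\<Omega>|lebesgue. norm (classical_grad (\<phi> k) x - G x) powr 2)) \<longlonglongrightarrow> 0"
    using H01 unfolding W01p_on_def by blast
  obtain Gs where wGs: "weak_grad_on UNIV u Gs"
    and weak: "\<And>\<psi>. test_fun \<Omega> \<psi> \<Longrightarrow>
          (LINT x:\<Omega>|lebesgue. Gs x \<bullet> classical_grad \<psi> x)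
          + integral\<^sup>L (completion (lborel \<Otimes>\<^sub>M lborel))
              (\<lambda>(x,y). (u x - u y) * (\<psi> x - \<psi> y) / norm (x - y) powr (real CARD('n) + 2 * s))
          + (LINT x:\<Omega>|lebesgue. u x powr q * \<psi> x)
          = (LINT x:\<Omega>|lebesgue. f x * u x powr (-\<gamma>) * \<psi> x)"
    using sol unfolding distributional_solution_def by blast
  have lf: "locally_integrable_on (\<lambda>x. f x * u x powr (-\<gamma>)) \<Omega>"
    using sol unfolding distributional_solution_def by blast
  have \<Omega>l: "\<Omega> \<in> sets lebesgue" by simp
  obtain U0 where U0[measurable]: "U0 \<in> borel_measurable lborel" "AE x in lborel. (if x \<in> \<Omega> then u x else 0) = U0 x"
    using completion_ex_borel_measurable_real[OF borel_measurable_if_I[OF u_meas \<Omega>l]] by blast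
  obtain f0 where f0[measurable]: "f0 \<in> borel_measurable lborel" "AE x in lborel. (if x \<in> \<Omega> then f x else 0) = f0 x"
    using completion_ex_borel_measurable_real[OF borel_measurable_if_I[OF f_meas \<Omega>l]] by blast
  obtain D0 where D0[measurable]: "D0 \<in> borel_measurable borel" "AE x in lborel. (if x \<in> \<Omega> then G x else 0) = D0 x"
    using borel_version_vec[OF borel_measurable_if_I[OF Gm \<Omega>l]] by blast
  \<comment> \<open>The maximum with 0 makes U nonnegative everywhere; a Borel version of u could be
    negative on a null set.\<close>
  define U where "U x = (if x \<in> \<Omega> then max 0 (U0 x) else 0)" for x
  define D where "D x = (if x \<in> \<Omega> then D0 x else 0)" for x
  define g where "g x = (if x \<in> \<Omega> then U x powr q else 0)" for x
  define p where "p x = (if x \<in> \<Omega> then max 0 (f0 x) * U x powr (- \<gamma>) else 0)" for x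
  have [measurable]: "U \<in> borel_measurable borel" using U0(1) unfolding U_def by measurable
  have [measurable]: "D \<in> borel_measurable borel" using D0(1) unfolding D_def by measurable
  have [measurable]: "g \<in> borel_measurable borel" unfolding g_def by measurable
  have [measurable]: "p \<in> borel_measurable borel" using f0(1) unfolding p_def by measurable
  have U: "AE x in lborel. U x = (if x \<in> \<Omega> then u x else 0)"
    using U0(2)
  proof eventually_elim
    case (elim x)
    then show ?case using upos[of x] by (cases "x \<in> \<Omega>") (auto simp: U_def)
  qed
  have uU: "AE x in lborel. u x = U x" using U uout by eventually_elim auto
  have D: "AE x in lborel. D x = (if x \<in> \<Omega> then G x else 0)"
    using D0(2) by eventually_elim (auto simp: D_def)
  have g: "AE x in lborel. g x = (if x \<in> \<Omega> then u x powr q else 0)"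
    using U by eventually_elim (auto simp: g_def)
  have p: "AE x in lborel. p x = (if x \<in> \<Omega> then f x * u x powr (- \<gamma>) else 0)"
    using U f0(2)
  proof eventually_elim
    case (elim x)
    then show ?case using bspec[OF f_nonneg, of x] by (cases "x \<in> \<Omega>") (auto simp: p_def)
  qed
  have U_nonneg: "0 \<le> U x" for x by (simp add: U_def)
  have U_sq: "integrable lborel (\<lambda>x. (norm (U x))\<^sup>2)"
  proof -
    have "AE x in lborel. indicator \<Omega> x *\<^sub>R \<bar>u x\<bar> powr 2 = (norm (U x))\<^sup>2"
      using U by eventually_elim (auto simp: powr_two split: split_indicator)
    from completion_AE_integral(2)[OF _ this] u2 show ?thesis unfolding set_integrable_def by simp
  qed
  have D_sq: "integrable lborel (\<lambda>x. (norm (D x))\<^sup>2)"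
  proof -
    have "AE x in lborel. indicator \<Omega> x *\<^sub>R norm (G x) powr 2 = (norm (D x))\<^sup>2"
      using D by eventually_elim (auto simp: powr_two split: split_indicator)
    from completion_AE_integral(2)[OF _ this] G2 show ?thesis unfolding set_integrable_def by simp
  qed
  note [measurable] = test_fun_borel[OF t\<phi>] test_fun_grad_borel[OF t\<phi>]
  have lim1: "(LINT x:\<Omega>|lebesgue. \<bar>\<phi> k x - u x\<bar> powr 2) = (\<integral>x. (norm (\<phi> k x - U x))\<^sup>2 \<partial>lborel)" for k
    unfolding set_lebesgue_integral_def
  proof (rule completion_AE_integral(1))
    show "AE x in lborel. indicator \<Omega> x *\<^sub>R \<bar>\<phi> k x - u x\<bar> powr 2 = (norm (\<phi> k x - U x))\<^sup>2"
      using U by eventually_elim (use test_funD(3)[OF t\<phi>] in \<open>auto simp: powr_two split: split_indicator\<close>)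
  qed measurable
  have lim2: "(LINT x:\<Omega>|lebesgue. norm (classical_grad (\<phi> k) x - G x) powr 2) = (\<integral>x. (norm (classical_grad (\<phi> k) x - D x))\<^sup>2 \<partial>lborel)" for k
    unfolding set_lebesgue_integral_def
  proof (rule completion_AE_integral(1))
    show "AE x in lborel. indicator \<Omega> x *\<^sub>R norm (classical_grad (\<phi> k) x - G x) powr 2 = (norm (classical_grad (\<phi> k) x - D x))\<^sup>2"
      using D by eventually_elim (use grad_outside_domain[OF t\<phi>] in \<open>auto simp: powr_two split: split_indicator\<close>)
  qed measurable
  define E where "E k = (\<integral>x. (norm (\<phi> k x - U x))\<^sup>2 \<partial>lborel) + (\<integral>x. (norm (classical_grad (\<phi> k) x - D x))\<^sup>2 \<partial>lborel)" for k
  have E: "E \<longlonglongrightarrow> 0" using lim unfolding lim1 lim2 E_def .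
  have \<phi>sq: "integrable lborel (\<lambda>x. (norm (\<phi> k x - U x))\<^sup>2)" for k
    using test_fun_integrable_sq(1)[OF t\<phi>[of k]] by (intro integrable_norm_diff_sq U_sq) auto
  \<comment> \<open>Norm convergence gives almost everywhere convergence along a subsequence, on
    which the H^1 convergence persists.\<close>
  obtain r where r: "strict_mono r" "AE x in lborel. (\<lambda>k. (norm (\<phi> (r k) x - U x))\<^sup>2) \<longlonglongrightarrow> 0"
  proof -
    have "(\<lambda>k. \<integral>x. norm ((norm (\<phi> k x - U x))\<^sup>2) \<partial>lborel) \<longlonglongrightarrow> 0"
    proof (rule tendsto_sandwich[of "\<lambda>_. 0" _ _ E])
      show "\<forall>\<^sub>F k in sequentially. (\<integral>x. norm ((norm (\<phi> k x - U x))\<^sup>2) \<partial>lborel) \<le> E k"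
        by (rule always_eventually) (simp add: E_def)
    qed (use E in auto)
    from tendsto_L1_AE_subseq[OF \<phi>sq this] show ?thesis using that by blast
  qed
  have es: "energy_solution \<Omega> s U D g p (\<lambda>k. \<phi> (r k))"
  proof
    show "(\<lambda>k. (\<integral>x. (norm (\<phi> (r k) x - U x))\<^sup>2 \<partial>lborel) + (\<integral>x. (norm (classical_grad (\<phi> (r k)) x - D x))\<^sup>2 \<partial>lborel)) \<longlonglongrightarrow> 0"
      using LIMSEQ_subseq_LIMSEQ[OF E r(1)] unfolding comp_def E_def .
    show "AE x in lborel. (\<lambda>k. \<phi> (r k) x) \<longlonglongrightarrow> U x"
      using r(2)
    proof eventually_elim
      case (elim x)
      then have "(\<lambda>k. sqrt ((norm (\<phi> (r k) x - U x))\<^sup>2)) \<longlonglongrightarrow> sqrt 0" by (rule tendsto_real_sqrt)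
      then show ?case by (simp add: LIM_zero_iff tendsto_rabs_zero_iff)
    qed
    show "0 \<le> g x" for x by (simp add: g_def)
    show "0 \<le> p x" for x by (simp add: p_def)
    show "integrable lborel g"
    proof -
      \<comment> \<open>u^q <= 1 + u^(q+1), and \<Omega> has finite measure: membership in L^(q+1)
        thus makes u^q integrable on all of \<Omega>, where the notion of solution only provides
        local integrability.\<close>
      have Uq: "integrable lborel (\<lambda>x. indicator \<Omega> x * U x powr (q + 1))"
      proof -
        have "AE x in lborel. indicator \<Omega> x *\<^sub>R \<bar>u x\<bar> powr (q + 1) = indicator \<Omega> x * U x powr (q + 1)"
          using U
        proof eventually_elim
          case (elim x)
          then show ?case using upos[of x] by (cases "x \<in> \<Omega>") auto
        qed
        from completion_AE_integral(2)[OF _ this] Lq show ?thesis unfolding Lp_on_def set_integrable_def by simp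
      qed
      have i1: "integrable lborel (\<lambda>x. indicator \<Omega> x :: real)" using \<Omega>f by (auto simp: fmeasurable_def)
      show ?thesis
      proof (rule Bochner_Integration.integrable_bound[OF Bochner_Integration.integrable_add[OF i1 Uq]])
        show "AE x in lborel. norm (g x) \<le> norm (indicator \<Omega> x + indicator \<Omega> x * U x powr (q + 1))"
        proof (rule AE_I2)
          fix x
          have "U x powr q \<le> 1 + U x powr (q + 1)"
          proof (cases "U x \<le> 1")
            case True
            then have "U x powr q \<le> 1" using q U_nonneg[of x] by (simp add: powr_le1)
            then show ?thesis by (simp add: add_increasing2)
          next
            case False
            then have "U x powr q \<le> U x powr (q + 1)" by (intro powr_mono) auto
            then show ?thesis by linarith
          qed
          then show "norm (g x) \<le> norm (indicator \<Omega> x + indicator \<Omega> x * U x powr (q + 1))"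
            by (auto simp: g_def split: split_indicator)
        qed
      qed measurable
    qed
    show "integrable lborel (\<lambda>x. p x * \<psi> x)" if \<psi>: "test_fun \<Omega> \<psi>" for \<psi>
    proof -
      note [measurable] = test_fun_borel[OF \<psi>]
      have "AE x in lborel. f x * u x powr (-\<gamma>) * \<psi> x = p x * \<psi> x"
        using p by eventually_elim (use test_funD(3)[OF \<psi>] in auto)
      from completion_AE_integral(2)[OF _ this] integrable_mult_test_fun[OF lf \<psi>] show ?thesis by simp
    qed
    show "(\<integral>x. D x \<bullet> classical_grad \<psi> x \<partial>lborel) + (\<integral>z. incr U z * incr \<psi> z \<partial>kernel_measure s) + (\<integral>x. g x * \<psi> x \<partial>lborel)
        = (\<integral>x. p x * \<psi> x \<partial>lborel)" if \<psi>: "test_fun \<Omega> \<psi>" for \<psi>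
    proof -
      note [measurable] = test_fun_borel[OF \<psi>] test_fun_grad_borel[OF \<psi>]
      \<comment> \<open>The two gradients are compared through the integral of u times the Laplacian
        of \<psi>.\<close>
      have 1: "(LINT x:\<Omega>|lebesgue. Gs x \<bullet> classical_grad \<psi> x) = (\<integral>x. D x \<bullet> classical_grad \<psi> x \<partial>lborel)"
      proof -
        have "(LINT x:\<Omega>|lebesgue. Gs x \<bullet> classical_grad \<psi> x) = (\<integral>x. G x \<bullet> classical_grad \<psi> x \<partial>lebesgue)"
          using weak_grad_laplacian(2)[OF wGs \<psi>] weak_grad_laplacian(3)[OF wG \<psi> order_refl] by simp
        also have "\<dots> = (\<integral>x. D x \<bullet> classical_grad \<psi> x \<partial>lborel)"
        proof (rule completion_AE_integral(1))
          show "AE x in lborel. G x \<bullet> classical_grad \<psi> x = D x \<bullet> classical_grad \<psi> x"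
            using D by eventually_elim (use grad_outside_domain[OF \<psi>] in auto)
        qed measurable
        finally show ?thesis .
      qed
      have 2: "integral\<^sup>L (completion (lborel \<Otimes>\<^sub>M lborel))
              (\<lambda>(x,y). (u x - u y) * (\<psi> x - \<psi> y) / norm (x - y) powr (real CARD('n) + 2 * s))
           = (\<integral>z. incr U z * incr \<psi> z \<partial>kernel_measure s)"
      proof -
        let ?k = "\<lambda>z::(real^'n) \<times> (real^'n). 1 / norm (fst z - snd z) powr (real CARD('n) + 2 * s)"
        have [measurable]: "incr U \<in> borel_measurable (lborel \<Otimes>\<^sub>M lborel)" "incr \<psi> \<in> borel_measurable (lborel \<Otimes>\<^sub>M lborel)"
          by measurable
        have "integral\<^sup>L (completion (lborel \<Otimes>\<^sub>M lborel))
              (\<lambda>(x,y). (u x - u y) * (\<psi> x - \<psi> y) / norm (x - y) powr (real CARD('n) + 2 * s))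
           = (\<integral>z. ?k z *\<^sub>R (incr U z * incr \<psi> z) \<partial>(lborel \<Otimes>\<^sub>M lborel))"
        proof (rule completion_AE_integral(1))
          show "AE z in lborel \<Otimes>\<^sub>M lborel. (case z of (x,y) \<Rightarrow> (u x - u y) * (\<psi> x - \<psi> y) / norm (x - y) powr (real CARD('n) + 2 * s))
            = ?k z *\<^sub>R (incr U z * incr \<psi> z)"
            using AE_lborel_pair[OF uU] by eventually_elim (auto simp: case_prod_unfold)
        qed measurable
        also have "\<dots> = (\<integral>z. incr U z * incr \<psi> z \<partial>kernel_measure s)"
          unfolding kernel_measure_def by (rule integral_density[symmetric]) auto
        finally show ?thesis .
      qed
      have 3: "(LINT x:\<Omega>|lebesgue. u x powr q * \<psi> x) = (\<integral>x. g x * \<psi> x \<partial>lborel)"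
        unfolding set_lebesgue_integral_def
      proof (rule completion_AE_integral(1))
        show "AE x in lborel. indicator \<Omega> x *\<^sub>R (u x powr q * \<psi> x) = g x * \<psi> x"
          using g by eventually_elim (auto split: split_indicator)
      qed measurable
      have 4: "(LINT x:\<Omega>|lebesgue. f x * u x powr (-\<gamma>) * \<psi> x) = (\<integral>x. p x * \<psi> x \<partial>lborel)"
        unfolding set_lebesgue_integral_def
      proof (rule completion_AE_integral(1))
        show "AE x in lborel. indicator \<Omega> x *\<^sub>R (f x * u x powr (-\<gamma>) * \<psi> x) = p x * \<psi> x"
          using p by eventually_elim (auto split: split_indicator)
      qed measurable
      show ?thesis using weak[OF \<psi>] unfolding 1 2 3 4 .
    qed
  qed (use s \<Omega>f U_sq D_sq t\<phi> in \<open>auto simp: U_def D_def\<close>)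
  show ?thesis by (rule that[OF es U p])
qed

lemma set_integrable_of_Lp:
  fixes \<Omega> :: "(real^'n::finite) set"
  assumes f: "Lp_on m \<Omega> f" and m: "1 \<le> m" and \<Omega>: "\<Omega> \<in> lmeasurable"
  shows "set_integrable lebesgue \<Omega> f"
  unfolding set_integrable_def
proof (rule Bochner_Integration.integrable_bound)
  have i: "integrable lebesgue (\<lambda>x. indicator \<Omega> x *\<^sub>R \<bar>f x\<bar> powr m)"
    using f unfolding Lp_on_def set_integrable_def by blast
  have "integrable lebesgue (\<lambda>x. indicator \<Omega> x :: real)" using \<Omega> by (auto simp: fmeasurable_def)
  then show "integrable lebesgue (\<lambda>x. indicator \<Omega> x + indicator \<Omega> x *\<^sub>R \<bar>f x\<bar> powr m)"
    using i by (rule Bochner_Integration.integrable_add)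
  show "(\<lambda>x. indicator \<Omega> x *\<^sub>R f x) \<in> borel_measurable lebesgue"
    using f \<Omega> unfolding Lp_on_def by (subst borel_measurable_restrict_space_iff[symmetric]) auto
  show "AE x in lebesgue. norm (indicator \<Omega> x *\<^sub>R f x) \<le> norm (indicator \<Omega> x + indicator \<Omega> x *\<^sub>R \<bar>f x\<bar> powr m)"
  proof (rule AE_I2)
    fix x
    have "\<bar>f x\<bar> \<le> 1 + \<bar>f x\<bar> powr m"
    proof (cases "\<bar>f x\<bar> \<le> 1")
      case True
      then show ?thesis by (simp add: add_increasing2)
    next
      case False
      then have "\<bar>f x\<bar> powr 1 \<le> \<bar>f x\<bar> powr m" using m by (intro powr_mono) auto
      then show ?thesis using False by simp
    qed
    then show "norm (indicator \<Omega> x *\<^sub>R f x) \<le> norm (indicator \<Omega> x + indicator \<Omega> x *\<^sub>R \<bar>f x\<bar> powr m)"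
      by (auto split: split_indicator)
  qed
qed

text \<open>On {u > t} the singular factor is at most its value at t, as \<gamma> >= 0, and
  Hardy-Littlewood bounds the integral of f over this set by the primitive of its rearrangement at
  \<mu>(t). The product is the B of \<open>level_inequality\<close>; the power of t is then moved to
  the left.\<close>

lemma energy_level_inequality:
  fixes \<Omega> :: "(real^'n::finite) set"
  assumes es: "energy_solution \<Omega> s U D g p \<phi>" and \<gamma>: "0 \<le> \<gamma>"
    and rf: "rearrangeable \<Omega> f" and ru: "rearrangeable \<Omega> u"
    and f0: "\<And>x. x \<in> \<Omega> \<Longrightarrow> 0 \<le> f x" and fint: "set_integrable lebesgue \<Omega> f" and u0: "\<And>x. x \<in> \<Omega> \<Longrightarrow> 0 < u x"
    and U: "AE x in lborel. U x = (if x \<in> \<Omega> then u x else 0)"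
    and p: "AE x in lborel. p x = (if x \<in> \<Omega> then f x * u x powr (- \<gamma>) else 0)"
    and t: "0 < t" and h: "0 < h"
  shows "h * vol_coeff TYPE('n) (distrib_fun \<Omega> u (t + h)) * t powr \<gamma>
    \<le> rearrangeable.rearr_primitive \<Omega> f (distrib_fun \<Omega> u t) * (distrib_fun \<Omega> u t - distrib_fun \<Omega> u (t + h))"
proof -
  interpret E: energy_solution \<Omega> s U D g p \<phi> by (rule es)
  interpret F: rearrangeable \<Omega> f by (rule rf)
  interpret u: rearrangeable \<Omega> u by (rule ru)
  have intf: "integrable lborel F.rearr" by (rule F.integrable_rearr[OF f0 fint])
  have lev: "measure lborel {x. r < U x} = distrib_fun \<Omega> u r" if "0 < r" for r
  proof -
    have "measure lborel {x. r < U x} = measure lebesgue {x. r < U x}" by simp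
    also have "\<dots> = measure lebesgue {x \<in> \<Omega>. r < \<bar>u x\<bar>}"
    proof (rule measure_eq_AE)
      show "AE x in lebesgue. (x \<in> {x. r < U x}) = (x \<in> {x \<in> \<Omega>. r < \<bar>u x\<bar>})"
        using AE_completion[OF U] by eventually_elim (use u0 that in \<open>auto simp: abs_of_pos\<close>)
    qed (use u.level_measurable[of r] in auto)
    finally show ?thesis unfolding distrib_fun_def .
  qed
  define F0 where "F0 = F.rearr_primitive (distrib_fun \<Omega> u t)"
  have F0: "0 \<le> F0" unfolding F0_def by (rule F.rearr_primitive_nonneg)
  have "(\<integral>\<^sup>+x. ennreal (p x) * indicator {x. t < U x} x \<partial>lborel) \<le> ennreal (t powr (- \<gamma>) * F0)"
  proof -
    let ?E = "{x \<in> \<Omega>. t < \<bar>u x\<bar>}"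
    have "(\<integral>\<^sup>+x. ennreal (p x) * indicator {x. t < U x} x \<partial>lborel)
      \<le> (\<integral>\<^sup>+x. ennreal (t powr (- \<gamma>)) * (ennreal (f x) * indicator ?E x) \<partial>lborel)"
    proof (rule nn_integral_mono_AE)
      show "AE x in lborel. ennreal (p x) * indicator {x. t < U x} x \<le> ennreal (t powr (- \<gamma>)) * (ennreal (f x) * indicator ?E x)"
        using U p
      proof eventually_elim
        case (elim x)
        show ?case
        proof (cases "x \<in> \<Omega> \<and> t < u x")
          case True
          have "u x powr (- \<gamma>) \<le> t powr (- \<gamma>)" using True t \<gamma> by (intro powr_mono2') auto
          then have "f x * u x powr (- \<gamma>) \<le> t powr (- \<gamma>) * f x" using f0 True by (simp add: mult.commute mult_left_mono)
          then show ?thesis using elim True f0[of x] u0[of x] by (simp add: ennreal_mult[symmetric] ennreal_leI)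
        next
          case False
          then show ?thesis using elim t by auto
        qed
      qed
    qed
    also have "\<dots> = (\<integral>\<^sup>+x. ennreal (t powr (- \<gamma>)) * (ennreal (f x) * indicator ?E x) \<partial>lebesgue)"
      by (rule nn_integral_completion[symmetric])
    also have "\<dots> = ennreal (t powr (- \<gamma>)) * (\<integral>\<^sup>+x. ennreal (f x) * indicator ?E x \<partial>lebesgue)"
    proof (rule nn_integral_cmult)
      have "(\<lambda>x. ennreal (if x \<in> \<Omega> then f x else 0) * indicator ?E x) \<in> borel_measurable lebesgue"
        using borel_measurable_if_I[OF F.meas] F.dom u.level_measurable[of t] by (intro borel_measurable_times_ennreal) auto
      also have "(\<lambda>x. ennreal (if x \<in> \<Omega> then f x else 0) * indicator ?E x) = (\<lambda>x. ennreal (f x) * indicator ?E x)"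
        by (auto simp: fun_eq_iff split: split_indicator)
      finally show "(\<lambda>x. ennreal (f x) * indicator ?E x) \<in> borel_measurable lebesgue" .
    qed
    also have "\<dots> \<le> ennreal (t powr (- \<gamma>)) * ennreal F0"
    proof (rule mult_left_mono)
      have "(\<integral>\<^sup>+x. ennreal (f x) * indicator ?E x \<partial>lebesgue)
        \<le> (\<integral>\<^sup>+\<sigma>. ennreal (F.rearr \<sigma>) * indicator {0<..<measure lebesgue ?E} \<sigma> \<partial>lborel)"
        using u.level_measurable[of t] by (intro F.nn_integral_le_rearr f0) auto
      also have "\<dots> = ennreal F0" unfolding F0_def distrib_fun_def by (rule F.nn_integral_rearr_primitive[OF intf])
      finally show "(\<integral>\<^sup>+x. ennreal (f x) * indicator ?E x \<partial>lebesgue) \<le> ennreal F0" .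
    qed simp
    also have "\<dots> = ennreal (t powr (- \<gamma>) * F0)" using F0 by (simp add: ennreal_mult)
    finally show ?thesis .
  qed
  from E.level_inequality[OF t h _ this]
  have "h * vol_coeff TYPE('n) (distrib_fun \<Omega> u (t + h)) \<le> t powr (- \<gamma>) * F0 * (distrib_fun \<Omega> u t - distrib_fun \<Omega> u (t + h))"
    using F0 t h by (simp add: lev)
  then have "h * vol_coeff TYPE('n) (distrib_fun \<Omega> u (t + h)) * t powr \<gamma>
    \<le> t powr (- \<gamma>) * F0 * (distrib_fun \<Omega> u t - distrib_fun \<Omega> u (t + h)) * t powr \<gamma>" by (intro mult_right_mono) auto
  also have "\<dots> = F0 * (distrib_fun \<Omega> u t - distrib_fun \<Omega> u (t + h)) * (t powr (- \<gamma>) * t powr \<gamma>)" by (simp only: mult_ac)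
  also have "t powr (- \<gamma>) * t powr \<gamma> = 1" using t by (simp add: powr_add[symmetric])
  finally show ?thesis by (simp add: F0_def)
qed

theorem theorem4p1:
  fixes \<Omega> :: "(real^'n::finite) set"
    and s q \<gamma> m :: real
    and f u v :: "real^'n \<Rightarrow> real"
  assumes dom: "smooth_bounded_domain \<Omega>"
    and s: "0 < s" "s < 1"
    and gam: "0 \<le> \<gamma>" "\<gamma> \<le> 1"
    and f_meas: "f \<in> borel_measurable (lebesgue_on \<Omega>)"
    and f_nonneg: "\<forall>x\<in>\<Omega>. f x \<ge> 0"
    and f_zero: "1/2 < s \<Longrightarrow> {x\<in>\<Omega>. f x = 0} \<in> null_sets lebesgue"
    and case1: "\<gamma> = 1 \<Longrightarrow> set_integrable lebesgue \<Omega> f \<and> q \<ge> 0"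
    and case2: "\<gamma> < 1 \<Longrightarrow> m > 1 \<and> Lp_on m \<Omega> f \<and> q \<ge> max 0 ((1 - m * \<gamma>) / (m - 1))"
    and u_sol: "distributional_solution \<Omega> s q \<gamma> f u"
    and u_H01: "W01p_on 2 \<Omega> u"
    and u_Lq: "Lp_on (q + 1) \<Omega> u"
    and v_W01: "W01p_on 1 (sym_ball \<Omega>) v"
    and v_radial: "AE x in lebesgue. x \<in> sym_ball \<Omega> \<longrightarrow>
                     v x = decr_rearr (sym_ball \<Omega>) v (unit_ball_vol TYPE('n) * norm x ^ CARD('n))"
    and v_sol: "\<exists>G. weak_grad_on (sym_ball \<Omega>) v G \<and>
                  (\<forall>\<phi>. test_fun (sym_ball \<Omega>) \<phi> \<longrightarrow>
                     (LINT x:sym_ball \<Omega>|lebesgue. G x \<bullet> classical_grad \<phi> x)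
                     = (LINT x:sym_ball \<Omega>|lebesgue. schwarz \<Omega> f x * \<phi> x))"
  shows "AE \<tau> in lborel. 0 < \<tau> \<and> \<tau> < measure lebesgue \<Omega> \<longrightarrow>
           decr_rearr \<Omega> u \<tau> \<le> ((\<gamma> + 1) * decr_rearr (sym_ball \<Omega>) v \<tau>) powr (1 / (\<gamma> + 1))"
proof (rule AE_I2, rule impI)
  \<comment> \<open>The bound is obtained at every \<tau>, without an exceptional set.\<close>
  fix \<tau> :: real assume \<tau>: "0 < \<tau> \<and> \<tau> < measure lebesgue \<Omega>"
  have \<Omega>: "open \<Omega>" "bounded \<Omega>" using dom unfolding smooth_bounded_domain_def by blast+
  have \<Omega>l: "\<Omega> \<in> lmeasurable" using \<Omega> by (rule lmeasurable_open[OF _ _, rotated])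
  have q: "0 \<le> q" using case1 case2 gam by (cases "\<gamma> = 1") auto
  have fint: "set_integrable lebesgue \<Omega> f"
    using case1 case2 gam set_integrable_of_Lp[OF _ _ \<Omega>l] by (cases "\<gamma> = 1") auto
  have rf: "rearrangeable \<Omega> f" using \<Omega>l f_meas by unfold_locales
  have ru: "rearrangeable \<Omega> u" using \<Omega>l u_H01 by unfold_locales (auto simp: W01p_on_def Lp_on_def)
  have rv: "rearrangeable (sym_ball \<Omega>) v"
    using v_W01 by unfold_locales (auto simp: W01p_on_def Lp_on_def sym_ball_def)
  interpret F: rearrangeable \<Omega> f by (rule rf)
  interpret u: rearrangeable \<Omega> u by (rule ru)
  interpret V: rearrangeable "sym_ball \<Omega>" v by (rule rv)
  have f0: "0 \<le> f x" if "x \<in> \<Omega>" for x using f_nonneg that by blast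
  have u0: "0 < u x" if "x \<in> \<Omega>" for x using u_sol that unfolding distributional_solution_def by blast
  have intf: "integrable lborel F.rearr" by (rule F.integrable_rearr[OF f0 fint])
  obtain G where wg: "weak_grad_on (sym_ball \<Omega>) v G"
    and vs: "\<And>\<phi>. test_fun (sym_ball \<Omega>) \<phi> \<Longrightarrow>
      (LINT x:sym_ball \<Omega>|lebesgue. G x \<bullet> classical_grad \<phi> x) = (LINT x:sym_ball \<Omega>|lebesgue. schwarz \<Omega> f x * \<phi> x)"
    using v_sol by blast
  obtain U D g p \<phi> where E: "energy_solution \<Omega> s U D g p \<phi>"
    "AE x in lborel. U x = (if x \<in> \<Omega> then u x else 0)"
    "AE x in lborel. p x = (if x \<in> \<Omega> then f x * u x powr (- \<gamma>) else 0)"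
    by (rule distributional_solution_energy[OF \<Omega> s q f_meas f_nonneg u_sol u_H01 u_Lq])
  define M where "M = measure lebesgue \<Omega>"
  define A where "A = vol_coeff TYPE('n)"
  have A: "0 < A r" "isCont A r" if "0 < r" for r
    unfolding A_def using vol_coeff_pos[OF that] that unfolding vol_coeff_def by (auto intro!: continuous_intros)
  \<comment> \<open>An antiderivative on the open half-line only, since the quotient may fail to be
    integrable at 0. Only differences of H occur, so its additive constant is immaterial.\<close>
  obtain H where H: "\<And>r. 0 < r \<Longrightarrow> (H has_real_derivative F.rearr_primitive r / A r) (at r)"
  proof -
    have "isCont (\<lambda>r. F.rearr_primitive r / A r) r" if "0 < r" for r
      using F.isCont_rearr_primitive[OF intf that] A[OF that] by (intro continuous_intros) auto
    then have "\<exists>H. \<forall>r. (0::ereal) < ereal r \<longrightarrow> ereal r < \<infinity> \<longrightarrow> (H has_vector_derivative F.rearr_primitive r / A r) (at r)"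
      by (intro einterval_antiderivative) auto
    then show ?thesis using that by (auto simp: has_real_derivative_iff_has_vector_derivative zero_ereal_def)
  qed
  \<comment> \<open>That T lies below the rearrangement of u at \<tau> means \<tau> < \<mu>(T). The
    level estimate up to T and the radial lower bound at \<tau> are joined through
    \<open>H M - H (u.\<mu> T)\<close>.\<close>
  have key: "T powr (\<gamma> + 1) / (\<gamma> + 1) \<le> decr_rearr (sym_ball \<Omega>) v \<tau>" if T: "0 < T" "\<tau> < u.\<mu> T" for T
  proof -
    have "T powr (\<gamma> + 1) / (\<gamma> + 1) \<le> H M - H (u.\<mu> T)"
    proof (rule level_growth[where F=F.rearr_primitive and A=A and \<mu>=u.\<mu> and T=T and M=M and H=H])
      show "\<exists>t'>t. r < u.\<mu> t'" if "r < u.\<mu> t" for t r using u.distrib_right_continuous[OF that] by blast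
      show "h * A (u.\<mu> (t + h)) * t powr \<gamma> \<le> F.rearr_primitive (u.\<mu> t) * (u.\<mu> t - u.\<mu> (t + h))" if "0 < t" "0 < h" for t h
        unfolding A_def by (rule energy_level_inequality[OF E(1) gam(1) rf ru f0 fint u0 E(2,3) that])
    qed (use gam T \<tau> u.distrib_antimono u.distrib_le F.rearr_primitive_nonneg F.isCont_rearr_primitive[OF intf] A H in \<open>auto simp: M_def\<close>)
    also have "\<dots> \<le> decr_rearr (sym_ball \<Omega>) v \<tau>"
    \<comment> \<open>\<open>radial_solution_lower_bound\<close> needs a plateau from \<mu>(T) to
      some \<tau>2 strictly below M; the endpoint M is reached by continuity of H. For \<mu>(T) = M
      the left-hand side is 0.\<close>
    proof (cases "u.\<mu> T = M")
      case True
      then show ?thesis using V.decr_rearr_nonneg \<tau> by simp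
    next
      case False
      then have lt: "u.\<mu> T < M" using u.distrib_le[of T] by (simp add: M_def)
      have "H \<tau>2 - H (u.\<mu> T) \<le> decr_rearr (sym_ball \<Omega>) v \<tau>" if "u.\<mu> T < \<tau>2" "\<tau>2 < M" for \<tau>2
        by (rule radial_solution_lower_bound[OF rf rv f0 fint v_radial wg vs])
          (use H T \<tau> that in \<open>auto simp: A_def M_def\<close>)
      then have "\<forall>\<^sub>F \<tau>2 in at_left M. H \<tau>2 - H (u.\<mu> T) \<le> decr_rearr (sym_ball \<Omega>) v \<tau>"
        using lt by (intro eventually_at_leftI[of "u.\<mu> T"]) auto
      moreover have "((\<lambda>\<tau>2. H \<tau>2 - H (u.\<mu> T)) \<longlongrightarrow> H M - H (u.\<mu> T)) (at_left M)"
      proof -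
        have "isCont H M" using H[of M] \<tau> DERIV_isCont by (auto simp: M_def)
        then have "(H \<longlongrightarrow> H M) (at_left M)" unfolding isCont_def by (rule filterlim_mono[OF _ order_refl at_le]) simp
        then show ?thesis by (intro tendsto_intros)
      qed
      ultimately show ?thesis by (intro tendsto_upperbound) auto
    qed
    finally show ?thesis .
  qed
  show "decr_rearr \<Omega> u \<tau> \<le> ((\<gamma> + 1) * decr_rearr (sym_ball \<Omega>) v \<tau>) powr (1 / (\<gamma> + 1))"
  proof (rule ccontr)
    define y where "y = ((\<gamma> + 1) * decr_rearr (sym_ball \<Omega>) v \<tau>) powr (1 / (\<gamma> + 1))"
    assume "\<not> ?thesis"
    then obtain T where T: "y < T" "T < decr_rearr \<Omega> u \<tau>" using dense[of y] unfolding y_def by (auto simp: not_le)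
    have "0 \<le> y" by (simp add: y_def)
    then have T0: "0 < T" using T by linarith
    have "\<tau> < u.\<mu> T" using u.less_decr_rearr_iff[of \<tau> T] T T0 \<tau> by auto
    from key[OF T0 this] have "T powr (\<gamma> + 1) \<le> (\<gamma> + 1) * decr_rearr (sym_ball \<Omega>) v \<tau>"
      using gam by (simp add: pos_divide_le_eq mult.commute)
    then have "(T powr (\<gamma> + 1)) powr (1 / (\<gamma> + 1)) \<le> y" unfolding y_def using gam by (intro powr_mono2) auto
    then show False using T T0 gam by (simp add: powr_powr)
  qed
qed

end
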